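(* Let $k$ be an algebraically closed field and let $K$ be a finitely generated extension of $k$ of transcendence degree one. Let $S$ be a finite set of places of $K/k$, and let $\varphi:\mathbb{P}^1\to\mathbb{P}^1$ be a rational map of degree at least two defined over $K$. Let $Z\subset\mathbb{P}^1(K)$ be a finite set of points, and let $P\in\mathbb{P}^1(K)$. Then \[ \mathcal{O}_\varphi(P)\cap Z(K) \;=\; \mathrm{C}_S\bigl(\mathcal{O}_\varphi(P)\bigr)\cap Z(\mathsf{A}'_{K,S}). \]
   Context: The places of $K/k$ are the (nontrivial) absolute values of $K$ that are trivial on $k$; only these places are considered. For such a place $v$, $K_v$ denotes the completion of $K$ at $v$. The $\varphi$-orbit of $P$ is $\mathcal{O}_\varphi(P)=\{P,\varphi(P),\varphi^2(P),\dots\}\subset\mathbb{P}^1(K)$. Let $\mathsf{A}'_{K,S}=\prod'_{v\notin S}K_v$ be the restricted product over the places of $K/k$ not in $S$. The set of $\mathsf{A}'_{K,S}$-points of $\mathbb{P}^1$ is identified with $\prod_{v\notin S}\mathbb{P}^1(K_v)$ with the product topology (each factor with its $v$-adic topology), into which $\mathbb{P}^1(K)$ embeds diagonally. $\mathrm{C}_S(\mathcal{O}_\varphi(P))$ denotes the closure of the diagonally embedded orbit in $\prod_{v\notin S}\mathbb{P}^1(K_v)$. For the finite set $Z$, $Z(\mathsf{A}'_{K,S})=\prod_{v\notin S}Z$, i.e. the adelic points $(z_v)_{v\notin S}$ with every $z_v\in Z$; and $\mathcal{O}_\varphi(P)\cap Z(K)$ is identified with its diagonal image. *)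

theory Defs
  imports "HOL-Analysis.Analysis" "HOL-Computational_Algebra.Polynomial"
begin

section \<open>Fields and field extensions (K is the ambient type, k a subfield)\<close>

definition is_subfield :: "'a::field set \<Rightarrow> bool" where
  "is_subfield F \<longleftrightarrow> 0 \<in> F \<and> 1 \<in> F \<and>
     (\<forall>x\<in>F. \<forall>y\<in>F. x + y \<in> F \<and> x - y \<in> F \<and> x * y \<in> F) \<and>
     (\<forall>x\<in>F. x \<noteq> 0 \<longrightarrow> inverse x \<in> F)"

definition field_gen :: "'a::field set \<Rightarrow> 'a set" where
  "field_gen A = \<Inter>{F. is_subfield F \<and> A \<subseteq> F}"

definition algebraic_over :: "'a::field set \<Rightarrow> 'a \<Rightarrow> bool" where
  "algebraic_over F x \<longleftrightarrow> (\<exists>p. p \<noteq> 0 \<and> (\<forall>i. coeff p i \<in> F) \<and> poly p x = 0)"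

definition alg_closed_subfield :: "'a::field set \<Rightarrow> bool" where
  "alg_closed_subfield k \<longleftrightarrow> is_subfield k \<and>
     (\<forall>p. (\<forall>i. coeff p i \<in> k) \<and> degree p \<ge> 1 \<longrightarrow> (\<exists>x\<in>k. poly p x = 0))"

definition finitely_generated_over :: "'a::field set \<Rightarrow> bool" where
  "finitely_generated_over k \<longleftrightarrow> (\<exists>G. finite G \<and> field_gen (k \<union> G) = UNIV)"

definition trdeg_one_over :: "'a::field set \<Rightarrow> bool" where
  "trdeg_one_over k \<longleftrightarrow> (\<exists>t. \<not> algebraic_over k t \<and>
       (\<forall>x. algebraic_over (field_gen (k \<union> {t})) x))"

definition abs_value :: "('a::field \<Rightarrow> real) \<Rightarrow> bool" where
  "abs_value v \<longleftrightarrow> (\<forall>x. v x \<ge> 0) \<and> (\<forall>x. v x = 0 \<longleftrightarrow> x = 0) \<and>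
     (\<forall>x y. v (x * y) = v x * v y) \<and> (\<forall>x y. v (x + y) \<le> v x + v y)"

definition abs_equiv :: "('a::field \<Rightarrow> real) \<Rightarrow> ('a \<Rightarrow> real) \<Rightarrow> bool" where
  "abs_equiv v w \<longleftrightarrow> (\<exists>c>0. \<forall>x. w x = v x powr c)"

definition abs_values_over :: "'a::field set \<Rightarrow> ('a \<Rightarrow> real) set" where
  "abs_values_over k = {v. abs_value v \<and> (\<exists>x. x \<noteq> 0 \<and> v x \<noteq> 1) \<and> (\<forall>c\<in>k. c \<noteq> 0 \<longrightarrow> v c = 1)}"

definition places :: "'a::field set \<Rightarrow> ('a \<Rightarrow> real) set set" where
  "places k = {{w. abs_equiv v w} | v. v \<in> abs_values_over k}"

definition rep :: "('a::field \<Rightarrow> real) set \<Rightarrow> ('a \<Rightarrow> real)" where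
  "rep p = (SOME v. v \<in> p)"

definition v_cauchy :: "('a::field \<Rightarrow> real) \<Rightarrow> (nat \<Rightarrow> 'a) \<Rightarrow> bool" where
  "v_cauchy v x \<longleftrightarrow> (\<forall>e>0. \<exists>N. \<forall>m\<ge>N. \<forall>n\<ge>N. v (x m - x n) < e)"

definition v_class :: "('a::field \<Rightarrow> real) \<Rightarrow> (nat \<Rightarrow> 'a) \<Rightarrow> (nat \<Rightarrow> 'a) set" where
  "v_class v x = {y. v_cauchy v y \<and> (\<lambda>n. v (x n - y n)) \<longlonglongrightarrow> 0}"

definition completion :: "('a::field \<Rightarrow> real) \<Rightarrow> (nat \<Rightarrow> 'a) set set" where
  "completion v = {v_class v x | x. v_cauchy v x}"

definition compl_rep :: "(nat \<Rightarrow> 'a) set \<Rightarrow> nat \<Rightarrow> 'a" where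
  "compl_rep a = (SOME x. x \<in> a)"

definition compl_abs :: "('a::field \<Rightarrow> real) \<Rightarrow> (nat \<Rightarrow> 'a) set \<Rightarrow> real" where
  "compl_abs v a = lim (\<lambda>n. v (compl_rep a n))"

definition compl_diff :: "('a::field \<Rightarrow> real) \<Rightarrow> (nat \<Rightarrow> 'a) set \<Rightarrow> (nat \<Rightarrow> 'a) set \<Rightarrow> (nat \<Rightarrow> 'a) set" where
  "compl_diff v a b = v_class v (\<lambda>n. compl_rep a n - compl_rep b n)"

definition compl_emb :: "('a::field \<Rightarrow> real) \<Rightarrow> 'a \<Rightarrow> (nat \<Rightarrow> 'a) set" where
  "compl_emb v c = v_class v (\<lambda>n. c)"

text \<open>P^1(F) = F \<union> {\<infinity>}, rendered as option: None is the point at infinity.\<close>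

definition P1_compl :: "('a::field \<Rightarrow> real) \<Rightarrow> (nat \<Rightarrow> 'a) set option set" where
  "P1_compl v = insert None (Some ` completion v)"

fun chordal :: "('a::field \<Rightarrow> real) \<Rightarrow> (nat \<Rightarrow> 'a) set option \<Rightarrow> (nat \<Rightarrow> 'a) set option \<Rightarrow> real" where
  "chordal v (Some a) (Some b) =
     compl_abs v (compl_diff v a b) / (max 1 (compl_abs v a) * max 1 (compl_abs v b))"
| "chordal v (Some a) None = 1 / max 1 (compl_abs v a)"
| "chordal v None (Some b) = 1 / max 1 (compl_abs v b)"
| "chordal v None None = 0"

definition P1_top :: "('a::field \<Rightarrow> real) \<Rightarrow> (nat \<Rightarrow> 'a) set option topology" where
  "P1_top v = topology (\<lambda>U. U \<subseteq> P1_compl v \<and>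
      (\<forall>x\<in>U. \<exists>e>0. \<forall>y\<in>P1_compl v. chordal v x y < e \<longrightarrow> y \<in> U))"

definition P1_emb :: "('a::field \<Rightarrow> real) \<Rightarrow> 'a option \<Rightarrow> (nat \<Rightarrow> 'a) set option" where
  "P1_emb v = map_option (compl_emb v)"

definition adelic_P1_top :: "'a::field set \<Rightarrow> ('a \<Rightarrow> real) set set
    \<Rightarrow> (('a \<Rightarrow> real) set \<Rightarrow> (nat \<Rightarrow> 'a) set option) topology" where
  "adelic_P1_top k S = product_topology (\<lambda>p. P1_top (rep p)) (places k - S)"

definition diag :: "'a::field set \<Rightarrow> ('a \<Rightarrow> real) set set \<Rightarrow> 'a option
    \<Rightarrow> ('a \<Rightarrow> real) set \<Rightarrow> (nat \<Rightarrow> 'a) set option" where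
  "diag k S Q = restrict (\<lambda>p. P1_emb (rep p) Q) (places k - S)"

definition adelic_points :: "'a::field set \<Rightarrow> ('a \<Rightarrow> real) set set \<Rightarrow> 'a option set
    \<Rightarrow> (('a \<Rightarrow> real) set \<Rightarrow> (nat \<Rightarrow> 'a) set option) set" where
  "adelic_points k S Z = (\<Pi>\<^sub>E p\<in>places k - S. P1_emb (rep p) ` Z)"

definition C_S :: "'a::field set \<Rightarrow> ('a \<Rightarrow> real) set set \<Rightarrow> 'a option set
    \<Rightarrow> (('a \<Rightarrow> real) set \<Rightarrow> (nat \<Rightarrow> 'a) set option) set" where
  "C_S k S A = adelic_P1_top k S closure_of (diag k S ` A)"

text \<open>The rational map x \<mapsto> f(x)/g(x) on P^1(K), f, g coprime; its degree is max(deg f, deg g).\<close>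
fun rat_map :: "'a::field poly \<Rightarrow> 'a poly \<Rightarrow> 'a option \<Rightarrow> 'a option" where
  "rat_map f g (Some x) = (if poly g x \<noteq> 0 then Some (poly f x / poly g x) else None)"
| "rat_map f g None = (if degree f > degree g then None
     else if degree f = degree g then Some (lead_coeff f / lead_coeff g) else Some 0)"

definition rat_map_degree :: "'a::field poly \<Rightarrow> 'a poly \<Rightarrow> nat" where
  "rat_map_degree f g = max (degree f) (degree g)"

definition orbit :: "('b \<Rightarrow> 'b) \<Rightarrow> 'b \<Rightarrow> 'b set" where
  "orbit \<phi> P = {(\<phi> ^^ n) P | n. True}"

end

theory Submission
  imports "HOL-Algebra.Algebraic_Closure_Type" Defs
begin

text \<open>All places are non-archimedean, and the residue field of each of them is k. Suppose that the orbit x_n of P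
  comes, at every place v outside S, arbitrarily close to some z_v in Z, but that no single orbit point equals all
  the z_v. Then the orbit is infinite and accumulates at z_v for every such v; change coordinates so that P is
  infinity.

  There are a finite set B of places and an infinite set of algebraic points, stable under conjugation, none of
  which is congruent to x_n for large n at any place outside B. If some periodic point r has a nonzero multiplier,
  these are the strict preimages of r under the iterates of its return map, which is an isometry of the residue disc
  of r at every place outside B. At such a place the reduction of x_n is eventually periodic and that of the
  preimage is not. This excludes a congruence only for n depending on the place, but at almost all places a congruence
  for any n would force z_v onto the cycle of r, from which the isometry keeps the orbit away. If all periodic points
  are superattracting, they are simple
  roots of their fixed point equations, hence infinite in number, and those with cycle disjoint from Z serve: an
  orbit entering the residue disc of such a point converges to its cycle.

  Take polynomials over K for more of these points than B has elements. At each place of B, x_n is close to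
  the roots of at most one of them, so some polynomial h satisfies |h(x_n)| >= c_v max(1, |x_n|)^(deg h) at all
  places, for infinitely many n. Hence for such m, n the function (x_n - x_m) / (h(x_n) h(x_m)) has poles bounded by a
  fixed divisor and is determined by its residues at a fixed finite set T of places. The orbit takes finitely many values
  modulo the places in T, so the function vanishes for some m \<noteq> n, that is, x_m = x_n: a contradiction.\<close>

section \<open>Non-archimedean absolute values\<close>

text \<open>Periodic points need not be defined over K, so congruences are measured in an algebraic
  closure, at all extensions of a place at once; stability under conjugation is what leads back to
  polynomials over K. At the finitely many bad places nothing keeps the orbit away from a given
  point. This is why infinitely many avoided points are wanted: each bad place can spoil at most one
  conjugacy class, and pigeonhole does the rest. The split by multipliers is there for positive
  characteristic, where all periodic points of an inseparable map are superattracting. In the final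
  quotient the numerator x_n - x_m grows at most like max(1, |x_n|) max(1, |x_m|), and every h of
  positive degree absorbs this in the denominator, so the bound on the poles is uniform in m and n.
  Maps are treated as pairs of binary forms: infinity becomes an ordinary point, and good reduction
  means that the maximum norm is raised exactly to the power d.\<close>

locale nonarch =
  fixes v :: "'b::field \<Rightarrow> real"
  assumes nonneg [simp]: "v x \<ge> 0"
    and eq_0_iff [simp]: "v x = 0 \<longleftrightarrow> x = 0"
    and mult: "v (x * y) = v x * v y"
    and ultra: "v (x + y) \<le> max (v x) (v y)"
begin

lemma zero [simp]: "v 0 = 0"
  by simp

lemma pos_iff [simp]: "v x > 0 \<longleftrightarrow> x \<noteq> 0"
  using nonneg[of x] eq_0_iff[of x] by linarith

lemma one [simp]: "v 1 = 1"
  using mult[of 1 1] by simp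

lemma power: "v (x ^ n) = v x ^ n"
  by (induction n) (auto simp: mult)

lemma minus_one: "v (- 1) = 1"
  using power[of "-1" 2] nonneg[of "-1"] by (simp add: power2_eq_1_iff)

lemma minus [simp]: "v (- x) = v x"
  using mult[of "-1" x] minus_one by simp

lemma ultra_diff: "v (x - y) \<le> max (v x) (v y)"
  using ultra[of x "-y"] by simp

lemma diff_commute: "v (x - y) = v (y - x)"
  using minus[of "x - y"] by simp

lemma inverse: "v (inverse x) = inverse (v x)"
proof (cases "x = 0")
  case False
  hence "v x * v (inverse x) = 1" by (simp flip: mult)
  thus ?thesis by (metis inverse_unique)
qed auto

lemma divide: "v (x / y) = v x / v y"
  by (simp add: divide_inverse mult inverse)

lemma add_eq_right: "v x < v y \<Longrightarrow> v (x + y) = v y"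
  using ultra[of x y] ultra_diff[of "x + y" x] by auto

lemma add_eq_left: "v y < v x \<Longrightarrow> v (x + y) = v x"
  using add_eq_right[of y x] by (simp add: add.commute)

lemma sum_le: "C \<ge> 0 \<Longrightarrow> (\<And>a. a \<in> A \<Longrightarrow> v (f a) \<le> C) \<Longrightarrow> v (sum f A) \<le> C"
proof (induction A rule: infinite_finite_induct)
  case (insert x F)
  have "v (f x) \<le> C" "v (sum f F) \<le> C" using insert by auto
  hence "v (f x + sum f F) \<le> C" using ultra[of "f x" "sum f F"] by linarith
  thus ?case using insert by simp
qed auto

lemma sum_less: "C > 0 \<Longrightarrow> (\<And>a. a \<in> A \<Longrightarrow> v (f a) < C) \<Longrightarrow> v (sum f A) < C"
proof (induction A rule: infinite_finite_induct)
  case (insert x F)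
  have "v (f x) < C" "v (sum f F) < C" using insert by auto
  hence "v (f x + sum f F) < C" using ultra[of "f x" "sum f F"] by linarith
  thus ?case using insert by simp
qed auto

lemma sum_dominant:
  assumes "finite A" "i \<in> A" "\<And>j. j \<in> A \<Longrightarrow> j \<noteq> i \<Longrightarrow> v (f j) < v (f i)"
  shows "v (sum f A) = v (f i)"
proof (cases "v (f i) > 0")
  case True
  have "v (sum f (A - {i})) < v (f i)"
    using assms True by (intro sum_less) auto
  moreover have "sum f A = f i + sum f (A - {i})"
    by (rule sum.remove) (use assms in auto)
  ultimately show ?thesis by (simp add: add_eq_left)
next
  case False
  hence "f j = 0" if "j \<in> A" for j
    using assms(3)[OF that] False nonneg[of "f j"] by (cases "j = i") (auto simp del: nonneg)
  thus ?thesis using assms(2) by (simp add: sum.neutral)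
qed

text \<open>A vanishing sum cannot have a strictly largest term. This turns a polynomial relation
  into an equality between the values of two of its terms.\<close>

lemma exists_tie:
  assumes "finite A" "i0 \<in> A" "f i0 \<noteq> 0" "sum f A = 0"
  shows "\<exists>i\<in>A. \<exists>j\<in>A. i \<noteq> j \<and> f i \<noteq> 0 \<and> v (f i) = v (f j)" (is ?P)
proof (rule ccontr)
  assume neg: "\<not> ?P"
  have no: "v (f i) \<noteq> v (f j)" if "i \<in> A" "j \<in> A" "j \<noteq> i" "f i \<noteq> 0" for i j
  proof
    assume "v (f i) = v (f j)"
    hence ?P using that by (intro bexI[of _ i] bexI[of _ j] conjI) simp_all
    with neg show False by contradiction
  qed
  have "\<exists>i\<in>A. \<forall>j\<in>A. v (f j) \<le> v (f i)"
  proof -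
    have "Max ((\<lambda>i. v (f i)) ` A) \<in> (\<lambda>i. v (f i)) ` A"
      using assms(1,2) by (intro Max_in) auto
    then obtain i where "i \<in> A" "v (f i) = Max ((\<lambda>i. v (f i)) ` A)" by auto
    moreover have "v (f j) \<le> Max ((\<lambda>i. v (f i)) ` A)" if "j \<in> A" for j
      using assms(1) that by (intro Max_ge) auto
    ultimately show ?thesis by metis
  qed
  then obtain i where i: "i \<in> A" "\<And>j. j \<in> A \<Longrightarrow> v (f j) \<le> v (f i)" by blast
  have "v (f i0) > 0" using assms(3) by simp
  hence "v (f i) > 0" using i(2)[OF assms(2)] by linarith
  hence fi: "f i \<noteq> 0" by simp
  have "v (f j) < v (f i)" if "j \<in> A" "j \<noteq> i" for j
  proof -
    have "v (f i) \<noteq> v (f j)" by (intro no that fi i(1))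
    thus ?thesis using i(2)[OF that(1)] by linarith
  qed
  hence "v (sum f A) = v (f i)" using assms(1) i(1) by (intro sum_dominant)
  thus False using assms fi by simp
qed

lemma powr_nonarch: "c > 0 \<Longrightarrow> nonarch (\<lambda>x. v x powr c)"
proof
  fix x y assume "c > 0"
  show "v (x + y) powr c \<le> max (v x powr c) (v y powr c)"
  proof (cases "v x \<le> v y")
    case True
    hence "v (x + y) powr c \<le> v y powr c"
      using ultra[of x y] \<open>c > 0\<close> by (intro powr_mono2) auto
    thus ?thesis by simp
  next
    case False
    hence "v (x + y) powr c \<le> v x powr c"
      using ultra[of x y] \<open>c > 0\<close> by (intro powr_mono2) auto
    thus ?thesis by simp
  qed
qed (auto simp: mult powr_mult)

end

text \<open>Expand \<open>(x + y) ^ n\<close> binomially: the integer coefficients have value at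
  most 1, so \<open>v (x + y) ^ n\<close> is at most n + 1 times \<open>M ^ n\<close>. A linear
  factor cannot keep up with the powers of a ratio greater than 1.\<close>

lemma abs_value_nonarch:
  assumes "abs_value v" and bdd: "\<And>n. v (of_nat n) \<le> 1"
  shows "nonarch v"
proof
  show "v x \<ge> 0" "v x = 0 \<longleftrightarrow> x = 0" "v (x * y) = v x * v y" for x y
    using assms by (auto simp: abs_value_def)
  note m = this
  have one: "v 1 = 1" using m(3)[of 1 1] m(2)[of 1] by simp
  have pw: "v (x ^ n) = v x ^ n" for x n by (induction n) (auto simp: m one)
  have tri: "v (sum f A) \<le> (\<Sum>a\<in>A. v (f a))" if "finite A" for f :: "nat \<Rightarrow> _" and A
    using that
  proof (induction A rule: finite_induct)
    case empty thus ?case using m(2)[of 0] by simp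
  next
    case (insert a F)
    have "v (f a + sum f F) \<le> v (f a) + v (sum f F)" using assms(1) by (auto simp: abs_value_def)
    thus ?case using insert by simp
  qed
  fix x y
  define M where "M = max (v x) (v y)"
  have M0: "M \<ge> 0" using m(1) by (simp add: M_def le_max_iff_disj)
  have bound: "v (x + y) ^ n \<le> (real n + 1) * M ^ n" for n
  proof -
    have "v (x + y) ^ n = v (\<Sum>k\<le>n. of_nat (n choose k) * x ^ k * y ^ (n - k))"
      by (simp add: pw[symmetric] binomial_ring)
    also have "\<dots> \<le> (\<Sum>k\<le>n. v (of_nat (n choose k) * x ^ k * y ^ (n - k)))"
      by (rule tri) simp
    also have "\<dots> \<le> (\<Sum>k\<le>n. M ^ n)"
    proof (rule sum_mono)
      fix k assume "k \<in> {..n}"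
      hence "k \<le> n" by simp
      have "v (of_nat (n choose k) * x ^ k * y ^ (n - k)) \<le> 1 * (M ^ k * M ^ (n - k))"
        unfolding m(3) pw mult.assoc
        using M0 by (intro mult_mono bdd power_mono) (auto simp: m M_def)
      also have "\<dots> = M ^ n" using \<open>k \<le> n\<close> by (simp flip: power_add)
      finally show "v (of_nat (n choose k) * x ^ k * y ^ (n - k)) \<le> M ^ n" .
    qed
    finally show ?thesis by (simp add: add.commute)
  qed
  show "v (x + y) \<le> max (v x) (v y)"
  proof (rule ccontr)
    assume "\<not> ?thesis"
    hence gt: "v (x + y) > M" unfolding M_def by linarith
    show False
    proof (cases "M = 0")
      case True
      thus False using bound[of 1] gt by simp
    next
      case False
      hence Mp: "M > 0" using M0 by simp
      define c where "c = v (x + y) / M"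
      have c: "c > 1" using gt Mp by (simp add: c_def)
      have "c ^ n \<le> real n + 1" for n
        using bound[of n] Mp by (simp add: c_def power_divide divide_simps)
      moreover have "\<forall>\<^sub>F n in sequentially. c ^ n > real n + 1"
      proof -
        have "(\<lambda>n. (real n + 1) / c ^ n) \<longlonglongrightarrow> 0"
        proof -
          have "(\<lambda>n. real n * (1/c) ^ n) \<longlonglongrightarrow> 0"
            using c by (intro powser_times_n_limit_0) auto
          moreover have "(\<lambda>n. (1/c) ^ n) \<longlonglongrightarrow> 0"
            using c by (intro LIMSEQ_power_zero) auto
          ultimately have "(\<lambda>n. real n * (1/c) ^ n + (1/c) ^ n) \<longlonglongrightarrow> 0 + 0"
            by (intro tendsto_add)
          thus ?thesis by (simp add: power_divide add_divide_distrib)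
        qed
        hence "\<forall>\<^sub>F n in sequentially. (real n + 1) / c ^ n < 1"
          by (rule order_tendstoD) simp
        thus ?thesis using c by (auto elim!: eventually_mono simp: divide_simps)
      qed
      ultimately show False
        by (auto simp: eventually_sequentially not_less[symmetric])
    qed
  qed
qed

section \<open>Places\<close>

lemma is_subfield_of_nat: "is_subfield k \<Longrightarrow> of_nat n \<in> k"
  by (induction n) (auto simp: is_subfield_def)

text \<open>The integers lie in \<open>k\<close>, where \<open>v\<close> takes only the values 0 and
  1.\<close>

lemma abs_values_over_nonarch:
  assumes "is_subfield k" "v \<in> abs_values_over k"
  shows "nonarch v"
proof (rule abs_value_nonarch)
  show "abs_value v" using assms by (simp add: abs_values_over_def)
  have "v c \<le> 1" if "c \<in> k" for c
  proof (cases "c = 0")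
    case True
    moreover have "v 0 = 0" using \<open>abs_value v\<close> by (simp add: abs_value_def)
    ultimately show ?thesis by simp
  next
    case False
    with assms(2) that show ?thesis by (simp add: abs_values_over_def)
  qed
  thus "v (of_nat n) \<le> 1" for n
    using is_subfield_of_nat[OF assms(1)] by blast
qed

lemma nonarch_abs_value: "nonarch v \<Longrightarrow> abs_value v"
proof -
  assume "nonarch v"
  then interpret nonarch v .
  have "v (x + y) \<le> v x + v y" for x y using ultra[of x y] nonneg[of x] nonneg[of y] by linarith
  thus ?thesis by (simp add: abs_value_def mult)
qed

lemma rep_in: "p \<in> places k \<Longrightarrow> rep p \<in> p"
proof -
  assume "p \<in> places k"
  then obtain v where "v \<in> abs_values_over k" "p = {w. abs_equiv v w}"
    by (auto simp: places_def)
  moreover from this have "abs_equiv v v"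
    by (auto simp: abs_equiv_def abs_values_over_def abs_value_def intro!: exI[of _ 1])
  ultimately have "v \<in> p" by simp
  thus ?thesis unfolding rep_def by (rule someI[of "\<lambda>v. v \<in> p"])
qed

text \<open>\<open>rep\<close> is an arbitrary choice from an equivalence class, so each property is
  carried over from the defining absolute value through a positive power.\<close>

lemma rep_place:
  assumes "is_subfield k" "p \<in> places k"
  shows "nonarch (rep p)" "\<exists>x. x \<noteq> 0 \<and> rep p x \<noteq> 1" "\<And>c. c \<in> k \<Longrightarrow> c \<noteq> 0 \<Longrightarrow> rep p c = 1"
    "p = {w. abs_equiv (rep p) w}"
proof -
  from assms obtain v where v: "v \<in> abs_values_over k" "p = {w. abs_equiv v w}"
    by (auto simp: places_def)
  interpret v: nonarch v using abs_values_over_nonarch assms v by blast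
  have "abs_equiv v (rep p)" using rep_in[OF assms(2)] v by auto
  then obtain c where c: "c > 0" "\<And>x. rep p x = v x powr c" by (auto simp: abs_equiv_def)
  hence e: "rep p = (\<lambda>x. v x powr c)" by auto
  show "nonarch (rep p)" unfolding e using c by (intro v.powr_nonarch)
  obtain x where x: "x \<noteq> 0" "v x \<noteq> 1" using v by (auto simp: abs_values_over_def)
  have "v x powr c \<noteq> 1" using x c v.pos_iff[of x]
    by (simp add: powr_def)
  thus "\<exists>x. x \<noteq> 0 \<and> rep p x \<noteq> 1" using e x by auto
  show "rep p c = 1" if "c \<in> k" "c \<noteq> 0" for c
    using v that e by (auto simp: abs_values_over_def)
  have "abs_equiv v w \<longleftrightarrow> abs_equiv (rep p) w" for w
    proof
      assume "abs_equiv v w"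
      then obtain d where "d > 0" "\<And>x. w x = v x powr d" by (auto simp: abs_equiv_def)
      thus "abs_equiv (rep p) w" unfolding abs_equiv_def
        using c by (intro exI[of _ "d / c"]) (simp add: powr_powr)
    next
      assume "abs_equiv (rep p) w"
      then obtain d where "d > 0" "\<And>x. w x = rep p x powr d" by (auto simp: abs_equiv_def)
      thus "abs_equiv v w" unfolding abs_equiv_def
        using c by (intro exI[of _ "c * d"]) (simp add: powr_powr)
    qed
  thus "p = {w. abs_equiv (rep p) w}" using v(2) by blast
qed

lemma places_eqI:
  assumes "is_subfield k" "p \<in> places k" "q \<in> places k" "abs_equiv (rep p) (rep q)"
  shows "p = q"
proof -
  interpret a: nonarch "rep p" by (rule rep_place[OF assms(1,2)])
  obtain c where c: "c > 0" "\<And>x. rep q x = rep p x powr c" using assms by (auto simp: abs_equiv_def)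
  have "abs_equiv (rep p) w \<longleftrightarrow> abs_equiv (rep q) w" for w
  proof
    assume "abs_equiv (rep p) w"
    then obtain d where "d > 0" "\<And>x. w x = rep p x powr d" by (auto simp: abs_equiv_def)
    thus "abs_equiv (rep q) w" unfolding abs_equiv_def
      using c by (intro exI[of _ "d / c"]) (simp add: powr_powr)
  next
    assume "abs_equiv (rep q) w"
    then obtain d where "d > 0" "\<And>x. w x = rep q x powr d" by (auto simp: abs_equiv_def)
    thus "abs_equiv (rep p) w" unfolding abs_equiv_def
      using c by (intro exI[of _ "c * d"]) (simp add: powr_powr)
  qed
  hence "{w. abs_equiv (rep p) w} = {w. abs_equiv (rep q) w}" by blast
  from trans[OF trans[OF rep_place(4)[OF assms(1,2)] this] rep_place(4)[OF assms(1,3), symmetric]]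
  show ?thesis .
qed

text \<open>The power \<open>c\<close> appears because \<open>rep\<close> need not choose
  \<open>w\<close> itself from the class of \<open>w\<close>.\<close>

lemma place_of_nonarch:
  assumes "is_subfield k" "nonarch w" "\<And>c. c \<in> k \<Longrightarrow> c \<noteq> 0 \<Longrightarrow> w c = 1" "x \<noteq> 0" "w x \<noteq> 1"
  obtains p c where "p \<in> places k" "c > 0" "\<And>x. rep p x = w x powr c"
proof -
  have "w \<in> abs_values_over k"
    unfolding abs_values_over_def using nonarch_abs_value[OF assms(2)] assms(3-5) by blast
  hence p: "{u. abs_equiv w u} \<in> places k" by (auto simp: places_def)
  from rep_in[OF this] have "abs_equiv w (rep {u. abs_equiv w u})" by simp
  then obtain c where "c > 0" "\<And>x. rep {u. abs_equiv w u} x = w x powr c"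
    unfolding abs_equiv_def by blast
  thus ?thesis using p that by blast
qed

section \<open>Valuation rings\<close>

definition is_subring :: "'b::field set \<Rightarrow> bool" where
  "is_subring A \<longleftrightarrow> 1 \<in> A \<and> (\<forall>x\<in>A. \<forall>y\<in>A. x + y \<in> A \<and> x - y \<in> A \<and> x * y \<in> A)"

context
  fixes A :: "'b::field set"
  assumes A: "is_subring A"
begin

lemma subring_one: "1 \<in> A"
  and subring_add: "x \<in> A \<Longrightarrow> y \<in> A \<Longrightarrow> x + y \<in> A"
  and subring_diff: "x \<in> A \<Longrightarrow> y \<in> A \<Longrightarrow> x - y \<in> A"
  and subring_mult: "x \<in> A \<Longrightarrow> y \<in> A \<Longrightarrow> x * y \<in> A"
  using A by (simp_all add: is_subring_def)

lemma subring_zero: "0 \<in> A"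
  using subring_diff[OF subring_one subring_one] by simp

lemma subring_minus: "x \<in> A \<Longrightarrow> - x \<in> A"
  using subring_diff[OF subring_zero, of x] by simp

lemma subring_power: "x \<in> A \<Longrightarrow> x ^ n \<in> A"
  by (induction n) (simp_all add: subring_one subring_mult)

lemma subring_sum: "(\<And>i. i \<in> I \<Longrightarrow> f i \<in> A) \<Longrightarrow> sum f I \<in> A"
  by (induction I rule: infinite_finite_induct) (simp_all add: subring_zero subring_add)

lemmas subring_closed = subring_one subring_zero subring_add subring_diff subring_mult
  subring_minus subring_power subring_sum

end

lemma is_subfield_subring: "is_subfield k \<Longrightarrow> is_subring k"
  by (simp add: is_subfield_def is_subring_def)

definition adjoin :: "'b::field set \<Rightarrow> 'b \<Rightarrow> 'b set" where
  "adjoin A y = {poly p y | p. \<forall>i. coeff p i \<in> A}"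

lemma adjoinI: "(\<And>i. coeff p i \<in> A) \<Longrightarrow> poly p y \<in> adjoin A y"
  by (auto simp: adjoin_def)

lemma adjoin_subring:
  assumes "is_subring A" shows "is_subring (adjoin A y)"
  unfolding is_subring_def
proof (intro conjI ballI)
  note c = subring_closed[OF assms]
  show "1 \<in> adjoin A y"
    using adjoinI[of 1 A y] c by (simp add: coeff_1)
  fix a b assume "a \<in> adjoin A y" "b \<in> adjoin A y"
  then obtain p q where p: "\<And>i. coeff p i \<in> A" "a = poly p y" and q: "\<And>i. coeff q i \<in> A" "b = poly q y"
    by (auto simp: adjoin_def)
  show "a + b \<in> adjoin A y" using adjoinI[of "p + q" A y] p q c by simp
  show "a - b \<in> adjoin A y" using adjoinI[of "p - q" A y] p q c by simp
  have "coeff (p * q) i \<in> A" for i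
    unfolding coeff_mult using p q by (intro subring_sum[OF assms] subring_mult[OF assms]) auto
  thus "a * b \<in> adjoin A y" using adjoinI[of "p * q" A y] p q by simp
qed

lemma adjoin_superset: assumes "is_subring A" shows "A \<subseteq> adjoin A y"
proof
  fix a assume "a \<in> A"
  thus "a \<in> adjoin A y" using adjoinI[of "[:a:]" A y] subring_zero[OF assms]
    by (simp add: coeff_pCons split: nat.splits)
qed

lemma adjoin_self: assumes "is_subring A" shows "y \<in> adjoin A y"
  using adjoinI[of "[:0, 1:]" A y] subring_zero[OF assms] subring_one[OF assms]
  by (simp add: coeff_pCons split: nat.splits)

definition valuation_ring :: "'b::field set \<Rightarrow> bool" where
  "valuation_ring R \<longleftrightarrow> is_subring R \<and> (\<forall>y. y \<noteq> 0 \<longrightarrow> y \<in> R \<or> inverse y \<in> R)"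

text \<open>A subring maximal among those avoiding s, where 1/s lies in the subring, is a valuation ring.\<close>

context
  fixes M :: "'b::field set" and s :: 'b
  assumes M: "is_subring M" and sM: "s \<notin> M" and tM: "inverse s \<in> M"
    and max: "\<And>B. is_subring B \<Longrightarrow> M \<subseteq> B \<Longrightarrow> s \<notin> B \<Longrightarrow> B = M"
begin

lemma max_s_nz: "s \<noteq> 0"
  using sM subring_zero[OF M] by auto

lemma max_adjoin: "y \<notin> M \<Longrightarrow> s \<in> adjoin M y"
  using max[OF adjoin_subring[OF M, of y] adjoin_superset[OF M]] adjoin_self[OF M, of y] by blast

lemma one_minus_power: "b \<in> M \<Longrightarrow> \<exists>b'\<in>M. (1 - inverse s * b) ^ n = 1 - inverse s * b'"
proof (induction n)
  case 0
  show ?case using subring_zero[OF M] by (intro bexI[of _ 0]) simp_all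
next
  case (Suc n)
  then obtain b' where b': "b' \<in> M" "(1 - inverse s * b) ^ n = 1 - inverse s * b'" by blast
  have "(1 - inverse s * b) ^ Suc n = 1 - inverse s * (b + b' - inverse s * b * b')"
    unfolding power_Suc b'(2) by (simp add: algebra_simps)
  thus ?case using Suc.prems b' tM
    by (intro bexI[of _ "b + b' - inverse s * b * b'"]) (auto intro!: subring_closed[OF M])
qed

text \<open>If \<open>c = 1 - inverse s * b\<close> had no inverse in M, maximality would put s into
  the ring generated by M and 1/c. Multiplying by a power of c, which is again 1 minus a multiple of
  \<open>inverse s\<close>, would bring s into M itself.\<close>

lemma max_unit:
  assumes "b \<in> M"
  shows "1 - inverse s * b \<noteq> 0" "inverse (1 - inverse s * b) \<in> M"
proof -
  define c where "c = 1 - inverse s * b"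
  have cM: "c \<in> M" unfolding c_def using assms tM by (intro subring_closed[OF M])
  have "c \<noteq> 0"
  proof
    assume "c = 0"
    hence "b = s" using max_s_nz by (simp add: c_def field_simps)
    thus False using assms sM by simp
  qed
  thus "1 - inverse s * b \<noteq> 0" by (simp add: c_def)
  have "inverse c \<in> M"
  proof (rule ccontr)
    assume "inverse c \<notin> M"
    then obtain p where p: "\<And>i. coeff p i \<in> M" "s = poly p (inverse c)"
      using max_adjoin by (auto simp: adjoin_def)
    define n where "n = degree p"
    define a where "a = (\<Sum>i\<le>n. coeff p i * c ^ (n - i))"
    have aM: "a \<in> M" unfolding a_def using p cM by (intro subring_closed[OF M]) auto
    have "c ^ n * s = (\<Sum>i\<le>n. coeff p i * (c ^ n * inverse c ^ i))"
      unfolding p(2) poly_altdef n_def sum_distrib_left by (intro sum.cong) auto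
    also have "\<dots> = a"
      unfolding a_def
    proof (intro sum.cong refl)
      fix i assume "i \<in> {..n}"
      hence "c ^ n = c ^ (n - i) * c ^ i" by (simp flip: power_add)
      thus "coeff p i * (c ^ n * inverse c ^ i) = coeff p i * c ^ (n - i)"
        using \<open>c \<noteq> 0\<close> by (simp add: field_simps)
    qed
    finally have a: "c ^ n * s = a" .
    obtain b' where b': "b' \<in> M" "c ^ n = 1 - inverse s * b'"
      using one_minus_power[OF assms, of n] unfolding c_def by blast
    have "s = c ^ n * s + b'" unfolding b'(2) using max_s_nz by (simp add: field_simps)
    hence "s = a + b'" using a by simp
    thus False using sM subring_add[OF M aM b'(1)] by simp
  qed
  thus "inverse (1 - inverse s * b) \<in> M" by (simp add: c_def)
qed

text \<open>The descent in Chevalley's extension theorem: the relation for z has a constant term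
  that \<open>max_unit\<close> allows to divide out, which expresses \<open>y ^ n\<close> by lower
  powers of y and shortens the relation for y, against the minimality of p.\<close>

lemma max_no_short:
  assumes yz: "y * z = 1"
    and p: "\<And>i. coeff p i \<in> M" "poly p y = s" "\<And>p'. (\<And>i. coeff p' i \<in> M) \<Longrightarrow> poly p' y = s \<Longrightarrow> degree p \<le> degree p'"
    and q: "\<And>i. coeff q i \<in> M" "poly q z = s"
    and le: "degree q \<le> degree p"
  shows False
proof -
  define n where "n = degree p"
  define m where "m = degree q"
  define t where "t = inverse s"
  have tM': "t \<in> M" using tM by (simp add: t_def)
  have ts: "t * s = 1" using max_s_nz by (simp add: t_def)
  have n0: "n > 0"
  proof (rule ccontr)
    assume "\<not> n > 0"
    hence "poly p y = coeff p 0" by (simp add: poly_altdef n_def)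
    thus False using p sM by simp
  qed
  define c where "c = 1 - t * coeff q 0"
  have c: "c \<noteq> 0" "inverse c \<in> M" using max_unit[OF q(1)[of 0]] by (simp_all add: c_def t_def)
  have ynz: "y \<noteq> 0" using yz by auto
  have z: "z = inverse y" using yz by (metis inverse_unique)
  have "1 = (\<Sum>j\<le>m. t * coeff q j * z ^ j)"
    using ts unfolding q(2)[symmetric] poly_altdef m_def sum_distrib_left by (simp add: mult.assoc)
  also have "\<dots> = t * coeff q 0 + (\<Sum>j\<in>{1..m}. t * coeff q j * z ^ j)"
    by (simp add: sum.atMost_shift sum.atLeast1_atMost_eq lessThan_atLeast0)
  finally have ceq: "c = (\<Sum>j\<in>{1..m}. t * coeff q j * z ^ j)" by (simp add: c_def algebra_simps)
  have yn: "y ^ n = (\<Sum>j\<in>{1..m}. inverse c * t * coeff q j * y ^ (n - j))"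
  proof -
    have "c * y ^ n = (\<Sum>j\<in>{1..m}. t * coeff q j * y ^ (n - j))"
      unfolding ceq sum_distrib_right
    proof (intro sum.cong refl)
      fix j assume "j \<in> {1..m}"
      hence "y ^ n = y ^ (n - j) * y ^ j" using le by (simp add: m_def n_def flip: power_add)
      thus "t * coeff q j * z ^ j * y ^ n = t * coeff q j * y ^ (n - j)"
        using ynz by (simp add: z field_simps)
    qed
    hence "y ^ n = inverse c * (\<Sum>j\<in>{1..m}. t * coeff q j * y ^ (n - j))"
      using c by (simp add: field_simps)
    thus ?thesis by (simp add: sum_distrib_left mult.assoc)
  qed
  \<comment> \<open>The leading power \<open>y ^ n\<close> of p is replaced by the expression just
    found.\<close>
  define r where "r = (\<Sum>j\<in>{1..m}. monom (coeff p n * (inverse c * t * coeff q j)) (n - j))"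
  define p' where "p' = (p - monom (coeff p n) n) + r"
  have "coeff p' i \<in> M" for i
    unfolding p'_def r_def coeff_add coeff_diff coeff_sum coeff_monom
    using p(1) q(1) c(2) tM' by (auto intro!: subring_closed[OF M])
  moreover have "poly p' y = s"
  proof -
    have "poly r y = coeff p n * y ^ n"
      unfolding r_def poly_sum poly_monom yn sum_distrib_left by (intro sum.cong) auto
    thus ?thesis by (simp add: p'_def poly_monom p(2))
  qed
  ultimately have "degree p \<le> degree p'" by (rule p(3))
  moreover have "degree p' < n"
    unfolding p'_def
  proof (rule degree_add_less)
    show "degree r < n" unfolding r_def
    proof (rule degree_sum_less)
      fix j assume "j \<in> {1..m}"
      have "degree (monom (coeff p n * (inverse c * t * coeff q j)) (n - j)) \<le> n - j"
        by (rule degree_monom_le)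
      thus "degree (monom (coeff p n * (inverse c * t * coeff q j)) (n - j)) < n"
        using \<open>j \<in> _\<close> n0 by auto
    qed (use n0 in auto)
    show "degree (p - monom (coeff p n) n) < n"
    proof -
      have "degree (p - monom (coeff p n) n) \<le> n"
        by (intro degree_diff_le) (auto simp: n_def degree_monom_le)
      moreover have "coeff (p - monom (coeff p n) n) n = 0" by simp
      ultimately show ?thesis using n0
        by (metis le_neq_implies_less leading_coeff_0_iff degree_0)
    qed
  qed
  ultimately show False by (simp add: n_def)
qed

text \<open>If neither y nor its inverse lay in M, both would represent s polynomially. Of two
  shortest representations, the one of larger degree could still be shortened.\<close>

lemma max_valuation_ring: "valuation_ring M"
  unfolding valuation_ring_def
proof (intro conjI allI impI M)
  fix y :: 'b assume "y \<noteq> 0"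
  show "y \<in> M \<or> inverse y \<in> M"
  proof (rule ccontr)
    assume "\<not> ?thesis"
    hence y: "y \<notin> M" "inverse y \<notin> M" by auto
    have ex: "\<exists>p. ((\<forall>i. coeff p i \<in> M) \<and> poly p u = s) \<and> (\<forall>p'. (\<forall>i. coeff p' i \<in> M) \<and> poly p' u = s \<longrightarrow> degree p \<le> degree p')"
      if "u \<notin> M" for u
    proof -
      obtain p where "(\<forall>i. coeff p i \<in> M) \<and> poly p u = s"
        using max_adjoin[OF \<open>u \<notin> M\<close>] by (auto simp: adjoin_def)
      from ex_has_least_nat[of "\<lambda>p. (\<forall>i. coeff p i \<in> M) \<and> poly p u = s", OF this, of degree]
      show ?thesis .
    qed
    obtain p where p: "\<And>i. coeff p i \<in> M" "poly p y = s"
      "\<And>p'. (\<And>i. coeff p' i \<in> M) \<Longrightarrow> poly p' y = s \<Longrightarrow> degree p \<le> degree p'"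
      using ex[OF y(1)] by blast
    obtain q where q: "\<And>i. coeff q i \<in> M" "poly q (inverse y) = s"
      "\<And>p'. (\<And>i. coeff p' i \<in> M) \<Longrightarrow> poly p' (inverse y) = s \<Longrightarrow> degree q \<le> degree p'"
      using ex[OF y(2)] by blast
    show False
    proof (cases "degree q \<le> degree p")
      case True
      show False by (rule max_no_short[of y "inverse y" p q]) (use \<open>y \<noteq> 0\<close> p q True in auto)
    next
      case False
      show False by (rule max_no_short[of "inverse y" y q p]) (use \<open>y \<noteq> 0\<close> p q False in auto)
    qed
  qed
qed

end

text \<open>Chevalley's extension theorem, by Zorn's lemma. Keeping one element s outside, whose
  inverse is inside, is what makes s large for the resulting valuation.\<close>

theorem exists_valuation_ring:
  assumes "is_subring A" "s \<notin> A" "inverse s \<in> A"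
  shows "\<exists>R. valuation_ring R \<and> A \<subseteq> R \<and> s \<notin> R"
proof -
  define SS where "SS = {B. is_subring B \<and> A \<subseteq> B \<and> s \<notin> B}"
  have "\<exists>M\<in>SS. \<forall>B\<in>SS. M \<subseteq> B \<longrightarrow> B = M"
  proof (rule subset_Zorn_nonempty)
    show "SS \<noteq> {}" using assms by (auto simp: SS_def)
    fix C assume C: "C \<noteq> {}" "subset.chain SS C"
    have sub: "B \<in> SS" if "B \<in> C" for B using C(2) that by (auto simp: subset.chain_def)
    have tot: "B \<subseteq> B' \<or> B' \<subseteq> B" if "B \<in> C" "B' \<in> C" for B B'
      using C(2) that by (auto simp: subset.chain_def)
    have sub: "is_subring B" "A \<subseteq> B" "s \<notin> B" if "B \<in> C" for B
      using sub[OF that] by (auto simp: SS_def)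
    have "is_subring (\<Union>C)"
      unfolding is_subring_def
    proof (intro conjI ballI)
      show "1 \<in> \<Union>C" using C(1) sub(1) subring_one by blast
      fix x y assume "x \<in> \<Union>C" "y \<in> \<Union>C"
      then obtain B where B: "B \<in> C" "x \<in> B" "y \<in> B" using tot by blast
      hence "is_subring B" using sub(1) by blast
      note c = subring_closed[OF this]
      show "x + y \<in> \<Union>C" using c(3)[OF B(2,3)] B(1) by blast
      show "x - y \<in> \<Union>C" using c(4)[OF B(2,3)] B(1) by blast
      show "x * y \<in> \<Union>C" using c(5)[OF B(2,3)] B(1) by blast
    qed
    moreover have "A \<subseteq> \<Union>C" using C(1) sub(2) by blast
    moreover have "s \<notin> \<Union>C" using sub(3) by blast
    ultimately show "\<Union>C \<in> SS" by (simp add: SS_def)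
  qed
  then obtain M where "M \<in> SS" and mx: "\<And>B. B \<in> SS \<Longrightarrow> M \<subseteq> B \<Longrightarrow> B = M" by metis
  hence M: "is_subring M" "A \<subseteq> M" "s \<notin> M" by (simp_all add: SS_def)
  have "valuation_ring M"
  proof (rule max_valuation_ring[of M s])
    fix B assume B: "is_subring B" "M \<subseteq> B" "s \<notin> B"
    show "B = M" by (rule mx) (use B M in \<open>auto simp: SS_def\<close>)
  qed (use M assms in auto)
  thus ?thesis using M by blast
qed

section \<open>Absolute values of valuation rings\<close>

context
  fixes R :: "'b::field set"
  assumes R: "valuation_ring R"
begin

lemma vr: "is_subring R"
  using R by (simp add: valuation_ring_def)

lemma vr_cases: "y \<noteq> 0 \<Longrightarrow> y \<in> R \<or> inverse y \<in> R"
  using R by (simp add: valuation_ring_def)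

lemma vr_power_iff: "m > 0 \<Longrightarrow> y ^ m \<in> R \<longleftrightarrow> y \<in> R"
proof
  assume m: "m > 0" and y: "y ^ m \<in> R"
  show "y \<in> R"
  proof (rule ccontr)
    assume n: "y \<notin> R"
    hence "y \<noteq> 0" using subring_zero[OF vr] by auto
    hence i: "inverse y \<in> R" using vr_cases n by blast
    obtain l where l: "m = Suc l" using m gr0_implies_Suc by blast
    have "y = y ^ m * inverse y ^ l" using \<open>y \<noteq> 0\<close> by (simp add: l field_simps)
    hence "y \<in> R" using subring_mult[OF vr y subring_power[OF vr i, of l]] by simp
    thus False using n by simp
  qed
qed (rule subring_power[OF vr])

text \<open>Equality of values, expressed without forming the value group.\<close>

definition assoc :: "'b \<Rightarrow> 'b \<Rightarrow> bool" where
  "assoc a b \<longleftrightarrow> a \<noteq> 0 \<and> b \<noteq> 0 \<and> a / b \<in> R \<and> b / a \<in> R"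

lemma assoc_sym: "assoc a b \<Longrightarrow> assoc b a"
  by (auto simp: assoc_def)

lemma assoc_refl: "a \<noteq> 0 \<Longrightarrow> assoc a a"
  by (simp add: assoc_def subring_one[OF vr])

lemma assoc_trans: "assoc a b \<Longrightarrow> assoc b c \<Longrightarrow> assoc a c"
proof -
  assume "assoc a b" "assoc b c"
  thus ?thesis using subring_mult[OF vr, of "a / b" "b / c"] subring_mult[OF vr, of "c / b" "b / a"]
    by (simp add: assoc_def)
qed

lemma assoc_mult: "assoc a b \<Longrightarrow> assoc c d \<Longrightarrow> assoc (a * c) (b * d)"
proof -
  assume "assoc a b" "assoc c d"
  thus ?thesis using subring_mult[OF vr, of "a / b" "c / d"] subring_mult[OF vr, of "b / a" "d / c"]
    by (simp add: assoc_def)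
qed

lemma assoc_power: "assoc a b \<Longrightarrow> assoc (a ^ n) (b ^ n)"
  by (induction n) (auto intro: assoc_mult assoc_refl)

lemma assoc_mem: "assoc a b \<Longrightarrow> a \<in> R \<longleftrightarrow> b \<in> R"
proof -
  assume "assoc a b"
  thus ?thesis using subring_mult[OF vr, of "a / b" b] subring_mult[OF vr, of "b / a" a]
    by (auto simp: assoc_def)
qed

text \<open>Membership in the maximal ideal of R.\<close>

definition nonunit :: "'b \<Rightarrow> bool" where
  "nonunit a \<longleftrightarrow> a \<in> R \<and> (a = 0 \<or> inverse a \<notin> R)"

text \<open>If the inverse of the sum lay in R, so would that of b, because
  \<open>inverse b = (a / b + 1) * inverse (a + b)\<close>.\<close>

lemma nonunit_add_aux:
  assumes "nonunit a" "nonunit b" "b \<noteq> 0" "a / b \<in> R"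
  shows "nonunit (a + b)"
proof -
  have "a + b \<in> R" using assms subring_add[OF vr] by (simp add: nonunit_def)
  moreover have "inverse (a + b) \<notin> R" if "a + b \<noteq> 0"
  proof
    assume i: "inverse (a + b) \<in> R"
    have "inverse b = (a / b + 1) * inverse (a + b)"
      using that assms(3) by (simp add: divide_simps)
    hence "inverse b \<in> R"
      using subring_mult[OF vr subring_add[OF vr assms(4) subring_one[OF vr]] i] by simp
    thus False using assms by (simp add: nonunit_def)
  qed
  ultimately show ?thesis by (auto simp: nonunit_def)
qed

lemma nonunit_add:
  assumes "nonunit a" "nonunit b"
  shows "nonunit (a + b)"
proof (cases "a = 0 \<or> b = 0")
  case True
  thus ?thesis using assms by auto
next
  case False
  hence "a / b \<in> R \<or> b / a \<in> R" using vr_cases[of "a / b"] by simp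
  thus ?thesis using nonunit_add_aux[OF assms] nonunit_add_aux[OF assms(2,1)] False
    by (auto simp: add.commute)
qed

lemma nonunit_sum: "(\<And>i. i \<in> I \<Longrightarrow> nonunit (f i)) \<Longrightarrow> nonunit (sum f I)"
proof (induction I rule: infinite_finite_induct)
  case (insert x F)
  thus ?case by (simp add: nonunit_add)
qed (auto simp: nonunit_def subring_zero[OF vr])

text \<open>The counterpart of \<open>exists_tie\<close> for a valuation ring. After division by a
  largest term the other quotients lie in R and add up to -1; as sums of nonunits are nonunits, some
  quotient is a unit.\<close>

lemma vr_tie:
  assumes "finite I" "i0 \<in> I" "f i0 \<noteq> 0" "sum f I = 0"
  obtains i j where "i \<in> I" "j \<in> I" "i \<noteq> j" "assoc (f i) (f j)"
proof -
  have ex: "\<exists>i\<in>J. \<forall>j\<in>J. f j / f i \<in> R"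
    if "finite J" "J \<noteq> {}" "\<And>j. j \<in> J \<Longrightarrow> f j \<noteq> 0" for J
    using that
  proof (induction J rule: finite_ne_induct)
    case (singleton x)
    thus ?case by (simp add: subring_one[OF vr])
  next
    case (insert x F)
    then obtain i where i: "i \<in> F" "\<And>j. j \<in> F \<Longrightarrow> f j / f i \<in> R" by auto
    have nz: "f x \<noteq> 0" "f i \<noteq> 0" using insert i by auto
    show ?case
    proof (cases "f x / f i \<in> R")
      case True
      thus ?thesis using i by (intro bexI[of _ i]) auto
    next
      case False
      hence r: "f i / f x \<in> R" using vr_cases[of "f x / f i"] nz by simp
      have "f j / f x \<in> R" if "j \<in> F" for j
        using subring_mult[OF vr i(2)[OF that] r] nz by simp
      thus ?thesis using nz subring_one[OF vr] by (intro bexI[of _ x]) auto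
    qed
  qed
  define J where "J = {i\<in>I. f i \<noteq> 0}"
  have J: "finite J" "J \<noteq> {}" "\<And>j. j \<in> J \<Longrightarrow> f j \<noteq> 0" using assms by (auto simp: J_def)
  obtain i where i: "i \<in> J" "\<And>j. j \<in> J \<Longrightarrow> f j / f i \<in> R" using ex[OF J] by blast
  have fi: "f i \<noteq> 0" using J i by blast
  have "sum f J = 0"
    using assms(1,4) unfolding J_def by (subst sum.mono_neutral_left[of I]) auto
  moreover have "sum f J = f i + sum f (J - {i})" by (rule sum.remove) (use J i in auto)
  ultimately have "sum f (J - {i}) / f i = - 1" using fi by (simp add: field_simps add_eq_0_iff)
  hence s: "(\<Sum>j\<in>J - {i}. f j / f i) = - 1" by (simp add: sum_divide_distrib)
  have "\<exists>j\<in>J - {i}. \<not> nonunit (f j / f i)"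
  proof (rule ccontr)
    assume "\<not> (\<exists>j\<in>J - {i}. \<not> nonunit (f j / f i))"
    hence "nonunit (\<Sum>j\<in>J - {i}. f j / f i)" by (intro nonunit_sum) blast
    hence "nonunit (- 1)" by (simp only: s)
    thus False using subring_minus[OF vr subring_one[OF vr]] by (simp add: nonunit_def)
  qed
  then obtain j where j: "j \<in> J" "j \<noteq> i" "\<not> nonunit (f j / f i)" by blast
  have "assoc (f i) (f j)"
    using j(3) i(2)[OF j(1)] J(3)[OF j(1)] fi by (simp add: nonunit_def assoc_def)
  thus ?thesis using that[of i j] i j by (auto simp: J_def)
qed

text \<open>\<open>tors\<close> says that the value group is torsion modulo the values of H, so
  \<nu> has only one candidate extension: the m-th root of its value on an m-th power. H will be the
  multiplicative group of K when an absolute value is extended, and the powers of x when a place is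
  constructed.\<close>

lemma exists_abs_of_valuation_ring:
  fixes H :: "'b set" and \<nu> :: "'b \<Rightarrow> real"
  assumes H: "\<And>h. h \<in> H \<Longrightarrow> h \<noteq> 0" "1 \<in> H" "\<And>h h'. h \<in> H \<Longrightarrow> h' \<in> H \<Longrightarrow> h * h' \<in> H"
      "\<And>h. h \<in> H \<Longrightarrow> inverse h \<in> H"
    and \<nu>: "\<And>h. h \<in> H \<Longrightarrow> \<nu> h > 0" "\<And>h h'. h \<in> H \<Longrightarrow> h' \<in> H \<Longrightarrow> \<nu> (h * h') = \<nu> h * \<nu> h'"
      "\<And>h. h \<in> H \<Longrightarrow> \<nu> h \<le> 1 \<longleftrightarrow> h \<in> R"
    and tors: "\<And>z. z \<noteq> 0 \<Longrightarrow> \<exists>m>0. \<exists>h\<in>H. assoc (z ^ m) h"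
  obtains w where "nonarch w" "\<And>z. w z \<le> 1 \<longleftrightarrow> z \<in> R" "\<And>h. h \<in> H \<Longrightarrow> w h = \<nu> h"
proof -
  define Q where "Q = (\<lambda>z (p::nat \<times> 'b). fst p > 0 \<and> snd p \<in> H \<and> assoc (z ^ fst p) (snd p))"
  define w where "w = (\<lambda>z. if z = 0 then 0 else
     (let p = SOME p. Q z p in \<nu> (snd p) powr (1 / real (fst p))))"
  have hpow: "h ^ n \<in> H" if "h \<in> H" for h n
    using that by (induction n) (auto simp: H)
  have \<nu>1: "\<nu> 1 = 1" using \<nu>(2)[of 1 1] \<nu>(1)[of 1] H(2) by simp
  have \<nu>pow: "\<nu> (h ^ n) = \<nu> h ^ n" if "h \<in> H" for h n
    using that by (induction n) (auto simp: \<nu>1 \<nu>(2) hpow)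
  have \<nu>inv: "\<nu> (inverse h) = inverse (\<nu> h)" if "h \<in> H" for h
  proof -
    have "\<nu> h * \<nu> (inverse h) = 1" using \<nu>(2)[OF that H(4)[OF that]] H(1)[OF that] \<nu>1 by simp
    thus ?thesis by (metis inverse_unique)
  qed
  have \<nu>assoc: "\<nu> h = \<nu> h'" if "h \<in> H" "h' \<in> H" "assoc h h'" for h h'
  proof -
    have "\<nu> (h * inverse h') \<le> 1" "\<nu> (h' * inverse h) \<le> 1"
      using that \<nu>(3)[of "h * inverse h'"] \<nu>(3)[of "h' * inverse h"]
      by (auto simp: assoc_def H divide_inverse)
    hence "\<nu> h * inverse (\<nu> h') \<le> 1" "\<nu> h' * inverse (\<nu> h) \<le> 1"
      using \<nu>(2)[OF that(1) H(4)[OF that(2)]] \<nu>(2)[OF that(2) H(4)[OF that(1)]] \<nu>inv that by simp_all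
    thus ?thesis using \<nu>(1)[OF that(1)] \<nu>(1)[OF that(2)] by (simp add: field_simps)
  qed
  \<comment> \<open>Independence of the choices: two representations of powers of z are compared at
    the common exponent \<open>m * m'\<close>.\<close>
  have weq: "w z = \<nu> h powr (1 / real m)" if "z \<noteq> 0" "m > 0" "h \<in> H" "assoc (z ^ m) h" for z m h
  proof -
    define p where "p = (SOME p. Q z p)"
    have "Q z (m, h)" using that by (simp add: Q_def)
    hence p: "Q z p" unfolding p_def by (rule someI)
    obtain m' h' where mh: "p = (m', h')" by (cases p)
    have m': "m' > 0" "h' \<in> H" "assoc (z ^ m') h'" using p by (auto simp: Q_def mh)
    have "assoc ((z ^ m) ^ m') (h ^ m')" "assoc ((z ^ m') ^ m) (h' ^ m)"
      using that m' by (auto intro: assoc_power)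
    hence "assoc (h ^ m') (h' ^ m)"
      by (metis assoc_sym assoc_trans power_mult mult.commute)
    hence "\<nu> h ^ m' = \<nu> h' ^ m"
      using \<nu>assoc[of "h ^ m'" "h' ^ m"] hpow \<nu>pow that m' by simp
    hence e: "\<nu> h powr real m' = \<nu> h' powr real m"
      using \<nu>(1) that m' by (simp add: powr_realpow)
    have "\<nu> h powr (1 / real m) = (\<nu> h powr real m') powr (1 / (real m * real m'))"
      using that m' by (simp add: powr_powr)
    also have "\<dots> = \<nu> h' powr (1 / real m')"
      unfolding e using that m' by (simp add: powr_powr)
    finally show ?thesis using mh that(1) by (simp add: w_def Let_def p_def)
  qed
  have wpos: "w z > 0" if "z \<noteq> 0" for z
  proof -
    obtain m h where "m > 0" "h \<in> H" "assoc (z ^ m) h" using tors[OF \<open>z \<noteq> 0\<close>] by blast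
    from weq[OF that this] show ?thesis using \<nu>(1)[OF \<open>h \<in> H\<close>] by simp
  qed
  have w0: "w 0 = 0" by (simp add: w_def)
  have wmult: "w (x * y) = w x * w y" for x y
  proof (cases "x = 0 \<or> y = 0")
    case True
    thus ?thesis using w0 by auto
  next
    case False
    obtain m h where m: "m > 0" "h \<in> H" "assoc (x ^ m) h" using tors False by blast
    obtain m' h' where m': "m' > 0" "h' \<in> H" "assoc (y ^ m') h'" using tors False by blast
    have "assoc ((x ^ m) ^ m' * (y ^ m') ^ m) (h ^ m' * h' ^ m)"
      using m m' by (intro assoc_mult assoc_power)
    hence "assoc ((x * y) ^ (m * m')) (h ^ m' * h' ^ m)"
      by (simp add: power_mult_distrib power_mult[symmetric] mult.commute)
    hence "w (x * y) = \<nu> (h ^ m' * h' ^ m) powr (1 / real (m * m'))"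
      using False m m' hpow H by (intro weq) auto
    also have "\<nu> (h ^ m' * h' ^ m) = \<nu> h powr real m' * \<nu> h' powr real m"
      using m m' hpow \<nu> by (simp add: \<nu>pow powr_realpow)
    also have "(\<nu> h powr real m' * \<nu> h' powr real m) powr (1 / real (m * m')) =
        \<nu> h powr (1 / real m) * \<nu> h' powr (1 / real m')"
      using m m' by (simp add: powr_mult powr_powr)
    also have "\<dots> = w x * w y" using weq False m m' by simp
    finally show ?thesis .
  qed
  have wR: "w z \<le> 1 \<longleftrightarrow> z \<in> R" for z
  proof (cases "z = 0")
    case True
    thus ?thesis using w0 subring_zero[OF vr] by simp
  next
    case False
    obtain m h where m: "m > 0" "h \<in> H" "assoc (z ^ m) h" using tors False by blast
    have "w z \<le> 1 \<longleftrightarrow> \<nu> h \<le> 1"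
    proof
      assume "\<nu> h \<le> 1"
      thus "w z \<le> 1" using weq[OF False m] \<nu>(1)[OF m(2)] by (simp add: powr_le1)
    next
      assume "w z \<le> 1"
      hence "(\<nu> h powr (1 / real m)) powr real m \<le> 1"
        using weq[OF False m] by (intro powr_le1) auto
      thus "\<nu> h \<le> 1" using m \<nu>(1)[OF m(2)] by (simp add: powr_powr)
    qed
    also have "\<dots> \<longleftrightarrow> h \<in> R" using \<nu>(3) m by blast
    also have "\<dots> \<longleftrightarrow> z ^ m \<in> R" using assoc_mem[OF m(3)] by simp
    finally show ?thesis using vr_power_iff[OF m(1)] by simp
  qed
  \<comment> \<open>Division by y reduces the ultrametric inequality to the closure of R under
    adding 1.\<close>
  have ult: "w (x + y) \<le> w y" if "w x \<le> w y" "y \<noteq> 0" for x y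
  proof -
    have "w (x / y) * w y = w x" using wmult[of "x / y" y] that by simp
    hence "w (x / y) * w y \<le> 1 * w y" using that by simp
    hence "w (x / y) \<le> 1" using wpos[OF that(2)] by (rule mult_right_le_imp_le)
    hence "w (x / y + 1) \<le> 1"
      using wR subring_add[OF vr _ subring_one[OF vr]] by blast
    moreover have "w (x + y) = w (x / y + 1) * w y"
      using that by (simp add: wmult[symmetric] distrib_right)
    ultimately show ?thesis using wpos[OF that(2)] by simp
  qed
  have nn: "w x \<ge> 0" for x using wpos[of x] w0 by (cases "x = 0") auto
  have "nonarch w"
  proof
    fix x y
    show "w x \<ge> 0" by (rule nn)
    show "w x = 0 \<longleftrightarrow> x = 0" using wpos[of x] w0 by (cases "x = 0") auto
    show "w (x * y) = w x * w y" by (rule wmult)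
    show "w (x + y) \<le> max (w x) (w y)"
    proof (cases "x = 0 \<or> y = 0")
      case True
      thus ?thesis by auto
    next
      case False
      show ?thesis
      proof (cases "w x \<le> w y")
        case True
        thus ?thesis using ult[of x y] False by simp
      next
        case ge: False
        hence "w (y + x) \<le> w x" using ult[of y x] False by simp
        thus ?thesis by (simp add: add.commute)
      qed
    qed
  qed
  moreover have "w h = \<nu> h" if "h \<in> H" for h
    using weq[of h 1 h] that H(1) \<nu>(1)[OF that] assoc_refl[of h] by simp
  ultimately show ?thesis using wR that by blast
qed

end

text \<open>Any valuation ring of the algebraic closure that contains the one of v and omits some s
  with v s > 1 will do; its values are torsion over those of K because of a tie in an algebraic
  equation.\<close>

theorem exists_extension:
  fixes v :: "'a::field \<Rightarrow> real"
  assumes "nonarch v" "x \<noteq> 0" "v x \<noteq> 1"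
  obtains w :: "'a alg_closure \<Rightarrow> real" where "nonarch w" "\<And>a. w (to_ac a) = v a"
proof -
  interpret nonarch v by fact
  obtain s where s: "v s > 1"
  proof (cases "v x > 1")
    case False
    hence "v x < 1" using assms(3) by simp
    hence "v (inverse x) > 1" using assms(2) unfolding inverse
      by (intro one_less_inverse) simp_all
    thus ?thesis using that by blast
  qed (use that in blast)
  define A where "A = to_ac ` {a. v a \<le> 1}"
  have A: "is_subring A"
    unfolding is_subring_def
  proof (intro conjI ballI)
    show "1 \<in> A" unfolding A_def by (intro image_eqI[of _ _ 1]) auto
    fix a b assume "a \<in> A" "b \<in> A"
    then obtain a' b' where ab: "a = to_ac a'" "b = to_ac b'" "v a' \<le> 1" "v b' \<le> 1" by (auto simp: A_def)
    have "v (a' + b') \<le> 1" using ultra[of a' b'] ab by linarith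
    thus "a + b \<in> A" unfolding A_def using ab by (intro image_eqI[of _ _ "a' + b'"]) auto
    have "v (a' - b') \<le> 1" using ultra_diff[of a' b'] ab by linarith
    thus "a - b \<in> A" unfolding A_def using ab by (intro image_eqI[of _ _ "a' - b'"]) auto
    have "v (a' * b') \<le> 1" using ab by (simp add: mult mult_le_one)
    thus "a * b \<in> A" unfolding A_def using ab by (intro image_eqI[of _ _ "a' * b'"]) auto
  qed
  have "to_ac s \<notin> A" using s by (auto simp: A_def)
  moreover have "inverse (to_ac s) \<in> A"
    unfolding A_def using s by (intro image_eqI[of _ _ "inverse s"]) (auto simp: inverse inverse_le_1_iff)
  ultimately obtain R where R: "valuation_ring R" "A \<subseteq> R" "to_ac s \<notin> R"
    using exists_valuation_ring[OF A] by blast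
  note vr = vr[OF R(1)]
  \<comment> \<open>R meets K exactly in the valuation ring of v: an a with v a > 1 has a power that
    dominates s, so with a the ring would also contain s.\<close>
  have mem: "to_ac a \<in> R \<longleftrightarrow> v a \<le> 1" for a
  proof
    assume a: "to_ac a \<in> R"
    show "v a \<le> 1"
    proof (rule ccontr)
      assume "\<not> v a \<le> 1"
      then obtain n where n: "v a ^ n > v s" using real_arch_pow[of "v a" "v s"] by auto
      have an: "a \<noteq> 0" using \<open>\<not> v a \<le> 1\<close> by auto
      have "v (s / a ^ n) \<le> 1" using n an by (simp add: divide power)
      hence "to_ac (s / a ^ n) \<in> R" using R(2) by (auto simp: A_def)
      hence "to_ac (s / a ^ n) * to_ac a ^ n \<in> R"
        using subring_mult[OF vr] subring_power[OF vr a] by blast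
      hence "to_ac s \<in> R" using an by simp
      thus False using R by simp
    qed
  qed (use R(2) in \<open>auto simp: A_def\<close>)
  define H where "H = range to_ac - {0 :: 'a alg_closure}"
  obtain w where w: "nonarch w" "\<And>h. h \<in> H \<Longrightarrow> w h = v (of_ac h)"
  proof (rule exists_abs_of_valuation_ring[OF R(1), of H "\<lambda>h. v (of_ac h)"])
    fix z :: "'a alg_closure" assume z: "z \<noteq> 0"
    obtain p :: "'a poly" where p: "p \<noteq> 0" "poly (map_poly to_ac p) z = 0"
      using alg_closure_algebraic by blast
    \<comment> \<open>Two terms of the equation of z are associated, hence some power of z is
      associated to a quotient of coefficients.\<close>
    define f where "f = (\<lambda>i. to_ac (coeff p i) * z ^ i)"
    have "sum f {..degree p} = 0"
      using p(2) by (simp add: poly_altdef f_def coeff_map_poly degree_map_poly)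
    moreover have "f (degree p) \<noteq> 0" using p z by (simp add: f_def)
    ultimately obtain i j where ij: "i \<noteq> j" "assoc R (f i) (f j)"
      using vr_tie[OF R(1), of "{..degree p}" "degree p" f]
      by (metis finite_atMost atMost_iff order_refl)
    have step: "\<exists>m>0. \<exists>h\<in>H. assoc R (z ^ m) h" if "i < j" "assoc R (f i) (f j)" for i j
    proof (intro exI[of _ "j - i"] conjI bexI)
      have nz: "coeff p i \<noteq> 0" "coeff p j \<noteq> 0"
        using that(2) assoc_def[OF R(1)] by (auto simp: f_def)
      have zj: "z ^ j = z ^ (j - i) * z ^ i" using that by (simp flip: power_add)
      show "assoc R (z ^ (j - i)) (to_ac (coeff p i / coeff p j))"
        using that(2) nz z unfolding assoc_def[OF R(1)] f_def zj by (simp add: field_simps)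
      show "to_ac (coeff p i / coeff p j) \<in> H" using nz by (simp add: H_def del: to_ac_divide)
    qed (use that in auto)
    show "\<exists>m>0. \<exists>h\<in>H. assoc R (z ^ m) h"
      using ij step[of i j] step[of j i] assoc_sym[OF R(1)] by (metis linorder_neqE_nat)
  next
    fix h assume "h \<in> H"
    thus "inverse h \<in> H" by (auto simp: H_def simp flip: to_ac_inverse)
  next
    fix h h' assume "h \<in> H" "h' \<in> H"
    thus "h * h' \<in> H" "v (of_ac (h * h')) = v (of_ac h) * v (of_ac h')"
      by (auto simp: H_def mult simp flip: to_ac_mult)
  next
    fix h assume "h \<in> H"
    thus "v (of_ac h) \<le> 1 \<longleftrightarrow> h \<in> R" by (auto simp: H_def mem)
  next
    show "1 \<in> H" unfolding H_def using to_ac_1 by (metis DiffI rangeI singletonD zero_neq_one)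
  qed (auto simp: H_def)
  have "w (to_ac a) = v a" for a
  proof (cases "a = 0")
    case True
    thus ?thesis using nonarch.zero[OF w(1)] by simp
  next
    case False
    thus ?thesis using w(2)[of "to_ac a"] by (simp add: H_def)
  qed
  thus ?thesis using w(1) that by blast
qed

text \<open>The valuation ring is chosen to contain k and 1/x but not x. \<open>dep\<close> makes
  every z algebraic over k(x), so that a power of z is associated to a power of x and the value of x
  determines all others.\<close>

theorem exists_place_pole:
  fixes k :: "'a::field set"
  assumes k: "is_subfield k" and x: "\<not> algebraic_over k x"
    and dep: "\<And>z::'a. \<exists>(P :: nat \<Rightarrow> 'a poly) r. (\<forall>i\<le>r. \<forall>l. coeff (P i) l \<in> k) \<and> (\<exists>i\<le>r. P i \<noteq> 0) \<and>
        (\<Sum>i\<le>r. poly (P i) x * z ^ i) = 0"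
  obtains p where "p \<in> places k" "rep p x > 1"
proof -
  have kr: "is_subring k" by (rule is_subfield_subring[OF k])
  have xnz: "x \<noteq> 0"
  proof
    assume "x = 0"
    hence "algebraic_over k x" unfolding algebraic_over_def
      using subring_zero[OF kr] subring_one[OF kr]
      by (intro exI[of _ "[:0, 1:]"]) (auto simp: coeff_pCons split: nat.splits)
    thus False using x by simp
  qed
  define A where "A = adjoin k (inverse x)"
  have A: "is_subring A" unfolding A_def by (rule adjoin_subring[OF kr])
  have "x \<notin> A"
  proof
    assume "x \<in> A"
    then obtain p where p: "\<And>i. coeff p i \<in> k" "x = poly p (inverse x)" by (auto simp: A_def adjoin_def)
    \<comment> \<open>A relation x = p(1/x) says that 1 - T p(T) vanishes at T = 1/x; the reversed
      polynomial would be an equation for x over k.\<close>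
    define r where "r = 1 - pCons 0 p"
    have r: "poly r (inverse x) = 0" using p(2) xnz by (simp add: r_def field_simps)
    have rk: "coeff r i \<in> k" for i
      unfolding r_def coeff_diff coeff_1 coeff_pCons
      using p(1) by (auto intro!: subring_closed[OF kr] split: nat.splits)
    have "r \<noteq> 0"
    proof
      assume "r = 0"
      hence "coeff r 0 = 0" by simp
      thus False by (simp add: r_def)
    qed
    moreover have "poly (reflect_poly r) x = 0"
      using poly_reflect_poly_nz[of x r] xnz r by simp
    moreover have "coeff (reflect_poly r) i \<in> k" for i
      using rk subring_zero[OF kr] by (simp add: coeff_reflect_poly)
    ultimately have "algebraic_over k x" unfolding algebraic_over_def
      by (intro exI[of _ "reflect_poly r"]) auto
    thus False using x by simp
  qed
  moreover have "inverse x \<in> A" unfolding A_def by (rule adjoin_self[OF kr])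
  ultimately obtain R where R: "valuation_ring R" "A \<subseteq> R" "x \<notin> R"
    using exists_valuation_ring[OF A] by blast
  note vr = vr[OF R(1)]
  have kR: "c \<in> R" if "c \<in> k" for c
    using adjoin_superset[OF kr, of "inverse x"] that R(2) by (auto simp: A_def)
  have iR: "inverse x \<in> R" using adjoin_self[OF kr, of "inverse x"] R(2) by (auto simp: A_def)
  have xi: "x powi i \<in> R \<longleftrightarrow> i \<le> 0" for i
  proof (cases "i \<le> 0")
    case True
    hence "x powi i = inverse x ^ nat (- i)" by (simp add: power_int_def power_inverse)
    thus ?thesis using True subring_power[OF vr iR] by simp
  next
    case False
    hence "x powi i = x ^ nat i" by (simp add: power_int_def)
    thus ?thesis using False vr_power_iff[OF R(1), of "nat i" x] R(3) by simp
  qed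
  have inj: "i = j" if "x powi i = x powi j" for i j
  proof -
    have "x powi (i - j) = 1" "x powi (j - i) = 1" using that xnz by (simp_all add: power_int_diff)
    thus ?thesis using xi[of "i - j"] xi[of "j - i"] subring_one[OF vr] by simp
  qed
  define H where "H = range (\<lambda>i. x powi i)"
  \<comment> \<open>The base 2 is arbitrary, since places are classes up to powers.\<close>
  define \<nu> where "\<nu> = (\<lambda>h. 2 powi (THE i. h = x powi i) :: real)"
  have \<nu>: "\<nu> (x powi i) = 2 powi i" for i
  proof -
    have "(THE j. x powi i = x powi j) = i" using inj by (intro the_equality) auto
    thus ?thesis by (simp add: \<nu>_def)
  qed
  obtain w where w: "nonarch w" "\<And>z. w z \<le> 1 \<longleftrightarrow> z \<in> R" "\<And>h. h \<in> H \<Longrightarrow> w h = \<nu> h"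
  proof (rule exists_abs_of_valuation_ring[OF R(1), of H \<nu>])
    fix z :: 'a assume z: "z \<noteq> 0"
    obtain P r where P: "\<And>i l. i \<le> r \<Longrightarrow> coeff (P i) l \<in> k" "\<exists>i\<le>r. P i \<noteq> 0"
       "(\<Sum>i\<le>r. poly (P i) x * z ^ i) = 0" using dep[of z] by blast
    obtain i0 where i0: "i0 \<le> r" "P i0 \<noteq> 0" using P(2) by blast
    define I where "I = (SIGMA i:{..r}. {..degree (P i)})"
    define f where "f = (\<lambda>(i, l). coeff (P i) l * x ^ l * z ^ i)"
    have "sum f I = (\<Sum>i\<le>r. poly (P i) x * z ^ i)"
      unfolding I_def f_def poly_altdef sum_distrib_right by (subst sum.Sigma) auto
    hence s0: "sum f I = 0" using P by simp
    have "f (i0, degree (P i0)) \<noteq> 0" using i0 xnz z by (simp add: f_def)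
    moreover have "(i0, degree (P i0)) \<in> I" using i0 by (simp add: I_def)
    moreover have "finite I" by (simp add: I_def)
    ultimately obtain a b where ab: "a \<in> I" "b \<in> I" "a \<noteq> b" "assoc R (f a) (f b)"
      using vr_tie[OF R(1), of I _ f] s0 by metis
    obtain i l where a: "a = (i, l)" by (cases a)
    obtain j m where b: "b = (j, m)" by (cases b)
    have key: "assoc R (coeff (P i) l * x ^ l * z ^ i) (coeff (P j) m * x ^ m * z ^ j)"
      using ab(4) by (simp add: a b f_def)
    have ass: "assoc R (x ^ l * z ^ i) (x ^ m * z ^ j)"
    proof -
      have c: "assoc R c 1" if "c \<in> k" "c \<noteq> 0" for c
        using that k kR unfolding assoc_def[OF R(1)] by (auto simp: is_subfield_def divide_inverse)
      have nz: "coeff (P i) l \<noteq> 0" "coeff (P j) m \<noteq> 0" using key by (auto simp: assoc_def[OF R(1)])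
      have "coeff (P i) l \<in> k" "coeff (P j) m \<in> k" using ab P(1) by (auto simp: a b I_def)
      hence "assoc R (coeff (P i) l) 1" "assoc R (coeff (P j) m) 1" using c nz by auto
      hence n: "assoc R (1 * (x ^ l * z ^ i)) (coeff (P i) l * (x ^ l * z ^ i))"
         "assoc R (coeff (P j) m * (x ^ m * z ^ j)) (1 * (x ^ m * z ^ j))"
        using xnz z by (intro assoc_mult[OF R(1)] assoc_refl[OF R(1)]; auto intro: assoc_sym[OF R(1)])+
      from assoc_trans[OF R(1) assoc_trans[OF R(1) n(1) key[unfolded mult.assoc]] n(2)[unfolded mult.assoc]]
      show ?thesis by simp
    qed
    \<comment> \<open>Two terms with the same power of z would make a nontrivial power of x
      associated to 1.\<close>
    have ne: "i \<noteq> j"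
    proof
      assume "i = j"
      hence "x ^ l / x ^ m \<in> R" "x ^ m / x ^ l \<in> R"
        using ass z by (auto simp: assoc_def[OF R(1)])
      hence "x powi (int l - int m) \<in> R" "x powi (int m - int l) \<in> R"
        using xnz by (simp_all add: power_int_diff)
      hence "l = m" unfolding xi by linarith
      thus False using ab(3) \<open>i = j\<close> by (simp add: a b)
    qed
    have step: "\<exists>m>0. \<exists>h\<in>H. assoc R (z ^ m) h"
      if "i < j" "assoc R (x ^ l * z ^ i) (x ^ m * z ^ j)" for i j l m
    proof (intro exI[of _ "j - i"] conjI bexI)
      have zj: "z ^ j = z ^ (j - i) * z ^ i" using that by (simp flip: power_add)
      show "assoc R (z ^ (j - i)) (x powi (int l - int m))"
        using that(2) xnz z unfolding assoc_def[OF R(1)] zj power_int_diff[OF disjI1[OF xnz]]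
        by (simp add: field_simps)
      show "x powi (int l - int m) \<in> H" by (simp add: H_def)
    qed (use that in auto)
    show "\<exists>m>0. \<exists>h\<in>H. assoc R (z ^ m) h"
      using ne ass step[of i j l m] step[of j i m l] assoc_sym[OF R(1)] by (metis linorder_neqE_nat)
  next
    fix h assume "h \<in> H"
    then obtain j where i: "h = x powi j" by (auto simp: H_def)
    show "h \<noteq> 0" using xnz by (simp add: i)
    have "inverse h = x powi (- j)" by (simp add: i power_int_minus)
    thus "inverse h \<in> H" by (simp add: H_def)
    show "\<nu> h > 0" by (simp add: i \<nu>)
    show "\<nu> h \<le> 1 \<longleftrightarrow> h \<in> R"
    proof (cases "j \<le> 0")
      case True
      hence "(2::real) powi j \<le> 2 powi 0" by (intro power_int_increasing) auto
      thus ?thesis unfolding i \<nu> xi using True by simp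
    next
      case False
      hence "(2::real) powi 0 < 2 powi j" by (intro power_int_strict_increasing) auto
      thus ?thesis unfolding i \<nu> xi using False by simp
    qed
  next
    fix h h' assume "h \<in> H" "h' \<in> H"
    then obtain i j where "h = x powi i" "h' = x powi j" by (auto simp: H_def)
    hence e: "h * h' = x powi (i + j)" "h = x powi i" "h' = x powi j" using xnz by (simp_all add: power_int_add)
    show "h * h' \<in> H" by (simp add: e(1) H_def)
    show "\<nu> (h * h') = \<nu> h * \<nu> h'" unfolding e(1) by (simp add: e(2,3) \<nu> power_int_add)
  next
    have "x powi 0 \<in> H" unfolding H_def by blast
    thus "1 \<in> H" by simp
  qed auto
  have wx: "w x > 1" using w(2)[of x] R(3) by simp
  have wk: "w c = 1" if "c \<in> k" "c \<noteq> 0" for c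
  proof -
    have "inverse c \<in> k" using that k by (simp add: is_subfield_def)
    hence "w c \<le> 1" "w (inverse c) \<le> 1" using w(2) kR that by auto
    thus ?thesis using that nonarch.inverse[OF w(1)] nonarch.pos_iff[OF w(1), of c]
      by (simp add: inverse_le_1_iff)
  qed
  obtain p c where p: "p \<in> places k" "c > 0" "\<And>y. rep p y = w y powr c"
    using place_of_nonarch[OF k w(1) wk xnz] wx by (metis less_irrefl)
  have "rep p x > 1" unfolding p(3) using wx p(2) by (rule gr_one_powr)
  thus ?thesis using p that by blast
qed

section \<open>Finite dimension over a subfield\<close>

context
  fixes F :: "'a::field set"
  assumes F: "is_subfield F"
begin

lemma subfield_subring: "is_subring F"
  by (rule is_subfield_subring[OF F])

lemma subfield_inverse: "x \<in> F \<Longrightarrow> inverse x \<in> F"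
  using F by (cases "x = 0") (auto simp: is_subfield_def)

lemma subfield_divide: "x \<in> F \<Longrightarrow> y \<in> F \<Longrightarrow> x / y \<in> F"
  unfolding divide_inverse by (intro subring_mult[OF subfield_subring] subfield_inverse)

lemmas subfield_closed = subring_closed[OF subfield_subring] subfield_inverse subfield_divide

text \<open>Elimination: the pivot \<open>m i0 j0\<close> removes one equation and one unknown, and
  the value at j0 is recovered from equation i0.\<close>

lemma homogeneous_system:
  assumes "finite I" "finite J" "card I < card J" "\<And>i j. i \<in> I \<Longrightarrow> j \<in> J \<Longrightarrow> m i j \<in> F"
  shows "\<exists>a. (\<forall>j\<in>J. a j \<in> F) \<and> (\<exists>j\<in>J. a j \<noteq> 0) \<and> (\<forall>i\<in>I. (\<Sum>j\<in>J. m i j * a j) = 0)"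
  using assms
proof (induction I arbitrary: J m rule: finite_induct)
  case empty
  then obtain j where "j \<in> J" by fastforce
  thus ?case using subring_one[OF subfield_subring] by (intro exI[of _ "\<lambda>_. 1"]) auto
next
  case (insert i0 I)
  show ?case
  proof (cases "\<forall>j\<in>J. m i0 j = 0")
    case True
    have "\<exists>a. (\<forall>j\<in>J. a j \<in> F) \<and> (\<exists>j\<in>J. a j \<noteq> 0) \<and> (\<forall>i\<in>I. (\<Sum>j\<in>J. m i j * a j) = 0)"
      using insert by (intro insert.IH) auto
    thus ?thesis using True by auto
  next
    case False
    then obtain j0 where j0: "j0 \<in> J" "m i0 j0 \<noteq> 0" by blast
    define J' where "J' = J - {j0}"
    define m' where "m' = (\<lambda>i j. m i j - m i j0 * m i0 j / m i0 j0)"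
    have J': "finite J'" "card I < card J'" using insert j0 by (auto simp: J'_def)
    have "\<exists>a. (\<forall>j\<in>J'. a j \<in> F) \<and> (\<exists>j\<in>J'. a j \<noteq> 0) \<and> (\<forall>i\<in>I. (\<Sum>j\<in>J'. m' i j * a j) = 0)"
    proof (rule insert.IH[OF J'])
      fix i j assume "i \<in> I" "j \<in> J'"
      thus "m' i j \<in> F" unfolding m'_def
        using insert.prems(3) j0 by (intro subfield_closed) (auto simp: J'_def)
    qed
    then obtain a where a: "\<And>j. j \<in> J' \<Longrightarrow> a j \<in> F" "\<exists>j\<in>J'. a j \<noteq> 0" "\<And>i. i \<in> I \<Longrightarrow> (\<Sum>j\<in>J'. m' i j * a j) = 0"
      by blast
    define s where "s = (\<Sum>j\<in>J'. m i0 j * a j)"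
    define b where "b = a(j0 := - s / m i0 j0)"
    have sF: "s \<in> F" unfolding s_def using a insert.prems(3) by (intro subfield_closed) (auto simp: J'_def)
    have sumb: "(\<Sum>j\<in>J. m i j * b j) = (\<Sum>j\<in>J'. m i j * a j) - m i j0 * s / m i0 j0" for i
    proof -
      have "(\<Sum>j\<in>J. m i j * b j) = m i j0 * b j0 + (\<Sum>j\<in>J'. m i j * b j)"
        unfolding J'_def using insert.prems(1) j0(1) by (rule sum.remove)
      also have "(\<Sum>j\<in>J'. m i j * b j) = (\<Sum>j\<in>J'. m i j * a j)"
        by (intro sum.cong) (auto simp: b_def J'_def)
      finally show ?thesis by (simp add: b_def)
    qed
    show ?thesis
    proof (intro exI[of _ b] conjI ballI)
      fix j assume "j \<in> J"
      thus "b j \<in> F" unfolding b_def using a(1) sF insert.prems(3)[of i0 j0] j0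
        by (auto simp: J'_def intro!: subfield_closed)
    next
      show "\<exists>j\<in>J. b j \<noteq> 0" using a(2) by (auto simp: b_def J'_def)
    next
      fix i assume i: "i \<in> insert i0 I"
      show "(\<Sum>j\<in>J. m i j * b j) = 0"
      proof (cases "i = i0")
        case True
        thus ?thesis using sumb[of i0] j0 by (simp add: s_def)
      next
        case False
        hence "0 = (\<Sum>j\<in>J'. m' i j * a j)" using i a(3)[of i] by simp
        also have "\<dots> = (\<Sum>j\<in>J'. m i j * a j) - (\<Sum>j\<in>J'. m i j0 / m i0 j0 * (m i0 j * a j))"
          unfolding m'_def sum_subtractf[symmetric] by (intro sum.cong) (auto simp: algebra_simps)
        also have "\<dots> = (\<Sum>j\<in>J. m i j * b j)"
          unfolding sumb s_def by (simp add: sum_distrib_left sum_divide_distrib)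
        finally show ?thesis by simp
      qed
    qed
  qed
qed

end

definition lspan :: "'a::field set \<Rightarrow> 'a set \<Rightarrow> 'a set" where
  "lspan F Y = {\<Sum>y\<in>Y. a y * y | a. \<forall>y\<in>Y. a y \<in> F}"

text \<open>Containment in a span rather than equality, so that V can be any set and no basis has to
  be chosen.\<close>

definition fin_over :: "'a::field set \<Rightarrow> 'a set \<Rightarrow> bool" where
  "fin_over F V \<longleftrightarrow> (\<exists>Y. finite Y \<and> V \<subseteq> lspan F Y)"

context
  fixes F :: "'a::field set"
  assumes F: "is_subfield F"
begin

text \<open>Generators may coincide under g; their coefficients are collected fibrewise.\<close>

lemma lspan_indexed:
  assumes "finite S" "\<And>s. s \<in> S \<Longrightarrow> a s \<in> F"
  shows "(\<Sum>s\<in>S. a s * g s) \<in> lspan F (g ` S)"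
proof -
  have "(\<Sum>s\<in>S. a s * g s) = (\<Sum>y\<in>g ` S. \<Sum>s\<in>{s\<in>S. g s = y}. a s * g s)"
    using assms(1) by (rule sum.image_gen)
  also have "\<dots> = (\<Sum>y\<in>g ` S. (\<Sum>s\<in>{s\<in>S. g s = y}. a s) * y)"
    unfolding sum_distrib_right by (intro sum.cong) auto
  finally show ?thesis
    unfolding lspan_def using assms(2)
    by (auto intro!: exI[of _ "\<lambda>y. \<Sum>s\<in>{s\<in>S. g s = y}. a s"] subfield_closed[OF F])
qed

lemma fin_over_dependent:
  assumes "V \<subseteq> lspan F Y" "finite Y" "finite J" "card Y < card J" "\<And>j. j \<in> J \<Longrightarrow> u j \<in> V"
  shows "\<exists>a. (\<forall>j\<in>J. a j \<in> F) \<and> (\<exists>j\<in>J. a j \<noteq> 0) \<and> (\<Sum>j\<in>J. a j * u j) = 0"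
proof -
  have "\<exists>c. (\<forall>y\<in>Y. c y \<in> F) \<and> u j = (\<Sum>y\<in>Y. c y * y)" if "j \<in> J" for j
    using assms(1) assms(5)[OF that] unfolding lspan_def by blast
  then obtain c where c: "\<And>j y. j \<in> J \<Longrightarrow> y \<in> Y \<Longrightarrow> c j y \<in> F" "\<And>j. j \<in> J \<Longrightarrow> u j = (\<Sum>y\<in>Y. c j y * y)"
    by metis
  obtain a where a: "\<forall>j\<in>J. a j \<in> F" "\<exists>j\<in>J. a j \<noteq> 0" "\<And>y. y \<in> Y \<Longrightarrow> (\<Sum>j\<in>J. c j y * a j) = 0"
  proof -
    have "\<exists>a. (\<forall>j\<in>J. a j \<in> F) \<and> (\<exists>j\<in>J. a j \<noteq> 0) \<and> (\<forall>y\<in>Y. (\<Sum>j\<in>J. c j y * a j) = 0)"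
      by (rule homogeneous_system[OF F assms(2,3,4)]) (rule c(1))
    thus ?thesis using that by blast
  qed
  have "(\<Sum>j\<in>J. a j * u j) = (\<Sum>j\<in>J. \<Sum>y\<in>Y. c j y * a j * y)"
    using c(2) by (intro sum.cong) (auto simp: sum_distrib_left mult_ac)
  also have "\<dots> = (\<Sum>y\<in>Y. (\<Sum>j\<in>J. c j y * a j) * y)"
    by (subst sum.swap) (simp add: sum_distrib_right)
  also have "\<dots> = 0" using a(3) by simp
  finally show ?thesis using a by blast
qed

text \<open>The powers of u are linearly dependent over F. Dividing a relation by its lowest
  occurring power of u exhibits the inverse of u as a polynomial in u.\<close>

lemma fin_over_subfield:
  assumes "is_subring V" "F \<subseteq> V" "fin_over F V"
  shows "is_subfield V"
proof -
  obtain Y where Y: "finite Y" "V \<subseteq> lspan F Y" using assms(3) by (auto simp: fin_over_def)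
  note cl = subring_closed[OF assms(1)]
  have "inverse u \<in> V" if u: "u \<in> V" "u \<noteq> 0" for u
  proof -
    have "\<exists>a. (\<forall>j\<in>{..card Y}. a j \<in> F) \<and> (\<exists>j\<in>{..card Y}. a j \<noteq> 0) \<and> (\<Sum>j\<in>{..card Y}. a j * u ^ j) = 0"
      using Y cl(7)[OF u(1)] by (intro fin_over_dependent[of V Y]) auto
    then obtain a where a: "\<And>j. j \<le> card Y \<Longrightarrow> a j \<in> F" "\<exists>j\<le>card Y. a j \<noteq> 0"
      "(\<Sum>j\<in>{..card Y}. a j * u ^ j) = 0" by auto
    define n where "n = card Y"
    define i where "i = (LEAST j. j \<le> n \<and> a j \<noteq> 0)"
    have i: "i \<le> n" "a i \<noteq> 0" using LeastI_ex[of "\<lambda>j. j \<le> n \<and> a j \<noteq> 0"] a(2) by (auto simp: i_def n_def)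
    have lt: "a j = 0" if "j < i" for j
      using not_less_Least[of j "\<lambda>j. j \<le> n \<and> a j \<noteq> 0"] that i(1) by (auto simp: i_def)
    define t where "t = (\<Sum>j\<in>{Suc i..n}. a j * u ^ (j - Suc i))"
    have "(\<Sum>j\<in>{..n}. a j * u ^ j) = (\<Sum>j\<in>{i..n}. a j * u ^ j)"
      using lt by (intro sum.mono_neutral_right) (auto simp: not_le)
    also have "\<dots> = a i * u ^ i + (\<Sum>j\<in>{Suc i..n}. a j * u ^ j)"
      using i(1) by (rule sum.atLeast_Suc_atMost)
    also have "(\<Sum>j\<in>{Suc i..n}. a j * u ^ j) = u ^ i * (u * t)"
      unfolding t_def sum_distrib_left
    proof (intro sum.cong refl)
      fix j assume "j \<in> {Suc i..n}"
      hence "u ^ j = u ^ (j - Suc i) * u ^ Suc i" by (simp only: power_add[symmetric]) simp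
      thus "a j * u ^ j = u ^ i * (u * (a j * u ^ (j - Suc i)))" by (simp add: mult_ac)
    qed
    also have "a i * u ^ i + u ^ i * (u * t) = u ^ i * (a i + u * t)" by (simp add: algebra_simps)
    finally have "a i + u * t = 0" using a(3) u(2) by (simp add: n_def)
    hence "u * (- t / a i) = 1" using i(2) by (simp add: field_simps add_eq_0_iff)
    hence "inverse u = inverse (a i) * (- t)" using inverse_unique[of u "- t / a i"]
      by (simp add: divide_inverse mult.commute)
    moreover have "inverse (a i) \<in> V" using subfield_inverse[OF F a(1)] i assms(2) by (auto simp: n_def)
    moreover have "t \<in> V" unfolding t_def using a(1) assms(2) u(1) by (intro cl) (auto simp: n_def)
    ultimately show ?thesis using cl by simp
  qed
  thus ?thesis using cl(1-5) by (simp add: is_subfield_def)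
qed

text \<open>Polynomials in g are reduced modulo the equation m of g, whose leading coefficient is
  invertible in F.\<close>

lemma fin_over_adjoin:
  assumes "algebraic_over F g"
  shows "fin_over F (adjoin F g)"
proof -
  note cl = subfield_closed[OF F]
  obtain m where m: "m \<noteq> 0" "\<And>i. coeff m i \<in> F" "poly m g = 0" using assms by (auto simp: algebraic_over_def)
  have red: "poly q g \<in> lspan F ((\<lambda>i. g ^ i) ` {..degree m})" if "\<forall>i. coeff q i \<in> F" for q
    using that
  proof (induction "degree q" arbitrary: q rule: less_induct)
    case less
    show ?case
    proof (cases "degree q \<le> degree m")
      case True
      have "poly q g = (\<Sum>i\<in>{..degree m}. coeff q i * g ^ i)"
        unfolding poly_altdef using True by (intro sum.mono_neutral_left) (auto simp: coeff_eq_0)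
      thus ?thesis using lspan_indexed[of "{..degree m}" "coeff q" "\<lambda>i. g ^ i"] less.prems by simp
    next
      case False
      define n where "n = degree q"
      define c where "c = lead_coeff q / lead_coeff m"
      define h where "h = monom c (n - degree m) * m"
      have cnz: "c \<noteq> 0" using False m(1) by (auto simp: c_def)
      have dh: "degree h = n"
        unfolding h_def using m(1) cnz False
        by (subst degree_mult_eq) (auto simp: degree_monom_eq monom_eq_0_iff n_def)
      have ch: "coeff h n = lead_coeff q"
        using m(1) False by (simp add: h_def coeff_monom_mult c_def n_def)
      define q' where "q' = q - h"
      have "degree q' < n"
      proof -
        have "degree q' \<le> n" unfolding q'_def using dh by (intro degree_diff_le) (auto simp: n_def)
        moreover have "coeff q' n = 0" using ch by (simp add: q'_def n_def)
        ultimately show ?thesis using False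
          by (metis degree_0 le_neq_implies_less leading_coeff_0_iff le0 n_def)
      qed
      moreover have "coeff q' i \<in> F" for i
        unfolding q'_def h_def coeff_diff coeff_monom_mult c_def
        using less.prems m(2) by (auto intro!: cl)
      ultimately have "poly q' g \<in> lspan F ((\<lambda>i. g ^ i) ` {..degree m})"
        using less.hyps[of q'] by (simp add: n_def)
      moreover have "poly q' g = poly q g" by (simp add: q'_def h_def m(3))
      ultimately show ?thesis by simp
    qed
  qed
  show ?thesis unfolding fin_over_def adjoin_def
    using red by (intro exI[of _ "(\<lambda>i. g ^ i) ` {..degree m}"]) auto
qed

lemma fin_over_trans:
  assumes V: "fin_over F V" and W: "fin_over V W"
  shows "fin_over F W"
proof -
  obtain Y where Y: "finite Y" "V \<subseteq> lspan F Y" using V by (auto simp: fin_over_def)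
  obtain Z where Z: "finite Z" "W \<subseteq> lspan V Z" using W by (auto simp: fin_over_def)
  have "x \<in> lspan F ((\<lambda>(z, y). y * z) ` (Z \<times> Y))" if "x \<in> W" for x
  proof -
    obtain b where b: "\<And>z. z \<in> Z \<Longrightarrow> b z \<in> V" "x = (\<Sum>z\<in>Z. b z * z)"
      using \<open>x \<in> W\<close> Z(2) unfolding lspan_def by blast
    have "\<exists>a. (\<forall>y\<in>Y. a y \<in> F) \<and> b z = (\<Sum>y\<in>Y. a y * y)" if "z \<in> Z" for z
      using b(1)[OF that] Y(2) unfolding lspan_def by blast
    then obtain a where a: "\<And>z y. z \<in> Z \<Longrightarrow> y \<in> Y \<Longrightarrow> a z y \<in> F" "\<And>z. z \<in> Z \<Longrightarrow> b z = (\<Sum>y\<in>Y. a z y * y)"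
      by metis
    have "x = (\<Sum>z\<in>Z. \<Sum>y\<in>Y. a z y * (y * z))"
      unfolding b(2) using a(2) by (intro sum.cong) (auto simp: sum_distrib_right sum_distrib_left mult_ac)
    also have "\<dots> = (\<Sum>p\<in>Z \<times> Y. a (fst p) (snd p) * (case p of (z, y) \<Rightarrow> y * z))"
      by (simp add: sum.cartesian_product case_prod_beta)
    also have "\<dots> \<in> lspan F ((\<lambda>(z, y). y * z) ` (Z \<times> Y))"
      using Y(1) Z(1) a(1) by (intro lspan_indexed) auto
    finally show ?thesis .
  qed
  thus ?thesis unfolding fin_over_def using Y(1) Z(1)
    by (intro exI[of _ "(\<lambda>(z, y). y * z) ` (Z \<times> Y)"]) auto
qed

end

lemma algebraic_over_mono: "algebraic_over F x \<Longrightarrow> F \<subseteq> F' \<Longrightarrow> algebraic_over F' x"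
  unfolding algebraic_over_def by blast

lemma fin_over_adjoin_finite:
  assumes "finite G" "is_subfield F" "\<And>g. g \<in> G \<Longrightarrow> algebraic_over F g"
  shows "\<exists>V. is_subfield V \<and> F \<subseteq> V \<and> G \<subseteq> V \<and> fin_over F V"
  using assms
proof (induction G rule: finite_induct)
  case empty
  have "x \<in> lspan F {1}" if "x \<in> F" for x
    unfolding lspan_def using that by (intro CollectI exI[of _ "\<lambda>_. x"]) simp
  hence "F \<subseteq> lspan F {1}" by blast
  hence "fin_over F F" unfolding fin_over_def by blast
  thus ?case using empty by blast
next
  case (insert g G)
  then obtain V where V: "is_subfield V" "F \<subseteq> V" "G \<subseteq> V" "fin_over F V" by auto
  have Vr: "is_subring V" by (rule is_subfield_subring[OF V(1)])
  have alg: "algebraic_over V g" using insert.prems(2)[of g] V(2) algebraic_over_mono by blast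
  have fin: "fin_over V (adjoin V g)" by (rule fin_over_adjoin[OF V(1) alg])
  have "is_subfield (adjoin V g)"
    by (rule fin_over_subfield[OF V(1) adjoin_subring[OF Vr] adjoin_superset[OF Vr] fin])
  moreover have "fin_over F (adjoin V g)" by (rule fin_over_trans[OF insert.prems(1) V(4) fin])
  moreover have "F \<subseteq> adjoin V g" "insert g G \<subseteq> adjoin V g"
    using V adjoin_superset[OF Vr, of g] adjoin_self[OF Vr, of g] by auto
  ultimately show ?case by blast
qed

section \<open>The field k(x) inside K\<close>

definition ratfield :: "'a::field set \<Rightarrow> 'a \<Rightarrow> 'a set" where
  "ratfield k x = {poly p x / poly q x | p q. (\<forall>i. coeff p i \<in> k) \<and> (\<forall>i. coeff q i \<in> k) \<and> poly q x \<noteq> 0}"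

lemma ratfield_eq: "is_subring k \<Longrightarrow> ratfield k x = {a / b | a b. a \<in> adjoin k x \<and> b \<in> adjoin k x \<and> b \<noteq> 0}"
  unfolding ratfield_def adjoin_def by blast

lemma ratfield_subfield:
  assumes "is_subring k"
  shows "is_subfield (ratfield k x)" "k \<subseteq> ratfield k x" "x \<in> ratfield k x"
proof -
  note cl = subring_closed[OF adjoin_subring[OF assms, of x]]
  have mem: "n / m \<in> ratfield k x" if "n \<in> adjoin k x" "m \<in> adjoin k x" "m \<noteq> 0" for n m
    unfolding ratfield_eq[OF assms] using that by blast
  have sub: "a \<in> ratfield k x" if "a \<in> adjoin k x" for a
    unfolding ratfield_eq[OF assms] using that cl(1)
    by (intro CollectI exI[of _ a] exI[of _ 1]) simp
  show "k \<subseteq> ratfield k x" using sub adjoin_superset[OF assms] by blast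
  show "x \<in> ratfield k x" using sub adjoin_self[OF assms] by blast
  show "is_subfield (ratfield k x)"
    unfolding is_subfield_def
  proof (intro conjI ballI impI)
    show "0 \<in> ratfield k x" "1 \<in> ratfield k x" using sub cl by blast+
    fix u assume "u \<in> ratfield k x"
    then obtain a b where u: "u = a / b" "a \<in> adjoin k x" "b \<in> adjoin k x" "b \<noteq> 0"
      by (auto simp: ratfield_eq[OF assms])
    {
      assume "u \<noteq> 0"
      hence "inverse u = b / a" "a \<noteq> 0" using u by auto
      thus "inverse u \<in> ratfield k x" unfolding ratfield_eq[OF assms] using u by blast
    }
    fix w assume "w \<in> ratfield k x"
    then obtain c d where w: "w = c / d" "c \<in> adjoin k x" "d \<in> adjoin k x" "d \<noteq> 0"
      by (auto simp: ratfield_eq[OF assms])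
    have e: "u + w = (a * d + c * b) / (b * d)" "u - w = (a * d - c * b) / (b * d)"
      "u * w = (a * c) / (b * d)" "b * d \<noteq> 0"
      unfolding u(1) w(1) using u(4) w(4) by (simp_all add: field_simps)
    show "u + w \<in> ratfield k x" unfolding e(1) using u w e(4) by (intro mem cl)
    show "u - w \<in> ratfield k x" unfolding e(2) using u w e(4) by (intro mem cl)
    show "u * w \<in> ratfield k x" unfolding e(3) using u w e(4) by (intro mem cl)
  qed
qed

lemma field_gen_subset: "is_subfield F \<Longrightarrow> A \<subseteq> F \<Longrightarrow> field_gen A \<subseteq> F"
  unfolding field_gen_def by blast

text \<open>All coefficients are multiplied by the product D of the denominators; as D is not 0, the
  relation stays nontrivial.\<close>

lemma clear_denominators:
  fixes r :: nat
  assumes k: "is_subring k" and a: "\<And>i. i \<le> r \<Longrightarrow> a i \<in> ratfield k x" "\<exists>i\<le>r. a i \<noteq> 0"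
    and s: "(\<Sum>i\<le>r. a i * u i) = 0"
  shows "\<exists>P. (\<forall>i\<le>r. \<forall>l. coeff (P i) l \<in> k) \<and> (\<exists>i\<le>r. P i \<noteq> 0) \<and> (\<Sum>i\<le>r. poly (P i) x * u i) = 0"
proof -
  have "\<forall>i\<le>r. \<exists>n d. n \<in> adjoin k x \<and> d \<in> adjoin k x \<and> d \<noteq> 0 \<and> a i = n / d"
    using a(1) unfolding ratfield_eq[OF k] by blast
  then obtain n d where nd: "\<And>i. i \<le> r \<Longrightarrow> n i \<in> adjoin k x" "\<And>i. i \<le> r \<Longrightarrow> d i \<in> adjoin k x"
    "\<And>i. i \<le> r \<Longrightarrow> d i \<noteq> 0" "\<And>i. i \<le> r \<Longrightarrow> a i = n i / d i" by metis
  have pr: "(\<Prod>j\<in>J. d j) \<in> adjoin k x" if "J \<subseteq> {..r}" for J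
  proof -
    have "finite J" using that by (rule finite_subset) simp
    thus ?thesis using that
      by (induction J rule: finite_induct) (auto intro!: subring_closed[OF adjoin_subring[OF k]] nd)
  qed
  define D where "D = (\<Prod>j\<in>{..r}. d j)"
  have D: "D \<noteq> 0" using nd(3) by (simp add: D_def)
  have "\<forall>i\<le>r. \<exists>p. (\<forall>l. coeff p l \<in> k) \<and> a i * D = poly p x"
  proof (intro allI impI)
    fix i assume i: "i \<le> r"
    have "D = d i * (\<Prod>j\<in>{..r} - {i}. d j)" unfolding D_def using i by (intro prod.remove) auto
    hence "a i * D = n i * (\<Prod>j\<in>{..r} - {i}. d j)" using nd(3,4)[OF i] by simp
    also have "\<dots> \<in> adjoin k x" using nd(1)[OF i] by (intro subring_mult[OF adjoin_subring[OF k]] pr) auto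
    finally show "\<exists>p. (\<forall>l. coeff p l \<in> k) \<and> a i * D = poly p x" by (auto simp: adjoin_def)
  qed
  then obtain P where P: "\<And>i l. i \<le> r \<Longrightarrow> coeff (P i) l \<in> k" "\<And>i. i \<le> r \<Longrightarrow> a i * D = poly (P i) x" by metis
  have "(\<Sum>i\<le>r. poly (P i) x * u i) = (\<Sum>i\<le>r. D * (a i * u i))"
    using P(2) by (intro sum.cong) (auto simp: mult_ac simp flip: P(2))
  also have "\<dots> = 0" using s by (simp flip: sum_distrib_left)
  finally have "(\<Sum>i\<le>r. poly (P i) x * u i) = 0" .
  moreover have "\<exists>i\<le>r. P i \<noteq> 0"
  proof -
    obtain i where i: "i \<le> r" "a i \<noteq> 0" using a(2) by blast
    hence "poly (P i) x \<noteq> 0" using D by (simp flip: P(2))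
    thus ?thesis using i by auto
  qed
  ultimately show ?thesis using P(1) by blast
qed

section \<open>Function fields in one variable\<close>

locale function_field =
  fixes k :: "'a::field set"
  assumes alg_closed: "alg_closed_subfield k"
    and fin_gen: "finitely_generated_over k"
    and trdeg: "trdeg_one_over k"
begin

lemma k: "is_subfield k"
  using alg_closed by (simp add: alg_closed_subfield_def)

lemma kr: "is_subring k"
  by (rule is_subfield_subring[OF k])

lemmas k_closed = subfield_closed[OF k]

text \<open>Over F, which contains k and t, K is generated by finitely many elements, all of them
  algebraic.\<close>

lemma finite_dim_aux:
  assumes F: "is_subfield F" "k \<subseteq> F" and t: "t \<in> F" "\<And>x. algebraic_over (field_gen (k \<union> {t})) x"
  shows "fin_over F UNIV"
proof -
  obtain G where G: "finite G" "field_gen (k \<union> G) = UNIV"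
    using fin_gen by (auto simp: finitely_generated_over_def)
  have "field_gen (k \<union> {t}) \<subseteq> F" using F t by (intro field_gen_subset) auto
  hence "algebraic_over F g" for g using t(2) algebraic_over_mono by blast
  then obtain V where V: "is_subfield V" "F \<subseteq> V" "G \<subseteq> V" "fin_over F V"
    using fin_over_adjoin_finite[OF G(1) F(1)] by blast
  have "field_gen (k \<union> G) \<subseteq> V" using V F by (intro field_gen_subset) auto
  hence "V = UNIV" using G by auto
  thus ?thesis using V by simp
qed

lemma dependent_of_fin_over:
  assumes "fin_over (ratfield k x) UNIV"
  shows "\<exists>r. \<forall>u :: nat \<Rightarrow> 'a. \<exists>P. (\<forall>i\<le>r. \<forall>l. coeff (P i) l \<in> k) \<and> (\<exists>i\<le>r. P i \<noteq> 0) \<and>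
      (\<Sum>i\<le>r. poly (P i) x * u i) = 0"
proof -
  obtain Y where Y: "finite Y" "UNIV \<subseteq> lspan (ratfield k x) Y" using assms by (auto simp: fin_over_def)
  show ?thesis
  proof (intro exI[of _ "card Y"] allI)
    fix u :: "nat \<Rightarrow> 'a"
    have "\<exists>a. (\<forall>j\<in>{..card Y}. a j \<in> ratfield k x) \<and> (\<exists>j\<in>{..card Y}. a j \<noteq> 0) \<and> (\<Sum>j\<in>{..card Y}. a j * u j) = 0"
      using Y by (intro fin_over_dependent[OF ratfield_subfield(1)[OF kr, of x], of UNIV Y]) auto
    then obtain a where a: "\<And>j. j \<le> card Y \<Longrightarrow> a j \<in> ratfield k x" "\<exists>j\<le>card Y. a j \<noteq> 0"
      "(\<Sum>j\<le>card Y. a j * u j) = 0" by auto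
    show "\<exists>P. (\<forall>i\<le>card Y. \<forall>l. coeff (P i) l \<in> k) \<and> (\<exists>i\<le>card Y. P i \<noteq> 0) \<and>
      (\<Sum>i\<le>card Y. poly (P i) x * u i) = 0"
      by (rule clear_denominators[OF kr a])
  qed
qed

text \<open>K is finite over k(x) for every transcendental x; denominators are cleared.\<close>

theorem dependent:
  assumes x: "\<not> algebraic_over k x"
  shows "\<exists>r. \<forall>u :: nat \<Rightarrow> 'a. \<exists>P. (\<forall>i\<le>r. \<forall>l. coeff (P i) l \<in> k) \<and> (\<exists>i\<le>r. P i \<noteq> 0) \<and>
      (\<Sum>i\<le>r. poly (P i) x * u i) = 0"
proof -
  obtain t where t: "\<And>x. algebraic_over (field_gen (k \<union> {t})) x"
    using trdeg by (auto simp: trdeg_one_over_def)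
  have "fin_over (ratfield k t) UNIV"
    using ratfield_subfield[OF kr, of t] t by (intro finite_dim_aux[of _ t]) auto
  then obtain r P where P: "\<And>i l. i \<le> r \<Longrightarrow> coeff (P i) l \<in> k" "\<exists>i\<le>r. P i \<noteq> 0"
      "(\<Sum>i\<le>r. poly (P i) t * x ^ i) = 0" using dependent_of_fin_over by meson
  define N where "N = Max ((\<lambda>i. degree (P i)) ` {..r})"
  have N: "degree (P i) \<le> N" if "i \<le> r" for i unfolding N_def using that by (intro Max_ge) auto
  \<comment> \<open>Exchange of x and t: the algebraic relation of x over k(t) is regrouped by
    powers of t, with coefficients \<open>R l\<close> evaluated at x, and so becomes an equation of
    t over k(x).\<close>
  define R where "R = (\<lambda>l. \<Sum>i\<le>r. monom (coeff (P i) l) i)"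
  have Rk: "coeff (R l) j \<in> k" for l j
    unfolding R_def coeff_sum coeff_monom using P(1) by (intro k_closed) (auto intro: k_closed)
  define q where "q = (\<Sum>l\<le>N. monom (poly (R l) x) l)"
  have Rf: "poly (R l) x \<in> ratfield k x" for l
    unfolding ratfield_def using Rk k_closed(1,2)
    by (intro CollectI exI[of _ "R l"] exI[of _ 1]) (auto simp: coeff_1)
  have qk: "coeff q j \<in> ratfield k x" for j
    unfolding q_def coeff_sum coeff_monom using Rf
    by (intro subfield_closed[OF ratfield_subfield(1)[OF kr]])
       (auto intro: subfield_closed[OF ratfield_subfield(1)[OF kr]])
  have "poly q t = (\<Sum>l\<le>N. \<Sum>i\<le>r. coeff (P i) l * x ^ i * t ^ l)"
    by (simp add: q_def R_def poly_sum poly_monom sum_distrib_right)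
  also have "\<dots> = (\<Sum>i\<le>r. \<Sum>l\<le>N. coeff (P i) l * x ^ i * t ^ l)" by (rule sum.swap)
  also have "\<dots> = (\<Sum>i\<le>r. poly (P i) t * x ^ i)"
  proof (intro sum.cong refl)
    fix i assume i: "i \<in> {..r}"
    have "poly (P i) t = (\<Sum>l\<le>N. coeff (P i) l * t ^ l)"
      unfolding poly_altdef using N[of i] i by (intro sum.mono_neutral_left) (auto simp: coeff_eq_0)
    thus "(\<Sum>l\<le>N. coeff (P i) l * x ^ i * t ^ l) = poly (P i) t * x ^ i"
      by (simp add: sum_distrib_right sum_distrib_left mult_ac)
  qed
  also have "\<dots> = 0" by (rule P(3))
  finally have q0: "poly q t = 0" .
  \<comment> \<open>Otherwise some nonzero \<open>R l\<close> over k would vanish at x, against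
    transcendence.\<close>
  have "q \<noteq> 0"
  proof
    assume "q = 0"
    obtain i where i: "i \<le> r" "P i \<noteq> 0" using P(2) by blast
    define l where "l = degree (P i)"
    have lN: "l \<le> N" using N[OF i(1)] by (simp add: l_def)
    have "coeff q l = poly (R l) x"
      unfolding q_def coeff_sum coeff_monom using lN by (simp add: sum.delta)
    hence "poly (R l) x = 0" using \<open>q = 0\<close> by simp
    moreover have "coeff (R l) i = coeff (P i) l"
      unfolding R_def coeff_sum coeff_monom using i by (simp add: sum.delta)
    hence "R l \<noteq> 0" using i(2) by (auto simp: l_def)
    ultimately have "algebraic_over k x" unfolding algebraic_over_def using Rk by blast
    thus False using x by simp
  qed
  hence alg: "algebraic_over (ratfield k x) t" using qk q0 by (auto simp: algebraic_over_def)
  note rx = ratfield_subfield[OF kr, of x]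
  obtain V where V: "is_subfield V" "ratfield k x \<subseteq> V" "{t} \<subseteq> V" "fin_over (ratfield k x) V"
    using fin_over_adjoin_finite[of "{t}" "ratfield k x"] rx(1) alg by auto
  have "fin_over V UNIV" using V rx t by (intro finite_dim_aux[of _ t]) auto
  hence "fin_over (ratfield k x) UNIV" by (rule fin_over_trans[OF rx(1) V(4)])
  thus ?thesis by (rule dependent_of_fin_over)
qed

lemma synthetic_div_coeffs: "(\<And>i. coeff p i \<in> k) \<Longrightarrow> c \<in> k \<Longrightarrow> coeff (synthetic_div p c) i \<in> k"
proof (induction p arbitrary: i)
  case 0
  thus ?case using k_closed(2) by simp
next
  case (pCons a p)
  have pk: "coeff p j \<in> k" for j using pCons.prems(1)[of "Suc j"] by simp
  have "poly p c \<in> k" unfolding poly_altdef using pk pCons.prems(2) by (intro k_closed) auto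
  thus ?case using pCons.IH[OF pk pCons.prems(2)] by (auto simp: coeff_pCons split: nat.splits)
qed

lemma splits_over_k:
  assumes "p \<noteq> 0" "\<And>i. coeff p i \<in> k"
  shows "\<exists>cs. set cs \<subseteq> k \<and> (\<forall>x. poly p x = lead_coeff p * (\<Prod>c\<leftarrow>cs. x - c))"
  using assms
proof (induction "degree p" arbitrary: p)
  case 0
  then obtain a where "p = [:a:]" by (metis degree_eq_zeroE)
  thus ?case by (intro exI[of _ "[]"]) auto
next
  case (Suc n)
  obtain c where c: "c \<in> k" "poly p c = 0"
    using alg_closed Suc.prems(2) Suc.hyps(2) by (force simp: alg_closed_subfield_def)
  define q where "q = synthetic_div p c"
  have p: "p = [:- c, 1:] * q" using synthetic_div_correct'[of c p] c by (simp add: q_def)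
  have qnz: "q \<noteq> 0" using p Suc.prems(1) by auto
  have "degree q = n" using Suc.hyps(2) unfolding q_def by (simp add: degree_synthetic_div)
  moreover have "coeff q i \<in> k" for i unfolding q_def by (rule synthetic_div_coeffs[OF Suc.prems(2) c(1)])
  ultimately obtain cs where cs: "set cs \<subseteq> k" "\<And>x. poly q x = lead_coeff q * (\<Prod>c\<leftarrow>cs. x - c)"
    using Suc.hyps(1)[of q] qnz by blast
  have "lead_coeff p = lead_coeff q" unfolding p lead_coeff_mult by simp
  hence "poly p x = lead_coeff p * (\<Prod>c\<leftarrow>c # cs. x - c)" for x
  proof -
    have "poly p x = (x - c) * poly q x" unfolding p by (simp add: algebra_simps)
    thus ?thesis using cs(2)[of x] \<open>lead_coeff p = lead_coeff q\<close> by (simp add: mult_ac)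
  qed
  thus ?case using cs(1) c(1) by (intro exI[of _ "c # cs"]) auto
qed

lemma algebraic_iff: "algebraic_over k x \<longleftrightarrow> x \<in> k"
proof
  assume "algebraic_over k x"
  then obtain p where p: "p \<noteq> 0" "\<And>i. coeff p i \<in> k" "poly p x = 0" by (auto simp: algebraic_over_def)
  obtain cs where cs: "set cs \<subseteq> k" "poly p x = lead_coeff p * (\<Prod>c\<leftarrow>cs. x - c)"
    using splits_over_k[OF p(1,2)] by blast
  hence "(\<Prod>c\<leftarrow>cs. x - c) = 0" using p by simp
  thus "x \<in> k" using cs(1) by (auto simp: prod_list_zero_iff)
next
  assume "x \<in> k"
  hence "\<forall>i. coeff [:- x, 1:] i \<in> k" using k_closed by (auto simp: coeff_pCons split: nat.splits)
  thus "algebraic_over k x" unfolding algebraic_over_def by (intro exI[of _ "[:- x, 1:]"]) auto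
qed

text \<open>For finite k, the product of all x - c plus 1 would be a nonconstant polynomial over k
  without a root in k.\<close>

lemma infinite_k: "infinite k"
proof
  assume fin: "finite k"
  define p where "p = (\<Prod>c\<in>k. [:- c, 1:]) + 1"
  have coeffs: "\<forall>i. coeff (\<Prod>c\<in>C. [:- c, 1:]) i \<in> k" if "finite C" "C \<subseteq> k" for C
    using that
  proof (induction C rule: finite_induct)
    case empty
    thus ?case using k_closed(1,2) by (simp add: coeff_1)
  next
    case (insert c C)
    hence IH: "\<forall>i. coeff (\<Prod>c\<in>C. [:- c, 1:]) i \<in> k" "c \<in> k" by auto
    show ?case
    proof
      fix i
      show "coeff (\<Prod>c\<in>insert c C. [:- c, 1:]) i \<in> k"
        using insert(1,2) IH by (cases i) (auto simp: coeff_pCons intro!: k_closed)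
    qed
  qed
  have deg: "degree (\<Prod>c\<in>k. [:- c, 1:]) = card k"
    by (subst degree_prod_eq_sum_degree) auto
  have "card k > 0" using fin k_closed(1) by (auto simp: card_gt_0_iff)
  hence dp: "degree p \<ge> 1" unfolding p_def by (subst degree_add_eq_left) (auto simp: deg)
  have pk: "\<forall>i. coeff p i \<in> k" unfolding p_def coeff_add coeff_1
    using coeffs[OF fin order_refl] k_closed(1,2) by (auto intro!: k_closed(3))
  have "\<exists>x\<in>k. poly p x = 0" using alg_closed pk dp by (simp add: alg_closed_subfield_def)
  then obtain x where x: "x \<in> k" "poly p x = 0" by blast
  have "poly (\<Prod>c\<in>k. [:- c, 1:]) x = 0" using fin x(1) by (simp add: poly_prod prod_zero_iff)
  thus False using x(2) by (simp add: p_def)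
qed

end

section \<open>Weak approximation\<close>

text \<open>For a rational r = m/n, the inequality ln (v x) / ln (v a) < r says that x^n / a^m has
  v-value below 1, and the hypothesis passes this on to w. Applied to x and to its inverse, it makes
  the normalised logarithms of v and w agree.\<close>

lemma abs_equivI:
  assumes "nonarch v" "nonarch w" and nt: "a \<noteq> 0" "v a \<noteq> 1"
    and imp: "\<And>x. v x < 1 \<Longrightarrow> w x < 1"
  shows "abs_equiv v w"
proof -
  interpret v: nonarch v by fact
  interpret w: nonarch w by fact
  have gt: "w x > 1" if "v x > 1" for x
  proof -
    have "x \<noteq> 0" using that by auto
    have "v (inverse x) < 1" using that by (simp add: v.inverse inverse_less_1_iff)
    hence "inverse (w x) < 1" unfolding w.inverse[symmetric] by (rule imp)
    hence "w x \<le> 0 \<or> w x > 1" by (rule iffD1[OF inverse_less_1_iff])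
    moreover have "w x > 0" using \<open>x \<noteq> 0\<close> by (simp only: w.pos_iff not_False_eq_True)
    ultimately show ?thesis by linarith
  qed
  obtain a where a: "v a > 1"
  proof (cases "v a > 1")
    case False
    hence "v a < 1" using nt(2) by simp
    hence "v (inverse a) > 1" using nt(1) unfolding v.inverse by (intro one_less_inverse) simp_all
    thus ?thesis using that by blast
  qed (use that in blast)
  have anz: "a \<noteq> 0" using a by auto
  define A where "A = ln (v a)"
  define B where "B = ln (w a)"
  have AB: "A > 0" "B > 0" using a gt[OF a] unfolding A_def B_def by (simp_all only: ln_gt_zero)
  have pw: "ln (v x) / A = ln (w x) / B" if "x \<noteq> 0" for x
  proof -
    have lt: "ln (w x) / B < r" if r: "ln (v x) / A < r" "r \<in> \<rat>" and "x \<noteq> 0" for x and r :: real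
    proof -
      obtain m n :: int where mn: "n > 0" "r = of_int m / of_int n"
        using Rats_cases'[OF r(2)] by metis
      define y where "y = x powi n * a powi (- m)"
      have ynz: "y \<noteq> 0" using \<open>x \<noteq> 0\<close> anz by (simp add: y_def)
      have pi: "ln (u (z powi i)) = of_int i * ln (u z)" if "nonarch u" "z \<noteq> 0" for u :: "'a \<Rightarrow> real" and z i
      proof -
        interpret u: nonarch u by fact
        have "u (z powi i) = u z powi i"
          by (cases "i \<ge> 0") (simp_all add: power_int_def u.power u.inverse)
        also have "\<dots> = u z powr of_int i" using that by (simp add: powr_real_of_int')
        finally show ?thesis using that by (simp add: ln_powr)
      qed
      have "ln (v y) = of_int n * ln (v x) - of_int m * A"
        using \<open>x \<noteq> 0\<close> anz by (simp add: y_def v.mult ln_mult pi[OF assms(1)] A_def)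
      also have "\<dots> < 0" using r(1) mn AB by (simp add: field_simps)
      finally have "v y < 1" using ynz by (simp add: ln_less_zero_iff)
      hence "w y < 1" by (rule imp)
      hence "ln (w y) < 0" using ynz by (simp add: ln_less_zero_iff)
      moreover have "ln (w y) = of_int n * ln (w x) - of_int m * B"
        using \<open>x \<noteq> 0\<close> anz by (simp add: y_def w.mult ln_mult pi[OF assms(2)] B_def)
      ultimately have "of_int n * ln (w x) < of_int m * B" by simp
      thus ?thesis unfolding mn(2) using mn(1) AB by (simp add: field_simps)
    qed
    have le: "ln (w x) / B \<le> ln (v x) / A" if "x \<noteq> 0" for x
    proof (rule ccontr)
      assume "\<not> ?thesis"
      then obtain r where "r \<in> \<rat>" "ln (v x) / A < r" "r < ln (w x) / B"
        using Rats_dense_in_real[of "ln (v x) / A" "ln (w x) / B"] by auto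
      thus False using lt[of x r] that by simp
    qed
    have "ln (w (inverse x)) / B \<le> ln (v (inverse x)) / A" using that by (intro le) simp
    hence "ln (v x) / A \<le> ln (w x) / B" using that by (simp add: v.inverse w.inverse ln_inverse)
    thus ?thesis using le[OF that] by simp
  qed
  have "w x = v x powr (B / A)" for x
  proof (cases "x = 0")
    case False
    hence "ln (w x) = (B / A) * ln (v x)" using pw[OF False] AB by (simp add: field_simps)
    hence "exp (ln (w x)) = v x powr (B / A)" using False by (simp add: powr_def)
    thus ?thesis using False by simp
  qed auto
  thus ?thesis unfolding abs_equiv_def using AB by (intro exI[of _ "B / A"]) auto
qed

lemma abs_equiv_sym: "nonarch v \<Longrightarrow> abs_equiv v w \<Longrightarrow> abs_equiv w v"
proof -
  assume "nonarch v" and "abs_equiv v w"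
  then interpret nonarch v by simp
  obtain c where "c > 0" "\<And>x. w x = v x powr c" using \<open>abs_equiv v w\<close> by (auto simp: abs_equiv_def)
  thus ?thesis unfolding abs_equiv_def by (intro exI[of _ "1 / c"]) (simp add: powr_powr)
qed

definition nontrivial :: "('a::field \<Rightarrow> real) \<Rightarrow> bool" where
  "nontrivial v \<longleftrightarrow> (\<exists>x. x \<noteq> 0 \<and> v x \<noteq> 1)"

lemma approximation_two:
  assumes "nonarch v" "nonarch w" "nontrivial v" "nontrivial w" "\<not> abs_equiv v w"
  shows "\<exists>y. v y > 1 \<and> w y < 1"
proof -
  interpret v: nonarch v by fact
  interpret w: nonarch w by fact
  obtain a where a: "v a < 1" "w a \<ge> 1"
    using abs_equivI[OF assms(1,2)] assms(3,5) by (meson nontrivial_def not_less)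
  obtain b where b: "w b < 1" "v b \<ge> 1"
    using abs_equivI[OF assms(2,1)] assms(4,5) abs_equiv_sym[OF assms(2)] by (meson nontrivial_def not_less)
  have "a \<noteq> 0" "b \<noteq> 0" using a b by auto
  hence "v (b / a) > 1" using a b by (simp add: v.divide less_le_trans)
  moreover have "w (b / a) < 1" using a b \<open>a \<noteq> 0\<close> by (simp add: w.divide)
  ultimately show ?thesis by blast
qed

text \<open>Let y serve for W and let z separate v from the new u. If u y is at most 1, then
  \<open>y ^ n * z\<close> serves for both. Otherwise \<open>y ^ n\<close> is replaced by the
  quotient \<open>y ^ n / (1 + y ^ n)\<close>, which has value 1 where y is large and the value of
  \<open>y ^ n\<close> where y is small.\<close>

lemma approximation_finite:
  assumes "finite W" "nonarch v" "nontrivial v"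
    and "\<And>w. w \<in> W \<Longrightarrow> nonarch w \<and> nontrivial w \<and> \<not> abs_equiv v w"
  shows "\<exists>y. v y > 1 \<and> (\<forall>w\<in>W. w y < 1)"
  using assms(1,4)
proof (induction W rule: finite_induct)
  case empty
  interpret v: nonarch v by fact
  obtain x where x: "x \<noteq> 0" "v x \<noteq> 1" using assms(3) by (auto simp: nontrivial_def)
  show ?case
  proof (cases "v x > 1")
    case False
    hence "v x < 1" using x by simp
    hence "v (inverse x) > 1" using x unfolding v.inverse by (intro one_less_inverse) simp_all
    thus ?thesis by blast
  qed blast
next
  case (insert u W)
  interpret v: nonarch v by fact
  interpret u: nonarch u using insert.prems[of u] by simp
  obtain y where y: "v y > 1" "\<And>w. w \<in> W \<Longrightarrow> w y < 1" using insert by blast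
  obtain z where z: "v z > 1" "u z < 1" using approximation_two[OF assms(2) _ assms(3)] insert.prems by blast
  have small: "\<exists>n. \<forall>w\<in>W. w y ^ n * w z < 1"
  proof -
    have "\<forall>\<^sub>F n in sequentially. w y ^ n * w z < 1" if "w \<in> W" for w
    proof -
      interpret w: nonarch w using insert.prems[of w] that by simp
      have "(\<lambda>n. w y ^ n * w z) \<longlonglongrightarrow> 0 * w z"
        using y(2)[OF that] by (intro tendsto_mult_right LIMSEQ_power_zero) simp
      thus ?thesis by (simp add: order_tendstoD(2))
    qed
    hence "\<forall>\<^sub>F n in sequentially. \<forall>w\<in>W. w y ^ n * w z < 1"
      using insert.hyps(1) by (intro eventually_ball_finite) auto
    thus ?thesis by (auto simp: eventually_sequentially)
  qed
  then obtain n where n: "\<And>w. w \<in> W \<Longrightarrow> w y ^ n * w z < 1" by blast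
  show ?case
  proof (cases "u y \<le> 1")
    case True
    have "v (y ^ n * z) > 1"
      using y(1) z(1) by (simp add: v.mult v.power one_le_power less_1_mult' mult.commute)
    moreover have "u (y ^ n * z) < 1"
    proof -
      have "u y ^ n * u z \<le> 1 * u z" using True by (intro mult_right_mono power_le_one) auto
      thus ?thesis using z(2) by (simp add: u.mult u.power)
    qed
    moreover have "w (y ^ n * z) < 1" if "w \<in> W" for w
    proof -
      interpret w: nonarch w using insert.prems[of w] that by simp
      show ?thesis using n[OF that] by (simp add: w.mult w.power)
    qed
    ultimately show ?thesis by auto
  next
    case False
    show ?thesis
    \<comment> \<open>The quotient below is informative only for n > 0; for n = 0 the choice of n
      says that z itself is small on W.\<close>
    proof (cases "n = 0")
      case True
      thus ?thesis using z n by auto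
    next
      case n0: False
      define r where "r = y ^ n / (1 + y ^ n)"
      have big: "w r = 1" if "nonarch w" "w y > 1" for w
      proof -
        interpret w: nonarch w by fact
        have "w (y ^ n) > 1" using that n0 by (simp add: w.power)
        hence "w (1 + y ^ n) = w (y ^ n)" by (intro w.add_eq_right) simp
        thus ?thesis using \<open>w (y ^ n) > 1\<close> by (simp add: r_def w.divide del: w.eq_0_iff)
      qed
      have "v (r * z) > 1" using big[OF assms(2) y(1)] z(1) by (simp add: v.mult)
      moreover have "u (r * z) < 1"
        using big[of u] u.nonarch_axioms False z(2) by (simp add: u.mult)
      moreover have "w (r * z) < 1" if "w \<in> W" for w
      proof -
        interpret w: nonarch w using insert.prems[of w] that by simp
        have "w (y ^ n) < 1" using y(2)[OF that] n0 by (simp add: w.power power_less_one_iff)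
        hence "w (1 + y ^ n) = 1" using w.add_eq_left[of "y ^ n" 1] by simp
        thus ?thesis using n[OF that] by (simp add: r_def w.divide w.mult w.power)
      qed
      ultimately show ?thesis by auto
    qed
  qed
qed

section \<open>Places of a function field\<close>

context function_field
begin

lemma place_nonarch: "p \<in> places k \<Longrightarrow> nonarch (rep p)"
  by (rule rep_place(1)[OF k])

lemma place_trivial: "p \<in> places k \<Longrightarrow> c \<in> k \<Longrightarrow> c \<noteq> 0 \<Longrightarrow> rep p c = 1"
  by (rule rep_place(3)[OF k])

lemma place_trivial_le: "p \<in> places k \<Longrightarrow> c \<in> k \<Longrightarrow> rep p c \<le> 1"
proof (cases "c = 0")
  case True
  assume "p \<in> places k"
  from nonarch.zero[OF place_nonarch[OF this]] True show ?thesis by simp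
qed (simp add: place_trivial)

lemma place_nontrivial: "p \<in> places k \<Longrightarrow> nontrivial (rep p)"
  unfolding nontrivial_def by (rule rep_place(2)[OF k])

lemma transcendental_of_rep: "p \<in> places k \<Longrightarrow> x \<noteq> 0 \<Longrightarrow> rep p x \<noteq> 1 \<Longrightarrow> \<not> algebraic_over k x"
  by (auto simp: algebraic_iff place_trivial)

lemma rep_poly_pole:
  assumes "p \<in> places k" "rep p x > 1" "P \<noteq> 0" "\<And>i. coeff P i \<in> k"
  shows "rep p (poly P x) = rep p x ^ degree P"
proof -
  interpret v: nonarch "rep p" by (rule place_nonarch[OF assms(1)])
  have lc: "rep p (lead_coeff P * x ^ degree P) = rep p x ^ degree P"
    using place_trivial[OF assms(1,4)] assms(3) by (simp add: v.mult v.power)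
  have "rep p (poly P x) = rep p (lead_coeff P * x ^ degree P)"
    unfolding poly_altdef
  proof (rule v.sum_dominant)
    fix j assume j: "j \<in> {..degree P}" "j \<noteq> degree P"
    have "rep p (coeff P j * x ^ j) \<le> 1 * rep p x ^ j"
      unfolding v.mult v.power using place_trivial_le[OF assms(1,4)] by (intro mult_right_mono) auto
    also have "\<dots> < rep p x ^ degree P" using assms(2) j by (simp add: power_strict_increasing)
    finally show "rep p (coeff P j * x ^ j) < rep p (lead_coeff P * x ^ degree P)" using lc by simp
  qed auto
  thus ?thesis using lc by simp
qed

text \<open>If there were infinitely many poles, weak approximation would give functions
  \<open>u i\<close> large at the i-th pole and small at the others. In a relation among r + 1 of
  them with coefficients in k[x], consider a coefficient of largest degree: its term strictly
  dominates at the pole with the same index, as the values of the u break ties of degree.\<close>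

theorem finite_poles: "finite {p\<in>places k. rep p x > 1}"
proof (rule ccontr)
  assume inf: "infinite {p\<in>places k. rep p x > 1}"
  hence "{p\<in>places k. rep p x > 1} \<noteq> {}" by (metis finite.emptyI)
  then obtain p0 where p0: "p0 \<in> places k" "rep p0 x > 1" by blast
  interpret v0: nonarch "rep p0" by (rule place_nonarch[OF p0(1)])
  have "x \<noteq> 0" using p0 by auto
  hence "\<not> algebraic_over k x" using transcendental_of_rep[OF p0(1)] p0(2) by simp
  then obtain r where r: "\<And>u :: nat \<Rightarrow> 'a. \<exists>P. (\<forall>i\<le>r. \<forall>l. coeff (P i) l \<in> k) \<and> (\<exists>i\<le>r. P i \<noteq> 0) \<and>
      (\<Sum>i\<le>r. poly (P i) x * u i) = 0" using dependent by blast
  obtain f :: "nat \<Rightarrow> ('a \<Rightarrow> real) set" where f: "inj f" "range f \<subseteq> {p\<in>places k. rep p x > 1}"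
    using infinite_countable_subset[OF inf] by blast
  have fp: "f i \<in> places k" "rep (f i) x > 1" for i using f(2) by auto
  have "\<exists>y. rep (f i) y > 1 \<and> (\<forall>w\<in>(\<lambda>j. rep (f j)) ` ({..r} - {i}). w y < 1)" for i
  proof (rule approximation_finite)
    fix w assume "w \<in> (\<lambda>j. rep (f j)) ` ({..r} - {i})"
    then obtain j where j: "w = rep (f j)" "j \<noteq> i" by auto
    have "\<not> abs_equiv (rep (f i)) w"
      using places_eqI[OF k fp(1)[of i] fp(1)[of j]] j injD[OF f(1), of i j] by auto
    thus "nonarch w \<and> nontrivial w \<and> \<not> abs_equiv (rep (f i)) w"
      using j place_nonarch[OF fp(1)] place_nontrivial[OF fp(1)] by simp
  qed (auto intro: place_nonarch place_nontrivial fp)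
  then obtain u where u: "\<And>i. rep (f i) (u i) > 1" "\<And>i j. j \<le> r \<Longrightarrow> j \<noteq> i \<Longrightarrow> rep (f j) (u i) < 1"
    by (metis (no_types, lifting) DiffI atMost_iff image_eqI singletonD)
  obtain P where P: "\<And>i l. i \<le> r \<Longrightarrow> coeff (P i) l \<in> k" "\<exists>i\<le>r. P i \<noteq> 0"
    "(\<Sum>i\<le>r. poly (P i) x * u i) = 0" using r[of u] by blast
  define I where "I = {i. i \<le> r \<and> P i \<noteq> 0}"
  have I: "finite I" "I \<noteq> {}" using P(2) by (auto simp: I_def)
  have "Max ((\<lambda>i. degree (P i)) ` I) \<in> (\<lambda>i. degree (P i)) ` I" using I by (intro Max_in) auto
  then obtain i where i: "i \<in> I" "degree (P i) = Max ((\<lambda>i. degree (P i)) ` I)" by auto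
  have mx: "degree (P j) \<le> degree (P i)" if "j \<in> I" for j unfolding i(2) using that I by (intro Max_ge) auto
  interpret v: nonarch "rep (f i)" by (rule place_nonarch[OF fp(1)])
  have ir: "i \<le> r" "P i \<noteq> 0" using i by (auto simp: I_def)
  have "rep (f i) (\<Sum>j\<le>r. poly (P j) x * u j) = rep (f i) (poly (P i) x * u i)"
  proof (rule v.sum_dominant)
    fix j assume j: "j \<in> {..r}" "j \<noteq> i"
    have Lp: "rep (f i) x ^ degree (P i) > 0" using fp(2)[of i] by (intro zero_less_power) linarith
    have big: "rep (f i) (poly (P i) x * u i) > rep (f i) x ^ degree (P i)"
      unfolding v.mult rep_poly_pole[OF fp ir(2) P(1)[OF ir(1)]]
      using mult_strict_left_mono[OF u(1)[of i] Lp] by simp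
    show "rep (f i) (poly (P j) x * u j) < rep (f i) (poly (P i) x * u i)"
    proof (cases "P j = 0")
      case True
      have "rep (f i) (poly (P j) x * u j) = 0" using True by simp
      thus ?thesis using Lp big by linarith
    next
      case False
      hence "rep (f i) (poly (P j) x) = rep (f i) x ^ degree (P j)"
        using j by (intro rep_poly_pole fp P(1)) auto
      also have "\<dots> \<le> rep (f i) x ^ degree (P i)"
        using mx[of j] j False fp(2)[of i] by (intro power_increasing) (auto simp: I_def)
      finally have "rep (f i) (poly (P j) x * u j) \<le> rep (f i) x ^ degree (P i) * 1"
        unfolding v.mult using u(2)[OF ir(1), of j] j fp(2)[of i]
        by (intro mult_mono) auto
      thus ?thesis using big by linarith
    qed
  qed (use ir in simp_all)
  hence "poly (P i) x * u i = 0" using P(3) by simp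
  moreover have "rep (f i) (poly (P i) x * u i) > 0"
    unfolding v.mult rep_poly_pole[OF fp ir(2) P(1)[OF ir(1)]]
    using u(1)[of i] fp(2)[of i] by (intro mult_pos_pos zero_less_power) linarith+
  ultimately show False by simp
qed

lemma finite_nonunits: "x \<noteq> 0 \<Longrightarrow> finite {p\<in>places k. rep p x \<noteq> 1}"
proof -
  assume "x \<noteq> 0"
  have "rep p x > 1 \<or> rep p (inverse x) > 1" if "p \<in> places k" "rep p x \<noteq> 1" for p
  proof -
    interpret v: nonarch "rep p" by (rule place_nonarch[OF that(1)])
    have "rep p x > 0" using \<open>x \<noteq> 0\<close> by (simp only: v.pos_iff not_False_eq_True)
    thus ?thesis unfolding v.inverse using that(2) one_less_inverse[of "rep p x"] by linarith
  qed
  hence "{p\<in>places k. rep p x \<noteq> 1} \<subseteq> {p\<in>places k. rep p x > 1} \<union> {p\<in>places k. rep p (inverse x) > 1}"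
    by blast
  thus ?thesis using finite_poles[of x] finite_poles[of "inverse x"] by (meson finite_UnI finite_subset)
qed

text \<open>The residue field is k: an element u of absolute value 1 incongruent to every constant would make
  all polynomials in u units, so no nontrivial value could be algebraic over k(u).\<close>

lemma residue_unit:
  assumes p: "p \<in> places k" and u: "rep p u = 1"
  shows "\<exists>c\<in>k. rep p (u - c) < 1"
proof (rule ccontr)
  interpret v: nonarch "rep p" by (rule place_nonarch[OF p])
  assume "\<not> ?thesis"
  hence ge: "rep p (u - c) = 1" if "c \<in> k" for c
    using that v.ultra_diff[of u c] place_trivial_le[OF p that] u by force
  have uk: "u \<notin> k" using ge[of u] by auto
  have unit: "rep p (poly P u) = 1" if "P \<noteq> 0" "\<And>i. coeff P i \<in> k" for P
  proof -
    obtain cs where cs: "set cs \<subseteq> k" "poly P u = lead_coeff P * (\<Prod>c\<leftarrow>cs. u - c)"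
      using splits_over_k[OF \<open>P \<noteq> 0\<close>] \<open>\<And>i. coeff P i \<in> k\<close> by blast
    have "rep p (\<Prod>c\<leftarrow>cs. u - c) = 1" using cs(1) by (induction cs) (auto simp: v.mult ge)
    thus ?thesis using cs(2) place_trivial[OF p that(2)] that(1) by (simp add: v.mult)
  qed
  obtain y where y: "y \<noteq> 0" "rep p y \<noteq> 1" using place_nontrivial[OF p] by (auto simp: nontrivial_def)
  obtain r where r: "\<And>u' :: nat \<Rightarrow> 'a. \<exists>P. (\<forall>i\<le>r. \<forall>l. coeff (P i) l \<in> k) \<and> (\<exists>i\<le>r. P i \<noteq> 0) \<and>
      (\<Sum>i\<le>r. poly (P i) u * u' i) = 0" using dependent[of u] uk algebraic_iff by blast
  obtain P where P: "\<And>i l. i \<le> r \<Longrightarrow> coeff (P i) l \<in> k" "\<exists>i\<le>r. P i \<noteq> 0"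
    "(\<Sum>i\<le>r. poly (P i) u * y ^ i) = 0" using r[of "\<lambda>i. y ^ i"] by blast
  obtain i0 where i0: "i0 \<le> r" "P i0 \<noteq> 0" using P(2) by blast
  have "poly (P i0) u \<noteq> 0" using unit[OF i0(2) P(1)[OF i0(1)]] by auto
  then obtain i j where ij: "i \<le> r" "j \<le> r" "i \<noteq> j" "poly (P i) u * y ^ i \<noteq> 0"
    "rep p (poly (P i) u * y ^ i) = rep p (poly (P j) u * y ^ j)"
    using v.exists_tie[of "{..r}" i0 "\<lambda>i. poly (P i) u * y ^ i"] P(3) i0 y(1) by auto
  have "poly (P j) u * y ^ j \<noteq> 0" using ij(4,5) by (metis v.eq_0_iff)
  hence "P i \<noteq> 0" "P j \<noteq> 0" using ij(4) by auto
  hence "rep p y ^ i = rep p y ^ j"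
    using ij(5) unit[OF _ P(1)[OF ij(1)]] unit[OF _ P(1)[OF ij(2)]] by (simp add: v.mult v.power)
  moreover have "rep p y > 0" using y by simp
  ultimately show False using ij(3) y(2) by (metis power_inject_exp' )
qed

lemma residue:
  assumes p: "p \<in> places k" and "y \<noteq> 0" "rep p x \<le> rep p y"
  shows "\<exists>c\<in>k. rep p (x - c * y) < rep p y"
proof (cases "rep p x = rep p y")
  case True
  interpret v: nonarch "rep p" by (rule place_nonarch[OF p])
  have "rep p (x / y) = 1" using True assms(2) by (simp add: v.divide)
  then obtain c where c: "c \<in> k" "rep p (x / y - c) < 1" using residue_unit[OF p] by blast
  have "x - c * y = (x / y - c) * y" using assms(2) by (simp add: field_simps)
  hence "rep p (x - c * y) < rep p y" using c(2) assms(2) by (simp add: v.mult)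
  thus ?thesis using c by blast
next
  case False
  thus ?thesis using assms(3) k_closed(2) by (intro bexI[of _ 0]) auto
qed

text \<open>First for an interval of ratio L = |x| > 1: a relation over k[x] among r + 1 elements
  has two terms of equal value. The coefficients contribute powers of L, and the interval is too
  short for different powers, so two of the elements have equal value. Finitely many such intervals
  cover the given one.\<close>

lemma finite_values:
  assumes p: "p \<in> places k" and a: "a > 0"
  shows "finite {rep p z | z. a < rep p z \<and> rep p z \<le> b}"
proof -
  interpret v: nonarch "rep p" by (rule place_nonarch[OF p])
  obtain x where x: "rep p x > 1"
    using approximation_finite[of "{}" "rep p"] place_nonarch[OF p] place_nontrivial[OF p] by auto
  define L where "L = rep p x"
  have L: "L > 1" using x by (simp add: L_def)
  have "x \<noteq> 0" using x by auto
  then obtain r where r: "\<And>u :: nat \<Rightarrow> 'a. \<exists>P. (\<forall>i\<le>r. \<forall>l. coeff (P i) l \<in> k) \<and> (\<exists>i\<le>r. P i \<noteq> 0) \<and>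
      (\<Sum>i\<le>r. poly (P i) x * u i) = 0" using dependent[of x] transcendental_of_rep[OF p, of x] x by auto
  have one: "finite {rep p z | z. e < rep p z \<and> rep p z \<le> e * L}" if e: "e > 0" for e
  proof (rule ccontr)
    assume "infinite {rep p z | z. e < rep p z \<and> rep p z \<le> e * L}"
    then obtain h :: "nat \<Rightarrow> real" where h: "inj h" "range h \<subseteq> {rep p z | z. e < rep p z \<and> rep p z \<le> e * L}"
      using infinite_countable_subset by blast
    hence "\<forall>i. \<exists>z. h i = rep p z \<and> e < rep p z \<and> rep p z \<le> e * L" by blast
    then obtain z where z: "\<And>i. h i = rep p (z i)" "\<And>i. e < rep p (z i)" "\<And>i. rep p (z i) \<le> e * L" by metis
    have znz: "z i \<noteq> 0" for i using z(2)[of i] e by auto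
    obtain P where P: "\<And>i l. i \<le> r \<Longrightarrow> coeff (P i) l \<in> k" "\<exists>i\<le>r. P i \<noteq> 0"
      "(\<Sum>i\<le>r. poly (P i) x * z i) = 0" using r[of z] by blast
    obtain i0 where i0: "i0 \<le> r" "P i0 \<noteq> 0" using P(2) by blast
    have val: "rep p (poly (P i) x * z i) = L ^ degree (P i) * rep p (z i)" if "i \<le> r" "P i \<noteq> 0" for i
      using rep_poly_pole[OF p x that(2) P(1)[OF that(1)]] by (simp add: v.mult L_def)
    have "rep p (poly (P i0) x * z i0) > 0" unfolding val[OF i0] using L znz by simp
    hence nz0: "poly (P i0) x * z i0 \<noteq> 0" using v.pos_iff by blast
    then obtain i j where ij: "i \<le> r" "j \<le> r" "i \<noteq> j" "poly (P i) x * z i \<noteq> 0"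
      "rep p (poly (P i) x * z i) = rep p (poly (P j) x * z j)"
      using v.exists_tie[of "{..r}" i0 "\<lambda>i. poly (P i) x * z i"] P(3) i0(1) nz0 by auto
    have "poly (P j) x * z j \<noteq> 0" using ij(4,5) by (metis v.eq_0_iff)
    hence nz: "P i \<noteq> 0" "P j \<noteq> 0" using ij(4) by auto
    have eq: "L ^ degree (P i) * rep p (z i) = L ^ degree (P j) * rep p (z j)"
      using ij(5) val ij(1,2) nz by simp
    have no: False if lt: "m < n" and q: "L ^ m * rep p (z i) = L ^ n * rep p (z j)" for m n i j
    proof -
      have "L ^ n = L ^ m * L ^ (n - m)" using lt by (simp flip: power_add)
      hence "rep p (z i) = L ^ (n - m) * rep p (z j)" using q L by simp
      also have "\<dots> \<ge> L * rep p (z j)"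
        using L lt self_le_power[of L "n - m"] by (intro mult_right_mono) auto
      finally have "L * e < rep p (z i)" using z(2)[of j] L
        by (smt (verit) mult_le_cancel_left_pos mult_less_cancel_left_pos)
      thus False using z(3)[of i] by (simp add: mult.commute)
    qed
    have "degree (P i) = degree (P j)" using no[OF _ eq] no[OF _ eq[symmetric]] by (metis linorder_neqE_nat)
    hence "h i = h j" using eq L z(1) by simp
    thus False using ij(3) injD[OF h(1)] by blast
  qed
  obtain N where N: "b < L ^ N * a"
  proof -
    obtain N where "b / a < L ^ N" using real_arch_pow[OF L] by blast
    thus ?thesis using a that[of N] by (simp add: field_simps)
  qed
  have fin: "finite {rep p z | z. a < rep p z \<and> rep p z \<le> a * L ^ n}" for n
  proof (induction n)
    case 0
    have "{rep p z | z. a < rep p z \<and> rep p z \<le> a * L ^ 0} = {}" by auto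
    thus ?case by (simp only: finite.emptyI)
  next
    case (Suc n)
    have "{rep p z | z. a < rep p z \<and> rep p z \<le> a * L ^ Suc n} \<subseteq>
      {rep p z | z. a < rep p z \<and> rep p z \<le> a * L ^ n} \<union> {rep p z | z. a * L ^ n < rep p z \<and> rep p z \<le> (a * L ^ n) * L}"
      by (auto simp: mult_ac not_le)
    thus ?case using Suc one[of "a * L ^ n"] a L finite_subset by fastforce
  qed
  have "{rep p z | z. a < rep p z \<and> rep p z \<le> b} \<subseteq> {rep p z | z. a < rep p z \<and> rep p z \<le> a * L ^ N}"
    using N by (auto simp: mult.commute)
  thus ?thesis using fin finite_subset by blast
qed

section \<open>Existence and abundance of places\<close>

lemma exists_pole:
  assumes "x \<notin> k"
  obtains p where "p \<in> places k" "rep p x > 1"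
proof -
  have x: "\<not> algebraic_over k x" using assms algebraic_iff by simp
  then obtain r where r: "\<And>u :: nat \<Rightarrow> 'a. \<exists>P. (\<forall>i\<le>r. \<forall>l. coeff (P i) l \<in> k) \<and> (\<exists>i\<le>r. P i \<noteq> 0) \<and>
      (\<Sum>i\<le>r. poly (P i) x * u i) = 0" using dependent by blast
  have "\<exists>P r. (\<forall>i\<le>r. \<forall>l. coeff (P i) l \<in> k) \<and> (\<exists>i\<le>r. P i \<noteq> 0) \<and> (\<Sum>i\<le>r. poly (P i) x * z ^ i) = 0" for z :: 'a
    using r[of "\<lambda>i. z ^ i"] by blast
  from exists_place_pole[OF k x this] that show ?thesis by blast
qed

lemma integral_everywhere:
  assumes "\<And>p. p \<in> places k \<Longrightarrow> rep p x \<le> 1"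
  shows "x \<in> k"
proof (rule ccontr)
  assume "x \<notin> k"
  then obtain p where "p \<in> places k" "rep p x > 1" by (rule exists_pole)
  with assms[of p] show False by simp
qed

text \<open>Every t - c with c in k is small at some place, and no place serves two constants: their
  difference would be a nonzero constant of value below 1.\<close>

lemma infinite_places: "infinite (places k)"
proof
  assume fin: "finite (places k)"
  obtain t where t: "\<not> algebraic_over k t" using trdeg by (auto simp: trdeg_one_over_def)
  have "\<exists>p\<in>places k. rep p (t - c) < 1" if "c \<in> k" for c
  proof -
    have tk: "t \<notin> k" using t algebraic_iff by simp
    have "t - c \<noteq> 0" using tk that by auto
    have "inverse (t - c) \<notin> k"
    proof
      assume "inverse (t - c) \<in> k"
      hence "inverse (inverse (t - c)) \<in> k" by (rule k_closed)
      hence "t - c \<in> k" by simp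
      hence "t - c + c \<in> k" using that by (rule k_closed(3))
      thus False using tk by simp
    qed
    then obtain p where p: "p \<in> places k" "rep p (inverse (t - c)) > 1" using exists_pole by blast
    interpret v: nonarch "rep p" by (rule place_nonarch[OF p(1)])
    have "rep p (t - c) < 1" using p(2) \<open>t - c \<noteq> 0\<close> by (simp add: v.inverse one_less_inverse_iff)
    thus ?thesis using p(1) by blast
  qed
  then obtain q where q: "\<And>c. c \<in> k \<Longrightarrow> q c \<in> places k" "\<And>c. c \<in> k \<Longrightarrow> rep (q c) (t - c) < 1" by metis
  have "inj_on q k"
  proof (rule inj_onI)
    fix c d assume cd: "c \<in> k" "d \<in> k" "q c = q d"
    interpret v: nonarch "rep (q c)" by (rule place_nonarch[OF q(1)[OF cd(1)]])
    have "rep (q c) ((t - d) - (t - c)) < 1"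
      using v.ultra_diff[of "t - d" "t - c"] q(2)[OF cd(1)] q(2)[OF cd(2)] cd(3) by simp
    hence "rep (q c) (c - d) < 1" by simp
    thus "c = d" using place_trivial[OF q(1)[OF cd(1)], of "c - d"] k_closed(4)[OF cd(1,2)] by force
  qed
  moreover have "q ` k \<subseteq> places k" using q(1) by blast
  ultimately have "finite k" using fin by (metis finite_imageD finite_subset)
  thus False using infinite_k by simp
qed

end

section \<open>Functions with bounded poles\<close>

context function_field
begin

text \<open>A function with prescribed poles is determined by its residues at finitely many places; the bound is
  lowered one value at a time, each step costing at most one further place.\<close>

lemma separating_places_aux:
  fixes C :: "('a \<Rightarrow> real) set \<Rightarrow> real"
  assumes "finite B" "B \<subseteq> places k" "\<And>p. p \<in> B \<Longrightarrow> C p \<ge> 1" "\<And>p. p \<in> places k - B \<Longrightarrow> C p = 1"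
    and "finite A" "n = (\<Sum>p\<in>B. card {rep p z | z. 1 < rep p z \<and> rep p z \<le> C p})"
  shows "\<exists>T. finite T \<and> T \<subseteq> places k - A \<and>
    (\<forall>f. (\<forall>p\<in>places k. rep p f \<le> C p) \<and> (\<forall>p\<in>T. rep p f < 1) \<longrightarrow> f = 0)"
  using assms(3,4,6)
proof (induction n arbitrary: C rule: less_induct)
  case (less n)
  define V where "V = (\<lambda>(C :: ('a \<Rightarrow> real) set \<Rightarrow> real) p. {rep p z | z. 1 < rep p z \<and> rep p z \<le> C p})"
  have finV: "finite (V C p)" if "p \<in> places k" for C p
    unfolding V_def by (rule finite_values[OF that]) simp
  show ?case
  proof (cases "\<forall>p\<in>B. V C p = {}")
    case True
    obtain p0 where p0: "p0 \<in> places k" "p0 \<notin> A"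
      using infinite_places assms(5) by (meson finite_subset subsetI)
    show ?thesis
    proof (intro exI[of _ "{p0}"] conjI allI impI)
      fix f assume f: "(\<forall>p\<in>places k. rep p f \<le> C p) \<and> (\<forall>p\<in>{p0}. rep p f < 1)"
      have "f \<in> k"
      proof (rule integral_everywhere)
        fix p assume p: "p \<in> places k"
        show "rep p f \<le> 1"
        proof (cases "p \<in> B")
          case True
          show ?thesis
          proof (rule ccontr)
            assume "\<not> rep p f \<le> 1"
            hence "rep p f \<in> V C p" using f p by (auto simp: V_def)
            thus False using \<open>\<forall>p\<in>B. V C p = {}\<close> True by blast
          qed
        next
          case False
          thus ?thesis using less.prems(2)[of p] p f by auto
        qed
      qed
      thus "f = 0" using place_trivial[OF p0(1), of f] f by force
    qed (use p0 in auto)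
  next
    case False
    then obtain q where q: "q \<in> B" "V C q \<noteq> {}" by blast
    have qp: "q \<in> places k" using q assms(2) by blast
    define c where "c = Max (V C q)"
    have c: "c \<in> V C q" unfolding c_def using finV[OF qp] q(2) by (rule Max_in)
    have cmax: "x \<le> c" if "x \<in> V C q" for x unfolding c_def using finV[OF qp] that by (rule Max_ge)
    have c1: "c > 1" using c by (auto simp: V_def)
    \<comment> \<open>The next admissible value at q below the largest one; 1 stands in if there is
      none.\<close>
    define c' where "c' = Max (insert 1 (V C q - {c}))"
    have fin': "finite (insert 1 (V C q - {c}))" using finV[OF qp] by simp
    have c'1: "c' \<ge> 1" unfolding c'_def using fin' by (intro Max_ge) auto
    have "c' \<in> insert 1 (V C q - {c})" unfolding c'_def using fin' by (intro Max_in) auto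
    hence c'lt: "c' < c" using c1 cmax[of c'] by auto
    define C' where "C' = C(q := c')"
    have Vq: "V C' q \<subseteq> V C q - {c}"
    proof
      fix x assume "x \<in> V C' q"
      then obtain z where z: "x = rep q z" "1 < x" "x \<le> c'" by (auto simp: V_def C'_def)
      moreover have "c \<le> C q" using c by (auto simp: V_def)
      ultimately show "x \<in> V C q - {c}" using c'lt by (auto simp: V_def)
    qed
    have "(\<Sum>p\<in>B. card (V C' p)) < (\<Sum>p\<in>B. card (V C p))"
    proof (rule sum_strict_mono_ex1[OF assms(1)])
      show "\<forall>p\<in>B. card (V C' p) \<le> card (V C p)"
      proof
        fix p assume "p \<in> B"
        show "card (V C' p) \<le> card (V C p)"
        proof (cases "p = q")
          case True
          thus ?thesis using Vq finV[OF qp] by (intro card_mono) auto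
        next
          case False
          thus ?thesis by (simp add: V_def C'_def)
        qed
      qed
      have "card (V C' q) < card (V C q)" using Vq c finV[OF qp] by (intro psubset_card_mono) auto
      thus "\<exists>p\<in>B. card (V C' p) < card (V C p)" using q by blast
    qed
    hence lt: "(\<Sum>p\<in>B. card (V C' p)) < n" using less.prems(3) by (simp add: V_def)
    have "\<exists>T. finite T \<and> T \<subseteq> places k - A \<and>
      (\<forall>f. (\<forall>p\<in>places k. rep p f \<le> C' p) \<and> (\<forall>p\<in>T. rep p f < 1) \<longrightarrow> f = 0)"
    proof (rule less.IH[OF lt])
      show "1 \<le> C' p" if "p \<in> B" for p using less.prems(1)[OF that] c'1 by (simp add: C'_def)
      show "C' p = 1" if "p \<in> places k - B" for p using less.prems(2)[OF that] q that by (auto simp: C'_def)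
    qed (simp add: V_def)
    then obtain T where T12: "finite T" "T \<subseteq> places k - A"
      and T0: "\<forall>f. (\<forall>p\<in>places k. rep p f \<le> C' p) \<and> (\<forall>p\<in>T. rep p f < 1) \<longrightarrow> f = 0"
      by (elim exE conjE)
    have T3: "f = 0" if "\<And>p. p \<in> places k \<Longrightarrow> rep p f \<le> C' p" "\<And>p. p \<in> T \<Longrightarrow> rep p f < 1" for f
      using T0[rule_format, of f] that by simp
    note T = T12 T3
    have low: "f = 0" if f: "\<And>p. p \<in> places k \<Longrightarrow> rep p f \<le> C p" "\<And>p. p \<in> T \<Longrightarrow> rep p f < 1" "rep q f < c" for f
    proof (rule T(3)[OF _ f(2)])
      fix p assume p: "p \<in> places k"
      show "rep p f \<le> C' p"
      proof (cases "p = q")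
        case True
        show ?thesis
        proof (cases "rep q f > 1")
          case True
          hence "rep q f \<in> insert 1 (V C q - {c})" using f(1)[OF qp] f(3) by (auto simp: V_def)
          hence "rep q f \<le> c'" unfolding c'_def using fin' by (intro Max_ge)
          thus ?thesis using \<open>p = q\<close> by (simp add: C'_def)
        next
          case False
          thus ?thesis using \<open>p = q\<close> c'1 by (simp add: C'_def)
        qed
      next
        case False
        thus ?thesis using f(1)[OF p] by (simp add: C'_def)
      qed
    qed
    show ?thesis
    proof (cases "\<exists>g. g \<noteq> 0 \<and> (\<forall>p\<in>places k. rep p g \<le> C p) \<and> (\<forall>p\<in>T. rep p g < 1)")
      case False
      thus ?thesis using T(1,2) by blast
    next
      case True
      \<comment> \<open>Such a g attains the value c at q. Any competitor f differs from some
        constant multiple a g by a function of smaller value at q, which vanishes under the lowered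
        bound; one more place, at which g is a unit, then forces a = 0.\<close>
      then obtain g where g0: "g \<noteq> 0 \<and> (\<forall>p\<in>places k. rep p g \<le> C p) \<and> (\<forall>p\<in>T. rep p g < 1)" by (rule exE)
      hence g: "g \<noteq> 0" "\<And>p. p \<in> places k \<Longrightarrow> rep p g \<le> C p" "\<And>p. p \<in> T \<Longrightarrow> rep p g < 1" by simp_all
      have top: "rep q f \<le> c" if "rep q f \<le> C q" for f
        using that cmax[of "rep q f"] c1 by (cases "rep q f > 1") (auto simp: V_def)
      have gc: "rep q g = c" using low[OF g(2,3)] g(1) top[OF g(2)[OF qp]] by linarith
      have "finite (A \<union> {p\<in>places k. rep p g \<noteq> 1})" using assms(5) finite_nonunits[OF g(1)] by simp
      then obtain p1 where p1: "p1 \<in> places k" "p1 \<notin> A \<union> {p\<in>places k. rep p g \<noteq> 1}"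
        using infinite_places by (meson finite_subset subsetI)
      have g1: "rep p1 g = 1" using p1 by blast
      show ?thesis
      proof (intro exI[of _ "insert p1 T"] conjI allI impI)
        fix f assume "(\<forall>p\<in>places k. rep p f \<le> C p) \<and> (\<forall>p\<in>insert p1 T. rep p f < 1)"
        hence f: "\<And>p. p \<in> places k \<Longrightarrow> rep p f \<le> C p" "\<And>p. p \<in> T \<Longrightarrow> rep p f < 1" "rep p1 f < 1" by simp_all
        have "rep q f \<le> rep q g" using top[OF f(1)[OF qp]] gc by simp
        then obtain a where a: "a \<in> k" "rep q (f - a * g) < c" using residue[OF qp g(1)] gc by auto
        have comb: "rep p (f - a * g) \<le> max (rep p f) (rep p g)" if "p \<in> places k" for p
        proof -
          interpret v: nonarch "rep p" by (rule place_nonarch[OF that])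
          have "rep p (a * g) \<le> 1 * rep p g"
            unfolding v.mult using place_trivial_le[OF that a(1)] by (intro mult_right_mono) auto
          thus ?thesis using v.ultra_diff[of f "a * g"] by linarith
        qed
        have "f - a * g = 0"
        proof (rule low)
          show "rep p (f - a * g) \<le> C p" if "p \<in> places k" for p
            using comb[OF that] f(1)[OF that] g(2)[OF that] by linarith
          show "rep p (f - a * g) < 1" if "p \<in> T" for p
            using comb[of p] f(2)[OF that] g(3)[OF that] T(2) that by fastforce
        qed (rule a(2))
        hence fa: "f = a * g" by simp
        interpret v: nonarch "rep p1" by (rule place_nonarch[OF p1(1)])
        have "a = 0"
        proof (rule ccontr)
          assume "a \<noteq> 0"
          hence "rep p1 f = 1" using fa g1 place_trivial[OF p1(1) a(1)] by (simp add: v.mult)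
          thus False using f(3) by simp
        qed
        thus "f = 0" using fa by simp
      qed (use p1 T in auto)
    qed
  qed
qed

text \<open>The bound is first raised to at least 1 on B and to 1 elsewhere. The set A allows the
  separating places to be chosen away from all places of bad behaviour.\<close>

theorem separating_places:
  fixes C :: "('a \<Rightarrow> real) set \<Rightarrow> real"
  assumes fin: "finite B" "\<And>p. p \<in> places k - B \<Longrightarrow> C p \<le> 1" and A: "finite A"
  obtains T where "finite T" "T \<subseteq> places k - A"
    "\<And>f. (\<And>p. p \<in> places k \<Longrightarrow> rep p f \<le> C p) \<Longrightarrow> (\<And>p. p \<in> T \<Longrightarrow> rep p f < 1) \<Longrightarrow> f = 0"
proof -
  define C' where "C' = (\<lambda>p. if p \<in> B then max 1 (C p) else 1)"
  have le: "C p \<le> C' p" if "p \<in> places k" for p using fin(2)[of p] that by (auto simp: C'_def)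
  have "\<exists>T. finite T \<and> T \<subseteq> places k - A \<and>
    (\<forall>f. (\<forall>p\<in>places k. rep p f \<le> C' p) \<and> (\<forall>p\<in>T. rep p f < 1) \<longrightarrow> f = 0)"
    by (rule separating_places_aux[of "B \<inter> places k", OF _ _ _ _ A refl]) (auto simp: C'_def fin(1))
  then obtain T where T: "finite T" "T \<subseteq> places k - A"
    and T0: "\<forall>f. (\<forall>p\<in>places k. rep p f \<le> C' p) \<and> (\<forall>p\<in>T. rep p f < 1) \<longrightarrow> f = 0"
    by (elim exE conjE)
  show ?thesis
  proof (rule that[OF T(1,2)])
    fix f assume f: "\<And>p. p \<in> places k \<Longrightarrow> rep p f \<le> C p" "\<And>p. p \<in> T \<Longrightarrow> rep p f < 1"
    have "rep p f \<le> C' p" if "p \<in> places k" for p using f(1)[OF that] le[OF that] by linarith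
    thus "f = 0" using T0[rule_format, of f] f(2) by simp
  qed
qed

end

section \<open>Polynomials over a field evaluated in its algebraic closure\<close>

text \<open>Polynomials over K evaluated at algebraic points, so that vanishing is a condition over
  K and hence invariant under conjugation.\<close>

definition pac :: "'a::field poly \<Rightarrow> 'a alg_closure \<Rightarrow> 'a alg_closure" where
  "pac q = poly (map_poly to_ac q)"

lemma pac_altdef: "pac q x = (\<Sum>i\<le>degree q. to_ac (coeff q i) * x ^ i)"
  by (simp add: pac_def poly_altdef coeff_map_poly degree_map_poly)

lemma pac_0 [simp]: "pac 0 x = 0" and pac_1 [simp]: "pac 1 x = 1"
  by (simp_all add: pac_altdef)

lemma pac_pCons [simp]: "pac (pCons a q) x = to_ac a + x * pac q x"
  by (cases "a = 0 \<and> q = 0") (auto simp: pac_def map_poly_pCons)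

lemma pac_add [simp]: "pac (p + q) x = pac p x + pac q x"
  by (induction p q rule: poly_induct2) (simp_all add: algebra_simps)

lemma pac_smult [simp]: "pac (smult c p) x = to_ac c * pac p x"
  by (induction p) (simp_all add: algebra_simps)

lemma pac_diff [simp]: "pac (p - q) x = pac p x - pac q x"
  using pac_add[of "p - q" q x] by (simp add: algebra_simps)

lemma pac_mult [simp]: "pac (p * q) x = pac p x * pac q x"
  by (induction p) (simp_all add: algebra_simps)

lemma pac_power [simp]: "pac (p ^ n) x = pac p x ^ n"
  by (induction n) simp_all

lemma pac_sum [simp]: "pac (sum f A) x = (\<Sum>i\<in>A. pac (f i) x)"
  by (induction A rule: infinite_finite_induct) simp_all

lemma pac_to_ac [simp]: "pac q (to_ac x) = to_ac (poly q x)"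
  by (induction q) simp_all

lemma map_poly_to_ac_eq_0 [simp]: "map_poly to_ac q = 0 \<longleftrightarrow> q = 0"
  by (auto simp: poly_eq_iff coeff_map_poly)

lemma finite_pac_roots: "q \<noteq> 0 \<Longrightarrow> finite {x. pac q x = 0}"
  unfolding pac_def by (intro poly_roots_finite) simp

lemma exists_pac_root: "degree q > 0 \<Longrightarrow> \<exists>x. pac q x = 0"
  unfolding pac_def by (intro alg_closed_imp_poly_has_root) (simp add: degree_map_poly)

section \<open>Binary forms and the chordal distance\<close>

text \<open>The binary form of degree d that dehomogenises to p. The formal degree d may exceed the
  degree of p; the form then vanishes at infinity.\<close>

definition hform :: "nat \<Rightarrow> 'b::field poly \<Rightarrow> 'b \<times> 'b \<Rightarrow> 'b" where
  "hform d p u = (\<Sum>i\<le>d. coeff p i * fst u ^ i * snd u ^ (d - i))"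

lemma hform_affine: "degree p \<le> d \<Longrightarrow> hform d p (x, 1) = poly p x"
  unfolding hform_def poly_altdef by (simp, rule sum.mono_neutral_right) (auto simp: coeff_eq_0)

lemma hform_infty: "hform d p (x, 0) = coeff p d * x ^ d"
proof -
  have "hform d p (x, 0) = (\<Sum>i\<le>d. coeff p i * x ^ i * 0 ^ (d - i))"
    by (simp add: hform_def)
  also have "\<dots> = (\<Sum>i\<in>{d}. coeff p i * x ^ i * 0 ^ (d - i))"
    by (rule sum.mono_neutral_right) (auto simp: power_0_left)
  finally show ?thesis by simp
qed

lemma hform_scale: "hform d p (c * x, c * y) = c ^ d * hform d p (x, y)"
  unfolding hform_def sum_distrib_left
proof (rule sum.cong[OF refl])
  fix i assume "i \<in> {..d}"
  hence "c ^ d = c ^ i * c ^ (d - i)" by (simp flip: power_add)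
  thus "coeff p i * fst (c * x, c * y) ^ i * snd (c * x, c * y) ^ (d - i) =
      c ^ d * (coeff p i * fst (x, y) ^ i * snd (x, y) ^ (d - i))"
    by (simp add: power_mult_distrib mult_ac)
qed

lemma hform_eq_poly: "degree p \<le> d \<Longrightarrow> y \<noteq> 0 \<Longrightarrow> hform d p (x, y) = y ^ d * poly p (x / y)"
  using hform_scale[of d p y "x / y" 1] hform_affine[of p d "x / y"] by simp

lemma hform_add: "hform d (p + q) u = hform d p u + hform d q u"
  by (simp add: hform_def algebra_simps sum.distrib)

lemma hform_smult: "hform d (smult c p) u = c * hform d p u"
  by (simp add: hform_def sum_distrib_left mult_ac)

lemma hform_0 [simp]: "hform d 0 u = 0"
  by (simp add: hform_def)

lemma hform_sum: "hform d (sum p A) u = (\<Sum>i\<in>A. hform d (p i) u)"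
  by (induction A rule: infinite_finite_induct) (simp_all add: hform_add)

lemma coeff_mult_top:
  fixes p q :: "'b::field poly"
  assumes "degree p \<le> m" "degree q \<le> n"
  shows "coeff (p * q) (m + n) = coeff p m * coeff q n"
proof -
  have "coeff (p * q) (m + n) = (\<Sum>i\<in>{m}. coeff p i * coeff q (m + n - i))"
    unfolding coeff_mult
  proof (rule sum.mono_neutral_right)
    show "\<forall>i\<in>{..m + n} - {m}. coeff p i * coeff q (m + n - i) = 0"
    proof
      fix i assume i: "i \<in> {..m + n} - {m}"
      hence "i > m \<or> m + n - i > n" by auto
      thus "coeff p i * coeff q (m + n - i) = 0" using assms by (auto simp: coeff_eq_0)
    qed
  qed auto
  thus ?thesis by simp
qed

lemma hform_mult:
  assumes "degree p \<le> m" "degree q \<le> n"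
  shows "hform (m + n) (p * q) u = hform m p u * hform n q u"
proof -
  have dpq: "degree (p * q) \<le> m + n" using degree_mult_le[of p q] assms by linarith
  obtain x y where u: "u = (x, y)" by (cases u)
  show ?thesis
  proof (cases "y = 0")
    case True
    thus ?thesis unfolding u using coeff_mult_top[OF assms] by (simp add: hform_infty power_add mult_ac)
  next
    case False
    thus ?thesis unfolding u using assms dpq by (simp add: hform_eq_poly power_add mult_ac)
  qed
qed

lemma hform_power:
  assumes "degree p \<le> m"
  shows "degree (p ^ n) \<le> m * n" "hform (m * n) (p ^ n) u = hform m p u ^ n"
proof (induction n)
  case 0
  {
    case 1 show ?case by simp
  next
    case 2 show ?case by (simp add: hform_def)
  }
next
  case (Suc n)
  {
    case 1 show ?case using Suc.IH(1) degree_mult_le[of p "p ^ n"] assms by simp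
  next
    case 2 show ?case using hform_mult[OF assms Suc.IH(1), of u] Suc.IH(2) by simp
  }
qed

text \<open>The form of degree d belonging to f, with A and B substituted for its two variables;
  this composes maps in affine coordinates.\<close>

definition fsubst :: "nat \<Rightarrow> 'b::field poly \<Rightarrow> 'b poly \<Rightarrow> 'b poly \<Rightarrow> 'b poly" where
  "fsubst d f A B = (\<Sum>i\<le>d. smult (coeff f i) (A ^ i * B ^ (d - i)))"

lemma fsubst_degree:
  assumes "degree A \<le> D" "degree B \<le> D"
  shows "degree (fsubst d f A B) \<le> D * d"
  unfolding fsubst_def
proof (rule degree_sum_le)
  fix i assume i: "i \<in> {..d}"
  have "degree (A ^ i * B ^ (d - i)) \<le> D * i + D * (d - i)"
    using degree_mult_le[of "A ^ i" "B ^ (d - i)"] hform_power(1)[OF assms(1), of i]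
      hform_power(1)[OF assms(2), of "d - i"] by linarith
  also have "\<dots> = D * d" using i by (simp flip: distrib_left)
  finally show "degree (smult (coeff f i) (A ^ i * B ^ (d - i))) \<le> D * d"
    using degree_smult_le order_trans by blast
qed simp

lemma hform_fsubst:
  assumes "degree A \<le> D" "degree B \<le> D"
  shows "hform (D * d) (fsubst d f A B) u = hform d f (hform D A u, hform D B u)"
proof -
  have "hform (D * d) (fsubst d f A B) u = (\<Sum>i\<le>d. coeff f i * hform (D * d) (A ^ i * B ^ (d - i)) u)"
    by (simp add: fsubst_def hform_sum hform_smult)
  also have "\<dots> = (\<Sum>i\<le>d. coeff f i * hform D A u ^ i * hform D B u ^ (d - i))"
  proof (rule sum.cong[OF refl])
    fix i assume i: "i \<in> {..d}"
    hence e: "D * d = D * i + D * (d - i)" by (simp flip: distrib_left)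
    show "coeff f i * hform (D * d) (A ^ i * B ^ (d - i)) u = coeff f i * hform D A u ^ i * hform D B u ^ (d - i)"
      unfolding e using hform_mult[OF hform_power(1)[OF assms(1)] hform_power(1)[OF assms(2)]]
      by (simp add: hform_power(2)[OF assms(1)] hform_power(2)[OF assms(2)])
  qed
  finally show ?thesis by (simp add: hform_def)
qed

lemma pac_fsubst: "pac (fsubst d f A B) x = hform d (map_poly to_ac f) (pac A x, pac B x)"
  by (simp add: fsubst_def hform_def coeff_map_poly mult.assoc)

text \<open>Points of the projective line are nonzero pairs up to scaling: equality of u and w reads wedge u w = 0, and
  infinity is (1, 0).\<close>

definition wedge :: "'b::field \<times> 'b \<Rightarrow> 'b \<times> 'b \<Rightarrow> 'b" where
  "wedge u w = fst u * snd w - snd u * fst w"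

lemma wedge_self [simp]: "wedge u u = 0"
  by (simp add: wedge_def)

lemma wedge_commute: "wedge u w = - wedge w u"
  by (simp add: wedge_def algebra_simps)

lemma wedge_eq_0_sym: "wedge u w = 0 \<longleftrightarrow> wedge w u = 0"
  by (subst wedge_commute) simp

lemma wedge_proportional:
  assumes "u \<noteq> (0, 0)" "w \<noteq> (0, 0)"
  shows "wedge u w = 0 \<longleftrightarrow> (\<exists>c. c \<noteq> 0 \<and> u = (c * fst w, c * snd w))"
proof
  assume z: "wedge u w = 0"
  show "\<exists>c. c \<noteq> 0 \<and> u = (c * fst w, c * snd w)"
  proof (cases "fst w = 0")
    case True
    hence "snd w \<noteq> 0" using assms by (auto simp: prod_eq_iff)
    thus ?thesis using z True assms
      by (intro exI[of _ "snd u / snd w"]) (auto simp: wedge_def prod_eq_iff)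
  next
    case False
    hence "snd u = fst u / fst w * snd w" using z by (simp add: wedge_def field_simps)
    moreover from this have "fst u \<noteq> 0" using assms by (auto simp: prod_eq_iff)
    ultimately show ?thesis using False
      by (intro exI[of _ "fst u / fst w"]) (auto simp: prod_eq_iff)
  qed
next
  assume "\<exists>c. c \<noteq> 0 \<and> u = (c * fst w, c * snd w)"
  then obtain c where "u = (c * fst w, c * snd w)" by blast
  thus "wedge u w = 0" by (simp add: wedge_def mult_ac)
qed

lemma wedge_trans:
  assumes "wedge u t = 0" "wedge t w = 0" "t \<noteq> (0, 0)"
  shows "wedge u w = 0"
proof -
  have "fst t * wedge u w = fst u * wedge t w + fst w * wedge u t"
    "snd t * wedge u w = snd u * wedge t w + snd w * wedge u t"
    by (simp_all add: wedge_def algebra_simps)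
  thus ?thesis using assms by (auto simp: prod_eq_iff)
qed

section \<open>The chordal distance\<close>

context nonarch
begin

definition pnorm :: "'b \<times> 'b \<Rightarrow> real" where
  "pnorm u = max (v (fst u)) (v (snd u))"

lemma pnorm_nonneg [simp]: "pnorm u \<ge> 0"
  by (simp add: pnorm_def le_max_iff_disj)

lemma pnorm_pos: "u \<noteq> (0, 0) \<Longrightarrow> pnorm u > 0"
  by (auto simp: pnorm_def less_max_iff_disj prod_eq_iff)

lemma pnorm_scale: "pnorm (c * x, c * y) = v c * pnorm (x, y)"
  by (simp add: pnorm_def mult max_mult_distrib_left)

lemma wedge_le: "v (wedge u w) \<le> pnorm u * pnorm w"
proof -
  have "v (fst u) * v (snd w) \<le> pnorm u * pnorm w" "v (snd u) * v (fst w) \<le> pnorm u * pnorm w"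
    by (rule mult_mono; simp add: pnorm_def le_max_iff_disj)+
  thus ?thesis using ultra_diff[of "fst u * snd w" "snd u * fst w"] unfolding wedge_def mult by linarith
qed

text \<open>The chordal distance on the projective line. For nonzero pairs, a value below 1 means
  that the two points have the same reduction.\<close>

definition cdist :: "'b \<times> 'b \<Rightarrow> 'b \<times> 'b \<Rightarrow> real" where
  "cdist u w = v (wedge u w) / (pnorm u * pnorm w)"

lemma cdist_nonneg [simp]: "cdist u w \<ge> 0"
  by (simp add: cdist_def)

lemma cdist_le_1: "cdist u w \<le> 1"
proof (cases "pnorm u * pnorm w = 0")
  case True
  thus ?thesis by (auto simp: cdist_def)
next
  case False
  hence "pnorm u * pnorm w > 0" using pnorm_nonneg[of u] pnorm_nonneg[of w] by (metis less_le mult_nonneg_nonneg)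
  thus ?thesis using wedge_le[of u w] unfolding cdist_def by (simp only: divide_le_eq_1_pos)
qed

lemma cdist_commute: "cdist u w = cdist w u"
  unfolding cdist_def by (subst wedge_commute) (simp add: mult.commute)

lemma cdist_eq_0: "u \<noteq> (0, 0) \<Longrightarrow> w \<noteq> (0, 0) \<Longrightarrow> cdist u w = 0 \<longleftrightarrow> wedge u w = 0"
  using pnorm_pos[of u] pnorm_pos[of w] by (simp add: cdist_def)

lemma cdist_scale: "c \<noteq> 0 \<Longrightarrow> cdist (c * x, c * y) w = cdist (x, y) w"
proof -
  assume "c \<noteq> 0"
  have "wedge (c * x, c * y) w = c * wedge (x, y) w" by (simp add: wedge_def algebra_simps)
  thus ?thesis using \<open>c \<noteq> 0\<close> by (simp add: cdist_def pnorm_scale mult mult.assoc)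
qed

text \<open>Multiplied by either coordinate of t, \<open>wedge u w\<close> becomes a combination of
  \<open>wedge t w\<close> and \<open>wedge u t\<close> (a Pluecker relation); the larger coordinate
  of t supplies the norm of t.\<close>

lemma cdist_ultra:
  assumes "t \<noteq> (0, 0)" "u \<noteq> (0, 0)" "w \<noteq> (0, 0)"
  shows "cdist u w \<le> max (cdist u t) (cdist t w)"
proof -
  note pos = pnorm_pos[OF assms(1)] pnorm_pos[OF assms(2)] pnorm_pos[OF assms(3)]
  define M where "M = max (pnorm u * v (wedge t w)) (pnorm w * v (wedge u t))"
  have 1: "v (fst t) * v (wedge u w) \<le> M"
  proof -
    have "fst t * wedge u w = fst u * wedge t w + fst w * wedge u t" by (simp add: wedge_def algebra_simps)
    hence "v (fst t) * v (wedge u w) \<le> max (v (fst u) * v (wedge t w)) (v (fst w) * v (wedge u t))"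
      using ultra[of "fst u * wedge t w" "fst w * wedge u t"] by (simp flip: mult)
    also have "\<dots> \<le> M" unfolding M_def
      by (intro max.mono mult_right_mono) (auto simp: pnorm_def)
    finally show ?thesis .
  qed
  have 2: "v (snd t) * v (wedge u w) \<le> M"
  proof -
    have "snd t * wedge u w = snd u * wedge t w + snd w * wedge u t" by (simp add: wedge_def algebra_simps)
    hence "v (snd t) * v (wedge u w) \<le> max (v (snd u) * v (wedge t w)) (v (snd w) * v (wedge u t))"
      using ultra[of "snd u * wedge t w" "snd w * wedge u t"] by (simp flip: mult)
    also have "\<dots> \<le> M" unfolding M_def
      by (intro max.mono mult_right_mono) (auto simp: pnorm_def)
    finally show ?thesis .
  qed
  have "pnorm t * v (wedge u w) \<le> M" using 1 2 unfolding pnorm_def by (cases "v (fst t) \<le> v (snd t)") (auto simp: max_def)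
  hence "pnorm t * v (wedge u w) / (pnorm t * pnorm u * pnorm w) \<le> M / (pnorm t * pnorm u * pnorm w)"
    using pos by (intro divide_right_mono) auto
  also have "M / (pnorm t * pnorm u * pnorm w) = max (cdist u t) (cdist t w)"
  proof -
    have "pnorm u * v (wedge t w) / (pnorm t * pnorm u * pnorm w) = cdist t w"
      "pnorm w * v (wedge u t) / (pnorm t * pnorm u * pnorm w) = cdist u t"
      using pos by (simp_all add: cdist_def field_simps)
    thus ?thesis using pos unfolding M_def by (subst max_divide_distrib_right) (auto simp: max.commute)
  qed
  finally show ?thesis using pos by (simp add: cdist_def mult.assoc)
qed

lemma normalize_pair:
  assumes "u \<noteq> (0, 0)"
  obtains c u' where "c \<noteq> 0" "u = (c * fst u', c * snd u')" "pnorm u' = 1"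
proof -
  define c where "c = (if v (fst u) \<le> v (snd u) then snd u else fst u)"
  have c: "v c = pnorm u" by (simp add: c_def pnorm_def)
  hence cnz: "c \<noteq> 0" using pnorm_pos[OF assms] by auto
  have "pnorm u = v c * pnorm (fst u / c, snd u / c)"
    using pnorm_scale[of c "fst u / c" "snd u / c"] cnz by simp
  hence "pnorm (fst u / c, snd u / c) = 1" using c pnorm_pos[OF assms] by simp
  thus ?thesis using that[of c "(fst u / c, snd u / c)"] cnz by simp
qed

lemma power_diff_le: "v a \<le> 1 \<Longrightarrow> v b \<le> 1 \<Longrightarrow> v (a ^ n - b ^ n) \<le> v (a - b)"
proof (induction n)
  case (Suc n)
  have "a ^ Suc n - b ^ Suc n = a * (a ^ n - b ^ n) + (a - b) * b ^ n" by (simp add: algebra_simps)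
  moreover have "v (a * (a ^ n - b ^ n)) \<le> 1 * v (a - b)"
    unfolding mult using Suc by (intro mult_mono) auto
  moreover have "v ((a - b) * b ^ n) \<le> v (a - b) * 1"
    unfolding mult power using Suc.prems by (intro mult_left_mono power_le_one) auto
  ultimately show ?case using ultra[of "a * (a ^ n - b ^ n)" "(a - b) * b ^ n"] by simp
qed simp

text \<open>The 2 by 2 minor of two monomials of degree d is an integral monomial factor times a
  difference of e-th powers, hence an integral multiple of \<open>wedge u w\<close>.\<close>

lemma monomial_wedge_le:
  assumes u: "pnorm u \<le> 1" and w: "pnorm w \<le> 1" and ij: "j \<le> i" "i \<le> d"
  shows "v ((fst u ^ i * snd u ^ (d - i)) * (fst w ^ j * snd w ^ (d - j)) -
     (fst w ^ i * snd w ^ (d - i)) * (fst u ^ j * snd u ^ (d - j))) \<le> v (wedge u w)"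
proof -
  have le: "v (fst u) \<le> 1" "v (snd u) \<le> 1" "v (fst w) \<le> 1" "v (snd w) \<le> 1"
    using u w by (auto simp: pnorm_def)
  define e where "e = i - j"
  define r where "r = d - i"
  have i: "i = j + e" "d - i = r" "d - j = r + e" using ij by (auto simp: e_def r_def)
  have "(fst u ^ i * snd u ^ (d - i)) * (fst w ^ j * snd w ^ (d - j)) -
     (fst w ^ i * snd w ^ (d - i)) * (fst u ^ j * snd u ^ (d - j)) =
     (fst u * fst w) ^ j * (snd u * snd w) ^ r * ((fst u * snd w) ^ e - (snd u * fst w) ^ e)"
    unfolding i(2,3) unfolding i(1) by (simp add: power_add power_mult_distrib algebra_simps)
  also have "v \<dots> \<le> 1 * 1 * v (fst u * snd w - snd u * fst w)"
    unfolding mult power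
    by (intro mult_mono power_diff_le power_le_one mult_le_one) (auto simp: mult le intro!: mult_le_one)
  finally show ?thesis by (simp add: wedge_def)
qed

lemma hform_le:
  assumes "\<And>i. v (coeff p i) \<le> C"
  shows "v (hform d p u) \<le> C * pnorm u ^ d"
proof -
  have C: "C \<ge> 0" using assms[of 0] nonneg order_trans by blast
  show ?thesis unfolding hform_def
  proof (rule sum_le)
    fix i assume i: "i \<in> {..d}"
    have "v (coeff p i * fst u ^ i * snd u ^ (d - i)) \<le> C * pnorm u ^ i * pnorm u ^ (d - i)"
      unfolding mult power using assms C by (intro mult_mono power_mono) (auto simp: pnorm_def le_max_iff_disj)
    also have "\<dots> = C * pnorm u ^ d" using i by (simp add: mult.assoc flip: power_add)
    finally show "v (coeff p i * fst u ^ i * snd u ^ (d - i)) \<le> C * pnorm u ^ d" .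
  qed (use C in simp)
qed

text \<open>The wedge of the images is a combination of minors of monomials with integral
  coefficients. This is the source of the nonexpansiveness under good reduction.\<close>

lemma hform_wedge_le:
  assumes "\<And>i. v (coeff f i) \<le> 1" "\<And>i. v (coeff g i) \<le> 1" "pnorm u \<le> 1" "pnorm w \<le> 1"
  shows "v (wedge (hform d f u, hform d g u) (hform d f w, hform d g w)) \<le> v (wedge u w)"
proof -
  define M where "M = (\<lambda>(u::'b\<times>'b) i. fst u ^ i * snd u ^ (d - i))"
  have e: "wedge (hform d f u, hform d g u) (hform d f w, hform d g w) =
     (\<Sum>i\<le>d. \<Sum>j\<le>d. coeff f i * coeff g j * (M u i * M w j - M w i * M u j))"
    unfolding wedge_def hform_def M_def fst_conv snd_conv
    by (simp add: sum_product sum_subtractf[symmetric] algebra_simps)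
  have t: "v (M u i * M w j - M w i * M u j) \<le> v (wedge u w)" if "i \<le> d" "j \<le> d" for i j
  proof (cases "j \<le> i")
    case True
    thus ?thesis unfolding M_def using monomial_wedge_le[OF assms(3,4) True that(1)] by simp
  next
    case False
    have m: "M u i * M w j - M w i * M u j = - (M u j * M w i - M w j * M u i)" by (simp add: algebra_simps)
    have "v (M u j * M w i - M w j * M u i) \<le> v (wedge u w)"
      unfolding M_def using monomial_wedge_le[OF assms(3,4), of i j d] False that by simp
    thus ?thesis unfolding m minus .
  qed
  have "v (coeff f i * coeff g j * (M u i * M w j - M w i * M u j)) \<le> v (wedge u w)" if "i \<le> d" "j \<le> d" for i j
  proof -
    have "v (coeff f i * coeff g j * (M u i * M w j - M w i * M u j)) \<le> 1 * 1 * v (wedge u w)"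
      unfolding mult[of "coeff f i * coeff g j"] mult[of "coeff f i"] using assms t[OF that]
      by (intro mult_mono) auto
    thus ?thesis by simp
  qed
  thus ?thesis unfolding e by (intro sum_le) auto
qed

end

section \<open>Extended places\<close>

text \<open>Among the nonzero combinations of f and g, one of least degree divides both, by division
  with remainder.\<close>

lemma bezout_coprime_poly:
  fixes f g :: "'a::field poly"
  assumes "coprime f g"
  shows "\<exists>a b. a * f + b * g = 1"
proof -
  have fg: "f \<noteq> 0 \<or> g \<noteq> 0" using assms by auto
  define I where "I = (\<lambda>h. h \<noteq> 0 \<and> (\<exists>a b. h = a * f + b * g))"
  have "I f \<or> I g"
  proof (cases "f = 0")
    case True
    hence "I g" using fg unfolding I_def by (intro conjI exI[of _ 0] exI[of _ 1]) auto
    thus ?thesis ..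
  next
    case False
    hence "I f" unfolding I_def by (intro conjI exI[of _ 1] exI[of _ 0]) auto
    thus ?thesis ..
  qed
  then obtain h0 where "I h0" by blast
  from ex_has_least_nat[of I, OF this, of degree]
  obtain h where h: "I h" "\<And>h'. I h' \<Longrightarrow> degree h \<le> degree h'" by blast
  obtain a b where hab: "h = a * f + b * g" and hnz: "h \<noteq> 0" using h(1) unfolding I_def by blast
  have dv: "h dvd q" if "q = a' * f + b' * g" for q a' b'
  proof (rule ccontr)
    assume "\<not> h dvd q"
    hence m: "q mod h \<noteq> 0" by (simp add: dvd_eq_mod_eq_0)
    have "q mod h = q - (q div h) * h" by (simp add: minus_div_mult_eq_mod)
    also have "\<dots> = (a' - (q div h) * a) * f + (b' - (q div h) * b) * g"
      unfolding that hab by (simp add: algebra_simps)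
    finally have "I (q mod h)" unfolding I_def using m by blast
    hence "degree h \<le> degree (q mod h)" by (rule h(2))
    moreover have "degree (q mod h) < degree h"
      using degree_mod_less'[OF hnz m] .
    ultimately show False by simp
  qed
  have "h dvd f" by (rule dv[of _ 1 0]) simp
  moreover have "h dvd g" by (rule dv[of _ 0 1]) simp
  ultimately have "h dvd 1" using assms by (meson coprime_common_divisor)
  then obtain c where c: "h = [:c:]" by (metis is_unit_polyE)
  hence "c \<noteq> 0" using hnz by auto
  hence "smult (inverse c) a * f + smult (inverse c) b * g = 1"
  proof -
    have "smult (inverse c) a * f + smult (inverse c) b * g = smult (inverse c) h"
      by (simp add: hab smult_add_right)
    also have "\<dots> = 1" using \<open>c \<noteq> 0\<close> by (simp add: c)
    finally show ?thesis .
  qed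
  thus ?thesis by blast
qed

text \<open>A common factor of positive degree would have a root in the algebraic closure.\<close>

lemma bezout_field_poly:
  fixes f g :: "'a::field poly"
  assumes "\<And>\<gamma>. pac f \<gamma> = 0 \<Longrightarrow> pac g \<gamma> \<noteq> 0"
  shows "\<exists>a b. a * f + b * g = 1"
proof (rule bezout_coprime_poly, rule coprimeI)
  fix h assume h: "h dvd f" "h dvd g"
  then obtain f' g' where fg': "f = h * f'" "g = h * g'" by (auto simp: dvd_def)
  have "degree h = 0"
  proof (rule ccontr)
    assume "degree h \<noteq> 0"
    then obtain \<gamma> where "pac h \<gamma> = 0" using exists_pac_root[of h] by blast
    hence "pac f \<gamma> = 0" "pac g \<gamma> = 0" by (simp_all add: fg')
    thus False using assms by blast
  qed
  then obtain c where c: "h = [:c:]" by (metis degree_eq_zeroE)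
  hence "c \<noteq> 0" using fg' assms[of 0] by auto
  thus "h dvd 1" by (simp add: c is_unit_triv)
qed

definition emb :: "'a::field \<times> 'a \<Rightarrow> 'a alg_closure \<times> 'a alg_closure" where
  "emb u = (to_ac (fst u), to_ac (snd u))"

lemma emb_eq_0 [simp]: "emb u = (0, 0) \<longleftrightarrow> u = (0, 0)"
  by (auto simp: emb_def prod_eq_iff)

lemma wedge_emb [simp]: "wedge (emb u) (emb w) = to_ac (wedge u w)"
  by (simp add: wedge_def emb_def)

lemma hform_emb: "hform d (map_poly to_ac f) (emb u) = to_ac (hform d f u)"
  by (simp add: hform_def emb_def coeff_map_poly to_ac_sum)

context function_field
begin

text \<open>All extensions of a place are kept together: distances between points of K do not depend
  on the extension, distances to algebraic points may.\<close>

definition ext :: "('a \<Rightarrow> real) set \<Rightarrow> ('a alg_closure \<Rightarrow> real) set" where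
  "ext p = {w. nonarch w \<and> (\<forall>a. w (to_ac a) = rep p a)}"

lemma ext_nonarch: "w \<in> ext p \<Longrightarrow> nonarch w"
  and ext_to_ac: "w \<in> ext p \<Longrightarrow> w (to_ac a) = rep p a"
  by (auto simp: ext_def)

lemma exists_ext: "p \<in> places k \<Longrightarrow> \<exists>w. w \<in> ext p"
proof -
  assume p: "p \<in> places k"
  obtain x where "x \<noteq> 0" "rep p x \<noteq> 1" using place_nontrivial[OF p] by (auto simp: nontrivial_def)
  then obtain w where "nonarch w" "\<And>a. w (to_ac a) = rep p a"
    using exists_extension[OF place_nonarch[OF p]] by blast
  thus ?thesis by (auto simp: ext_def)
qed

lemma cdist_emb:
  assumes "p \<in> places k" "w \<in> ext p"
  shows "nonarch.cdist w (emb u) (emb t) = nonarch.cdist (rep p) u t"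
proof -
  interpret v: nonarch "rep p" by (rule place_nonarch[OF assms(1)])
  interpret w: nonarch w by (rule ext_nonarch[OF assms(2)])
  have n: "w.pnorm (emb u) = v.pnorm u" for u
    by (simp add: w.pnorm_def v.pnorm_def emb_def ext_to_ac[OF assms(2)])
  show ?thesis by (simp add: w.cdist_def v.cdist_def n ext_to_ac[OF assms(2)])
qed

text \<open>Almost all places of K, uniformly in the extension: a single bad extension already makes
  the place exceptional.\<close>

definition ae :: "(('a alg_closure \<Rightarrow> real) \<Rightarrow> bool) \<Rightarrow> bool" where
  "ae Q \<longleftrightarrow> finite {p\<in>places k. \<exists>w\<in>ext p. \<not> Q w}"

lemma ae_mono: "ae Q \<Longrightarrow> (\<And>p w. p \<in> places k \<Longrightarrow> w \<in> ext p \<Longrightarrow> Q w \<Longrightarrow> R w) \<Longrightarrow> ae R"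
  unfolding ae_def by (rule finite_subset[where B = "{p\<in>places k. \<exists>w\<in>ext p. \<not> Q w}"]) blast+

lemma ae_conj: "ae Q \<Longrightarrow> ae R \<Longrightarrow> ae (\<lambda>w. Q w \<and> R w)"
proof -
  assume "ae Q" "ae R"
  hence "finite ({p\<in>places k. \<exists>w\<in>ext p. \<not> Q w} \<union> {p\<in>places k. \<exists>w\<in>ext p. \<not> R w})" by (simp add: ae_def)
  thus ?thesis unfolding ae_def by (rule finite_subset[rotated]) blast
qed

lemma ae_ball:
  assumes "finite A" "\<And>a. a \<in> A \<Longrightarrow> ae (Q a)"
  shows "ae (\<lambda>w. \<forall>a\<in>A. Q a w)"
proof -
  have "finite (\<Union>a\<in>A. {p\<in>places k. \<exists>w\<in>ext p. \<not> Q a w})" using assms by (auto simp: ae_def)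
  thus ?thesis unfolding ae_def by (rule finite_subset[rotated]) blast
qed

text \<open>Where all nonzero coefficients of an equation of \<alpha> are units, a tie between two
  terms says that two different powers of \<alpha> have the same value.\<close>

lemma ae_unit:
  assumes "\<alpha> \<noteq> 0"
  shows "ae (\<lambda>w. w \<alpha> = 1)"
proof -
  \<comment> \<open>Factors X are split off, so that the constant term of the equation is a nonzero
    term to start the tie from.\<close>
  have red: "\<exists>q'. coeff q' 0 \<noteq> 0 \<and> pac q' \<alpha> = 0" if "q \<noteq> 0" "pac q \<alpha> = 0" for q
    using that
  proof (induction q)
    case (pCons a q)
    show ?case
    proof (cases "a = 0")
      case True
      thus ?thesis using pCons assms by auto
    next
      case False
      thus ?thesis using pCons.prems by (intro exI[of _ "pCons a q"]) auto
    qed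
  qed auto
  obtain q0 :: "'a poly" where "q0 \<noteq> 0" "pac q0 \<alpha> = 0"
    using alg_closure_algebraic[of \<alpha>] by (auto simp: pac_def)
  then obtain q where q: "coeff q 0 \<noteq> 0" "pac q \<alpha> = 0" using red by blast
  define B where "B = (\<Union>i\<in>{i. i \<le> degree q \<and> coeff q i \<noteq> 0}. {p\<in>places k. rep p (coeff q i) \<noteq> 1})"
  have "finite B" unfolding B_def using finite_nonunits by auto
  moreover have "w \<alpha> = 1" if p: "p \<in> places k" "p \<notin> B" and w: "w \<in> ext p" for p w
  proof -
    interpret w: nonarch w by (rule ext_nonarch[OF w])
    have c: "w (to_ac (coeff q i)) = 1" if "i \<le> degree q" "coeff q i \<noteq> 0" for i
      using that p unfolding B_def by (auto simp: ext_to_ac[OF w])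
    obtain i j where ij: "i \<le> degree q" "j \<le> degree q" "i \<noteq> j" "to_ac (coeff q i) * \<alpha> ^ i \<noteq> 0"
      "w (to_ac (coeff q i) * \<alpha> ^ i) = w (to_ac (coeff q j) * \<alpha> ^ j)"
      using w.exists_tie[of "{..degree q}" 0 "\<lambda>i. to_ac (coeff q i) * \<alpha> ^ i"] q by (auto simp: pac_altdef)
    have "to_ac (coeff q j) * \<alpha> ^ j \<noteq> 0" using ij(4,5) by (metis w.eq_0_iff)
    hence "coeff q i \<noteq> 0" "coeff q j \<noteq> 0" using ij(4) by auto
    hence e: "w \<alpha> ^ i = w \<alpha> ^ j" using ij(1,2,5) c by (simp add: w.mult w.power)
    have "w \<alpha> > 0" using assms by simp
    thus ?thesis using e ij(3) by (metis power_inject_exp')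
  qed
  hence "{p\<in>places k. \<exists>w\<in>ext p. \<not> w \<alpha> = 1} \<subseteq> B" by blast
  ultimately show ?thesis unfolding ae_def using finite_subset by blast
qed

lemma ae_integral: "ae (\<lambda>w. w \<alpha> \<le> 1)"
proof (cases "\<alpha> = 0")
  case True
  have "ae (\<lambda>w. w 1 = 1)" by (rule ae_unit) simp
  thus ?thesis using True by (elim ae_mono) (auto dest: ext_nonarch simp: nonarch.zero)
next
  case False
  from ae_unit[OF False] show ?thesis by (elim ae_mono) simp
qed

lemma ae_poly_integral: "ae (\<lambda>w. \<forall>i. w (coeff P i) \<le> 1)"
proof -
  have "ae (\<lambda>w. \<forall>a\<in>set (0 # coeffs P). w a \<le> 1)" by (intro ae_ball ae_integral) simp
  thus ?thesis
  proof (rule ae_mono)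
    fix p w assume "\<forall>a\<in>set (0 # coeffs P). w a \<le> 1"
    moreover have "coeff P i \<in> set (0 # coeffs P)" for i
    proof (cases "i \<le> degree P \<and> P \<noteq> 0")
      case True
      hence "coeff P i = coeffs P ! i" "i < length (coeffs P)" by (simp_all add: coeffs_nth length_coeffs_degree)
      thus ?thesis by (metis list.set_intros(2) nth_mem)
    next
      case False
      hence "coeff P i = 0" by (auto simp: coeff_eq_0)
      thus ?thesis by simp
    qed
    ultimately show "\<forall>i. w (coeff P i) \<le> 1" by blast
  qed
qed

end

section \<open>Good reduction\<close>

text \<open>A rational map of degree d as a pair of forms; \<open>nondeg\<close> over the algebraic
  closure says that the forms are coprime, at infinity as well.\<close>

locale dynamics = function_field k for k :: "'a::field set" +
  fixes d :: nat and f g :: "'a poly"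
  assumes d2: "d \<ge> 2" and degf: "degree f \<le> d" and degg: "degree g \<le> d"
    and nondeg: "\<And>u. hform d (map_poly to_ac f) u = 0 \<Longrightarrow> hform d (map_poly to_ac g) u = 0 \<Longrightarrow> u = (0, 0)"
begin

definition Phi :: "'a alg_closure \<times> 'a alg_closure \<Rightarrow> 'a alg_closure \<times> 'a alg_closure" where
  "Phi u = (hform d (map_poly to_ac f) u, hform d (map_poly to_ac g) u)"

definition phi :: "'a \<times> 'a \<Rightarrow> 'a \<times> 'a" where
  "phi u = (hform d f u, hform d g u)"

lemma Phi_emb: "Phi (emb u) = emb (phi u)"
  unfolding Phi_def phi_def hform_emb by (simp add: emb_def)

lemma Phi_pow_emb: "(Phi ^^ n) (emb u) = emb ((phi ^^ n) u)"
  by (induction n) (simp_all add: Phi_emb)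

lemma Phi_nz: "u \<noteq> (0, 0) \<Longrightarrow> Phi u \<noteq> (0, 0)"
  using nondeg[of u] by (auto simp: Phi_def simp del: split_paired_All)

lemma Phi_pow_nz: "u \<noteq> (0, 0) \<Longrightarrow> (Phi ^^ n) u \<noteq> (0, 0)"
  by (induction n) (simp_all add: Phi_nz)

lemma phi_pow_nz: "u \<noteq> (0, 0) \<Longrightarrow> (phi ^^ n) u \<noteq> (0, 0)"
  using Phi_pow_nz[of "emb u" n] by (simp add: Phi_pow_emb)

lemma Phi_scale: "Phi (c * x, c * y) = (c ^ d * fst (Phi (x, y)), c ^ d * snd (Phi (x, y)))"
  by (simp add: Phi_def hform_scale)

lemma Phi_pow_scale: "(Phi ^^ n) (c * x, c * y) =
   (c ^ (d ^ n) * fst ((Phi ^^ n) (x, y)), c ^ (d ^ n) * snd ((Phi ^^ n) (x, y)))"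
proof (induction n)
  case (Suc n)
  obtain a b where ab: "(Phi ^^ n) (x, y) = (a, b)" by (cases "(Phi ^^ n) (x, y)")
  show ?case using Suc by (simp add: ab Phi_scale mult.commute[of d] power_mult)
qed simp

lemma Phi_pow_proportional:
  assumes "wedge u w = 0" "u \<noteq> (0, 0)" "w \<noteq> (0, 0)"
  shows "wedge ((Phi ^^ n) u) ((Phi ^^ n) w) = 0"
proof -
  obtain c where "c \<noteq> 0" "u = (c * fst w, c * snd w)" using wedge_proportional assms by blast
  hence "(Phi ^^ n) u = (c ^ (d ^ n) * fst ((Phi ^^ n) w), c ^ (d ^ n) * snd ((Phi ^^ n) w))"
    using Phi_pow_scale[of n c "fst w" "snd w"] by simp
  thus ?thesis by (simp add: wedge_def)
qed

text \<open>Good reduction: integral coefficients and no cancellation in the norm. The norm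
  condition takes the place of a unit resultant.\<close>

definition good :: "('a alg_closure \<Rightarrow> real) \<Rightarrow> bool" where
  "good w \<longleftrightarrow> (\<forall>i. w (to_ac (coeff f i)) \<le> 1) \<and> (\<forall>i. w (to_ac (coeff g i)) \<le> 1) \<and>
    (\<forall>u. u \<noteq> (0, 0) \<longrightarrow> nonarch.pnorm w (Phi u) = nonarch.pnorm w u ^ d)"

text \<open>On the chart |x| \<le> |y|, the Bezout identity keeps f and g from being small together.
  On the other chart, near infinity, a unit coefficient of degree d dominates.\<close>

lemma good_norm_aux:
  assumes w: "nonarch w" and fi: "\<And>i. w (coeff (map_poly to_ac f) i) \<le> 1" and gi: "\<And>i. w (coeff (map_poly to_ac g) i) \<le> 1"
    and ai: "\<And>i. w (coeff (map_poly to_ac a) i) \<le> 1" and bi: "\<And>i. w (coeff (map_poly to_ac b) i) \<le> 1"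
    and ab: "a * f + b * g = 1"
    and lead: "w (to_ac (coeff f d)) = 1 \<or> w (to_ac (coeff g d)) = 1"
    and u: "u \<noteq> (0, 0)"
  shows "nonarch.pnorm w (Phi u) = nonarch.pnorm w u ^ d"
proof -
  interpret w: nonarch w by (rule w)
  obtain x y where xy: "u = (x, y)" by (cases u)
  have le1: "w.pnorm (Phi t) \<le> 1" if "w.pnorm t = 1" for t
    using w.hform_le[OF fi, of d t] w.hform_le[OF gi, of d t] that by (simp add: w.pnorm_def Phi_def)
  show ?thesis
  proof (cases "w x \<le> w y")
    case True
    have y: "y \<noteq> 0"
    proof
      assume "y = 0"
      hence "w x \<le> 0" using True by simp
      hence "w x = 0" using w.nonneg[of x] by linarith
      thus False using u \<open>y = 0\<close> by (simp add: xy)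
    qed
    define t where "t = x / y"
    have wt: "w t \<le> 1" using True y by (simp add: t_def w.divide)
    have pn: "w.pnorm (t, 1) = 1" using wt by (simp add: w.pnorm_def)
    have Ph: "Phi (t, 1) = (pac f t, pac g t)"
      using degf degg by (simp add: Phi_def hform_affine degree_map_poly pac_def)
    have pi: "w (pac q t) \<le> 1" if "\<And>i. w (coeff (map_poly to_ac q) i) \<le> 1" for q
    proof -
      have "w (hform (degree q) (map_poly to_ac q) (t, 1)) \<le> 1 * w.pnorm (t, 1) ^ degree q" by (rule w.hform_le[OF that])
      thus ?thesis using pn by (simp add: hform_affine degree_map_poly pac_def)
    qed
    have "1 = w (pac a t * pac f t + pac b t * pac g t)"
      using ab by (simp add: pac_add[symmetric] pac_mult[symmetric] del: pac_add pac_mult)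
    also have "\<dots> \<le> max (w (pac a t * pac f t)) (w (pac b t * pac g t))" by (rule w.ultra)
    also have "\<dots> \<le> max (w (pac f t)) (w (pac g t))"
    proof (rule max.mono)
      have "w (pac a t * pac f t) \<le> 1 * w (pac f t)" "w (pac b t * pac g t) \<le> 1 * w (pac g t)"
        unfolding w.mult using pi[of a, OF ai] pi[of b, OF bi] by (intro mult_right_mono; simp)+
      thus "w (pac a t * pac f t) \<le> w (pac f t)" "w (pac b t * pac g t) \<le> w (pac g t)" by simp_all
    qed
    finally have "w.pnorm (Phi (t, 1)) \<ge> 1" by (simp add: w.pnorm_def Ph)
    hence one: "w.pnorm (Phi (t, 1)) = 1" using le1[OF pn] by simp
    have "u = (y * t, y * 1)" using y by (simp add: xy t_def)
    hence "w.pnorm (Phi u) = w (y ^ d) * w.pnorm (Phi (t, 1))" "w.pnorm u = w y * w.pnorm (t, 1)"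
      using Phi_scale[of y t 1] w.pnorm_scale[of "y ^ d" "fst (Phi (t, 1))" "snd (Phi (t, 1))"] w.pnorm_scale[of y t 1] by simp_all
    thus ?thesis using one pn by (simp add: w.power)
  next
    case False
    have x: "x \<noteq> 0" using False by auto
    define t where "t = y / x"
    have wt: "w t < 1" using False x by (simp add: t_def w.divide)
    have pn: "w.pnorm (1, t) = 1" using wt by (simp add: w.pnorm_def)
    have lt: "w (hform d q (1, t) - coeff q d) < 1" if q: "\<And>i. w (coeff q i) \<le> 1" for q
    proof -
      have "hform d q (1, t) - coeff q d = (\<Sum>i<d. coeff q i * t ^ (d - i))"
        unfolding hform_def lessThan_Suc_atMost[symmetric] by simp
      also have "w \<dots> < 1"
      proof (rule w.sum_less)
        fix i assume i: "i \<in> {..<d}"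
        have "w (coeff q i * t ^ (d - i)) \<le> 1 * w t ^ (d - i)"
          unfolding w.mult w.power using q by (intro mult_right_mono) auto
        also have "\<dots> < 1" using i wt by (simp add: power_less_one_iff)
        finally show "w (coeff q i * t ^ (d - i)) < 1" .
      qed simp
      finally show ?thesis .
    qed
    have big: "w (hform d q (1, t)) = 1" if q: "\<And>i. w (coeff q i) \<le> 1" "w (coeff q d) = 1" for q
      using w.add_eq_left[of "hform d q (1, t) - coeff q d" "coeff q d"] lt[OF q(1)] q(2) by simp
    have "w.pnorm (Phi (1, t)) \<ge> 1"
      using lead big[OF fi] big[OF gi] by (auto simp: w.pnorm_def Phi_def coeff_map_poly)
    hence one: "w.pnorm (Phi (1, t)) = 1" using le1[OF pn] by simp
    have "u = (x * 1, x * t)" using x by (simp add: xy t_def)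
    hence "w.pnorm (Phi u) = w (x ^ d) * w.pnorm (Phi (1, t))" "w.pnorm u = w x * w.pnorm (1, t)"
      using Phi_scale[of x 1 t] w.pnorm_scale[of "x ^ d" "fst (Phi (1, t))" "snd (Phi (1, t))"] w.pnorm_scale[of x 1 t] by simp_all
    thus ?thesis using one pn by (simp add: w.power)
  qed
qed

lemma ae_good: "ae good"
proof -
  have "pac g \<gamma> \<noteq> 0" if "pac f \<gamma> = 0" for \<gamma>
    using nondeg[of "(\<gamma>, 1)"] that degf degg by (auto simp: hform_affine degree_map_poly pac_def)
  then obtain a b where ab: "a * f + b * g = 1" using bezout_field_poly by blast
  have "coeff f d \<noteq> 0 \<or> coeff g d \<noteq> 0" using nondeg[of "(1, 0)"] by (auto simp: hform_infty coeff_map_poly)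
  then obtain c where c: "c \<noteq> 0" "c = coeff f d \<or> c = coeff g d" by auto
  have "ae (\<lambda>w. (((\<forall>i. w (coeff (map_poly to_ac f) i) \<le> 1) \<and> (\<forall>i. w (coeff (map_poly to_ac g) i) \<le> 1)) \<and>
     ((\<forall>i. w (coeff (map_poly to_ac a) i) \<le> 1) \<and> (\<forall>i. w (coeff (map_poly to_ac b) i) \<le> 1))) \<and> w (to_ac c) = 1)"
    using c by (intro ae_conj ae_poly_integral ae_unit) simp
  thus ?thesis
  proof (rule ae_mono)
    fix p w assume p: "p \<in> places k" "w \<in> ext p" and h: "(((\<forall>i. w (coeff (map_poly to_ac f) i) \<le> 1) \<and> (\<forall>i. w (coeff (map_poly to_ac g) i) \<le> 1)) \<and>
     ((\<forall>i. w (coeff (map_poly to_ac a) i) \<le> 1) \<and> (\<forall>i. w (coeff (map_poly to_ac b) i) \<le> 1))) \<and> w (to_ac c) = 1"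
    have lead: "w (to_ac (coeff f d)) = 1 \<or> w (to_ac (coeff g d)) = 1" using h c(2) by auto
    show "good w"
      unfolding good_def
    proof (intro conjI allI impI)
      fix i show "w (to_ac (coeff f i)) \<le> 1" "w (to_ac (coeff g i)) \<le> 1" using h by (simp_all add: coeff_map_poly)
    next
      fix u :: "'a alg_closure \<times> 'a alg_closure" assume u: "u \<noteq> (0, 0)"
      show "nonarch.pnorm w (Phi u) = nonarch.pnorm w u ^ d"
        by (rule good_norm_aux[OF ext_nonarch[OF p(2)] _ _ _ _ ab lead u]) (use h in blast)+
    qed
  qed
qed

lemma good_pow_norm:
  assumes "good w" "u \<noteq> (0, 0)"
  shows "nonarch.pnorm w ((Phi ^^ n) u) = nonarch.pnorm w u ^ (d ^ n)"
proof (induction n)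
  case (Suc n)
  have "nonarch.pnorm w (Phi ((Phi ^^ n) u)) = nonarch.pnorm w ((Phi ^^ n) u) ^ d"
    using assms Phi_pow_nz[OF assms(2)] unfolding good_def by blast
  thus ?case using Suc by (simp add: power_mult[symmetric] mult.commute)
qed simp

text \<open>Both points are scaled to norm 1; their images then have norm 1 too, and only the wedges
  remain to be compared.\<close>

lemma good_nonexpansive:
  assumes w: "nonarch w" and good: "good w" and u: "u \<noteq> (0, 0)" and t: "t \<noteq> (0, 0)"
  shows "nonarch.cdist w (Phi u) (Phi t) \<le> nonarch.cdist w u t"
proof -
  interpret w: nonarch w by (rule w)
  obtain c u' where c: "c \<noteq> 0" "u = (c * fst u', c * snd u')" "w.pnorm u' = 1" using w.normalize_pair[OF u] by blast
  obtain e t' where e: "e \<noteq> 0" "t = (e * fst t', e * snd t')" "w.pnorm t' = 1" using w.normalize_pair[OF t] by blast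
  have u': "u' \<noteq> (0, 0)" and t': "t' \<noteq> (0, 0)" using u t c(2) e(2) by auto
  have "w.cdist (Phi u) (Phi t) = w.cdist (Phi u') (Phi t')"
  proof -
    have "Phi u = (c ^ d * fst (Phi u'), c ^ d * snd (Phi u'))" "Phi t = (e ^ d * fst (Phi t'), e ^ d * snd (Phi t'))"
      using Phi_scale[of c "fst u'" "snd u'"] Phi_scale[of e "fst t'" "snd t'"] c(2) e(2) by simp_all
    thus ?thesis using c(1) e(1) w.cdist_scale[of "c ^ d"] w.cdist_scale[of "e ^ d"]
      by (metis power_not_zero prod.collapse w.cdist_commute)
  qed
  also have "\<dots> \<le> w.cdist u' t'"
  proof -
    have "w.pnorm (Phi u') = 1" "w.pnorm (Phi t') = 1" using good u' t' c(3) e(3) unfolding good_def by (metis power_one)+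
    moreover have "w (wedge (Phi u') (Phi t')) \<le> w (wedge u' t')"
      unfolding Phi_def using good c(3) e(3) by (intro w.hform_wedge_le) (simp_all add: good_def coeff_map_poly)
    ultimately show ?thesis using c(3) e(3) by (simp add: w.cdist_def)
  qed
  also have "\<dots> = w.cdist u t"
    using c e w.cdist_scale[of c "fst u'" "snd u'"] w.cdist_scale[of e "fst t'" "snd t'"]
    by (metis prod.collapse w.cdist_commute)
  finally show ?thesis .
qed

lemma good_pow_nonexpansive:
  assumes w: "nonarch w" and good: "good w" and u: "u \<noteq> (0, 0)" and t: "t \<noteq> (0, 0)"
  shows "nonarch.cdist w ((Phi ^^ n) u) ((Phi ^^ n) t) \<le> nonarch.cdist w u t"
proof (induction n)
  case (Suc n)
  have "nonarch.cdist w (Phi ((Phi ^^ n) u)) (Phi ((Phi ^^ n) t)) \<le> nonarch.cdist w ((Phi ^^ n) u) ((Phi ^^ n) t)"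
    by (intro good_nonexpansive w good Phi_pow_nz u t)
  thus ?case using Suc by simp
qed simp

section \<open>Iterates in affine coordinates\<close>

fun FG :: "nat \<Rightarrow> 'a poly \<times> 'a poly" where
  "FG 0 = ([:0, 1:], 1)"
| "FG (Suc n) = (fsubst d f (fst (FG n)) (snd (FG n)), fsubst d g (fst (FG n)) (snd (FG n)))"

text \<open>Dehomogenised, the n-th iterate of the map is F n / G n, with both polynomials of degree at most d ^ n.\<close>

definition "F n = fst (FG n)"
definition "G n = snd (FG n)"

lemma FG_degree: "degree (F n) \<le> d ^ n \<and> degree (G n) \<le> d ^ n"
proof (induction n)
  case (Suc n)
  thus ?case using fsubst_degree[of "F n" "d ^ n" "G n" d f] fsubst_degree[of "F n" "d ^ n" "G n" d g]
    by (simp add: F_def G_def mult.commute)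
qed (simp add: F_def G_def)

lemma F_degree: "degree (F n) \<le> d ^ n" and G_degree: "degree (G n) \<le> d ^ n"
  using FG_degree by blast+

lemma phi_pow: "(phi ^^ n) u = (hform (d ^ n) (F n) u, hform (d ^ n) (G n) u)"
proof (induction n)
  case 0
  show ?case by (cases u) (simp add: F_def G_def hform_def lessThan_Suc_atMost[symmetric] coeff_1)
next
  case (Suc n)
  have "hform (d ^ Suc n) (fsubst d q (F n) (G n)) u = hform d q (hform (d ^ n) (F n) u, hform (d ^ n) (G n) u)" for q
    using hform_fsubst[OF F_degree[of n] G_degree[of n], of d q u] by (simp add: mult.commute)
  thus ?case using Suc by (simp add: phi_def F_def G_def)
qed

lemma Phi_pow_affine: "(Phi ^^ n) (x, 1) = (pac (F n) x, pac (G n) x)"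
proof (induction n)
  case 0
  show ?case by (simp add: F_def G_def)
next
  case (Suc n)
  thus ?case by (simp add: Phi_def F_def G_def pac_fsubst)
qed

end

section \<open>Wandering orbits that accumulate everywhere\<close>

lemma pderiv_map_poly_to_ac: "map_poly to_ac (pderiv p) = pderiv (map_poly to_ac p)"
  by (rule poly_eqI) (simp add: coeff_map_poly coeff_pderiv)

lemma (in nonarch) cdist_cong:
  assumes "wedge a b = 0" "a \<noteq> (0, 0)" "b \<noteq> (0, 0)"
  shows "cdist a t = cdist b t"
proof -
  obtain c where "c \<noteq> 0" "a = (c * fst b, c * snd b)" using wedge_proportional assms by blast
  thus ?thesis using cdist_scale[of c "fst b" "snd b" t] by simp
qed

lemma (in nonarch) cdist_less_trans:
  assumes "cdist u t < e" "cdist t w < e" "t \<noteq> (0, 0)" "u \<noteq> (0, 0)" "w \<noteq> (0, 0)"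
  shows "cdist u w < e"
  using cdist_ultra[OF assms(3-5)] assms(1,2) by linarith

lemma (in nonarch) poly_diff_le:
  assumes "\<And>i. v (coeff q i) \<le> 1" "v x \<le> 1" "v y \<le> 1"
  shows "v (poly q x - poly q y) \<le> v (x - y)"
proof -
  have "poly q x - poly q y = (\<Sum>i\<le>degree q. coeff q i * (x ^ i - y ^ i))"
    by (simp add: poly_altdef sum_subtractf[symmetric] algebra_simps)
  also have "v \<dots> \<le> v (x - y)"
  proof (rule sum_le)
    fix i
    have "v (coeff q i * (x ^ i - y ^ i)) \<le> 1 * v (x - y)"
      unfolding mult using assms by (intro mult_mono power_diff_le) auto
    thus "v (coeff q i * (x ^ i - y ^ i)) \<le> v (x - y)" by simp
  qed simp
  finally show ?thesis .
qed

text \<open>Gauss's lemma for a linear factor.\<close>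

lemma (in nonarch) coeff_linear_quotient_le:
  assumes p: "p = [:- r, 1:] * q" and C: "\<And>i. v (coeff p i) \<le> C"
  shows "v (coeff q i) \<le> C / max 1 (v r)"
proof -
  have c0: "coeff p 0 = - r * coeff q 0" and cS: "coeff p (Suc i) = coeff q i - r * coeff q (Suc i)" for i
    by (simp_all add: p)
  have C0: "C \<ge> 0" using C[of 0] nonneg[of "coeff p 0"] by linarith
  show ?thesis
  proof (cases "v r \<le> 1")
    case True
    have "v (coeff q i) \<le> C"
    proof (cases "i \<le> degree q")
      case True
      thus ?thesis
      proof (induction rule: inc_induct)
        case base
        have "coeff q (degree q) = coeff p (Suc (degree q))" using cS[of "degree q"] by (simp add: coeff_eq_0)
        thus ?case using C by simp
      next
        case (step i)
        have "coeff q i = coeff p (Suc i) + r * coeff q (Suc i)" using cS[of i] by simp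
        moreover have "v (r * coeff q (Suc i)) \<le> 1 * C"
          unfolding mult using step.IH \<open>v r \<le> 1\<close> by (intro mult_mono) auto
        ultimately show ?case using ultra[of "coeff p (Suc i)" "r * coeff q (Suc i)"] C[of "Suc i"] by simp
      qed
    next
      case False
      thus ?thesis using C0 by (simp add: coeff_eq_0)
    qed
    thus ?thesis using True by (simp add: max_absorb1)
  next
    case False
    hence r: "v r > 1" "r \<noteq> 0" by auto
    have "v (coeff q i) \<le> C / v r"
    proof (induction i)
      case 0
      have "v (coeff p 0) = v r * v (coeff q 0)" unfolding c0 by (simp add: mult)
      thus ?case using C[of 0] r by (simp add: field_simps)
    next
      case (Suc i)
      have "C / v r \<le> C" using r C0 by (simp add: divide_le_eq mult_le_cancel_left1)
      hence "v (coeff q i - coeff p (Suc i)) \<le> C"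
        using ultra_diff[of "coeff q i" "coeff p (Suc i)"] Suc C[of "Suc i"] by linarith
      moreover have "coeff q i - coeff p (Suc i) = r * coeff q (Suc i)" using cS[of i] by simp
      ultimately have "v r * v (coeff q (Suc i)) \<le> C" by (simp add: mult)
      thus ?case using r by (simp add: field_simps)
    qed
    thus ?thesis using r by (simp add: max_absorb2)
  qed
qed

text \<open>The value of the quotient at r is the derivative, so it decides whether the root is
  simple.\<close>

lemma synthetic_root:
  fixes P :: "'b::field poly"
  assumes "poly P r = 0"
  obtains q where "P = [:- r, 1:] * q" "poly q r = poly (pderiv P) r"
proof -
  obtain q where q: "P = [:- r, 1:] * q" using assms poly_eq_0_iff_dvd by (auto simp: dvd_def)
  have "poly (pderiv P) r = poly q r" unfolding q pderiv_mult by (simp add: pderiv_pCons)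
  thus ?thesis using q that by metis
qed

context dynamics
begin

text \<open>The roots of A N are the affine points fixed by the N-th iterate; W N is the Wronskian, which vanishes
  at such a root exactly if the multiplier is 0.\<close>

definition A :: "nat \<Rightarrow> 'a poly" where "A N = F N - [:0, 1:] * G N"
definition W :: "nat \<Rightarrow> 'a poly" where "W N = pderiv (F N) * G N - F N * pderiv (G N)"

text \<open>Its roots are the affine points that the N-th iterate maps to r.\<close>

definition fibre :: "nat \<Rightarrow> 'a alg_closure \<Rightarrow> 'a alg_closure poly" where
  "fibre N r = map_poly to_ac (F N) - smult r (map_poly to_ac (G N))"

lemma poly_fibre: "poly (fibre N r) x = wedge ((Phi ^^ N) (x, 1)) (r, 1)"
  by (simp add: fibre_def wedge_def Phi_pow_affine pac_def)

lemma pac_A: "pac (A N) x = wedge ((Phi ^^ N) (x, 1)) (x, 1)"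
  by (simp add: A_def wedge_def Phi_pow_affine)

text \<open>At a fixed point F = r G, so the Wronskian is G times the derivative of the fibre: a
  nonzero multiplier means that r is a simple root of its own fibre.\<close>

lemma pac_W:
  assumes "pac (A N) r = 0"
  shows "pac (W N) r = pac (G N) r * poly (pderiv (fibre N r)) r" "pac (G N) r \<noteq> 0"
proof -
  have Fr: "pac (F N) r = r * pac (G N) r" using assms by (simp add: A_def)
  have pd: "poly (pderiv (fibre N r)) r = pac (pderiv (F N)) r - r * pac (pderiv (G N)) r"
    by (simp add: fibre_def pderiv_diff pderiv_smult pac_def pderiv_map_poly_to_ac)
  thus "pac (W N) r = pac (G N) r * poly (pderiv (fibre N r)) r"
    unfolding pd by (simp add: W_def Fr algebra_simps)
  show "pac (G N) r \<noteq> 0"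
  proof
    assume "pac (G N) r = 0"
    hence "(Phi ^^ N) (r, 1) = (0, 0)" using Fr by (simp add: Phi_pow_affine)
    thus False using Phi_pow_nz[of "(r, 1)" N] by simp
  qed
qed

lemma fibre_degree_le: "degree (fibre N r) \<le> d ^ N"
  unfolding fibre_def using F_degree[of N] G_degree[of N]
  by (intro degree_diff_le) (auto simp: degree_map_poly intro: order_trans[OF degree_smult_le])

lemma periodic_pow:
  assumes "wedge ((Phi ^^ N) t) t = 0" "t \<noteq> (0, 0)"
  shows "wedge ((Phi ^^ (j * N)) t) t = 0"
proof (induction j)
  case (Suc j)
  have "wedge ((Phi ^^ N) ((Phi ^^ (j * N)) t)) ((Phi ^^ N) t) = 0"
    by (rule Phi_pow_proportional[OF Suc Phi_pow_nz[OF assms(2)] assms(2)])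
  from wedge_trans[OF this assms(1) Phi_pow_nz[OF assms(2)]]
  show ?case by (simp add: funpow_add)
qed simp

lemma periodic_mod:
  assumes "wedge ((Phi ^^ N) t) t = 0" "t \<noteq> (0, 0)"
  shows "wedge ((Phi ^^ m) t) ((Phi ^^ (m mod N)) t) = 0"
proof -
  have "(Phi ^^ m) t = (Phi ^^ (m mod N)) ((Phi ^^ (m div N * N)) t)"
    by (metis (no_types, lifting) comp_apply div_mult_mod_eq add.commute funpow_add)
  thus ?thesis using Phi_pow_proportional[OF periodic_pow[OF assms, of "m div N"] Phi_pow_nz[OF assms(2)] assms(2)]
    by simp
qed

text \<open>Outside finitely many places the nonzero coordinates and the wedge are units, so
  distinct points keep distinct reductions.\<close>

lemma ae_cdist:
  assumes "a \<noteq> (0, 0)" "b \<noteq> (0, 0)" "wedge a b \<noteq> 0"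
  shows "ae (\<lambda>w. \<not> nonarch.cdist w a b < 1)"
proof -
  define U where "U = {fst a, snd a, fst b, snd b, wedge a b} - {0}"
  have "ae (\<lambda>w. \<forall>x\<in>U. w x = 1)" by (intro ae_ball ae_unit) (auto simp: U_def)
  thus ?thesis
  proof (rule ae_mono)
    fix p w assume p: "w \<in> ext p" and U: "\<forall>x\<in>U. w x = 1"
    interpret w: nonarch w by (rule ext_nonarch[OF p])
    have one: "w x = (if x = 0 then 0 else 1)" if "x \<in> {fst a, snd a, fst b, snd b, wedge a b}" for x
      using U that by (auto simp: U_def)
    have "w.pnorm a = 1" "w.pnorm b = 1"
      using assms one[of "fst a"] one[of "snd a"] one[of "fst b"] one[of "snd b"]
      by (auto simp: w.pnorm_def prod_eq_iff)
    thus "\<not> w.cdist a b < 1" using one[of "wedge a b"] assms(3) by (simp add: w.cdist_def)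
  qed
qed

text \<open>Conjugacy over K is expressed as satisfying the same polynomial equations over K, which
  covers inseparable points as well.\<close>

definition conj_closed :: "'a alg_closure set \<Rightarrow> bool" where
  "conj_closed R \<longleftrightarrow> (\<forall>x\<in>R. \<forall>y. (\<forall>q. pac q x = 0 \<longleftrightarrow> pac q y = 0) \<longrightarrow> y \<in> R)"

end

text \<open>The hypothetical counterexample, with the starting point moved to infinity. The limit
  point in Z may depend on the place.\<close>

locale accumulating = dynamics k d f g for k :: "'a::field set" and d f g +
  fixes S :: "('a \<Rightarrow> real) set set" and Z :: "('a \<times> 'a) set"
  assumes finS: "finite S" and finZ: "finite Z" and Znz: "\<And>z. z \<in> Z \<Longrightarrow> z \<noteq> (0, 0)"
    and wandering: "\<And>m n. m \<noteq> n \<Longrightarrow> wedge ((phi ^^ m) (1, 0)) ((phi ^^ n) (1, 0)) \<noteq> 0"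
    and acc: "\<And>p. p \<in> places k - S \<Longrightarrow>
      \<exists>z\<in>Z. \<forall>e>0. \<forall>n0. \<exists>n\<ge>n0. nonarch.cdist (rep p) ((phi ^^ n) (1, 0)) z < e"
begin

definition U :: "nat \<Rightarrow> 'a alg_closure \<times> 'a alg_closure" where
  "U n = (Phi ^^ n) (1, 0)"

lemma U_emb: "U n = emb ((phi ^^ n) (1, 0))"
  using Phi_pow_emb[of n "(1, 0)"] by (simp add: U_def emb_def)

lemma U_nz: "U n \<noteq> (0, 0)"
  unfolding U_def by (rule Phi_pow_nz) simp

lemma U_add: "U (n + m) = (Phi ^^ m) (U n)"
  by (simp add: U_def add.commute funpow_add)

lemma U_wandering: "m \<noteq> n \<Longrightarrow> wedge (U m) (U n) \<noteq> 0"
  using wandering[of m n] by (simp add: U_emb)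

lemma U_coeffs: "U n = (to_ac (coeff (F n) (d ^ n)), to_ac (coeff (G n) (d ^ n)))"
  by (simp add: U_emb phi_pow hform_infty emb_def)

lemma U_affine: "n \<ge> 1 \<Longrightarrow> snd (U n) \<noteq> 0"
  using U_wandering[of n 0] by (auto simp: U_def wedge_def)

lemma G_lead: "n \<ge> 1 \<Longrightarrow> coeff (G n) (d ^ n) \<noteq> 0"
  using U_affine[of n] by (simp add: U_coeffs)

lemma A_lead: "coeff (A n) (Suc (d ^ n)) = - coeff (G n) (d ^ n)"
  using F_degree[of n] by (simp add: A_def coeff_eq_0)

text \<open>Infinity wanders and so is not fixed by the n-th iterate; hence all d^n + 1 fixed points
  are affine and the degree is the full one.\<close>

lemma A_degree: "n \<ge> 1 \<Longrightarrow> degree (A n) = Suc (d ^ n)"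
proof (rule antisym)
  assume "n \<ge> 1"
  have "degree ([:0, 1:] * G n) \<le> Suc (d ^ n)" using G_degree[of n] degree_mult_le[of "[:0, 1:]" "G n"] by simp
  thus "degree (A n) \<le> Suc (d ^ n)" unfolding A_def using F_degree[of n] by (intro degree_diff_le) auto
  show "Suc (d ^ n) \<le> degree (A n)" using G_lead[OF \<open>n \<ge> 1\<close>] A_lead[of n] by (intro le_degree) simp
qed

lemma A_nz: "n \<ge> 1 \<Longrightarrow> A n \<noteq> 0"
proof
  assume "n \<ge> 1" "A n = 0"
  with A_degree[of n] show False by simp
qed

text \<open>A meeting with a preperiodic point would make two later members of the orbit
  equal.\<close>

lemma U_not_preperiodic:
  assumes "wedge ((Phi ^^ M) t) r = 0" "wedge ((Phi ^^ N) r) r = 0" "N \<ge> 1" "t \<noteq> (0, 0)" "r \<noteq> (0, 0)"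
  shows "wedge (U n) t \<noteq> 0"
proof
  assume "wedge (U n) t = 0"
  hence "wedge (U (n + M)) ((Phi ^^ M) t) = 0" unfolding U_add using assms(4) by (intro Phi_pow_proportional U_nz)
  hence 1: "wedge (U (n + M)) r = 0" using assms(1) by (rule wedge_trans) (rule Phi_pow_nz[OF assms(4)])
  hence "wedge (U (n + M + N)) ((Phi ^^ N) r) = 0"
    unfolding U_add[of "n + M" N] using assms(5) by (intro Phi_pow_proportional U_nz)
  hence "wedge (U (n + M + N)) r = 0" using assms(2) by (rule wedge_trans) (rule Phi_pow_nz[OF assms(5)])
  moreover have "wedge r (U (n + M)) = 0" using 1 wedge_eq_0_sym by blast
  ultimately have "wedge (U (n + M + N)) (U (n + M)) = 0" using assms(5) by (rule wedge_trans)
  thus False using U_wandering[of "n + M + N" "n + M"] assms(3) by simp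
qed

text \<open>The coefficient at \<open>d ^ N\<close> is the wedge of \<open>U N\<close> and
  \<open>(\<beta>, 1)\<close>, nonzero because the wandering orbit never meets a preperiodic
  point.\<close>

lemma fibre_degree:
  assumes "wedge ((Phi ^^ M) (\<beta>, 1)) r = 0" "wedge ((Phi ^^ K) r) r = 0" "K \<ge> 1" "r \<noteq> (0, 0)"
  shows "degree (fibre N \<beta>) = d ^ N"
proof (rule antisym[OF fibre_degree_le])
  have "wedge (U N) (\<beta>, 1) \<noteq> 0" by (rule U_not_preperiodic[OF assms(1-3) _ assms(4)]) simp
  hence "coeff (fibre N \<beta>) (d ^ N) \<noteq> 0"
    by (simp add: fibre_def coeff_map_poly U_coeffs wedge_def mult.commute)
  thus "d ^ N \<le> degree (fibre N \<beta>)" by (rule le_degree)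
qed

text \<open>One z serves all extensions of p at once, as the orbit and z are defined over K.\<close>

lemma acc_ext:
  assumes "p \<in> places k - S"
  shows "\<exists>z. z \<in> Z \<and> (\<forall>w e n0. w \<in> ext p \<longrightarrow> e > 0 \<longrightarrow> (\<exists>n\<ge>n0. nonarch.cdist w (U n) (emb z) < e))"
proof -
  obtain z where z: "z \<in> Z" "\<And>e n0. e > 0 \<Longrightarrow> \<exists>n\<ge>n0. nonarch.cdist (rep p) ((phi ^^ n) (1, 0)) z < e"
    using acc[OF assms] by blast
  show ?thesis
  proof (intro exI[of _ z] conjI allI impI z(1))
    fix w e n0 assume "w \<in> ext p" "e > (0::real)"
    thus "\<exists>n\<ge>n0. nonarch.cdist w (U n) (emb z) < e"
      using z(2)[of e n0] cdist_emb[of p w] assms unfolding U_emb by simp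
  qed
qed

text \<open>Two members of the orbit close to the same z are congruent, and good reduction
  transports the congruence forward. The numbers m and e depend on the place only, not on the
  extension.\<close>

lemma eventually_periodic:
  assumes "p \<in> places k - S"
  shows "\<exists>m e. e > 0 \<and> (\<forall>n w l. n \<ge> m \<longrightarrow> w \<in> ext p \<longrightarrow> good w \<longrightarrow>
    nonarch.cdist w (U n) (U (n + l * e)) < 1)"
proof -
  obtain w0 where w0: "w0 \<in> ext p" using exists_ext assms by blast
  interpret w0: nonarch w0 by (rule ext_nonarch[OF w0])
  obtain z where z1: "z \<in> Z" and z2: "\<forall>w e n0. w \<in> ext p \<longrightarrow> e > 0 \<longrightarrow> (\<exists>n\<ge>n0. nonarch.cdist w (U n) (emb z) < e)"
    using acc_ext[OF assms] by (elim exE conjE)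
  note z = z1 z2[rule_format]
  have znz: "emb z \<noteq> (0, 0)" using Znz[OF z(1)] by simp
  obtain n1 where n1: "w0.cdist (U n1) (emb z) < 1" using z(2)[OF w0, of 1 0] by auto
  obtain n2 where n2: "n2 \<ge> Suc n1" "w0.cdist (U n2) (emb z) < 1" using z(2)[OF w0, of 1 "Suc n1"] by auto
  have base0: "w0.cdist (U n1) (U n2) < 1"
    by (rule w0.cdist_less_trans[OF n1 _ znz U_nz U_nz]) (use n2(2) w0.cdist_commute[of "emb z" "U n2"] in simp)
  define e where "e = n2 - n1"
  have e: "e > 0" "n2 = n1 + e" using n2 by (auto simp: e_def)
  show ?thesis
  proof (rule exI[of _ n1], rule exI[of _ e], intro conjI allI impI e(1))
    fix n w l assume n: "n \<ge> n1" and w: "w \<in> ext p" "good w"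
    interpret w: nonarch w by (rule ext_nonarch[OF w(1)])
    have base: "w.cdist (U n1) (U (n1 + e)) < 1"
      using base0 cdist_emb[OF _ w(1)] cdist_emb[OF _ w0] assms unfolding U_emb e(2) by simp
    have one: "w.cdist (U m) (U (m + e)) < 1" if "m \<ge> n1" for m
    proof -
      have "U m = (Phi ^^ (m - n1)) (U n1)" "U (m + e) = (Phi ^^ (m - n1)) (U (n1 + e))"
        using that U_add[of n1 "m - n1"] U_add[of "n1 + e" "m - n1"] by (simp_all add: add_ac)
      thus ?thesis using good_pow_nonexpansive[OF w.nonarch_axioms w(2) U_nz U_nz, of "m - n1" n1 "n1 + e"] base by simp
    qed
    show "w.cdist (U n) (U (n + l * e)) < 1"
    proof (induction l)
      case 0
      show ?case using U_nz[of n] by (simp add: w.cdist_def)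
    next
      case (Suc l)
      have "w.cdist (U (n + l * e)) (U (n + l * e + e)) < 1" using n by (intro one) simp
      with Suc have "w.cdist (U n) (U (n + l * e + e)) < 1" by (rule w.cdist_less_trans) (rule U_nz)+
      thus ?case by (simp add: add_ac)
    qed
  qed
qed

subsection \<open>A periodic point that is not superattracting\<close>

context
  fixes N :: nat
  assumes N: "N \<ge> 1"
begin

text \<open>All fixed points of the N-th iterate with nonzero multiplier, rather than a single one,
  so that the set is described by polynomial conditions over K.\<close>

definition Rep :: "'a alg_closure set" where
  "Rep = {r. pac (A N) r = 0 \<and> pac (W N) r \<noteq> 0}"

text \<open>Of an isometry of the residue disc of r, only the preservation of distances to the
  centre is recorded.\<close>

definition isom :: "('a alg_closure \<Rightarrow> real) \<Rightarrow> 'a alg_closure \<Rightarrow> bool" where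
  "isom w r \<longleftrightarrow> (\<forall>t. t \<noteq> (0, 0) \<longrightarrow> nonarch.cdist w t (r, 1) < 1 \<longrightarrow>
     nonarch.cdist w ((Phi ^^ N) t) (r, 1) = nonarch.cdist w t (r, 1))"

lemma finite_Rep: "finite Rep"
  unfolding Rep_def using finite_pac_roots[OF A_nz[OF N]] by (rule rev_finite_subset) blast

lemma Rep_periodic: "r \<in> Rep \<Longrightarrow> wedge ((Phi ^^ N) (r, 1)) (r, 1) = 0"
  by (simp add: Rep_def pac_A)

text \<open>The fibre over r is (X - r) q with q(r) nonzero. At almost all places q is integral and
  q(r) a unit, so q has value 1 on the whole residue disc and the distance to r is carried by the
  factor X - r alone.\<close>

lemma ae_isom:
  assumes r: "r \<in> Rep"
  shows "ae (\<lambda>w. isom w r)"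
proof -
  have "poly (fibre N r) r = 0" using Rep_periodic[OF r] by (simp add: poly_fibre)
  then obtain q where q: "fibre N r = [:- r, 1:] * q" "poly q r = poly (pderiv (fibre N r)) r" by (rule synthetic_root)
  have qr: "poly q r \<noteq> 0" using r pac_W[of N r] q(2) by (auto simp: Rep_def)
  have "ae (\<lambda>w. (good w \<and> w r \<le> 1) \<and> (\<forall>i. w (coeff q i) \<le> 1) \<and> w (poly q r) = 1)"
    by (intro ae_conj ae_good ae_integral ae_poly_integral ae_unit[OF qr])
  thus ?thesis
  proof (rule ae_mono)
    fix p w assume p: "w \<in> ext p" and h: "(good w \<and> w r \<le> 1) \<and> (\<forall>i. w (coeff q i) \<le> 1) \<and> w (poly q r) = 1"
    interpret w: nonarch w by (rule ext_nonarch[OF p])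
    have pr: "w.pnorm (r, 1) = 1" using h by (simp add: w.pnorm_def)
    show "isom w r"
      unfolding isom_def
    proof (intro allI impI)
      fix t assume t: "t \<noteq> (0, 0)" "w.cdist t (r, 1) < 1"
      obtain t1 t2 where t12: "t = (t1, t2)" by (cases t)
      \<comment> \<open>A point whose first coordinate dominates has distance 1 from the integral
        point r; so t is affine with integral coordinate.\<close>
      have le: "w t1 \<le> w t2"
      proof (rule ccontr)
        assume "\<not> w t1 \<le> w t2"
        hence gt: "w t2 < w t1" by simp
        have "w (- (t2 * r)) \<le> w t2 * 1" unfolding w.minus w.mult using h by (intro mult_left_mono) auto
        hence "w (t1 + - (t2 * r)) = w t1" using gt by (intro w.add_eq_left) simp
        moreover have "w.pnorm t = w t1" "w t1 > 0" using gt w.nonneg[of t2] by (auto simp: w.pnorm_def t12 simp del: w.nonneg)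
        ultimately have "w.cdist t (r, 1) = 1" using pr by (simp add: w.cdist_def wedge_def t12)
        thus False using t(2) by simp
      qed
      have t2: "t2 \<noteq> 0"
      proof
        assume "t2 = 0"
        hence "w t1 = 0" using le w.nonneg[of t1] by (simp del: w.nonneg w.eq_0_iff)
        thus False using t(1) \<open>t2 = 0\<close> by (simp add: t12)
      qed
      define y where "y = t1 / t2"
      have wy: "w y \<le> 1" using le t2 by (simp add: y_def w.divide)
      have ty: "t = (t2 * y, t2 * 1)" using t2 by (simp add: t12 y_def)
      have py: "w.pnorm (y, 1) = 1" using wy by (simp add: w.pnorm_def)
      have c1: "w.cdist t (r, 1) = w (y - r)"
        unfolding ty w.cdist_scale[OF t2] using pr py by (simp add: w.cdist_def wedge_def)
      have "w (poly q y - poly q r) \<le> w (y - r)" using h wy by (intro w.poly_diff_le) auto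
      hence "w (poly q y - poly q r) < w (poly q r)" using t(2) c1 h by simp
      hence "w (poly q y - poly q r + poly q r) = w (poly q r)" by (rule w.add_eq_right)
      hence wq: "w (poly q y) = 1" using h by simp
      have "w.cdist ((Phi ^^ N) t) (r, 1) = w.cdist ((Phi ^^ N) (y, 1)) (r, 1)"
        unfolding ty Phi_pow_scale using w.cdist_scale[of "t2 ^ d ^ N"] t2 by simp
      also have "\<dots> = w (wedge ((Phi ^^ N) (y, 1)) (r, 1))"
        using good_pow_norm[of w "(y, 1)" N] h py pr by (simp add: w.cdist_def)
      also have "\<dots> = w ((y - r) * poly q y)"
        unfolding poly_fibre[symmetric] q(1) by (simp add: algebra_simps)
      also have "\<dots> = w (y - r)" using wq by (simp add: w.mult)
      finally show "w.cdist ((Phi ^^ N) t) (r, 1) = w.cdist t (r, 1)" using c1 by simp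
    qed
  qed
qed

lemma isom_pow:
  assumes "isom w r" "t \<noteq> (0, 0)" "nonarch.cdist w t (r, 1) < 1"
  shows "nonarch.cdist w ((Phi ^^ (j * N)) t) (r, 1) = nonarch.cdist w t (r, 1)"
proof (induction j)
  case (Suc j)
  have "nonarch.cdist w ((Phi ^^ N) ((Phi ^^ (j * N)) t)) (r, 1) = nonarch.cdist w ((Phi ^^ (j * N)) t) (r, 1)"
    using assms(1)[unfolded isom_def, rule_format, OF Phi_pow_nz[OF assms(2), of "j * N"]] Suc assms(3) by simp
  thus ?case using Suc by (simp add: funpow_add)
qed simp

definition BI :: "('a \<Rightarrow> real) set set" where
  "BI = S \<union> {p\<in>places k. \<exists>w\<in>ext p. \<not> (good w \<and> (\<forall>r\<in>Rep. isom w r))}"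

lemma finite_BI: "finite BI"
proof -
  have "ae (\<lambda>w. good w \<and> (\<forall>r\<in>Rep. isom w r))"
    by (intro ae_conj ae_good ae_ball finite_Rep ae_isom)
  thus ?thesis using finS by (simp add: BI_def ae_def)
qed

lemma BI_good: "p \<in> places k - BI \<Longrightarrow> w \<in> ext p \<Longrightarrow> good w \<and> (\<forall>r\<in>Rep. isom w r)"
  and BI_S: "p \<in> places k - BI \<Longrightarrow> p \<in> places k - S"
  by (auto simp: BI_def)

lemma U_ne_Rep: "r \<in> Rep \<Longrightarrow> wedge (U n) (r, 1) \<noteq> 0"
  using U_not_preperiodic[of 0 "(r, 1)" "(r, 1)" N n] Rep_periodic N by simp

text \<open>From some index on, the distance to r is constant along each class modulo N: inside the
  disc by the isometry, outside because a later entry would, by eventual periodicity, put the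
  earlier point inside already. It thus takes at most N values from there on, all positive.\<close>

lemma Rep_no_accumulation:
  assumes p: "p \<in> places k - BI" and w: "w \<in> ext p" and r: "r \<in> Rep"
  shows "\<exists>e>0. \<exists>n0. \<forall>n\<ge>n0. nonarch.cdist w (U n) (r, 1) \<ge> e"
proof -
  interpret w: nonarch w by (rule ext_nonarch[OF w])
  have good: "good w" and iso: "isom w r" using BI_good[OF p w] r by auto
  obtain m e where e: "e > 0" and per0: "\<forall>n w l. n \<ge> m \<longrightarrow> w \<in> ext p \<longrightarrow> good w \<longrightarrow> nonarch.cdist w (U n) (U (n + l * e)) < 1"
    using eventually_periodic[OF BI_S[OF p]] by (elim exE conjE)
  note per = per0[rule_format]
  define c where "c = (\<lambda>n. w.cdist (U n) (r, 1))"
  have isoc: "c (n + j * N) = c n" if "c n < 1" for n j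
    unfolding c_def U_add using isom_pow[OF iso U_nz] that by (simp add: c_def)
  have step: "c (n + N) = c n" if "n \<ge> m" for n
  proof (cases "c n < 1")
    case True
    thus ?thesis using isoc[of n 1] by simp
  next
    case False
    have "\<not> c (n + N) < 1"
    proof
      assume lt: "c (n + N) < 1"
      \<comment> \<open>The time \<open>N * e\<close> is a multiple of the period e as well as of N,
        and N of these steps are already spent on entering the disc.\<close>
      have ne: "n + N + (e - 1) * N = n + N * e" using e by (cases e) (simp_all add: algebra_simps)
      have "c (n + N * e) < 1" using isoc[OF lt, of "e - 1"] lt unfolding ne by simp
      moreover have "w.cdist (U n) (U (n + N * e)) < 1" by (rule per[OF that w good])
      ultimately have "c n < 1" unfolding c_def by - (rule w.cdist_less_trans[of "U n" "U (n + N * e)"]; simp add: U_nz)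
      thus False using False by simp
    qed
    thus ?thesis using False w.cdist_le_1[of "U n" "(r, 1)"] w.cdist_le_1[of "U (n + N)" "(r, 1)"] by (simp add: c_def)
  qed
  have steps: "c (m + s + l * N) = c (m + s)" for s l
  proof (induction l)
    case (Suc l)
    have "c (m + s + l * N + N) = c (m + s + l * N)" by (rule step) simp
    thus ?case using Suc by (simp add: add_ac)
  qed simp
  define \<eta> where "\<eta> = Min ((\<lambda>s. c (m + s)) ` {..<N})"
  have ne: "(\<lambda>s. c (m + s)) ` {..<N} \<noteq> {}" using N by (auto simp: lessThan_empty_iff)
  have "\<eta> \<in> (\<lambda>s. c (m + s)) ` {..<N}" unfolding \<eta>_def using ne by (intro Min_in) auto
  then obtain s0 where "\<eta> = c (m + s0)" by blast
  moreover have "c n > 0" for n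
    using w.cdist_eq_0[OF U_nz, of "(r, 1)" n] U_ne_Rep[OF r, of n] w.cdist_nonneg[of "U n" "(r, 1)"]
    unfolding c_def by (simp add: less_le del: w.cdist_nonneg)
  ultimately have "\<eta> > 0" by simp
  moreover have "c n \<ge> \<eta>" if "n \<ge> m" for n
  proof -
    have "n = m + (n - m) mod N + (n - m) div N * N" using that by simp
    hence "c n = c (m + (n - m) mod N)" using steps by metis
    moreover have "(n - m) mod N \<in> {..<N}" using N by simp
    ultimately show ?thesis unfolding \<eta>_def by (intro Min_le) auto
  qed
  ultimately show ?thesis unfolding c_def by blast
qed

text \<open>As r is one of its own preimages, the condition \<open>\<gamma> \<noteq> r\<close> is
  what makes the preimage strict.\<close>

definition RI :: "'a alg_closure set" where
  "RI = {\<gamma>. \<exists>j. \<exists>r\<in>Rep. wedge ((Phi ^^ (j * N)) (\<gamma>, 1)) (r, 1) = 0 \<and> \<gamma> \<noteq> r}"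

text \<open>A congruence would keep the distance to r constant along the iteration, whereas it drops
  to 0.\<close>

lemma RI_not_cong:
  assumes "p \<in> places k - BI" "w \<in> ext p" "r \<in> Rep" "wedge ((Phi ^^ (j * N)) (\<gamma>, 1)) (r, 1) = 0" "\<gamma> \<noteq> r"
  shows "\<not> nonarch.cdist w (\<gamma>, 1) (r, 1) < 1"
proof
  interpret w: nonarch w by (rule ext_nonarch[OF assms(2)])
  assume lt: "w.cdist (\<gamma>, 1) (r, 1) < 1"
  have "isom w r" using BI_good[OF assms(1,2)] assms(3) by blast
  from isom_pow[OF this _ lt, of j] have "w.cdist ((Phi ^^ (j * N)) (\<gamma>, 1)) (r, 1) = w.cdist (\<gamma>, 1) (r, 1)" by simp
  moreover have "w.cdist ((Phi ^^ (j * N)) (\<gamma>, 1)) (r, 1) = 0" using assms(4) by (simp add: w.cdist_def)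
  ultimately have "wedge (\<gamma>, 1) (r, 1) = 0" using w.cdist_eq_0[of "(\<gamma>, 1)" "(r, 1)"] by simp
  thus False using assms(5) by (simp add: wedge_def)
qed

text \<open>Suppose U n is congruent to \<gamma>. In \<open>M = (j * N) * e\<close> steps, a
  multiple of the period e, U n returns to its residue class while \<gamma> lands on r. So U n is
  congruent to r, and therefore \<gamma> is as well.\<close>

lemma RI_eventually:
  assumes p: "p \<in> places k - BI" and \<gamma>: "\<gamma> \<in> RI"
  shows "\<exists>n0. \<forall>n\<ge>n0. \<forall>w\<in>ext p. \<not> nonarch.cdist w (U n) (\<gamma>, 1) < 1"
proof -
  obtain j r where r: "r \<in> Rep" "wedge ((Phi ^^ (j * N)) (\<gamma>, 1)) (r, 1) = 0" "\<gamma> \<noteq> r" using \<gamma> by (auto simp: RI_def)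
  obtain m e where e: "e > 0" and per0: "\<forall>n w l. n \<ge> m \<longrightarrow> w \<in> ext p \<longrightarrow> good w \<longrightarrow> nonarch.cdist w (U n) (U (n + l * e)) < 1"
    using eventually_periodic[OF BI_S[OF p]] by (elim exE conjE)
  note per = per0[rule_format]
  show ?thesis
  proof (intro exI[of _ m] allI impI ballI)
    fix n w assume n: "n \<ge> m" and w: "w \<in> ext p"
    interpret w: nonarch w by (rule ext_nonarch[OF w])
    have good: "good w" using BI_good[OF p w] by blast
    show "\<not> w.cdist (U n) (\<gamma>, 1) < 1"
    proof
      assume c: "w.cdist (U n) (\<gamma>, 1) < 1"
      define M where "M = (j * N) * e"
      have U1: "w.cdist (U n) (U (n + M)) < 1" unfolding M_def by (rule per[OF n w good])
      have "(Phi ^^ M) (\<gamma>, 1) = (Phi ^^ (j * (e - 1) * N)) ((Phi ^^ (j * N)) (\<gamma>, 1))"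
      proof -
        have "M = j * (e - 1) * N + j * N" unfolding M_def using e by (cases e) (simp_all add: algebra_simps)
        thus ?thesis by (simp add: funpow_add)
      qed
      moreover have "wedge ((Phi ^^ (j * (e - 1) * N)) ((Phi ^^ (j * N)) (\<gamma>, 1))) ((Phi ^^ (j * (e - 1) * N)) (r, 1)) = 0"
        using r(2) by (intro Phi_pow_proportional Phi_pow_nz) auto
      ultimately have z: "wedge ((Phi ^^ M) (\<gamma>, 1)) (r, 1) = 0"
        using wedge_trans[OF _ periodic_pow[OF Rep_periodic[OF r(1)], of "j * (e - 1)"] Phi_pow_nz] by simp
      have "w.cdist (U (n + M)) ((Phi ^^ M) (\<gamma>, 1)) < 1"
        unfolding U_add using good_pow_nonexpansive[OF w.nonarch_axioms good U_nz, of "(\<gamma>, 1)" M n] c by simp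
      hence "w.cdist (U (n + M)) (r, 1) < 1"
        using w.cdist_cong[OF z Phi_pow_nz] w.cdist_commute by simp
      with U1 have "w.cdist (U n) (r, 1) < 1" by (rule w.cdist_less_trans) (simp_all add: U_nz)
      moreover have "w.cdist (\<gamma>, 1) (U n) < 1" using c w.cdist_commute by simp
      ultimately have "w.cdist (\<gamma>, 1) (r, 1) < 1"
        using w.cdist_less_trans[of "(\<gamma>, 1)" "U n" 1 "(r, 1)"] U_nz by simp
      thus False using RI_not_cong[OF p w r] by simp
    qed
  qed
qed

text \<open>A congruence with \<gamma> drives the orbit along the reduced cycle of r. The limit
  point z is then congruent to a point of the cycle, hence equal to it at almost all places, and
  accumulation at the cycle is carried on to accumulation at r.\<close>

lemma RI_almost_all:
  assumes \<gamma>: "\<gamma> \<in> RI"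
  shows "\<exists>B. finite B \<and> (\<forall>n p w. p \<in> places k - BI - B \<longrightarrow> w \<in> ext p \<longrightarrow>
    \<not> nonarch.cdist w (U n) (\<gamma>, 1) < 1)"
proof -
  obtain j r where r: "r \<in> Rep" "wedge ((Phi ^^ (j * N)) (\<gamma>, 1)) (r, 1) = 0" "\<gamma> \<noteq> r" using \<gamma> by (auto simp: RI_def)
  \<comment> \<open>The finitely many pairs of a point of Z and a different point of the cycle of r;
    where none of them becomes congruent, congruence means equality.\<close>
  define T where "T = {(z, s). z \<in> Z \<and> s < N \<and> wedge (emb z) ((Phi ^^ s) (r, 1)) \<noteq> 0}"
  have finT: "finite T"
  proof -
    have "T \<subseteq> Z \<times> {..<N}" by (auto simp: T_def)
    thus ?thesis using finZ finite_subset by blast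
  qed
  define Q where "Q = (\<lambda>w. \<forall>x\<in>T. \<not> nonarch.cdist w (emb (fst x)) ((Phi ^^ snd x) (r, 1)) < 1)"
  have "ae Q" unfolding Q_def
  proof (rule ae_ball[OF finT])
    fix x assume x: "x \<in> T"
    hence "fst x \<noteq> (0, 0)" using Znz[of "fst x"] by (simp add: T_def case_prod_beta)
    thus "ae (\<lambda>w. \<not> nonarch.cdist w (emb (fst x)) ((Phi ^^ snd x) (r, 1)) < 1)"
      using x by (intro ae_cdist Phi_pow_nz) (simp_all add: T_def case_prod_beta)
  qed
  hence fin: "finite {p\<in>places k. \<exists>w\<in>ext p. \<not> Q w}" by (simp add: ae_def)
  show ?thesis
  proof (intro exI[of _ "{p\<in>places k. \<exists>w\<in>ext p. \<not> Q w}"] conjI allI impI fin)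
    fix n p w assume p: "p \<in> places k - BI - {p\<in>places k. \<exists>w\<in>ext p. \<not> Q w}" and w: "w \<in> ext p"
    have pB: "p \<in> places k - BI" and Qw: "Q w" using p w by auto
    interpret w: nonarch w by (rule ext_nonarch[OF w])
    have good: "good w" using BI_good[OF pB w] by blast
    show "\<not> w.cdist (U n) (\<gamma>, 1) < 1"
    proof
      assume c: "w.cdist (U n) (\<gamma>, 1) < 1"
      obtain z where z1: "z \<in> Z" and z2: "\<forall>w e n0. w \<in> ext p \<longrightarrow> e > 0 \<longrightarrow> (\<exists>n\<ge>n0. nonarch.cdist w (U n) (emb z) < e)"
        using acc_ext[OF BI_S[OF pB]] by (elim exE conjE)
      note z = z1 z2[rule_format]
      have znz: "emb z \<noteq> (0, 0)" using Znz[OF z(1)] by simp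
      obtain n' where n': "n' \<ge> n + j * N" "w.cdist (U n') (emb z) < 1" using z(2)[OF w, of 1 "n + j * N"] by auto
      define i where "i = n' - n - j * N"
      define s where "s = i mod N"
      have s: "s < N" using N by (simp add: s_def)
      have ni: "n' = n + (i + j * N)" using n' by (simp add: i_def)
      have "wedge ((Phi ^^ (i + j * N)) (\<gamma>, 1)) ((Phi ^^ i) (r, 1)) = 0"
        unfolding funpow_add comp_apply using r(2) by (intro Phi_pow_proportional Phi_pow_nz) auto
      hence ws: "wedge ((Phi ^^ (i + j * N)) (\<gamma>, 1)) ((Phi ^^ s) (r, 1)) = 0"
        unfolding s_def using periodic_mod[OF Rep_periodic[OF r(1)], of i] Phi_pow_nz[of "(r, 1)"]
        by - (rule wedge_trans[of _ "(Phi ^^ i) (r, 1)"]; simp)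
      have "w.cdist (U n') ((Phi ^^ (i + j * N)) (\<gamma>, 1)) < 1"
        unfolding ni U_add[of n "i + j * N"]
        using good_pow_nonexpansive[OF w.nonarch_axioms good U_nz, of "(\<gamma>, 1)" "i + j * N" n] c by simp
      hence "w.cdist (U n') ((Phi ^^ s) (r, 1)) < 1"
        using w.cdist_cong[OF ws Phi_pow_nz Phi_pow_nz] w.cdist_commute by simp
      hence cz: "w.cdist (emb z) ((Phi ^^ s) (r, 1)) < 1"
        using n'(2) w.cdist_commute znz U_nz Phi_pow_nz[of "(r, 1)" s]
        by - (rule w.cdist_less_trans[of "emb z" "U n'"]; simp)
      have wz: "wedge (emb z) ((Phi ^^ s) (r, 1)) = 0"
      proof (rule ccontr)
        assume "wedge (emb z) ((Phi ^^ s) (r, 1)) \<noteq> 0"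
        hence "(z, s) \<in> T" using z(1) s by (simp add: T_def)
        thus False using Qw cz unfolding Q_def by fastforce
      qed
      obtain e n0 where e: "e > 0" "\<And>n. n \<ge> n0 \<Longrightarrow> w.cdist (U n) (r, 1) \<ge> e"
        using Rep_no_accumulation[OF pB w r(1)] by blast
      obtain n1 where n1: "n1 \<ge> n0" "w.cdist (U n1) (emb z) < e" using z(2)[OF w e(1)] by blast
      have "w.cdist (U n1) ((Phi ^^ s) (r, 1)) < e"
        using n1(2) w.cdist_cong[OF wz znz Phi_pow_nz] w.cdist_commute by simp
      \<comment> \<open>The remaining N - s steps complete the period and lead from the cycle point
        back to r.\<close>
      hence "w.cdist ((Phi ^^ (N - s)) (U n1)) ((Phi ^^ (N - s)) ((Phi ^^ s) (r, 1))) < e"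
        using good_pow_nonexpansive[OF w.nonarch_axioms good U_nz Phi_pow_nz, of "(r, 1)" "N - s" n1 s] by simp
      moreover have "(Phi ^^ (N - s)) ((Phi ^^ s) (r, 1)) = (Phi ^^ N) (r, 1)"
        using s by (simp flip: comp_apply[of "Phi ^^ (N - s)"] funpow_add)
      ultimately have "w.cdist (U (n1 + (N - s))) ((Phi ^^ N) (r, 1)) < e" by (simp add: U_add)
      hence "w.cdist (U (n1 + (N - s))) (r, 1) < e"
        using w.cdist_cong[OF Rep_periodic[OF r(1)] Phi_pow_nz] w.cdist_commute by simp
      thus False using e(2)[of "n1 + (N - s)"] n1(1) by simp
    qed
  qed
qed

text \<open>The index n0 can be uniform in p because only the finitely many places of B ask for an
  index of their own.\<close>

lemma RI_avoided:
  assumes \<gamma>: "\<gamma> \<in> RI"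
  shows "\<exists>n0. \<forall>n\<ge>n0. \<forall>p\<in>places k - BI. \<forall>w\<in>ext p. \<not> nonarch.cdist w (U n) (\<gamma>, 1) < 1"
proof -
  obtain B where B1: "finite B" and B2: "\<forall>n p w. p \<in> places k - BI - B \<longrightarrow> w \<in> ext p \<longrightarrow>
      \<not> nonarch.cdist w (U n) (\<gamma>, 1) < 1"
    using RI_almost_all[OF \<gamma>] by (elim exE conjE)
  note B = B1 B2[rule_format]
  have "\<exists>n0. \<forall>n\<ge>n0. \<forall>w\<in>ext p. \<not> nonarch.cdist w (U n) (\<gamma>, 1) < 1" if "p \<in> places k - BI" for p
    by (rule RI_eventually[OF that \<gamma>])
  then obtain m where m: "\<And>p n w. p \<in> places k - BI \<Longrightarrow> n \<ge> m p \<Longrightarrow> w \<in> ext p \<Longrightarrow> \<not> nonarch.cdist w (U n) (\<gamma>, 1) < 1"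
    by metis
  define n0 where "n0 = Max (insert 0 (m ` B))"
  have n0: "m p \<le> n0" if "p \<in> B" for p unfolding n0_def using B(1) that by (intro Max_ge) auto
  show ?thesis
  proof (intro exI[of _ n0] allI impI ballI)
    fix n p w assume h: "n \<ge> n0" "p \<in> places k - BI" "w \<in> ext p"
    show "\<not> nonarch.cdist w (U n) (\<gamma>, 1) < 1"
    proof (cases "p \<in> B")
      case True
      show ?thesis using m[OF h(2) _ h(3)] n0[OF True] h(1) by simp
    next
      case False
      show ?thesis using B(2)[OF _ h(3)] h(2) False by blast
    qed
  qed
qed

text \<open>The fibre over r has degree at least 2 and r as a simple root, so it contains another
  point \<beta>. Points \<open>b n\<close> that reach \<beta> after n returns always exist; they are
  distinct, for once \<beta> has moved on to the fixed point r it is never met again.\<close>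

lemma infinite_RI:
  assumes r: "r \<in> Rep"
  shows "infinite RI"
proof -
  have rr: "wedge ((Phi ^^ N) (r, 1)) (r, 1) = 0" by (rule Rep_periodic[OF r])
  have dN: "d ^ N \<ge> 2" using d2 N self_le_power[of d N] by linarith
  have "poly (fibre N r) r = 0" using rr by (simp add: poly_fibre)
  then obtain q where q: "fibre N r = [:- r, 1:] * q" "poly q r = poly (pderiv (fibre N r)) r" by (rule synthetic_root)
  have qr: "poly q r \<noteq> 0" using r pac_W[of N r] q(2) by (auto simp: Rep_def)
  have "degree (fibre N r) = d ^ N" by (rule fibre_degree[of 0 _ "(r, 1)" N]) (use rr N in auto)
  moreover have "q \<noteq> 0" using qr by auto
  ultimately have "degree q = d ^ N - 1" unfolding q(1) by (subst (asm) degree_mult_eq) auto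
  hence "degree q > 0" using dN by simp
  then obtain \<beta> where \<beta>: "poly q \<beta> = 0" using alg_closed_imp_poly_has_root by blast
  have \<beta>r: "\<beta> \<noteq> r" using \<beta> qr by auto
  have "poly (fibre N r) \<beta> = 0" unfolding q(1) using \<beta> by simp
  hence \<beta>1: "wedge ((Phi ^^ N) (\<beta>, 1)) (r, 1) = 0" by (simp add: poly_fibre)
  have toR: "wedge ((Phi ^^ (Suc l * N)) (\<beta>, 1)) (r, 1) = 0" for l
  proof -
    have "wedge ((Phi ^^ (l * N)) ((Phi ^^ N) (\<beta>, 1))) ((Phi ^^ (l * N)) (r, 1)) = 0"
      using \<beta>1 by (intro Phi_pow_proportional Phi_pow_nz) auto
    hence "wedge ((Phi ^^ (l * N)) ((Phi ^^ N) (\<beta>, 1))) (r, 1) = 0"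
      using periodic_pow[OF rr, of l] Phi_pow_nz[of "(r, 1)"] by - (rule wedge_trans[of _ "(Phi ^^ (l * N)) (r, 1)"]; simp)
    moreover have "(Phi ^^ (Suc l * N)) (\<beta>, 1) = (Phi ^^ (l * N)) ((Phi ^^ N) (\<beta>, 1))"
      by (simp add: add.commute[of N] funpow_add)
    ultimately show ?thesis by simp
  qed
  have toR': "wedge ((Phi ^^ (l * N + n * N)) (x, 1)) (r, 1) = 0"
    if "wedge ((Phi ^^ (n * N)) (x, 1)) (\<beta>, 1) = 0" "l \<ge> 1" for x n l
  proof -
    have "wedge ((Phi ^^ (l * N)) ((Phi ^^ (n * N)) (x, 1))) ((Phi ^^ (l * N)) (\<beta>, 1)) = 0"
      using that by (intro Phi_pow_proportional Phi_pow_nz) auto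
    moreover have "wedge ((Phi ^^ (l * N)) (\<beta>, 1)) (r, 1) = 0" using toR[of "l - 1"] that(2) by simp
    ultimately have "wedge ((Phi ^^ (l * N)) ((Phi ^^ (n * N)) (x, 1))) (r, 1) = 0"
      by (rule wedge_trans) (simp add: Phi_pow_nz)
    thus ?thesis by (simp add: funpow_add)
  qed
  have "\<exists>x. wedge ((Phi ^^ (n * N)) (x, 1)) (\<beta>, 1) = 0" for n
  proof (induction n)
    case 0
    show ?case by (intro exI[of _ \<beta>]) simp
  next
    case (Suc n)
    then obtain x where x: "wedge ((Phi ^^ (n * N)) (x, 1)) (\<beta>, 1) = 0" by blast
    have "degree (fibre N x) = d ^ N"
      by (rule fibre_degree[OF toR'[OF x order_refl] rr N]) simp
    hence "degree (fibre N x) > 0" using dN by linarith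
    then obtain y where "poly (fibre N x) y = 0" using alg_closed_imp_poly_has_root by blast
    hence "wedge ((Phi ^^ N) (y, 1)) (x, 1) = 0" by (simp add: poly_fibre)
    hence "wedge ((Phi ^^ (n * N)) ((Phi ^^ N) (y, 1))) ((Phi ^^ (n * N)) (x, 1)) = 0"
      by (intro Phi_pow_proportional Phi_pow_nz) auto
    hence "wedge ((Phi ^^ (n * N)) ((Phi ^^ N) (y, 1))) (\<beta>, 1) = 0"
      using x by (rule wedge_trans) (simp add: Phi_pow_nz)
    moreover have "(Phi ^^ (Suc n * N)) (y, 1) = (Phi ^^ (n * N)) ((Phi ^^ N) (y, 1))"
      by (simp add: add.commute[of N] funpow_add)
    ultimately have "wedge ((Phi ^^ (Suc n * N)) (y, 1)) (\<beta>, 1) = 0" by (simp only:)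
    thus ?case by blast
  qed
  then obtain b where b: "\<And>n. wedge ((Phi ^^ (n * N)) (b n, 1)) (\<beta>, 1) = 0" by metis
  have absurd: False if "wedge t (r, 1) = 0" "wedge t (\<beta>, 1) = 0" "t \<noteq> (0, 0)" for t
  proof -
    have "wedge (r, 1) t = 0" using that(1) wedge_eq_0_sym by blast
    hence "wedge (r, 1) (\<beta>, 1) = 0" using that(2,3) by (rule wedge_trans)
    thus False using \<beta>r by (simp add: wedge_def)
  qed
  have "b n \<in> RI" for n
    unfolding RI_def
  proof (intro CollectI exI[of _ "Suc n"] bexI[OF _ r] conjI)
    show "wedge ((Phi ^^ (Suc n * N)) (b n, 1)) (r, 1) = 0" using toR'[OF b[of n], of 1] by simp
    show "b n \<noteq> r"
    proof
      assume "b n = r"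
      hence "wedge ((Phi ^^ (n * N)) (r, 1)) (\<beta>, 1) = 0" using b[of n] by simp
      thus False using absurd[OF periodic_pow[OF rr, of n]] Phi_pow_nz[of "(r, 1)"] by simp
    qed
  qed
  moreover have "inj b"
  proof (rule linorder_injI)
    fix i j :: nat assume ij: "i < j"
    show "b i \<noteq> b j"
    proof
      assume "b i = b j"
      hence e: "wedge ((Phi ^^ (j * N)) (b i, 1)) (\<beta>, 1) = 0" using b[of j] by simp
      have "wedge ((Phi ^^ ((j - i) * N + i * N)) (b i, 1)) (r, 1) = 0" using ij by (intro toR' b) simp
      moreover have "(j - i) * N + i * N = j * N" using ij by (simp flip: distrib_right)
      ultimately have "wedge ((Phi ^^ (j * N)) (b i, 1)) (r, 1) = 0" by simp
      thus False using absurd[OF _ e Phi_pow_nz] by simp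
    qed
  qed
  ultimately have "infinite (range b)" "range b \<subseteq> RI" using finite_imageD[of b UNIV] infinite_UNIV_nat by auto
  thus ?thesis using infinite_super by blast
qed

text \<open>Membership of \<gamma> amounts to polynomial equations and inequations over K, obtained
  by substituting an iterate of \<gamma> into \<open>A N\<close> and \<open>W N\<close>.\<close>

lemma RI_conj_closed: "conj_closed RI"
proof -
  \<comment> \<open>The formal degree \<open>Suc (d ^ N)\<close> is the exact degree of
    \<open>A N\<close>, so the form does not vanish at infinity and a root forces an affine
    image.\<close>
  define q1 where "q1 = (\<lambda>j. fsubst (Suc (d ^ N)) (A N) (F (j * N)) (G (j * N)))"
  define q2 where "q2 = (\<lambda>j. fsubst (degree (W N)) (W N) (F (j * N)) (G (j * N)))"
  have iff: "\<gamma> \<in> RI \<longleftrightarrow> (\<exists>j. pac (q1 j) \<gamma> = 0 \<and> pac (q2 j) \<gamma> \<noteq> 0 \<and> pac (A (j * N)) \<gamma> \<noteq> 0)" for \<gamma>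
  proof -
    have "(\<exists>r\<in>Rep. wedge ((Phi ^^ (j * N)) (\<gamma>, 1)) (r, 1) = 0 \<and> \<gamma> \<noteq> r) \<longleftrightarrow>
        (pac (q1 j) \<gamma> = 0 \<and> pac (q2 j) \<gamma> \<noteq> 0 \<and> pac (A (j * N)) \<gamma> \<noteq> 0)" for j
    proof -
      define a where "a = pac (F (j * N)) \<gamma>"
      define b where "b = pac (G (j * N)) \<gamma>"
      have P: "(Phi ^^ (j * N)) (\<gamma>, 1) = (a, b)" by (simp add: Phi_pow_affine a_def b_def)
      have ab: "(a, b) \<noteq> (0, 0)" using Phi_pow_nz[of "(\<gamma>, 1)" "j * N"] by (simp add: P)
      have e1: "pac (q1 j) \<gamma> = hform (Suc (d ^ N)) (map_poly to_ac (A N)) (a, b)"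
        by (simp add: q1_def pac_fsubst a_def b_def)
      have e2: "pac (q2 j) \<gamma> = hform (degree (W N)) (map_poly to_ac (W N)) (a, b)"
        by (simp add: q2_def pac_fsubst a_def b_def)
      have e3: "pac (A (j * N)) \<gamma> = a - \<gamma> * b" by (simp add: A_def a_def b_def)
      have r: "wedge (a, b) (r, 1) = 0 \<longleftrightarrow> b \<noteq> 0 \<and> r = a / b" for r
        using ab by (auto simp: wedge_def field_simps)
      have b0: "b \<noteq> 0" if "pac (q1 j) \<gamma> = 0"
      proof
        assume "b = 0"
        hence "to_ac (coeff (A N) (Suc (d ^ N))) * a ^ Suc (d ^ N) = 0"
          using that e1 by (simp only: hform_infty coeff_map_poly to_ac_0)
        moreover have "to_ac (coeff (A N) (Suc (d ^ N))) \<noteq> 0" using A_lead[of N] G_lead[OF N] by simp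
        ultimately have "a ^ Suc (d ^ N) = 0" by (simp only: mult_eq_0_iff simp_thms)
        hence "a = 0" by (simp only: power_eq_0_iff)
        thus False using ab \<open>b = 0\<close> by simp
      qed
      have h1: "pac (q1 j) \<gamma> = 0 \<longleftrightarrow> pac (A N) (a / b) = 0" if "b \<noteq> 0"
        unfolding e1 using that A_degree[OF N] by (subst hform_eq_poly) (auto simp: degree_map_poly pac_def)
      have h2: "pac (q2 j) \<gamma> = 0 \<longleftrightarrow> pac (W N) (a / b) = 0" if "b \<noteq> 0"
        unfolding e2 using that by (subst hform_eq_poly) (auto simp: degree_map_poly pac_def)
      have h3: "pac (A (j * N)) \<gamma> \<noteq> 0 \<longleftrightarrow> \<gamma> \<noteq> a / b" if "b \<noteq> 0"
        unfolding e3 using that by (auto simp: field_simps)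
      show ?thesis unfolding P r using b0 h1 h2 h3 by (auto simp: Rep_def)
    qed
    thus ?thesis by (simp add: RI_def)
  qed
  show ?thesis unfolding conj_closed_def
  proof (intro ballI allI impI)
    fix x y assume "x \<in> RI" "\<forall>q. pac q x = 0 \<longleftrightarrow> pac q y = 0"
    thus "y \<in> RI" unfolding iff by simp
  qed
qed

end

end

subsection \<open>All periodic points superattracting\<close>

lemma card_roots_separable:
  fixes p :: "'b::alg_closed_field poly"
  assumes "p \<noteq> 0" "\<And>x. poly p x = 0 \<Longrightarrow> poly (pderiv p) x \<noteq> 0"
  shows "card {x. poly p x = 0} = degree p"
  using assms
proof (induction "degree p" arbitrary: p)
  case 0
  then obtain a where a: "p = [:a:]" "a \<noteq> 0" by (metis degree_eq_zeroE pCons_0_0)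
  thus ?case by simp
next
  case (Suc n)
  then obtain r where r: "poly p r = 0" using alg_closed_imp_poly_has_root[of p] by auto
  then obtain q where q: "p = [:- r, 1:] * q" "poly q r = poly (pderiv p) r" by (rule synthetic_root)
  have qnz: "q \<noteq> 0" using q(1) Suc.prems(1) by auto
  have dq: "degree q = n" using Suc.hyps(2) qnz unfolding q(1) by (subst (asm) degree_mult_eq) auto
  have qr: "poly q r \<noteq> 0" using q(2) Suc.prems(2)[OF r] by simp
  have "poly (pderiv q) x \<noteq> 0" if x: "poly q x = 0" for x
  proof -
    have "poly p x = 0" using x by (simp add: q(1))
    hence "poly (pderiv p) x \<noteq> 0" by (rule Suc.prems(2))
    moreover have "poly (pderiv p) x = (x - r) * poly (pderiv q) x"
      unfolding q(1) pderiv_mult using x by (simp add: pderiv_pCons algebra_simps)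
    ultimately show ?thesis by auto
  qed
  hence c: "card {x. poly q x = 0} = n" using Suc.hyps(1)[of q] dq qnz by simp
  have "{x. poly p x = 0} = insert r {x. poly q x = 0}" unfolding q(1) by (auto simp: algebra_simps)
  moreover have "r \<notin> {x. poly q x = 0}" using qr by simp
  ultimately show ?case using c Suc.hyps(2) poly_roots_finite[OF qnz] by simp
qed

text \<open>Used to compare the number of fixed points of the N-th iterate, exponential in N, with
  the number of those that can meet Z.\<close>

lemma exp_exceeds_linear: "\<exists>N\<ge>1. M + c * N < 2 ^ N" for M c :: nat
proof -
  have "\<forall>\<^sub>F N in sequentially. real M + real c * real N < 2 ^ N"
  proof -
    have "(\<lambda>N. real N * (1/2) ^ N) \<longlonglongrightarrow> 0" by (intro powser_times_n_limit_0) auto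
    moreover have "(\<lambda>N. (1/2 :: real) ^ N) \<longlonglongrightarrow> 0" by (intro LIMSEQ_power_zero) auto
    ultimately have "(\<lambda>N. real M * (1/2) ^ N + real c * (real N * (1/2) ^ N)) \<longlonglongrightarrow> real M * 0 + real c * 0"
      by (intro tendsto_add tendsto_mult_left)
    hence "\<forall>\<^sub>F N in sequentially. real M * (1/2) ^ N + real c * (real N * (1/2) ^ N) < 1"
      by (rule order_tendstoD(2)) simp
    thus ?thesis by (rule eventually_mono) (simp add: power_divide field_simps)
  qed
  hence "\<forall>\<^sub>F N in sequentially. N \<ge> 1 \<and> real M + real c * real N < 2 ^ N"
    using eventually_ge_at_top[of 1] by eventually_elim simp
  then obtain N where N: "N \<ge> 1" "real M + real c * real N < 2 ^ N"
    by (auto simp: eventually_sequentially)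
  have "real (M + c * N) < real (2 ^ N)" using N(2) by simp
  hence "M + c * N < 2 ^ N" by (simp only: of_nat_less_iff)
  thus ?thesis using N(1) by blast
qed

context dynamics
begin

lemma good_FG_integral:
  assumes w: "nonarch w" and good: "good w"
  shows "(\<forall>i. w (to_ac (coeff (F n) i)) \<le> 1) \<and> (\<forall>i. w (to_ac (coeff (G n) i)) \<le> 1)"
proof -
  interpret w: nonarch w by (rule w)
  define I where "I = (\<lambda>q :: 'a poly. \<forall>i. w (to_ac (coeff q i)) \<le> 1)"
  have mult: "I (p * q)" if "I p" "I q" for p q
    unfolding I_def coeff_mult to_ac_sum
  proof
    fix n show "w (\<Sum>i\<le>n. to_ac (coeff p i * coeff q (n - i))) \<le> 1"
    proof (rule w.sum_le)
      fix i
      have "w (to_ac (coeff p i)) * w (to_ac (coeff q (n - i))) \<le> 1 * 1"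
        using that by (intro mult_mono) (auto simp: I_def)
      thus "w (to_ac (coeff p i * coeff q (n - i))) \<le> 1" by (simp add: w.mult)
    qed simp
  qed
  have one: "I 1" by (auto simp: I_def coeff_1)
  have pow: "I (p ^ n)" if "I p" for p n using that by (induction n) (auto intro: mult one)
  have subst: "I (fsubst d q a b)" if q: "\<And>i. w (to_ac (coeff q i)) \<le> 1" and ab: "I a" "I b" for q a b
    unfolding I_def fsubst_def coeff_sum to_ac_sum
  proof
    fix j show "w (\<Sum>i\<le>d. to_ac (coeff (smult (coeff q i) (a ^ i * b ^ (d - i))) j)) \<le> 1"
    proof (rule w.sum_le)
      fix i
      have "I (a ^ i * b ^ (d - i))" by (intro mult pow ab)
      hence "w (to_ac (coeff q i)) * w (to_ac (coeff (a ^ i * b ^ (d - i)) j)) \<le> 1 * 1"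
        using q by (intro mult_mono) (auto simp: I_def)
      thus "w (to_ac (coeff (smult (coeff q i) (a ^ i * b ^ (d - i))) j)) \<le> 1" by (simp add: w.mult)
    qed simp
  qed
  have "I (F n) \<and> I (G n)"
  proof (induction n)
    case 0
    have "I [:0, 1:]" by (auto simp: I_def coeff_pCons split: nat.splits)
    thus ?case using one by (simp add: F_def G_def)
  next
    case (Suc n)
    have "I (fsubst d f (F n) (G n))" "I (fsubst d g (F n) (G n))"
      using good Suc by (intro subst; simp add: good_def)+
    thus ?case by (simp add: F_def G_def)
  qed
  thus ?thesis by (simp add: I_def)
qed

text \<open>A vanishing multiplier makes \<gamma> a double root of its fibre. Gauss's lemma, applied
  twice, bounds the cofactor, and the norms combine exactly to the square of the distance.\<close>

lemma superattracting:
  assumes w: "nonarch w" and good: "good w" and N: "N \<ge> 1"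
    and A0: "pac (A N) \<gamma> = 0" and W0: "pac (W N) \<gamma> = 0"
  shows "nonarch.cdist w ((Phi ^^ N) (y, 1)) (\<gamma>, 1) \<le> nonarch.cdist w (y, 1) (\<gamma>, 1) ^ 2"
proof -
  interpret w: nonarch w by (rule w)
  define D where "D = d ^ N"
  have D2: "D \<ge> 2" unfolding D_def using d2 N self_le_power[of d N] by linarith
  define m where "m = max 1 (w \<gamma>)"
  define M where "M = max 1 (w y)"
  have m1: "m \<ge> 1" and M1: "M \<ge> 1" by (simp_all add: m_def M_def)
  have P0: "poly (fibre N \<gamma>) \<gamma> = 0" using A0 by (simp add: poly_fibre pac_A)
  then obtain q where q: "fibre N \<gamma> = [:- \<gamma>, 1:] * q" "poly q \<gamma> = poly (pderiv (fibre N \<gamma>)) \<gamma>" by (rule synthetic_root)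
  have "poly q \<gamma> = 0" using pac_W[OF A0] W0 q(2) by simp
  then obtain q2 where q2: "q = [:- \<gamma>, 1:] * q2" by (rule synthetic_root)
  \<comment> \<open>The bounds on coefficients pass from m for the fibre to 1 for q and to 1 / m for
    q2.\<close>
  have ci: "w (coeff (fibre N \<gamma>) i) \<le> m" for i
  proof -
    have F1: "w (to_ac (coeff (F N) i)) \<le> 1" and G1: "w (to_ac (coeff (G N) i)) \<le> 1"
      using good_FG_integral[OF w good, of N] by auto
    have "w (\<gamma> * to_ac (coeff (G N) i)) \<le> m * 1"
      unfolding w.mult using G1 m1 by (intro mult_mono) (auto simp: m_def)
    thus ?thesis
      using w.ultra_diff[of "to_ac (coeff (F N) i)" "\<gamma> * to_ac (coeff (G N) i)"] F1 m1
      by (simp add: fibre_def coeff_map_poly)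
  qed
  have "w (coeff q i) \<le> m / m" for i
    using w.coeff_linear_quotient_le[OF q(1) ci, of i] by (simp only: m_def)
  hence "w (coeff q i) \<le> 1" for i using m1 by simp
  hence c2: "w (coeff q2 i) \<le> 1 / m" for i
    using w.coeff_linear_quotient_le[OF q2, of 1 i] by (simp only: m_def)
  have dq2: "degree q2 \<le> D - 2"
  proof (cases "q2 = 0")
    case False
    have "fibre N \<gamma> = [:- \<gamma>, 1:] * ([:- \<gamma>, 1:] * q2)" using q(1) q2 by simp
    hence "degree (fibre N \<gamma>) = 2 + degree q2" using False by (simp add: degree_mult_eq del: mult_pCons_left)
    thus ?thesis using fibre_degree_le[of N \<gamma>] by (simp add: D_def)
  qed simp
  have pn: "w.pnorm (y, 1) = M" "w.pnorm (\<gamma>, 1) = m" by (simp_all add: w.pnorm_def M_def m_def max.commute)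
  have "w (poly q2 y) = w (hform (D - 2) q2 (y, 1))" using dq2 by (simp add: hform_affine)
  also have "\<dots> \<le> 1 / m * M ^ (D - 2)" using w.hform_le[OF c2, of "D - 2" "(y, 1)"] pn by simp
  finally have b: "w (poly q2 y) \<le> 1 / m * M ^ (D - 2)" .
  have e: "wedge ((Phi ^^ N) (y, 1)) (\<gamma>, 1) = (y - \<gamma>) ^ 2 * poly q2 y"
    unfolding poly_fibre[symmetric] q(1) q2 by (simp add: power2_eq_square algebra_simps)
  have n: "w.pnorm ((Phi ^^ N) (y, 1)) = M ^ D" using good_pow_norm[OF good, of "(y, 1)" N] pn by (simp add: D_def)
  have "w.cdist ((Phi ^^ N) (y, 1)) (\<gamma>, 1) = w (y - \<gamma>) ^ 2 * w (poly q2 y) / (M ^ D * m)"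
    unfolding w.cdist_def e n pn by (simp add: w.mult w.power)
  also have "\<dots> \<le> w (y - \<gamma>) ^ 2 * (1 / m * M ^ (D - 2)) / (M ^ D * m)"
    using b m1 M1 by (intro divide_right_mono mult_left_mono) auto
  also have "M ^ D = M ^ (D - 2) * M ^ 2"
    using power_add[of M "D - 2" 2] D2 by (simp only: le_add_diff_inverse2)
  also have "w (y - \<gamma>) ^ 2 * (1 / m * M ^ (D - 2)) / (M ^ (D - 2) * M ^ 2 * m) = (w (y - \<gamma>) / (M * m)) ^ 2"
    using m1 M1 by (simp add: field_simps power2_eq_square)
  also have "w (y - \<gamma>) / (M * m) = w.cdist (y, 1) (\<gamma>, 1)"
    unfolding w.cdist_def pn by (simp add: wedge_def)
  finally show ?thesis .
qed

end

context accumulating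
begin

text \<open>Periodic points of all periods at once; that the cycle avoids Z is again expressible by
  polynomials over K.\<close>

definition RII :: "'a alg_closure set" where
  "RII = {\<gamma>. \<exists>N\<ge>1. pac (A N) \<gamma> = 0 \<and> (\<forall>s. \<forall>z\<in>Z. wedge (emb z) ((Phi ^^ s) (\<gamma>, 1)) \<noteq> 0)}"

definition BII :: "('a \<Rightarrow> real) set set" where
  "BII = S \<union> {p\<in>places k. \<exists>w\<in>ext p. \<not> good w}"

lemma finite_BII: "finite BII"
  using ae_good finS by (simp add: BII_def ae_def)

text \<open>After i returns the distance to \<gamma> is at most \<delta>^(i+1), while z stays at
  distance at least \<eta> > 0 from the cycle; so late members of the orbit cannot come closer than
  \<eta> to z.\<close>

lemma RII_avoided:
  assumes super: "\<And>N r. N \<ge> 1 \<Longrightarrow> pac (A N) r = 0 \<Longrightarrow> pac (W N) r = 0"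
    and \<gamma>: "\<gamma> \<in> RII" and n: "n \<ge> 1" and p: "p \<in> places k - BII" and w: "w \<in> ext p"
  shows "\<not> nonarch.cdist w (U n) (\<gamma>, 1) < 1"
proof
  interpret w: nonarch w by (rule ext_nonarch[OF w])
  have good: "good w" and pS: "p \<in> places k - S" using p w by (auto simp: BII_def)
  obtain N where N: "N \<ge> 1" "pac (A N) \<gamma> = 0"
    and avoid: "\<And>s z. z \<in> Z \<Longrightarrow> wedge (emb z) ((Phi ^^ s) (\<gamma>, 1)) \<noteq> 0" using \<gamma> by (auto simp: RII_def)
  define \<delta> where "\<delta> = w.cdist (U n) (\<gamma>, 1)"
  assume "w.cdist (U n) (\<gamma>, 1) < 1"
  hence \<delta>: "\<delta> < 1" "\<delta> \<ge> 0" by (simp_all add: \<delta>_def)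
  define c where "c = (\<lambda>i. w.cdist (U (n + i * N)) (\<gamma>, 1))"
  have sq: "c (Suc i) \<le> c i ^ 2" for i
  proof -
    obtain a b where ab: "U (n + i * N) = (a, b)" by (cases "U (n + i * N)")
    have b: "b \<noteq> 0" using U_affine[of "n + i * N"] n ab by simp
    define y where "y = a / b"
    have eq: "U (n + i * N) = (b * y, b * 1)" using b by (simp add: ab y_def)
    have "c i = w.cdist (y, 1) (\<gamma>, 1)" unfolding c_def eq by (rule w.cdist_scale[OF b])
    moreover have "U (n + Suc i * N) = (Phi ^^ N) (U (n + i * N))"
      using U_add[of "n + i * N" N] by (simp add: add_ac)
    hence "c (Suc i) = w.cdist ((Phi ^^ N) (y, 1)) (\<gamma>, 1)"
      unfolding c_def eq Phi_pow_scale using w.cdist_scale[of "b ^ d ^ N"] b by simp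
    ultimately show ?thesis
      using superattracting[OF w.nonarch_axioms good N super[OF N], of y] by simp
  qed
  have cle: "c i \<le> \<delta> ^ Suc i" for i
  proof (induction i)
    case 0
    show ?case by (simp add: c_def \<delta>_def)
  next
    case (Suc i)
    have c0: "c i \<ge> 0" by (simp add: c_def)
    have "\<delta> ^ Suc i \<le> \<delta>" using \<delta> power_decreasing[of 1 "Suc i" \<delta>] by simp
    hence "c i * c i \<le> \<delta> ^ Suc i * \<delta>" using Suc c0 \<delta> by (intro mult_mono) auto
    thus ?case using sq[of i] by (simp add: power2_eq_square mult_ac)
  qed
  obtain z where z1: "z \<in> Z" and z2: "\<forall>w e n0. w \<in> ext p \<longrightarrow> e > 0 \<longrightarrow> (\<exists>n\<ge>n0. nonarch.cdist w (U n) (emb z) < e)"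
    using acc_ext[OF pS] by (elim exE conjE)
  note z = z1 z2[rule_format]
  have znz: "emb z \<noteq> (0, 0)" using Znz[OF z(1)] by simp
  define h where "h = (\<lambda>s. w.cdist (emb z) ((Phi ^^ s) (\<gamma>, 1)))"
  define \<eta> where "\<eta> = Min (h ` {..<N})"
  have ne: "h ` {..<N} \<noteq> {}" using N(1) by (auto simp: lessThan_empty_iff)
  have "\<eta> \<in> h ` {..<N}" unfolding \<eta>_def using ne by (intro Min_in) auto
  then obtain s0 where "\<eta> = h s0" by blast
  moreover have "h s > 0" for s
  proof -
    have "h s \<noteq> 0" unfolding h_def using w.cdist_eq_0[OF znz Phi_pow_nz[of "(\<gamma>, 1)" s]] avoid[OF z(1), of s] by simp
    moreover have "h s \<ge> 0" by (simp add: h_def)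
    ultimately show ?thesis by linarith
  qed
  ultimately have \<eta>: "\<eta> > 0" by simp
  obtain i where i: "\<delta> ^ i < \<eta>" using real_arch_pow_inv[OF \<eta> \<delta>(1)] by blast
  obtain n' where n': "n' \<ge> n + i * N" "w.cdist (U n') (emb z) < \<eta>" using z(2)[OF w \<eta>] by blast
  define i' where "i' = (n' - n) div N"
  define s where "s = (n' - n) mod N"
  have s: "s < N" using N(1) by (simp add: s_def)
  have "n' = n + i' * N + s" using n'(1) by (simp add: i'_def s_def)
  hence Us: "U n' = (Phi ^^ s) (U (n + i' * N))" using U_add by simp
  have i'ge: "i' \<ge> i"
  proof -
    have "i * N div N \<le> (n' - n) div N" using n'(1) by (intro div_le_mono) simp
    thus ?thesis using N(1) by (simp add: i'_def)
  qed
  have "w.cdist (U n') ((Phi ^^ s) (\<gamma>, 1)) \<le> c i'"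
    unfolding Us c_def by (rule good_pow_nonexpansive[OF w.nonarch_axioms good U_nz]) simp
  also have "\<dots> \<le> \<delta> ^ Suc i'" by (rule cle)
  also have "\<dots> \<le> \<delta> ^ i" using \<delta> i'ge by (intro power_decreasing) auto
  finally have c1: "w.cdist (U n') ((Phi ^^ s) (\<gamma>, 1)) < \<eta>" using i by simp
  have "w.cdist (emb z) (U n') < \<eta>" using n'(2) w.cdist_commute[of "emb z"] by simp
  from w.cdist_less_trans[OF this c1 U_nz znz Phi_pow_nz] have "h s < \<eta>" by (simp add: h_def)
  moreover have "\<eta> \<le> h s" unfolding \<eta>_def using s by (intro Min_le) auto
  ultimately show False by simp
qed

text \<open>The d^N + 1 fixed points of the N-th iterate are distinct. One outside RII meets Z
  within a period and is determined by the point of Z and the time, so there are at most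
  \<open>card Z * N\<close> of them.\<close>

lemma infinite_RII:
  assumes super: "\<And>N r. N \<ge> 1 \<Longrightarrow> pac (A N) r = 0 \<Longrightarrow> pac (W N) r = 0"
  shows "infinite RII"
proof
  assume fin: "finite RII"
  obtain N where N: "N \<ge> 1" "card RII + card Z * N < 2 ^ N" using exp_exceeds_linear[of "card RII" "card Z"] by blast
  \<comment> \<open>If \<gamma> meets z at time r < N, it is the image of z under the N - r steps
    that complete the period.\<close>
  define E where "E = (\<Union>x\<in>Z \<times> {..<N}. {\<gamma>. wedge (\<gamma>, 1) ((Phi ^^ (N - snd x)) (emb (fst x))) = 0})"
  have sub: "{\<gamma>. pac (A N) \<gamma> = 0} \<subseteq> RII \<union> E"
  proof
    fix \<gamma> assume "\<gamma> \<in> {\<gamma>. pac (A N) \<gamma> = 0}"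
    hence per: "wedge ((Phi ^^ N) (\<gamma>, 1)) (\<gamma>, 1) = 0" and A0: "pac (A N) \<gamma> = 0" by (simp_all add: pac_A)
    show "\<gamma> \<in> RII \<union> E"
    proof (cases "\<gamma> \<in> RII")
      case False
      then obtain s z where sz: "z \<in> Z" "wedge (emb z) ((Phi ^^ s) (\<gamma>, 1)) = 0" using N(1) A0 by (auto simp: RII_def)
      have znz: "emb z \<noteq> (0, 0)" using Znz[OF sz(1)] by simp
      define r where "r = s mod N"
      have r: "r < N" using N(1) by (simp add: r_def)
      have "wedge (emb z) ((Phi ^^ r) (\<gamma>, 1)) = 0"
        unfolding r_def by (rule wedge_trans[OF sz(2) periodic_mod[OF per]]) (simp_all add: Phi_pow_nz)
      hence "wedge ((Phi ^^ (N - r)) (emb z)) ((Phi ^^ (N - r)) ((Phi ^^ r) (\<gamma>, 1))) = 0"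
        by (intro Phi_pow_proportional znz Phi_pow_nz) auto
      moreover have "(Phi ^^ (N - r)) ((Phi ^^ r) (\<gamma>, 1)) = (Phi ^^ N) (\<gamma>, 1)"
        using r by (simp flip: comp_apply[of "Phi ^^ (N - r)"] funpow_add)
      ultimately have "wedge ((Phi ^^ (N - r)) (emb z)) ((Phi ^^ N) (\<gamma>, 1)) = 0" by simp
      from wedge_trans[OF this per Phi_pow_nz] have "wedge ((Phi ^^ (N - r)) (emb z)) (\<gamma>, 1) = 0" by simp
      hence "wedge (\<gamma>, 1) ((Phi ^^ (N - r)) (emb z)) = 0" by (simp only: wedge_eq_0_sym)
      hence "\<gamma> \<in> E" unfolding E_def using sz(1) r by (intro UN_I[of "(z, r)"]) auto
      thus ?thesis by simp
    qed simp
  qed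
  have single: "finite {\<gamma>. wedge (\<gamma>, 1) t = 0} \<and> card {\<gamma>. wedge (\<gamma>, 1) t = 0} \<le> 1" if "t \<noteq> (0, 0)" for t :: "'a alg_closure \<times> 'a alg_closure"
  proof -
    have "{\<gamma>. wedge (\<gamma>, 1) t = 0} \<subseteq> {fst t / snd t}"
    proof
      fix \<gamma> assume "\<gamma> \<in> {\<gamma>. wedge (\<gamma>, 1) t = 0}"
      hence e: "\<gamma> * snd t = fst t" by (simp add: wedge_def)
      hence "snd t \<noteq> 0" using that by (auto simp: prod_eq_iff)
      thus "\<gamma> \<in> {fst t / snd t}" using e by (simp add: field_simps)
    qed
    thus ?thesis using finite_subset card_mono[of "{fst t / snd t}"] by fastforce
  qed
  have Ei: "finite {\<gamma>. wedge (\<gamma>, 1) ((Phi ^^ (N - snd x)) (emb (fst x))) = 0} \<and>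
     card {\<gamma>. wedge (\<gamma>, 1) ((Phi ^^ (N - snd x)) (emb (fst x))) = 0} \<le> 1" if "x \<in> Z \<times> {..<N}" for x
    using that Znz[of "fst x"] by (intro single Phi_pow_nz) auto
  have finE: "finite E" unfolding E_def using finZ Ei by (intro finite_UN_I) auto
  have "card E \<le> (\<Sum>x\<in>Z \<times> {..<N}. card {\<gamma>. wedge (\<gamma>, 1) ((Phi ^^ (N - snd x)) (emb (fst x))) = 0})"
    unfolding E_def using finZ by (intro card_UN_le) simp
  also have "\<dots> \<le> (\<Sum>x\<in>Z \<times> {..<N}. 1)" using Ei by (intro sum_mono) blast
  finally have cE: "card E \<le> card Z * N" by (simp add: card_cartesian_product)
  have "card {x. poly (map_poly to_ac (A N)) x = 0} = degree (map_poly to_ac (A N))"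
  proof (rule card_roots_separable)
    show "map_poly to_ac (A N) \<noteq> 0" using A_nz[OF N(1)] by simp
    fix r assume "poly (map_poly to_ac (A N)) r = 0"
    hence A0: "pac (A N) r = 0" by (simp add: pac_def)
    have "pac (G N) r * poly (pderiv (fibre N r)) r = 0" "pac (G N) r \<noteq> 0"
      using pac_W[OF A0] super[OF N(1) A0] by simp_all
    hence d0: "poly (pderiv (fibre N r)) r = 0" by simp
    \<comment> \<open>As the fibre over r has a double root at r, the derivative of
      \<open>A N\<close> there is -G(r), which is not 0.\<close>
    have "map_poly to_ac (A N) = fibre N r - [:- r, 1:] * map_poly to_ac (G N)"
    proof (rule poly_eqI)
      fix i
      show "coeff (map_poly to_ac (A N)) i = coeff (fibre N r - [:- r, 1:] * map_poly to_ac (G N)) i"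
        by (cases i) (simp_all add: A_def fibre_def coeff_map_poly algebra_simps coeff_pCons)
    qed
    hence "poly (pderiv (map_poly to_ac (A N))) r = poly (pderiv (fibre N r)) r - poly (map_poly to_ac (G N)) r"
      by (simp add: pderiv_diff pderiv_smult pderiv_mult pderiv_pCons)
    thus "poly (pderiv (map_poly to_ac (A N))) r \<noteq> 0"
      using d0 \<open>pac (G N) r \<noteq> 0\<close> by (simp add: pac_def)
  qed
  hence "card {x. pac (A N) x = 0} = Suc (d ^ N)" using A_degree[OF N(1)] by (simp add: pac_def degree_map_poly)
  moreover have "card {x. pac (A N) x = 0} \<le> card (RII \<union> E)" using sub fin finE by (intro card_mono) auto
  moreover have "card (RII \<union> E) \<le> card RII + card E" by (rule card_Un_le)
  moreover have "(2::nat) ^ N \<le> d ^ N" using d2 by (intro power_mono) auto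
  ultimately show False using cE N(2) by linarith
qed

lemma RII_conj_closed: "conj_closed RII"
proof -
  have e: "wedge (emb z) ((Phi ^^ s) (\<gamma>, 1)) = pac (smult (fst z) (G s) - smult (snd z) (F s)) \<gamma>" for z s \<gamma>
    by (simp add: wedge_def emb_def Phi_pow_affine)
  show ?thesis unfolding conj_closed_def
  proof (intro ballI allI impI)
    fix x y assume "x \<in> RII" "\<forall>q. pac q x = 0 \<longleftrightarrow> pac q y = 0"
    thus "y \<in> RII" unfolding RII_def e mem_Collect_eq by metis
  qed
qed

theorem exists_avoided_set:
  "\<exists>B R. finite B \<and> S \<subseteq> B \<and> infinite R \<and> conj_closed R \<and>
    (\<forall>\<gamma>\<in>R. \<exists>n0. \<forall>n\<ge>n0. \<forall>p\<in>places k - B. \<forall>w\<in>ext p. \<not> nonarch.cdist w (U n) (\<gamma>, 1) < 1)"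
proof (cases "\<exists>N\<ge>1. \<exists>r. pac (A N) r = 0 \<and> pac (W N) r \<noteq> 0")
  case True
  then obtain N r where N: "N \<ge> 1" and "pac (A N) r = 0" "pac (W N) r \<noteq> 0" by blast
  hence r: "r \<in> Rep N" by (simp add: Rep_def[OF N])
  have "S \<subseteq> BI N" by (auto simp: BI_def[OF N])
  thus ?thesis
    using finite_BI[OF N] infinite_RI[OF N r] RI_conj_closed[OF N] RI_avoided[OF N]
    by (intro exI[of _ "BI N"] exI[of _ "RI N"]) simp
next
  case False
  hence super: "\<And>N r. N \<ge> 1 \<Longrightarrow> pac (A N) r = 0 \<Longrightarrow> pac (W N) r = 0" by blast
  have "\<exists>n0. \<forall>n\<ge>n0. \<forall>p\<in>places k - BII. \<forall>w\<in>ext p. \<not> nonarch.cdist w (U n) (\<gamma>, 1) < 1" if "\<gamma> \<in> RII" for \<gamma>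
    using RII_avoided[OF super that] by blast
  moreover have "S \<subseteq> BII" by (auto simp: BII_def)
  ultimately show ?thesis
    using finite_BII infinite_RII[OF super] RII_conj_closed
    by (intro exI[of _ BII] exI[of _ RII]) simp
qed

end

subsection \<open>Conclusion for orbits through infinity\<close>

text \<open>Take g of least degree. The minimal polynomial g' of another root divides g and must
  vanish at \<gamma> as well; otherwise g would divide the cofactor and g' would be
  constant.\<close>

lemma min_poly_conj:
  fixes \<gamma> :: "'a::field alg_closure"
  shows "\<exists>g :: 'a poly. g \<noteq> 0 \<and> pac g \<gamma> = 0 \<and> (\<forall>\<gamma>'. pac g \<gamma>' = 0 \<longrightarrow> (\<forall>q. pac q \<gamma> = 0 \<longleftrightarrow> pac q \<gamma>' = 0))"
proof -
  have mn: "\<exists>g :: 'a poly. (g \<noteq> 0 \<and> pac g x = 0) \<and> (\<forall>q. pac q x = 0 \<longrightarrow> g dvd q)" for x :: "'a alg_closure"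
  proof -
    define I where "I = (\<lambda>g :: 'a poly. g \<noteq> 0 \<and> pac g x = 0)"
    obtain g0 :: "'a poly" where "g0 \<noteq> 0" "poly (map_poly to_ac g0) x = 0" using alg_closure_algebraic by blast
    hence "I g0" by (simp add: I_def pac_def)
    from ex_has_least_nat[of I, OF this, of degree]
    obtain g where g: "I g" "\<And>g'. I g' \<Longrightarrow> degree g \<le> degree g'" by blast
    have "g dvd q" if "pac q x = 0" for q
    proof (rule ccontr)
      assume "\<not> g dvd q"
      hence m: "q mod g \<noteq> 0" by (simp add: dvd_eq_mod_eq_0)
      have "pac (q div g * g + q mod g) x = 0" using that by simp
      hence "pac (q mod g) x = 0" using g(1) unfolding pac_add pac_mult by (simp add: I_def)
      hence "degree g \<le> degree (q mod g)" using m by (intro g(2)) (simp add: I_def)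
      moreover have "degree (q mod g) < degree g" using degree_mod_less'[of g q] m g(1) by (simp add: I_def)
      ultimately show False by simp
    qed
    thus ?thesis using g(1) unfolding I_def by blast
  qed
  obtain g :: "'a poly" where g: "g \<noteq> 0" "pac g \<gamma> = 0" "\<And>q. pac q \<gamma> = 0 \<Longrightarrow> g dvd q" using mn[of \<gamma>] by blast
  have "pac q \<gamma> = 0 \<longleftrightarrow> pac q \<gamma>' = 0" if "pac g \<gamma>' = 0" for \<gamma>' q
  proof
    assume "pac q \<gamma> = 0"
    hence "g dvd q" by (rule g(3))
    then obtain h where "q = g * h" by (auto simp: dvd_def)
    thus "pac q \<gamma>' = 0" using that by simp
  next
    assume q: "pac q \<gamma>' = 0"
    obtain g' :: "'a poly" where g': "g' \<noteq> 0" "pac g' \<gamma>' = 0" "\<And>q. pac q \<gamma>' = 0 \<Longrightarrow> g' dvd q" using mn[of \<gamma>'] by blast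
    have "g' dvd g" "g' dvd q" using g'(3) that q by blast+
    then obtain h h' where h: "g = g' * h" and h': "q = g' * h'" unfolding dvd_def by blast
    show "pac q \<gamma> = 0"
    proof (cases "pac g' \<gamma> = 0")
      case True
      thus ?thesis by (simp add: h')
    next
      case False
      hence "pac h \<gamma> = 0" using g(2) by (simp add: h)
      then obtain h2 where h2: "h = g * h2" using g(3) by (auto simp: dvd_def)
      have "g * (g' * h2) = g * 1" using h h2 by (simp add: mult_ac)
      hence "g' * h2 = 1" using g(1) by (rule mult_left_cancel[THEN iffD1, rotated])
      hence "pac (g' * h2) \<gamma>' = 1" by simp
      thus ?thesis using g'(2) by simp
    qed
  qed
  thus ?thesis using g(1,2) by blast
qed

section \<open>Lower bounds for polynomials at one place\<close>

lemma (in nonarch) poly_large: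
  assumes "degree g > 0"
  shows "\<exists>B. \<forall>x. v x > B \<longrightarrow> v (poly g x) = v (lead_coeff g) * v x ^ degree g"
proof -
  define L where "L = v (lead_coeff g)"
  have "g \<noteq> 0" using assms by auto
  hence L: "L > 0" by (simp add: L_def)
  define C where "C = Max ((\<lambda>i. v (coeff g i)) ` {..degree g})"
  have C: "v (coeff g i) \<le> C" if "i \<le> degree g" for i unfolding C_def using that by (intro Max_ge) auto
  have C0: "C \<ge> 0" using C[of 0] nonneg[of "coeff g 0"] by linarith
  define B where "B = max 1 (C / L)"
  have "v (poly g x) = L * v x ^ degree g" if "v x > B" for x
  proof -
    have x1: "v x > 1" and xC: "C < L * v x" using that L by (simp_all add: B_def field_simps)
    have "v (poly g x) = v (lead_coeff g * x ^ degree g)"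
      unfolding poly_altdef
    proof (rule sum_dominant)
      fix j assume j: "j \<in> {..degree g}" "j \<noteq> degree g"
      have "v (coeff g j * x ^ j) \<le> C * v x ^ (degree g - 1)"
        unfolding mult power using C[of j] C0 x1 j by (intro mult_mono power_increasing) auto
      also have "\<dots> < L * v x * v x ^ (degree g - 1)"
        using xC x1 by (intro mult_strict_right_mono zero_less_power) auto
      also have "\<dots> = L * v x ^ degree g" using assms by (cases "degree g") simp_all
      finally show "v (coeff g j * x ^ j) < v (lead_coeff g * x ^ degree g)" by (simp add: mult power L_def)
    qed auto
    thus ?thesis by (simp add: mult power L_def)
  qed
  thus ?thesis unfolding L_def by blast
qed

text \<open>Coprime polynomials are not small together: for bounded x by the Bezout identity, for
  large x because of the leading term of g alone.\<close>

lemma (in nonarch) coprime_values: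
  assumes deg: "degree g > 0" "degree h > 0" and ab: "a * g + b * h = 1"
  shows "\<exists>e>0. \<forall>x. v (poly g x) \<ge> e * max 1 (v x) ^ degree g \<or> v (poly h x) \<ge> e * max 1 (v x) ^ degree h"
proof -
  obtain B where B: "\<And>x. v x > B \<Longrightarrow> v (poly g x) = v (lead_coeff g) * v x ^ degree g" using poly_large[OF deg(1)] by blast
  define M where "M = max 1 B"
  have M1: "M \<ge> 1" by (simp add: M_def)
  have bd: "\<exists>C>0. \<forall>x. v x \<le> M \<longrightarrow> v (poly q x) \<le> C" for q
  proof -
    define C where "C = 1 + (\<Sum>i\<le>degree q. v (coeff q i) * M ^ i)"
    have pos: "(\<Sum>i\<le>degree q. v (coeff q i) * M ^ i) \<ge> 0" using M1 by (intro sum_nonneg) auto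
    have "v (poly q x) \<le> C" if "v x \<le> M" for x
      unfolding poly_altdef
    proof (rule sum_le)
      show "C \<ge> 0" using pos by (simp add: C_def)
      fix i assume i: "i \<in> {..degree q}"
      have "v (coeff q i * x ^ i) \<le> v (coeff q i) * M ^ i"
        unfolding mult power using that by (intro mult_left_mono power_mono) auto
      also have "\<dots> \<le> (\<Sum>i\<le>degree q. v (coeff q i) * M ^ i)" using i M1 by (intro member_le_sum) auto
      finally show "v (coeff q i * x ^ i) \<le> C" by (simp add: C_def)
    qed
    moreover have "C > 0" using pos by (simp add: C_def)
    ultimately show ?thesis by blast
  qed
  obtain Ca where Ca: "Ca > 0" "\<And>x. v x \<le> M \<Longrightarrow> v (poly a x) \<le> Ca" using bd[of a] by blast
  obtain Cb where Cb: "Cb > 0" "\<And>x. v x \<le> M \<Longrightarrow> v (poly b x) \<le> Cb" using bd[of b] by blast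
  define L where "L = v (lead_coeff g)"
  have L: "L > 0" using deg(1) by (auto simp: L_def)
  define K where "K = M ^ (degree g + degree h)"
  have K1: "K \<ge> 1" using M1 by (simp add: K_def one_le_power)
  define e where "e = min L (min (1 / (Ca * K)) (1 / (Cb * K)))"
  have e: "e > 0" "e \<le> L" "e \<le> 1 / (Ca * K)" "e \<le> 1 / (Cb * K)" using L Ca(1) Cb(1) K1 by (auto simp: e_def)
  have "v (poly g x) \<ge> e * max 1 (v x) ^ degree g \<or> v (poly h x) \<ge> e * max 1 (v x) ^ degree h" for x
  proof (cases "v x \<le> M")
    case False
    hence "v x > 1" "v x > B" by (auto simp: M_def)
    hence "v (poly g x) = L * max 1 (v x) ^ degree g" using B by (simp add: L_def)
    thus ?thesis using e(2) by (simp add: mult_right_mono)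
  next
    case True
    have mx: "max 1 (v x) ^ n \<le> K" if "n \<le> degree g + degree h" for n
    proof -
      have "max 1 (v x) ^ n \<le> M ^ n" using True M1 by (intro power_mono) auto
      also have "\<dots> \<le> K" unfolding K_def using that M1 by (intro power_increasing) auto
      finally show ?thesis .
    qed
    have "1 = v (poly a x * poly g x + poly b x * poly h x)"
      using ab by (metis poly_add poly_mult poly_1 one)
    also have "\<dots> \<le> max (v (poly a x) * v (poly g x)) (v (poly b x) * v (poly h x))"
      using ultra by (simp flip: mult)
    also have "\<dots> \<le> max (Ca * v (poly g x)) (Cb * v (poly h x))"
      using Ca(2)[OF True] Cb(2)[OF True] by (intro max.mono mult_right_mono) auto
    finally have "Ca * v (poly g x) \<ge> 1 \<or> Cb * v (poly h x) \<ge> 1" by linarith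
    thus ?thesis
    proof
      assume c: "Ca * v (poly g x) \<ge> 1"
      have "e * max 1 (v x) ^ degree g \<le> 1 / (Ca * K) * K"
        using e(1,3) mx[of "degree g"] K1 Ca(1) by (intro mult_mono) auto
      also have "\<dots> = 1 / Ca" using K1 by simp
      also have "\<dots> \<le> v (poly g x)" using c Ca(1) by (simp add: field_simps)
      finally show ?thesis ..
    next
      assume c: "Cb * v (poly h x) \<ge> 1"
      have "e * max 1 (v x) ^ degree h \<le> 1 / (Cb * K) * K"
        using e(1,4) mx[of "degree h"] K1 Cb(1) by (intro mult_mono) auto
      also have "\<dots> = 1 / Cb" using K1 by simp
      also have "\<dots> \<le> v (poly h x)" using c Cb(1) by (simp add: field_simps)
      finally show ?thesis ..
    qed
  qed
  thus ?thesis using e(1) by blast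
qed

text \<open>The hypothesis on y is what incongruence with the roots yields; each linear factor then
  contributes a full factor \<open>max 1 (v y)\<close>.\<close>

lemma (in nonarch) poly_far_from_roots:
  fixes P :: "'b poly"
  assumes "P = smult c (\<Prod>x\<in>#A. [:- x, 1:])" "\<And>r. r \<in># A \<Longrightarrow> v (y - r) \<ge> max 1 (v y)"
  shows "v (poly P y) \<ge> v c * max 1 (v y) ^ size A"
proof -
  have "v (poly (\<Prod>x\<in>#A. [:- x, 1:]) y) \<ge> max 1 (v y) ^ size A"
    using assms(2)
  proof (induction A)
    case (add r A)
    have "v (y - r) * v (poly (\<Prod>x\<in>#A. [:- x, 1:]) y) \<ge> max 1 (v y) * max 1 (v y) ^ size A"
      using add by (intro mult_mono) auto
    moreover have "poly (\<Prod>x\<in>#add_mset r A. [:- x, 1:]) y = (y - r) * poly (\<Prod>x\<in>#A. [:- x, 1:]) y"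
      by (simp add: algebra_simps)
    ultimately show ?case by (simp add: mult)
  qed simp
  thus ?thesis unfolding assms(1) by (simp add: mult mult_left_mono)
qed

context accumulating
begin

text \<open>The affine coordinate of the orbit. For n = 0 the point is infinity and the division by
  0 gives 0, hence the condition \<open>n \<ge> 1\<close> whenever it is compared with the
  orbit.\<close>

definition xx :: "nat \<Rightarrow> 'a" where
  "xx n = fst ((phi ^^ n) (1, 0)) / snd ((phi ^^ n) (1, 0))"

lemma u_affine: "n \<ge> 1 \<Longrightarrow> (phi ^^ n) (1, 0) = (snd ((phi ^^ n) (1, 0)) * xx n, snd ((phi ^^ n) (1, 0)) * 1) \<and> snd ((phi ^^ n) (1, 0)) \<noteq> 0"
  using U_affine[of n] by (simp add: xx_def U_emb emb_def prod_eq_iff)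

lemma wedge_affine: "n \<ge> 1 \<Longrightarrow> m \<ge> 1 \<Longrightarrow> xx n = xx m \<Longrightarrow> n = m"
proof (rule ccontr)
  assume h: "n \<ge> 1" "m \<ge> 1" "xx n = xx m" "n \<noteq> m"
  define b where "b = snd ((phi ^^ n) (1, 0))"
  define c where "c = snd ((phi ^^ m) (1, 0))"
  have "(phi ^^ n) (1, 0) = (b * xx n, b * 1)" "(phi ^^ m) (1, 0) = (c * xx n, c * 1)"
    using u_affine[OF h(1)] u_affine[OF h(2)] h(3) unfolding b_def c_def by simp_all
  hence "wedge ((phi ^^ n) (1, 0)) ((phi ^^ m) (1, 0)) = 0" by (simp add: wedge_def)
  thus False using wandering[OF h(4)] by simp
qed

lemma cdist_xx:
  assumes "p \<in> places k" "n \<ge> 1" "m \<ge> 1"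
  shows "nonarch.cdist (rep p) ((phi ^^ n) (1, 0)) ((phi ^^ m) (1, 0)) =
    rep p (xx n - xx m) / (max 1 (rep p (xx n)) * max 1 (rep p (xx m)))"
proof -
  interpret v: nonarch "rep p" by (rule place_nonarch[OF assms(1)])
  define b where "b = snd ((phi ^^ n) (1, 0))"
  define c where "c = snd ((phi ^^ m) (1, 0))"
  have e: "(phi ^^ n) (1, 0) = (b * xx n, b * 1)" "(phi ^^ m) (1, 0) = (c * xx m, c * 1)" "b \<noteq> 0" "c \<noteq> 0"
    using u_affine[OF assms(2)] u_affine[OF assms(3)] unfolding b_def c_def by simp_all
  have "v.cdist ((phi ^^ n) (1, 0)) ((phi ^^ m) (1, 0)) = v.cdist (xx n, 1) (c * xx m, c * 1)"
    unfolding e(1,2) by (rule v.cdist_scale[OF e(3)])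
  also have "\<dots> = v.cdist (c * xx m, c * 1) (xx n, 1)" by (rule v.cdist_commute)
  also have "\<dots> = v.cdist (xx m, 1) (xx n, 1)" by (rule v.cdist_scale[OF e(4)])
  also have "\<dots> = v.cdist (xx n, 1) (xx m, 1)" by (rule v.cdist_commute)
  finally show ?thesis by (simp add: v.cdist_def wedge_def v.pnorm_def max.commute)
qed

lemma cdist_U_affine:
  assumes "w \<in> ext p" "n \<ge> 1"
  shows "nonarch.cdist w (U n) (\<gamma>, 1) = w (to_ac (xx n) - \<gamma>) / (max 1 (w (to_ac (xx n))) * max 1 (w \<gamma>))"
proof -
  interpret w: nonarch w by (rule ext_nonarch[OF assms(1)])
  define b where "b = snd ((phi ^^ n) (1, 0))"
  have e: "U n = (to_ac b * to_ac (xx n), to_ac b * 1)" "to_ac b \<noteq> 0"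
    unfolding U_emb using u_affine[OF assms(2)] by (simp_all add: emb_def b_def prod_eq_iff)
  have "w.cdist (U n) (\<gamma>, 1) = w.cdist (to_ac (xx n), 1) (\<gamma>, 1)" unfolding e(1) by (rule w.cdist_scale[OF e(2)])
  thus ?thesis by (simp add: w.cdist_def wedge_def w.pnorm_def max.commute)
qed

text \<open>Greedy choice of pairwise non-conjugate points: the roots of finitely many minimal
  polynomials cannot exhaust R, and conjugacy is symmetric.\<close>

lemma independent_points:
  assumes R: "infinite R" and mp: "\<And>\<gamma> \<gamma>' q. pac (mp \<gamma>) \<gamma>' = 0 \<Longrightarrow> pac q \<gamma> = 0 \<longleftrightarrow> pac q \<gamma>' = 0"
    "\<And>\<gamma>. mp \<gamma> \<noteq> 0" "\<And>\<gamma>. pac (mp \<gamma>) \<gamma> = 0"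
  shows "\<exists>T. T \<subseteq> R \<and> finite T \<and> card T = m \<and> (\<forall>\<gamma>\<in>T. \<forall>\<gamma>'\<in>T. \<gamma> \<noteq> \<gamma>' \<longrightarrow> pac (mp \<gamma>) \<gamma>' \<noteq> 0)"
proof (induction m)
  case 0
  show ?case by (intro exI[of _ "{}"]) simp
next
  case (Suc m)
  then obtain T where T: "T \<subseteq> R" "finite T" "card T = m" "\<And>\<gamma> \<gamma>'. \<gamma> \<in> T \<Longrightarrow> \<gamma>' \<in> T \<Longrightarrow> \<gamma> \<noteq> \<gamma>' \<Longrightarrow> pac (mp \<gamma>) \<gamma>' \<noteq> 0" by blast
  have "finite (\<Union>t\<in>T. {x. pac (mp t) x = 0})" using T(2) finite_pac_roots mp(2) by blast
  then obtain \<gamma> where \<gamma>: "\<gamma> \<in> R" "\<gamma> \<notin> (\<Union>t\<in>T. {x. pac (mp t) x = 0})" using R by (meson finite_subset subsetI)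
  have a: "pac (mp t) \<gamma> \<noteq> 0" if "t \<in> T" for t using \<gamma>(2) that by blast
  have b: "pac (mp \<gamma>) t \<noteq> 0" if "t \<in> T" for t
  proof
    assume "pac (mp \<gamma>) t = 0"
    hence "pac (mp t) \<gamma> = 0 \<longleftrightarrow> pac (mp t) t = 0" by (rule mp(1))
    thus False using a[OF that] mp(3) by simp
  qed
  have "\<gamma> \<notin> T" using a mp(3) by blast
  show ?case
  proof (intro exI[of _ "insert \<gamma> T"] conjI ballI impI)
    fix x y assume "x \<in> insert \<gamma> T" "y \<in> insert \<gamma> T" "x \<noteq> y"
    thus "pac (mp x) y \<noteq> 0" using a b T(4) by auto
  qed (use T \<gamma> \<open>\<gamma> \<notin> T\<close> in auto)
qed

text \<open>An orbit that avoids sufficiently many conjugacy classes outside B stays away from one of them inside B as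
  well, so along a subsequence its members are quotients of functions with bounded poles.\<close>

lemma bounded_subsequence:
  "\<exists>gg J c B'. degree gg > 0 \<and> infinite J \<and> (\<forall>n\<in>J. n \<ge> 1) \<and> finite B' \<and> S \<subseteq> B' \<and>
    (\<forall>p\<in>places k. c p > 0) \<and> (\<forall>p\<in>places k - B'. c p = 1) \<and>
    (\<forall>n\<in>J. \<forall>p\<in>places k. rep p (poly gg (xx n)) \<ge> c p * max 1 (rep p (xx n)) ^ degree gg)"
proof -
  obtain B R where B: "finite B" "S \<subseteq> B" and R: "infinite R" "conj_closed R" and avoid:
    "\<forall>\<gamma>\<in>R. \<exists>n0. \<forall>n\<ge>n0. \<forall>p\<in>places k - B. \<forall>w\<in>ext p. \<not> nonarch.cdist w (U n) (\<gamma>, 1) < 1"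
    using exists_avoided_set by (elim exE conjE)
  have "\<forall>\<gamma>. \<exists>g :: 'a poly. g \<noteq> 0 \<and> pac g \<gamma> = 0 \<and> (\<forall>\<gamma>'. pac g \<gamma>' = 0 \<longrightarrow> (\<forall>q. pac q \<gamma> = 0 \<longleftrightarrow> pac q \<gamma>' = 0))"
    using min_poly_conj by blast
  then obtain mp :: "'a alg_closure \<Rightarrow> 'a poly" where mp0: "\<forall>\<gamma>. mp \<gamma> \<noteq> 0 \<and> pac (mp \<gamma>) \<gamma> = 0 \<and>
      (\<forall>\<gamma>'. pac (mp \<gamma>) \<gamma>' = 0 \<longrightarrow> (\<forall>q. pac q \<gamma> = 0 \<longleftrightarrow> pac q \<gamma>' = 0))" by (rule choice[THEN exE])
  have mp: "mp \<gamma> \<noteq> 0" "pac (mp \<gamma>) \<gamma> = 0" for \<gamma> using mp0 by simp_all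
  have mpc: "pac q \<gamma> = 0 \<longleftrightarrow> pac q \<gamma>' = 0" if "pac (mp \<gamma>) \<gamma>' = 0" for \<gamma> \<gamma>' q using mp0 that by simp
  have dmp: "degree (mp \<gamma>) > 0" for \<gamma>
  proof (rule ccontr)
    assume "\<not> degree (mp \<gamma>) > 0"
    then obtain a where "mp \<gamma> = [:a:]" by (metis degree_eq_zeroE neq0_conv)
    thus False using mp[of \<gamma>] by auto
  qed
  \<comment> \<open>One conjugacy class more than there are places in B.\<close>
  obtain T where T: "T \<subseteq> R" "finite T" "card T = Suc (card B)"
    "\<And>\<gamma> \<gamma>'. \<gamma> \<in> T \<Longrightarrow> \<gamma>' \<in> T \<Longrightarrow> \<gamma> \<noteq> \<gamma>' \<Longrightarrow> pac (mp \<gamma>) \<gamma>' \<noteq> 0"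
    using independent_points[OF R(1) mpc mp, of "Suc (card B)"] by blast
  have roots: "x \<in> R" if "\<gamma> \<in> T" "pac (mp \<gamma>) x = 0" for \<gamma> x
    using R(2) T(1) that mpc[OF that(2)] unfolding conj_closed_def by blast
  define Rt where "Rt = (\<Union>\<gamma>\<in>T. {x. pac (mp \<gamma>) x = 0})"
  have Rt: "finite Rt" "Rt \<subseteq> R" using T(2) finite_pac_roots mp(1) roots by (auto simp: Rt_def)
  obtain m where m: "\<forall>\<gamma>\<in>R. \<forall>n\<ge>m \<gamma>. \<forall>p\<in>places k - B. \<forall>w\<in>ext p. \<not> nonarch.cdist w (U n) (\<gamma>, 1) < 1"
    using bchoice[OF avoid] by blast
  define n0 where "n0 = Max (insert 1 (m ` Rt))"
  have n0: "n0 \<ge> 1" "\<And>x. x \<in> Rt \<Longrightarrow> n0 \<ge> m x" unfolding n0_def using Rt(1) by (auto intro: Max_ge)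
  \<comment> \<open>All roots of the minimal polynomial lie in R, so outside B the orbit is
    incongruent to each of them and every linear factor is as large as possible.\<close>
  have far: "rep p (poly (mp \<gamma>) (xx n)) \<ge> rep p (lead_coeff (mp \<gamma>)) * max 1 (rep p (xx n)) ^ degree (mp \<gamma>)"
    if far_if: "\<gamma> \<in> T" "n \<ge> n0" "p \<in> places k - B" for \<gamma> n p
  proof -
    obtain w where w: "w \<in> ext p" using exists_ext far_if(3) by blast
    interpret w: nonarch w by (rule ext_nonarch[OF w])
    obtain M where M: "size M = degree (map_poly to_ac (mp \<gamma>))"
       "map_poly to_ac (mp \<gamma>) = smult (lead_coeff (map_poly to_ac (mp \<gamma>))) (\<Prod>x\<in>#M. [:- x, 1:])"
      using alg_closed_imp_factorization[of "map_poly to_ac (mp \<gamma>)"] mp(1)[of \<gamma>] unfolding map_poly_to_ac_eq_0 by blast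
    define cc where "cc = lead_coeff (map_poly to_ac (mp \<gamma>))"
    note M2 = M(2)[folded cc_def]
    define y where "y = to_ac (xx n)"
    have "w (poly (map_poly to_ac (mp \<gamma>)) y) \<ge> w cc * max 1 (w y) ^ size M"
    proof (rule w.poly_far_from_roots[OF M2])
      fix r assume r: "r \<in># M"
      have "pac (mp \<gamma>) r = 0" unfolding pac_def M2 using r by (auto simp: poly_prod_mset)
      hence rR: "r \<in> Rt" using far_if(1) by (auto simp: Rt_def)
      have "\<not> w.cdist (U n) (r, 1) < 1" using m Rt(2) rR n0(2)[OF rR] far_if(2,3) w by (meson le_trans subsetD)
      hence "w (y - r) / (max 1 (w y) * max 1 (w r)) \<ge> 1"
        using cdist_U_affine[OF w, of n r] far_if(2) n0(1) by (simp add: y_def)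
      moreover have "max 1 (w y) * max 1 (w r) > 0" by (intro mult_pos_pos) (auto simp: less_max_iff_disj)
      ultimately have "w (y - r) \<ge> max 1 (w y) * max 1 (w r)" by (simp only: le_divide_eq_1_pos)
      moreover have "max 1 (w y) * max 1 (w r) \<ge> max 1 (w y) * 1" by (intro mult_left_mono) auto
      ultimately show "w (y - r) \<ge> max 1 (w y)" by linarith
    qed
    moreover have "cc = to_ac (lead_coeff (mp \<gamma>))" by (simp add: cc_def degree_map_poly coeff_map_poly)
    moreover have "size M = degree (mp \<gamma>)" using M(1) by (simp add: degree_map_poly)
    moreover have "poly (map_poly to_ac (mp \<gamma>)) y = to_ac (poly (mp \<gamma>) (xx n))" by (simp add: y_def pac_def[symmetric])
    ultimately show ?thesis by (simp only: y_def ext_to_ac[OF w])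
  qed
  \<comment> \<open>At each place, no two of the minimal polynomials are small at the same x, since
    they are coprime; finitely many pairs allow one constant.\<close>
  have "\<forall>p\<in>places k. \<exists>e>0. \<forall>\<gamma>\<in>T. \<forall>\<gamma>'\<in>T. \<gamma> \<noteq> \<gamma>' \<longrightarrow> (\<forall>x. rep p (poly (mp \<gamma>) x) \<ge> e * max 1 (rep p x) ^ degree (mp \<gamma>) \<or>
       rep p (poly (mp \<gamma>') x) \<ge> e * max 1 (rep p x) ^ degree (mp \<gamma>'))"
  proof
    fix p assume p: "p \<in> places k"
    interpret v: nonarch "rep p" by (rule place_nonarch[OF p])
    define T2 where "T2 = {(\<gamma>, \<gamma>'). \<gamma> \<in> T \<and> \<gamma>' \<in> T \<and> \<gamma> \<noteq> \<gamma>'}"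
    have finT2: "finite T2" by (rule finite_subset[of _ "T \<times> T"]) (use T(2) in \<open>auto simp: T2_def\<close>)
    have "\<forall>x\<in>T2. \<exists>e>0. \<forall>y. rep p (poly (mp (fst x)) y) \<ge> e * max 1 (rep p y) ^ degree (mp (fst x)) \<or>
       rep p (poly (mp (snd x)) y) \<ge> e * max 1 (rep p y) ^ degree (mp (snd x))"
    proof
      fix x assume x: "x \<in> T2"
      have "\<exists>a b. a * mp (fst x) + b * mp (snd x) = 1"
      proof (rule bezout_field_poly)
        fix \<rho> assume r: "pac (mp (fst x)) \<rho> = 0"
        show "pac (mp (snd x)) \<rho> \<noteq> 0"
        proof
          assume "pac (mp (snd x)) \<rho> = 0"
          hence "pac (mp (fst x)) (snd x) = 0 \<longleftrightarrow> pac (mp (fst x)) \<rho> = 0" by (rule mpc)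
          thus False using r T(4)[of "fst x" "snd x"] x by (auto simp: T2_def)
        qed
      qed
      then obtain a b where "a * mp (fst x) + b * mp (snd x) = 1" by blast
      thus "\<exists>e>0. \<forall>y. rep p (poly (mp (fst x)) y) \<ge> e * max 1 (rep p y) ^ degree (mp (fst x)) \<or>
       rep p (poly (mp (snd x)) y) \<ge> e * max 1 (rep p y) ^ degree (mp (snd x))"
        by (rule v.coprime_values[OF dmp dmp])
    qed
    then obtain e where e: "\<forall>x\<in>T2. e x > 0 \<and> (\<forall>y. rep p (poly (mp (fst x)) y) \<ge> e x * max 1 (rep p y) ^ degree (mp (fst x)) \<or>
       rep p (poly (mp (snd x)) y) \<ge> e x * max 1 (rep p y) ^ degree (mp (snd x)))" by (rule bchoice[THEN exE])
    define \<epsilon> where "\<epsilon> = Min (insert 1 (e ` T2))"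
    have \<epsilon>: "\<epsilon> > 0" unfolding \<epsilon>_def using finT2 e by (subst Min_gr_iff) auto
    have \<epsilon>le: "\<epsilon> \<le> e x" if "x \<in> T2" for x unfolding \<epsilon>_def using finT2 that by (intro Min_le) auto
    show "\<exists>e>0. \<forall>\<gamma>\<in>T. \<forall>\<gamma>'\<in>T. \<gamma> \<noteq> \<gamma>' \<longrightarrow> (\<forall>x. rep p (poly (mp \<gamma>) x) \<ge> e * max 1 (rep p x) ^ degree (mp \<gamma>) \<or>
       rep p (poly (mp \<gamma>') x) \<ge> e * max 1 (rep p x) ^ degree (mp \<gamma>'))"
    proof (intro exI[of _ \<epsilon>] conjI ballI impI allI \<epsilon>)
      fix \<gamma> \<gamma>' y assume "\<gamma> \<in> T" "\<gamma>' \<in> T" "\<gamma> \<noteq> \<gamma>'"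
      hence x: "(\<gamma>, \<gamma>') \<in> T2" by (simp add: T2_def)
      have le: "\<epsilon> * max 1 (rep p y) ^ n \<le> e (\<gamma>, \<gamma>') * max 1 (rep p y) ^ n" for n
        using \<epsilon>le[OF x] by (intro mult_right_mono) (auto simp: le_max_iff_disj)
      have "rep p (poly (mp \<gamma>) y) \<ge> e (\<gamma>, \<gamma>') * max 1 (rep p y) ^ degree (mp \<gamma>) \<or>
         rep p (poly (mp \<gamma>') y) \<ge> e (\<gamma>, \<gamma>') * max 1 (rep p y) ^ degree (mp \<gamma>')"
        using e[rule_format, OF x] by simp
      thus "rep p (poly (mp \<gamma>) y) \<ge> \<epsilon> * max 1 (rep p y) ^ degree (mp \<gamma>) \<or>
         rep p (poly (mp \<gamma>') y) \<ge> \<epsilon> * max 1 (rep p y) ^ degree (mp \<gamma>')"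
        using le[of "degree (mp \<gamma>)"] le[of "degree (mp \<gamma>')"] by linarith
    qed
  qed
  then obtain \<epsilon> where \<epsilon>: "\<forall>p\<in>places k. \<epsilon> p > 0 \<and> (\<forall>\<gamma>\<in>T. \<forall>\<gamma>'\<in>T. \<gamma> \<noteq> \<gamma>' \<longrightarrow> (\<forall>x. rep p (poly (mp \<gamma>) x) \<ge> \<epsilon> p * max 1 (rep p x) ^ degree (mp \<gamma>) \<or>
       rep p (poly (mp \<gamma>') x) \<ge> \<epsilon> p * max 1 (rep p x) ^ degree (mp \<gamma>')))" by (rule bchoice[THEN exE])
  \<comment> \<open>The classes whose polynomial is small at the n-th orbit point; coprimality
    leaves at most one of them at each place.\<close>
  define bad where "bad = (\<lambda>n p. {\<gamma>\<in>T. p \<in> places k \<and> rep p (poly (mp \<gamma>) (xx n)) < \<epsilon> p * max 1 (rep p (xx n)) ^ degree (mp \<gamma>)})"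
  have bad1: "card (bad n p) \<le> 1" for n p
  proof -
    have "\<gamma> = \<gamma>'" if "\<gamma> \<in> bad n p" "\<gamma>' \<in> bad n p" for \<gamma> \<gamma>'
    proof (rule ccontr)
      assume ne: "\<gamma> \<noteq> \<gamma>'"
      have p: "p \<in> places k" and TT: "\<gamma> \<in> T" "\<gamma>' \<in> T" using that by (auto simp: bad_def)
      have "rep p (poly (mp \<gamma>) (xx n)) \<ge> \<epsilon> p * max 1 (rep p (xx n)) ^ degree (mp \<gamma>) \<or>
       rep p (poly (mp \<gamma>') (xx n)) \<ge> \<epsilon> p * max 1 (rep p (xx n)) ^ degree (mp \<gamma>')" using \<epsilon> p TT ne by blast
      thus False using that by (auto simp: bad_def)
    qed
    moreover have "finite (bad n p)" using T(2) by (simp add: bad_def)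
    ultimately show ?thesis by (simp add: card_le_Suc0_iff_eq)
  qed
  have ex: "\<exists>\<gamma>\<in>T. \<forall>p\<in>B. \<gamma> \<notin> bad n p" for n
  proof (rule ccontr)
    assume "\<not> (\<exists>\<gamma>\<in>T. \<forall>p\<in>B. \<gamma> \<notin> bad n p)"
    hence "T \<subseteq> (\<Union>p\<in>B. bad n p)" by blast
    moreover have "finite (\<Union>p\<in>B. bad n p)" using B(1) T(2) by (auto simp: bad_def)
    ultimately have "card T \<le> card (\<Union>p\<in>B. bad n p)" by (rule card_mono[rotated])
    also have "\<dots> \<le> (\<Sum>p\<in>B. card (bad n p))" by (rule card_UN_le[OF B(1)])
    also have "\<dots> \<le> (\<Sum>p\<in>B. 1)" by (intro sum_mono bad1)
    finally show False using T(3) by simp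
  qed
  \<comment> \<open>The class that is harmless throughout B depends on n, but one of the finitely
    many classes occurs for infinitely many n.\<close>
  have "\<exists>\<gamma>\<in>T. infinite {n\<in>{n0..}. \<forall>p\<in>B. \<gamma> \<notin> bad n p}"
    using pigeonhole_infinite_rel[of "{n0..}" T "\<lambda>n \<gamma>. \<forall>p\<in>B. \<gamma> \<notin> bad n p"] T(2) ex infinite_Ici by blast
  then obtain \<gamma> where \<gamma>: "\<gamma> \<in> T" "infinite {n\<in>{n0..}. \<forall>p\<in>B. \<gamma> \<notin> bad n p}" by blast
  define c where "c = (\<lambda>p. if p \<in> B then \<epsilon> p else rep p (lead_coeff (mp \<gamma>)))"
  have lc: "lead_coeff (mp \<gamma>) \<noteq> 0" using mp(1) by simp
  define J where "J = {n\<in>{n0..}. \<forall>p\<in>B. \<gamma> \<notin> bad n p}"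
  define B' where "B' = B \<union> {p\<in>places k. rep p (lead_coeff (mp \<gamma>)) \<noteq> 1}"
  have "\<forall>n\<in>J. n \<ge> 1" using n0(1) by (auto simp: J_def)
  moreover have "finite B'" using B(1) finite_nonunits[OF lc] by (simp add: B'_def)
  moreover have "S \<subseteq> B'" using B(2) by (auto simp: B'_def)
  moreover have "c p > 0" if "p \<in> places k" for p
  proof (cases "p \<in> B")
    case True
    thus ?thesis using \<epsilon> that by (simp add: c_def)
  next
    case False
    have "rep p (lead_coeff (mp \<gamma>)) > 0" using lc nonarch.pos_iff[OF place_nonarch[OF that]] by blast
    thus ?thesis using False by (simp add: c_def)
  qed
  moreover have "c p = 1" if "p \<in> places k - B'" for p
    using that by (auto simp: c_def B'_def)
  moreover have "rep p (poly (mp \<gamma>) (xx n)) \<ge> c p * max 1 (rep p (xx n)) ^ degree (mp \<gamma>)"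
    if n: "n \<in> J" and p: "p \<in> places k" for n p
  proof (cases "p \<in> B")
    case True
    hence "\<gamma> \<notin> bad n p" using n by (simp add: J_def)
    thus ?thesis using \<gamma>(1) p True by (simp add: bad_def c_def not_less)
  next
    case False
    thus ?thesis using far[OF \<gamma>(1), of n p] n p by (simp add: c_def J_def)
  qed
  ultimately show ?thesis using dmp \<gamma>(2) unfolding J_def[symmetric]
    by (intro exI[of _ "mp \<gamma>"] exI[of _ J] exI[of _ c] exI[of _ B']) simp
qed

theorem no_accumulating: False
proof -
  obtain gg J c B' where D: "degree gg > 0" and J: "infinite J" "\<forall>n\<in>J. n \<ge> 1" and B': "finite B'" "S \<subseteq> B'"
    and c: "\<forall>p\<in>places k. c p > 0" "\<forall>p\<in>places k - B'. c p = 1"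
    and lower: "\<forall>n\<in>J. \<forall>p\<in>places k. rep p (poly gg (xx n)) \<ge> c p * max 1 (rep p (xx n)) ^ degree gg"
    using bounded_subsequence by (elim exE conjE)
  \<comment> \<open>The bound for the quotient \<open>ff\<close>: a factor \<open>1 / c p\<close>
    from each of its two denominators.\<close>
  define C where "C = (\<lambda>p. 1 / (c p * c p))"
  \<comment> \<open>T will avoid these places, so that the orbit is eventually periodic modulo each
    place of T.\<close>
  define Av where "Av = B' \<union> {p\<in>places k. \<exists>w\<in>ext p. \<not> good w}"
  have finAv: "finite Av" using B'(1) ae_good by (simp add: Av_def ae_def)
  obtain T where T: "finite T" "T \<subseteq> places k - Av"
    and sep: "\<And>f. (\<And>p. p \<in> places k \<Longrightarrow> rep p f \<le> C p) \<Longrightarrow> (\<And>p. p \<in> T \<Longrightarrow> rep p f < 1) \<Longrightarrow> f = 0"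
  proof (rule separating_places[of B' C Av])
    show "C p \<le> 1" if "p \<in> places k - B'" for p using c(2) that by (simp add: C_def)
  qed (use B'(1) finAv in auto)
  have "\<forall>p\<in>T. \<exists>x. snd x > 0 \<and> (\<forall>n l. n \<ge> fst x \<longrightarrow>
     nonarch.cdist (rep p) ((phi ^^ n) (1, 0)) ((phi ^^ (n + l * snd x)) (1, 0)) < 1)"
  proof
    fix p assume p: "p \<in> T"
    have pS: "p \<in> places k - S" using p T(2) B'(2) by (auto simp: Av_def)
    obtain w where w: "w \<in> ext p" using exists_ext pS by blast
    have good: "good w" using p T(2) w by (auto simp: Av_def)
    obtain m e where e: "e > 0" and per: "\<forall>n w l. n \<ge> m \<longrightarrow> w \<in> ext p \<longrightarrow> good w \<longrightarrow> nonarch.cdist w (U n) (U (n + l * e)) < 1"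
      using eventually_periodic[OF pS] by (elim exE conjE)
    have "nonarch.cdist (rep p) ((phi ^^ n) (1, 0)) ((phi ^^ (n + l * e)) (1, 0)) < 1" if "n \<ge> m" for n l
    proof -
      have "nonarch.cdist w (U n) (U (n + l * e)) < 1" using per that w good by blast
      thus ?thesis unfolding U_emb using cdist_emb[OF _ w] pS by simp
    qed
    thus "\<exists>x. snd x > 0 \<and> (\<forall>n l. n \<ge> fst x \<longrightarrow>
     nonarch.cdist (rep p) ((phi ^^ n) (1, 0)) ((phi ^^ (n + l * snd x)) (1, 0)) < 1)"
      using e by (intro exI[of _ "(m, e)"]) simp
  qed
  then obtain me where me: "\<forall>p\<in>T. snd (me p) > 0 \<and> (\<forall>n l. n \<ge> fst (me p) \<longrightarrow>
     nonarch.cdist (rep p) ((phi ^^ n) (1, 0)) ((phi ^^ (n + l * snd (me p))) (1, 0)) < 1)" by (rule bchoice[THEN exE])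
  \<comment> \<open>A common multiple of the periods at the places of T: large indices that agree
    modulo E give congruent points at all of them.\<close>
  define E where "E = (\<Prod>p\<in>T. snd (me p))"
  have E: "E > 0" unfolding E_def using me by (intro prod_pos) blast
  define m where "m = Max (insert 0 ((\<lambda>p. fst (me p)) ` T))"
  have m: "fst (me p) \<le> m" if "p \<in> T" for p unfolding m_def using T(1) that by (intro Max_ge) auto
  define J' where "J' = {n\<in>J. n \<ge> m}"
  have "infinite J'"
  proof
    assume "finite J'"
    hence "finite (J' \<union> {..<m})" by simp
    moreover have "J \<subseteq> J' \<union> {..<m}" by (auto simp: J'_def)
    ultimately show False using J(1) finite_subset by blast
  qed
  moreover have "finite ((\<lambda>n. n mod E) ` J')" by (rule finite_subset[of _ "{..<E}"]) (use E in auto)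
  ultimately obtain a0 where a0: "infinite {n\<in>J'. n mod E = a0 mod E}"
    using pigeonhole_infinite[of J' "\<lambda>n. n mod E"] by blast
  hence "{n\<in>J'. n mod E = a0 mod E} \<noteq> {}" by (rule infinite_imp_nonempty)
  then obtain n where n: "n \<in> J'" "n mod E = a0 mod E" by blast
  have "infinite ({n\<in>J'. n mod E = a0 mod E} - {..n})" using a0 by (rule Diff_infinite_finite[rotated]) simp
  then obtain n' where n': "n' \<in> {n\<in>J'. n mod E = a0 mod E} - {..n}" using infinite_imp_nonempty by blast
  hence n'J: "n' \<in> J'" "n' mod E = n mod E" "n' > n" using n by auto
  have nJ: "n \<in> J" "n' \<in> J" "n \<ge> 1" "n' \<ge> 1" "n \<ge> m" using n n'J J(2) by (auto simp: J'_def)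
  have close: "nonarch.cdist (rep p) ((phi ^^ n) (1, 0)) ((phi ^^ n') (1, 0)) < 1" if p: "p \<in> T" for p
  proof -
    have "E dvd n' - n" using n'J(2,3) by (metis less_imp_le mod_eq_dvd_iff_nat)
    moreover have "snd (me p) dvd E" unfolding E_def using T(1) p by (rule dvd_prodI)
    ultimately have "snd (me p) dvd n' - n" by (rule dvd_trans[rotated])
    then obtain l where "n' - n = snd (me p) * l" by (auto simp: dvd_def)
    hence "n' = n + l * snd (me p)" using n'J(3) by (simp add: mult.commute)
    thus ?thesis using me p m[OF p] nJ(5) by simp
  qed
  define G1 where "G1 = poly gg (xx n)"
  define G2 where "G2 = poly gg (xx n')"
  define ff where "ff = (xx n - xx n') / (G1 * G2)"
  have bound: "rep p ff \<le> nonarch.cdist (rep p) ((phi ^^ n) (1, 0)) ((phi ^^ n') (1, 0)) * C p" and nz: "G1 \<noteq> 0" "G2 \<noteq> 0"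
    if p: "p \<in> places k" for p
  proof -
    interpret v: nonarch "rep p" by (rule place_nonarch[OF p])
    define M1 where "M1 = max 1 (rep p (xx n))"
    define M2 where "M2 = max 1 (rep p (xx n'))"
    have M: "M1 \<ge> 1" "M2 \<ge> 1" by (simp_all add: M1_def M2_def)
    have cp: "c p > 0" using c(1) p by blast
    \<comment> \<open>One power of M in each denominator absorbs the growth of
      \<open>xx n - xx n'\<close>; the positive degree of \<open>gg\<close> provides it.\<close>
    have self: "M \<le> M ^ degree gg" if "M \<ge> 1" for M :: real using D that by (simp add: self_le_power)
    have L1: "rep p G1 \<ge> c p * M1"
    proof -
      have "c p * M1 \<le> c p * M1 ^ degree gg" using cp self[OF M(1)] by (intro mult_left_mono) auto
      thus ?thesis using lower nJ(1) p unfolding G1_def M1_def by fastforce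
    qed
    have L2: "rep p G2 \<ge> c p * M2"
    proof -
      have "c p * M2 \<le> c p * M2 ^ degree gg" using cp self[OF M(2)] by (intro mult_left_mono) auto
      thus ?thesis using lower nJ(2) p unfolding G2_def M2_def by fastforce
    qed
    have pos: "c p * M1 > 0" "c p * M2 > 0" using cp M by simp_all
    show "G1 \<noteq> 0" using L1 pos by auto
    show "G2 \<noteq> 0" using L2 pos by auto
    have "rep p ff = rep p (xx n - xx n') / (rep p G1 * rep p G2)" by (simp add: ff_def v.divide v.mult)
    also have "\<dots> \<le> rep p (xx n - xx n') / ((c p * M1) * (c p * M2))"
    proof (rule divide_left_mono)
      show "c p * M1 * (c p * M2) \<le> rep p G1 * rep p G2" using L1 L2 pos by (intro mult_mono) auto
      have "rep p G1 > 0" "rep p G2 > 0" using L1 L2 pos by linarith+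
      thus "0 < rep p G1 * rep p G2 * (c p * M1 * (c p * M2))" using pos by (metis mult_pos_pos)
    qed simp
    also have "\<dots> = rep p (xx n - xx n') / (M1 * M2) * C p" by (simp add: C_def field_simps)
    also have "rep p (xx n - xx n') / (M1 * M2) = v.cdist ((phi ^^ n) (1, 0)) ((phi ^^ n') (1, 0))"
      using cdist_xx[OF p nJ(3,4)] by (simp add: M1_def M2_def)
    finally show "rep p ff \<le> v.cdist ((phi ^^ n) (1, 0)) ((phi ^^ n') (1, 0)) * C p" .
  qed
  have "ff = 0"
  proof (rule sep)
    fix p assume p: "p \<in> places k"
    have "C p \<ge> 0" by (simp add: C_def)
    hence "nonarch.cdist (rep p) ((phi ^^ n) (1, 0)) ((phi ^^ n') (1, 0)) * C p \<le> 1 * C p"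
      by (intro mult_right_mono nonarch.cdist_le_1[OF place_nonarch[OF p]])
    thus "rep p ff \<le> C p" using bound[OF p] by simp
  next
    fix p assume p: "p \<in> T"
    hence pp: "p \<in> places k" "p \<in> places k - B'" using T(2) by (auto simp: Av_def)
    hence "C p = 1" using c(2) by (simp add: C_def)
    thus "rep p ff < 1" using bound[OF pp(1)] close[OF p] by simp
  qed
  moreover obtain p where "p \<in> places k" using infinite_places infinite_imp_nonempty by blast
  ultimately have "xx n = xx n'" using nz by (auto simp: ff_def)
  thus False using wedge_affine[OF nJ(3,4)] n'J(3) by simp
qed

end

section \<open>Change of coordinates\<close>

lemma map_poly_to_ac_add: "map_poly to_ac (p + q) = map_poly to_ac p + map_poly to_ac q"
  and map_poly_to_ac_diff: "map_poly to_ac (p - q) = map_poly to_ac p - map_poly to_ac q"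
  and map_poly_to_ac_smult: "map_poly to_ac (smult c p) = smult (to_ac c) (map_poly to_ac p)"
  and map_poly_to_ac_mult: "map_poly to_ac (p * q) = map_poly to_ac p * map_poly to_ac q"
  by (rule poly_eqI, simp add: coeff_map_poly coeff_mult to_ac_sum)+

lemma map_poly_to_ac_power: "map_poly to_ac (p ^ n) = map_poly to_ac p ^ n"
  by (induction n) (simp_all add: map_poly_to_ac_mult)

lemma map_poly_to_ac_sum: "map_poly to_ac (sum p I) = (\<Sum>i\<in>I. map_poly to_ac (p i))"
  by (induction I rule: infinite_finite_induct) (simp_all add: map_poly_to_ac_add)

lemma map_poly_fsubst: "map_poly to_ac (fsubst d f P Q) = fsubst d (map_poly to_ac f) (map_poly to_ac P) (map_poly to_ac Q)"
  by (simp add: fsubst_def map_poly_to_ac_sum map_poly_to_ac_smult map_poly_to_ac_mult map_poly_to_ac_power coeff_map_poly)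

definition lin :: "'b::field \<Rightarrow> 'b \<Rightarrow> 'b \<Rightarrow> 'b \<Rightarrow> 'b \<times> 'b \<Rightarrow> 'b \<times> 'b" where
  "lin a c b e u = (a * fst u + c * snd u, b * fst u + e * snd u)"

context dynamics
begin

lemma phi_scale: "phi (c * x, c * y) = (c ^ d * fst (phi (x, y)), c ^ d * snd (phi (x, y)))"
  by (simp add: phi_def hform_scale)

text \<open>Conjugation by a matrix M with M(1, 0) = s. The adjugate N stands for the inverse, which
  keeps all formulas polynomial at the price of scalars. At each place N expands chordal distances
  by a bounded factor at most, hence preserves accumulation.\<close>

theorem no_everywhere_accumulating:
  assumes finS: "finite S" and finZ: "finite Z" and Znz: "\<And>z. z \<in> Z \<Longrightarrow> z \<noteq> (0, 0)" and s: "s \<noteq> (0, 0)"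
    and wandering: "\<And>m n. m \<noteq> n \<Longrightarrow> wedge ((phi ^^ m) s) ((phi ^^ n) s) \<noteq> 0"
    and acc: "\<And>p. p \<in> places k - S \<Longrightarrow>
      \<exists>z\<in>Z. \<forall>e>0. \<forall>n0. \<exists>n\<ge>n0. nonarch.cdist (rep p) ((phi ^^ n) s) z < e"
  shows False
proof -
  obtain a b where ab: "s = (a, b)" by (cases s)
  have "\<exists>c e. a * e - b * c \<noteq> 0"
  proof (cases "b = 0")
    case True
    hence "a * 1 - b * 0 \<noteq> 0" using s ab by simp
    thus ?thesis by blast
  next
    case False
    hence "a * 0 - b * 1 \<noteq> 0" by simp
    thus ?thesis by blast
  qed
  then obtain c e where D: "a * e - b * c \<noteq> 0" by blast
  define \<Delta> where "\<Delta> = a * e - b * c"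
  have Dnz: "\<Delta> \<noteq> 0" using D by (simp add: \<Delta>_def)
  define M where "M = lin a c b e"
  define N where "N = lin e (- c) (- b) a"
  have MN: "M (N u) = (\<Delta> * fst u, \<Delta> * snd u)" and NM: "N (M u) = (\<Delta> * fst u, \<Delta> * snd u)" for u
    by (simp_all add: M_def N_def lin_def \<Delta>_def algebra_simps)
  have N_scale: "N (t * x, t * y) = (t * fst (N (x, y)), t * snd (N (x, y)))"
    and M_scale: "M (t * x, t * y) = (t * fst (M (x, y)), t * snd (M (x, y)))" for t x y
    by (simp_all add: M_def N_def lin_def algebra_simps)
  have wN: "wedge (N u) (N w) = \<Delta> * wedge u w" for u w
    by (simp add: N_def lin_def wedge_def \<Delta>_def algebra_simps)
  have N0: "N u \<noteq> (0, 0)" if "u \<noteq> (0, 0)" for u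
  proof
    assume "N u = (0, 0)"
    hence "M (N u) = (0, 0)" by (simp add: M_def lin_def)
    thus False using MN[of u] Dnz that by (auto simp: prod_eq_iff)
  qed
  define P where "P = [:c, a:]"
  define Q where "Q = [:e, b:]"
  have dPQ: "degree P \<le> 1" "degree Q \<le> 1" by (simp_all add: P_def Q_def)
  have Mform: "M u = (hform 1 P u, hform 1 Q u)" for u
    by (simp add: M_def lin_def hform_def P_def Q_def algebra_simps)
  \<comment> \<open>The pair of forms of the composition of M, phi and N.\<close>
  define f' where "f' = smult e (fsubst d f P Q) - smult c (fsubst d g P Q)"
  define g' where "g' = smult a (fsubst d g P Q) - smult b (fsubst d f P Q)"
  have deg': "degree f' \<le> d" "degree g' \<le> d"
    unfolding f'_def g'_def using fsubst_degree[OF dPQ, of d f] fsubst_degree[OF dPQ, of d g]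
    by (auto intro!: degree_diff_le intro: order_trans[OF degree_smult_le])
  have hdiff: "hform d (p - q) u = hform d p u - hform d q u" for p q :: "'c::field poly" and u
    using hform_add[of d "p - q" q u] by simp
  have phi': "(hform d f' u, hform d g' u) = N (phi (M u))" for u
    using hform_fsubst[OF dPQ, of d f u] hform_fsubst[OF dPQ, of d g u]
    by (simp add: f'_def g'_def hdiff hform_smult phi_def Mform[unfolded One_nat_def, symmetric] N_def lin_def)
  interpret T: dynamics k d f' g'
  proof
    show "d \<ge> 2" "degree f' \<le> d" "degree g' \<le> d" using d2 deg' by auto
    fix u :: "'a alg_closure \<times> 'a alg_closure"
    define PL where "PL = map_poly to_ac P"
    define QL where "QL = map_poly to_ac Q"
    have dL: "degree PL \<le> 1" "degree QL \<le> 1" using dPQ by (simp_all add: PL_def QL_def degree_map_poly)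
    define t where "t = (hform 1 PL u, hform 1 QL u)"
    assume "hform d (map_poly to_ac f') u = 0" "hform d (map_poly to_ac g') u = 0"
    hence 1: "to_ac e * fst (Phi t) - to_ac c * snd (Phi t) = 0" and 2: "to_ac a * snd (Phi t) - to_ac b * fst (Phi t) = 0"
      using hform_fsubst[OF dL, of d "map_poly to_ac f" u] hform_fsubst[OF dL, of d "map_poly to_ac g" u]
      by (simp_all add: f'_def g'_def map_poly_to_ac_diff map_poly_to_ac_smult map_poly_fsubst hdiff hform_smult
            Phi_def t_def PL_def QL_def)
    have "to_ac \<Delta> * fst (Phi t) = to_ac a * (to_ac e * fst (Phi t) - to_ac c * snd (Phi t)) + to_ac c * (to_ac a * snd (Phi t) - to_ac b * fst (Phi t))"
      "to_ac \<Delta> * snd (Phi t) = to_ac b * (to_ac e * fst (Phi t) - to_ac c * snd (Phi t)) + to_ac e * (to_ac a * snd (Phi t) - to_ac b * fst (Phi t))"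
      by (simp_all add: \<Delta>_def algebra_simps)
    hence "Phi t = (0, 0)" unfolding 1 2 using Dnz by (simp add: prod_eq_iff)
    hence t0: "t = (0, 0)" using Phi_nz by blast
    have PQ: "hform 1 PL u = to_ac a * fst u + to_ac c * snd u" "hform 1 QL u = to_ac b * fst u + to_ac e * snd u"
      by (simp_all add: PL_def QL_def P_def Q_def hform_def coeff_map_poly algebra_simps)
    have "to_ac a * fst u + to_ac c * snd u = 0" "to_ac b * fst u + to_ac e * snd u = 0"
      using t0 PQ by (simp_all add: t_def)
    moreover have "to_ac \<Delta> * fst u = to_ac e * (to_ac a * fst u + to_ac c * snd u) - to_ac c * (to_ac b * fst u + to_ac e * snd u)"
      "to_ac \<Delta> * snd u = to_ac a * (to_ac b * fst u + to_ac e * snd u) - to_ac b * (to_ac a * fst u + to_ac c * snd u)"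
      by (simp_all add: \<Delta>_def algebra_simps)
    ultimately have "to_ac \<Delta> * fst u = 0" "to_ac \<Delta> * snd u = 0" by simp_all
    thus "u = (0, 0)" using Dnz by (simp add: prod_eq_iff)
  qed
  have Tphi: "T.phi u = N (phi (M u))" for u using phi'[of u] by (simp add: T.phi_def)
  have M1: "M (1, 0) = s" by (simp add: M_def lin_def ab)
  \<comment> \<open>The two orbits correspond only up to scalars, because M N is multiplication by
    \<Delta> and phi is homogeneous of degree d.\<close>
  have conj: "\<exists>t. t \<noteq> 0 \<and> (T.phi ^^ n) (1, 0) = (t * fst (N ((phi ^^ n) s)), t * snd (N ((phi ^^ n) s)))" for n
  proof (induction n)
    case 0
    have "N s = (\<Delta>, 0)" using NM[of "(1, 0)"] M1 by simp
    thus ?case using Dnz by (intro exI[of _ "inverse \<Delta>"]) simp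
  next
    case (Suc n)
    then obtain t where t: "t \<noteq> 0" "(T.phi ^^ n) (1, 0) = (t * fst (N ((phi ^^ n) s)), t * snd (N ((phi ^^ n) s)))" by blast
    define y where "y = (phi ^^ n) s"
    have "M ((T.phi ^^ n) (1, 0)) = (t * \<Delta> * fst y, t * \<Delta> * snd y)"
      unfolding t(2) M_scale y_def[symmetric] prod.collapse MN by (simp add: mult.assoc)
    hence "(T.phi ^^ Suc n) (1, 0) = N ((t * \<Delta>) ^ d * fst (phi y), (t * \<Delta>) ^ d * snd (phi y))"
      by (simp add: Tphi phi_scale)
    also have "\<dots> = ((t * \<Delta>) ^ d * fst (N (phi y)), (t * \<Delta>) ^ d * snd (N (phi y)))" by (simp add: N_scale)
    finally have "(T.phi ^^ Suc n) (1, 0) = ((t * \<Delta>) ^ d * fst (N ((phi ^^ Suc n) s)), (t * \<Delta>) ^ d * snd (N ((phi ^^ Suc n) s)))"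
      by (simp add: y_def)
    thus ?case using t(1) Dnz by (intro exI[of _ "(t * \<Delta>) ^ d"]) simp
  qed
  have pnz: "(phi ^^ n) s \<noteq> (0, 0)" for n by (rule phi_pow_nz[OF s])
  interpret accumulating k d f' g' S "N ` Z"
  proof
    show "finite S" "finite (N ` Z)" using finS finZ by auto
    show "z \<noteq> (0, 0)" if "z \<in> N ` Z" for z using that N0[OF Znz] by (elim imageE) simp
    show "wedge ((T.phi ^^ m) (1, 0)) ((T.phi ^^ n) (1, 0)) \<noteq> 0" if mn: "m \<noteq> n" for m n
    proof -
      obtain t where t: "t \<noteq> 0" "(T.phi ^^ m) (1, 0) = (t * fst (N ((phi ^^ m) s)), t * snd (N ((phi ^^ m) s)))" using conj by blast
      obtain r where r: "r \<noteq> 0" "(T.phi ^^ n) (1, 0) = (r * fst (N ((phi ^^ n) s)), r * snd (N ((phi ^^ n) s)))" using conj by blast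
      have "wedge ((T.phi ^^ m) (1, 0)) ((T.phi ^^ n) (1, 0)) = t * r * wedge (N ((phi ^^ m) s)) (N ((phi ^^ n) s))"
        unfolding t(2) r(2) by (simp add: wedge_def algebra_simps)
      thus ?thesis using wandering[OF mn] t(1) r(1) Dnz by (simp add: wN)
    qed
    fix p assume p: "p \<in> places k - S"
    hence pk: "p \<in> places k" by blast
    interpret v: nonarch "rep p" by (rule place_nonarch[OF pk])
    obtain z where z: "z \<in> Z" "\<forall>e>0. \<forall>n0. \<exists>n\<ge>n0. v.cdist ((phi ^^ n) s) z < e" using acc[OF p] by blast
    define C where "C = max (max (rep p a) (rep p b)) (max (rep p c) (rep p e))"
    have C: "rep p a \<le> C" "rep p b \<le> C" "rep p c \<le> C" "rep p e \<le> C" by (auto simp: C_def)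
    have pn: "rep p \<Delta> * v.pnorm u \<le> C * v.pnorm (N u)" for u
    proof -
      have C0: "C \<ge> 0" using C(1) v.nonneg[of a] by linarith
      have le: "rep p (x * fst (N u) + y * snd (N u)) \<le> C * v.pnorm (N u)" if "rep p x \<le> C" "rep p y \<le> C" for x y
      proof -
        have "rep p (x * fst (N u)) \<le> C * v.pnorm (N u)" "rep p (y * snd (N u)) \<le> C * v.pnorm (N u)"
          unfolding v.mult using that C0 by (intro mult_mono; simp add: v.pnorm_def)+
        thus ?thesis using v.ultra[of "x * fst (N u)" "y * snd (N u)"] by linarith
      qed
      have "rep p \<Delta> * v.pnorm u = v.pnorm (M (N u))" using v.pnorm_scale[of \<Delta> "fst u" "snd u"] by (simp add: MN)
      also have "\<dots> \<le> C * v.pnorm (N u)" unfolding v.pnorm_def[of "M (N u)"] using le C by (simp add: M_def lin_def)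
      finally show ?thesis .
    qed
    have Dp: "rep p \<Delta> > 0" using Dnz by simp
    have Cp: "C > 0"
    proof (rule ccontr)
      assume "\<not> C > 0"
      hence "C * v.pnorm (N (1, 1)) \<le> 0" by (intro mult_nonpos_nonneg) auto
      moreover have "rep p \<Delta> * v.pnorm (1, 1) > 0" using Dp v.pnorm_pos[of "(1, 1)"] by simp
      ultimately show False using pn[of "(1, 1)"] by linarith
    qed
    \<comment> \<open>Each of the two norms can lose a factor |\<Delta>| / C, while the wedge gains
      one factor |\<Delta>|.\<close>
    define K where "K = C ^ 2 / rep p \<Delta>"
    have Kp: "K > 0" using Cp Dp by (simp add: K_def)
    have lip: "v.cdist (N u) (N y) \<le> K * v.cdist u y" if u: "u \<noteq> (0, 0)" and y: "y \<noteq> (0, 0)" for u y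
    proof -
      have pu: "v.pnorm u > 0" "v.pnorm y > 0" using u y by (auto intro: v.pnorm_pos)
      have pN: "v.pnorm (N u) > 0" "v.pnorm (N y) > 0" using v.pnorm_pos[OF N0[OF u]] v.pnorm_pos[OF N0[OF y]] .
      have pNu: "v.pnorm (N u) \<ge> rep p \<Delta> / C * v.pnorm u" "v.pnorm (N y) \<ge> rep p \<Delta> / C * v.pnorm y"
        using pn[of u] pn[of y] Cp by (simp_all add: field_simps)
      have "v.cdist (N u) (N y) = rep p \<Delta> * rep p (wedge u y) / (v.pnorm (N u) * v.pnorm (N y))"
        by (simp add: v.cdist_def wN v.mult)
      also have "\<dots> \<le> rep p \<Delta> * rep p (wedge u y) / ((rep p \<Delta> / C * v.pnorm u) * (rep p \<Delta> / C * v.pnorm y))"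
        using pNu pu Dp Cp pN by (intro divide_left_mono mult_mono mult_pos_pos mult_nonneg_nonneg) auto
      also have "\<dots> = K * v.cdist u y" using Dp Cp pu by (simp add: K_def v.cdist_def field_simps power2_eq_square)
      finally show ?thesis .
    qed
    show "\<exists>z\<in>N ` Z. \<forall>e>0. \<forall>n0. \<exists>n\<ge>n0. v.cdist ((T.phi ^^ n) (1, 0)) z < e"
    proof (intro bexI[of _ "N z"] allI impI imageI z(1))
      fix \<epsilon> :: real and n0 assume \<epsilon>: "\<epsilon> > 0"
      have "\<epsilon> / K > 0" using \<epsilon> Kp by simp
      then obtain n where n: "n \<ge> n0" "v.cdist ((phi ^^ n) s) z < \<epsilon> / K" using z(2) by blast
      obtain t where t: "t \<noteq> 0" "(T.phi ^^ n) (1, 0) = (t * fst (N ((phi ^^ n) s)), t * snd (N ((phi ^^ n) s)))" using conj by blast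
      have "v.cdist ((T.phi ^^ n) (1, 0)) (N z) = v.cdist (N ((phi ^^ n) s)) (N z)"
        unfolding t(2) v.cdist_scale[OF t(1)] by simp
      also have "\<dots> \<le> K * v.cdist ((phi ^^ n) s) z" by (rule lip[OF pnz Znz[OF z(1)]])
      also have "\<dots> < \<epsilon>" using n(2) Kp by (simp add: field_simps)
      finally show "\<exists>n\<ge>n0. v.cdist ((T.phi ^^ n) (1, 0)) (N z) < \<epsilon>" using n(1) by blast
    qed
  qed
  show False by (rule no_accumulating)
qed

end

section \<open>Completions and the adelic topology\<close>

definition hp :: "'b::field option \<Rightarrow> 'b \<times> 'b" where
  "hp x = (case x of None \<Rightarrow> (1, 0) | Some c \<Rightarrow> (c, 1))"

lemma hp_nz: "hp x \<noteq> (0, 0)"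
  by (cases x) (auto simp: hp_def)

lemma hp_inj: "wedge (hp x) (hp y) = 0 \<Longrightarrow> x = y"
  by (cases x; cases y) (auto simp: hp_def wedge_def)

section \<open>The chordal metric on completed projective lines\<close>

context nonarch
begin

lemma v_cauchy_const: "v_cauchy v (\<lambda>_. c)"
  by (auto simp: v_cauchy_def)

lemma v_cauchy_diff:
  assumes "v_cauchy v x" "v_cauchy v y"
  shows "v_cauchy v (\<lambda>n. x n - y n)"
  unfolding v_cauchy_def
proof (intro allI impI)
  fix e :: real assume e: "e > 0"
  obtain N1 where N1: "\<And>m n. m \<ge> N1 \<Longrightarrow> n \<ge> N1 \<Longrightarrow> v (x m - x n) < e" using assms(1) e unfolding v_cauchy_def by blast
  obtain N2 where N2: "\<And>m n. m \<ge> N2 \<Longrightarrow> n \<ge> N2 \<Longrightarrow> v (y m - y n) < e" using assms(2) e unfolding v_cauchy_def by blast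
  show "\<exists>N. \<forall>m\<ge>N. \<forall>n\<ge>N. v (x m - y m - (x n - y n)) < e"
  proof (intro exI[of _ "max N1 N2"] allI impI)
    fix m n assume mn: "m \<ge> max N1 N2" "n \<ge> max N1 N2"
    have "v ((x m - x n) - (y m - y n)) \<le> max (v (x m - x n)) (v (y m - y n))" by (rule ultra_diff)
    also have "\<dots> < e" using N1[of m n] N2[of m n] mn by simp
    finally show "v (x m - y m - (x n - y n)) < e" by (simp add: algebra_simps)
  qed
qed

lemma abs_diff_le: "\<bar>v x - v y\<bar> \<le> v (x - y)"
proof -
  have "v x \<le> v y + v (x - y)" using ultra[of y "x - y"] nonneg[of y] nonneg[of "x - y"] by (simp del: nonneg)
  moreover have "v y \<le> v x + v (x - y)" using ultra[of x "y - x"] nonneg[of x] nonneg[of "y - x"] diff_commute[of x y] by (simp del: nonneg)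
  ultimately show ?thesis by linarith
qed

lemma v_cauchy_convergent: "v_cauchy v x \<Longrightarrow> convergent (\<lambda>n. v (x n))"
proof -
  assume x: "v_cauchy v x"
  have "Cauchy (\<lambda>n. v (x n))"
  proof (rule metric_CauchyI)
    fix e :: real assume "e > 0"
    then obtain N where N: "\<And>m n. m \<ge> N \<Longrightarrow> n \<ge> N \<Longrightarrow> v (x m - x n) < e" using x unfolding v_cauchy_def by blast
    show "\<exists>N. \<forall>m\<ge>N. \<forall>n\<ge>N. dist (v (x m)) (v (x n)) < e"
      using N by (intro exI[of _ N]) (auto simp: dist_real_def intro: le_less_trans[OF abs_diff_le])
  qed
  thus ?thesis by (rule Cauchy_convergent)
qed

lemma v_class_self: "v_cauchy v x \<Longrightarrow> x \<in> v_class v x"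
  by (simp add: v_class_def)

lemma compl_rep_class:
  assumes "v_cauchy v x"
  shows "v_cauchy v (compl_rep (v_class v x))" "(\<lambda>n. v (x n - compl_rep (v_class v x) n)) \<longlonglongrightarrow> 0"
proof -
  have "compl_rep (v_class v x) \<in> v_class v x"
    unfolding compl_rep_def using v_class_self[OF assms] by (rule someI[of "\<lambda>y. y \<in> v_class v x"])
  thus "v_cauchy v (compl_rep (v_class v x))" "(\<lambda>n. v (x n - compl_rep (v_class v x) n)) \<longlonglongrightarrow> 0"
    by (simp_all add: v_class_def)
qed

lemma compl_rep_cauchy: "a \<in> completion v \<Longrightarrow> v_cauchy v (compl_rep a)"
  using compl_rep_class(1) by (auto simp: completion_def)

lemma compl_abs_lim: "a \<in> completion v \<Longrightarrow> (\<lambda>n. v (compl_rep a n)) \<longlonglongrightarrow> compl_abs v a"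
  unfolding compl_abs_def using v_cauchy_convergent[OF compl_rep_cauchy] convergent_LIMSEQ_iff by blast

lemma compl_diff_lim:
  assumes "a \<in> completion v" "b \<in> completion v"
  shows "(\<lambda>n. v (compl_rep a n - compl_rep b n)) \<longlonglongrightarrow> compl_abs v (compl_diff v a b)"
proof -
  define x where "x = (\<lambda>n. compl_rep a n - compl_rep b n)"
  have x: "v_cauchy v x" unfolding x_def using assms by (intro v_cauchy_diff compl_rep_cauchy)
  define y where "y = compl_rep (v_class v x)"
  have "v_class v x \<in> completion v" using x by (auto simp: completion_def)
  hence 1: "(\<lambda>n. v (y n)) \<longlonglongrightarrow> compl_abs v (v_class v x)" unfolding y_def by (rule compl_abs_lim)
  have "(\<lambda>n. v (x n - y n)) \<longlonglongrightarrow> 0" unfolding y_def by (rule compl_rep_class(2)[OF x])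
  hence "(\<lambda>n. v (x n) - v (y n)) \<longlonglongrightarrow> 0"
    by (rule Lim_null_comparison[rotated]) (simp add: abs_diff_le)
  from tendsto_add[OF this 1] show ?thesis by (simp add: x_def compl_diff_def)
qed

text \<open>Approximations over K, in homogeneous coordinates, of a point of the completed
  line.\<close>

definition seqp :: "(nat \<Rightarrow> 'b) set option \<Rightarrow> nat \<Rightarrow> 'b \<times> 'b" where
  "seqp a n = (case a of None \<Rightarrow> (1, 0) | Some a \<Rightarrow> (compl_rep a n, 1))"

lemma seqp_nz: "seqp a n \<noteq> (0, 0)"
  by (cases a) (auto simp: seqp_def)

lemma cdist_affine: "cdist (x, 1) (y, 1) = v (x - y) / (max 1 (v x) * max 1 (v y))"
  "cdist (x, 1) (1, 0) = 1 / max 1 (v x)" "cdist (1, 0) (x, 1) = 1 / max 1 (v x)"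
  by (simp_all add: cdist_def wedge_def pnorm_def max.commute)

text \<open>Ties the metric on the completion to distances between approximations, so that its
  properties follow by passage to the limit.\<close>

lemma chordal_lim:
  assumes "a \<in> P1_compl v" "b \<in> P1_compl v"
  shows "(\<lambda>n. cdist (seqp a n) (seqp b n)) \<longlonglongrightarrow> chordal v a b"
proof -
  have m: "(\<lambda>n. max 1 (v (compl_rep a n))) \<longlonglongrightarrow> max 1 (compl_abs v a)" if "a \<in> completion v" for a
    by (intro tendsto_max tendsto_const compl_abs_lim that)
  have nz: "max 1 (x::real) \<noteq> 0" for x by linarith
  show ?thesis
  proof (cases a; cases b)
    fix a' b' assume e: "a = Some a'" "b = Some b'"
    hence ab: "a' \<in> completion v" "b' \<in> completion v" using assms by (auto simp: P1_compl_def)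
    show ?thesis unfolding e using nz
      by (auto simp: seqp_def cdist_affine intro!: tendsto_divide compl_diff_lim tendsto_mult m ab)
  next
    fix a' assume e: "a = Some a'" "b = None"
    hence ab: "a' \<in> completion v" using assms by (auto simp: P1_compl_def)
    show ?thesis unfolding e using nz
      by (auto simp: seqp_def cdist_affine intro!: tendsto_divide tendsto_const m ab)
  next
    fix b' assume e: "a = None" "b = Some b'"
    hence ab: "b' \<in> completion v" using assms by (auto simp: P1_compl_def)
    show ?thesis unfolding e using nz
      by (auto simp: seqp_def cdist_affine intro!: tendsto_divide tendsto_const m ab)
  next
    assume e: "a = None" "b = None"
    show ?thesis unfolding e by (simp add: seqp_def cdist_def)
  qed
qed

lemma chordal_ultra:
  assumes "a \<in> P1_compl v" "b \<in> P1_compl v" "c \<in> P1_compl v"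
  shows "chordal v a c \<le> max (chordal v a b) (chordal v b c)"
proof (rule LIMSEQ_le[OF chordal_lim[OF assms(1,3)] tendsto_max[OF chordal_lim[OF assms(1,2)] chordal_lim[OF assms(2,3)]]])
  show "\<exists>N. \<forall>n\<ge>N. cdist (seqp a n) (seqp c n) \<le> max (cdist (seqp a n) (seqp b n)) (cdist (seqp b n) (seqp c n))"
    by (intro exI[of _ 0] allI impI cdist_ultra seqp_nz)
qed

lemma P1_emb_in: "P1_emb v x \<in> P1_compl v"
  using v_cauchy_const by (cases x) (auto simp: P1_emb_def P1_compl_def compl_emb_def completion_def)

lemma seqp_emb_lim: "(\<lambda>n. cdist (seqp (P1_emb v x) n) (hp x)) \<longlonglongrightarrow> 0"
proof (cases x)
  case None
  thus ?thesis by (simp add: P1_emb_def seqp_def hp_def cdist_def)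
next
  case (Some c)
  define y where "y = compl_rep (v_class v (\<lambda>_. c))"
  have lim: "(\<lambda>n. v (c - y n)) \<longlonglongrightarrow> 0" unfolding y_def by (rule compl_rep_class(2)[OF v_cauchy_const])
  have "cdist (y n, 1) (c, 1) \<le> v (c - y n)" for n
  proof -
    have "max 1 (v (y n)) * max 1 (v c) \<ge> 1 * 1" by (intro mult_mono) auto
    hence "v (y n - c) / (max 1 (v (y n)) * max 1 (v c)) \<le> v (y n - c) / 1" by (intro divide_left_mono) auto
    thus ?thesis by (simp add: cdist_affine diff_commute)
  qed
  hence "(\<lambda>n. cdist (y n, 1) (c, 1)) \<longlonglongrightarrow> 0"
    by (intro Lim_null_comparison[OF _ lim]) simp
  thus ?thesis using Some by (simp add: P1_emb_def seqp_def hp_def compl_emb_def y_def)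
qed

text \<open>\<open>compl_rep\<close> of an embedded constant is merely some sequence tending to it;
  the equality therefore arises in the limit, the ultrametric inequality giving both
  directions.\<close>

lemma chordal_emb: "chordal v (P1_emb v x) (P1_emb v y) = cdist (hp x) (hp y)"
proof (rule antisym)
  let ?a = "seqp (P1_emb v x)" and ?b = "seqp (P1_emb v y)"
  have lx: "(\<lambda>n. cdist (?a n) (hp x)) \<longlonglongrightarrow> 0" and ly: "(\<lambda>n. cdist (?b n) (hp y)) \<longlonglongrightarrow> 0" by (rule seqp_emb_lim)+
  have lxy: "(\<lambda>n. cdist (?a n) (?b n)) \<longlonglongrightarrow> chordal v (P1_emb v x) (P1_emb v y)" by (intro chordal_lim P1_emb_in)
  have c0: "chordal v (P1_emb v x) (P1_emb v y) \<ge> 0" by (rule LIMSEQ_le_const[OF lxy]) auto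
  have "chordal v (P1_emb v x) (P1_emb v y) \<le> max 0 (max (cdist (hp x) (hp y)) 0)"
  proof (rule LIMSEQ_le[OF lxy])
    show "(\<lambda>n. max (cdist (?a n) (hp x)) (max (cdist (hp x) (hp y)) (cdist (?b n) (hp y)))) \<longlonglongrightarrow> max 0 (max (cdist (hp x) (hp y)) 0)"
      by (intro tendsto_max lx ly tendsto_const)
    show "\<exists>N. \<forall>n\<ge>N. cdist (?a n) (?b n) \<le> max (cdist (?a n) (hp x)) (max (cdist (hp x) (hp y)) (cdist (?b n) (hp y)))"
    proof (intro exI[of _ 0] allI impI)
      fix n
      have "cdist (?a n) (?b n) \<le> max (cdist (?a n) (hp x)) (cdist (hp x) (?b n))" by (intro cdist_ultra hp_nz seqp_nz)
      moreover have "cdist (hp x) (?b n) \<le> max (cdist (hp x) (hp y)) (cdist (hp y) (?b n))" by (intro cdist_ultra hp_nz seqp_nz)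
      ultimately show "cdist (?a n) (?b n) \<le> max (cdist (?a n) (hp x)) (max (cdist (hp x) (hp y)) (cdist (?b n) (hp y)))"
        using cdist_commute[of "hp y" "?b n"] by linarith
    qed
  qed
  thus "chordal v (P1_emb v x) (P1_emb v y) \<le> cdist (hp x) (hp y)" by simp
  have "cdist (hp x) (hp y) \<le> max 0 (max (chordal v (P1_emb v x) (P1_emb v y)) 0)"
  proof (rule LIMSEQ_le[OF tendsto_const])
    show "(\<lambda>n. max (cdist (?a n) (hp x)) (max (cdist (?a n) (?b n)) (cdist (?b n) (hp y)))) \<longlonglongrightarrow> max 0 (max (chordal v (P1_emb v x) (P1_emb v y)) 0)"
      by (intro tendsto_max lx ly lxy)
    show "\<exists>N. \<forall>n\<ge>N. cdist (hp x) (hp y) \<le> max (cdist (?a n) (hp x)) (max (cdist (?a n) (?b n)) (cdist (?b n) (hp y)))"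
    proof (intro exI[of _ 0] allI impI)
      fix n
      have "cdist (hp x) (hp y) \<le> max (cdist (hp x) (?a n)) (cdist (?a n) (hp y))" by (intro cdist_ultra hp_nz seqp_nz)
      moreover have "cdist (?a n) (hp y) \<le> max (cdist (?a n) (?b n)) (cdist (?b n) (hp y))" by (intro cdist_ultra hp_nz seqp_nz)
      ultimately show "cdist (hp x) (hp y) \<le> max (cdist (?a n) (hp x)) (max (cdist (?a n) (?b n)) (cdist (?b n) (hp y)))"
        using cdist_commute[of "hp x" "?a n"] by linarith
    qed
  qed
  thus "cdist (hp x) (hp y) \<le> chordal v (P1_emb v x) (P1_emb v y)" using c0 by simp
qed

lemma openin_P1_top: "openin (P1_top v) A \<longleftrightarrow> A \<subseteq> P1_compl v \<and>
      (\<forall>x\<in>A. \<exists>e>0. \<forall>y\<in>P1_compl v. chordal v x y < e \<longrightarrow> y \<in> A)"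
proof -
  have "istopology (\<lambda>A. A \<subseteq> P1_compl v \<and> (\<forall>x\<in>A. \<exists>e>0. \<forall>y\<in>P1_compl v. chordal v x y < e \<longrightarrow> y \<in> A))"
    unfolding istopology_def
  proof (intro conjI allI impI)
    fix A B
    assume A: "A \<subseteq> P1_compl v \<and> (\<forall>x\<in>A. \<exists>e>0. \<forall>y\<in>P1_compl v. chordal v x y < e \<longrightarrow> y \<in> A)"
      and B: "B \<subseteq> P1_compl v \<and> (\<forall>x\<in>B. \<exists>e>0. \<forall>y\<in>P1_compl v. chordal v x y < e \<longrightarrow> y \<in> B)"
    show "A \<inter> B \<subseteq> P1_compl v" using A by blast
    show "\<forall>x\<in>A \<inter> B. \<exists>e>0. \<forall>y\<in>P1_compl v. chordal v x y < e \<longrightarrow> y \<in> A \<inter> B"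
    proof
      fix x assume x: "x \<in> A \<inter> B"
      obtain e1 where e1: "e1 > 0" "\<forall>y\<in>P1_compl v. chordal v x y < e1 \<longrightarrow> y \<in> A" using A x by blast
      obtain e2 where e2: "e2 > 0" "\<forall>y\<in>P1_compl v. chordal v x y < e2 \<longrightarrow> y \<in> B" using B x by blast
      show "\<exists>e>0. \<forall>y\<in>P1_compl v. chordal v x y < e \<longrightarrow> y \<in> A \<inter> B"
        using e1 e2 by (intro exI[of _ "min e1 e2"]) auto
    qed
  next
    fix \<K> assume K: "\<forall>A\<in>\<K>. A \<subseteq> P1_compl v \<and> (\<forall>x\<in>A. \<exists>e>0. \<forall>y\<in>P1_compl v. chordal v x y < e \<longrightarrow> y \<in> A)"
    show "\<Union>\<K> \<subseteq> P1_compl v" using K by blast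
    show "\<forall>x\<in>\<Union>\<K>. \<exists>e>0. \<forall>y\<in>P1_compl v. chordal v x y < e \<longrightarrow> y \<in> \<Union>\<K>"
    proof
      fix x assume "x \<in> \<Union>\<K>"
      then obtain A where A: "A \<in> \<K>" "x \<in> A" by blast
      then obtain e where "e > 0" "\<forall>y\<in>P1_compl v. chordal v x y < e \<longrightarrow> y \<in> A" using K by blast
      thus "\<exists>e>0. \<forall>y\<in>P1_compl v. chordal v x y < e \<longrightarrow> y \<in> \<Union>\<K>" using A by blast
    qed
  qed
  thus ?thesis unfolding P1_top_def by (simp add: topology_inverse')
qed

lemma topspace_P1_top: "topspace (P1_top v) = P1_compl v"
proof
  show "topspace (P1_top v) \<subseteq> P1_compl v" unfolding topspace_def using openin_P1_top by blast
  have "openin (P1_top v) (P1_compl v)" unfolding openin_P1_top using zero_less_one by blast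
  thus "P1_compl v \<subseteq> topspace (P1_top v)" by (rule openin_subset)
qed

lemma openin_ball: "x \<in> P1_compl v \<Longrightarrow> openin (P1_top v) {y\<in>P1_compl v. chordal v x y < e}"
  unfolding openin_P1_top
proof (intro conjI ballI)
  fix y assume x: "x \<in> P1_compl v" and y: "y \<in> {y\<in>P1_compl v. chordal v x y < e}"
  hence y': "y \<in> P1_compl v" "chordal v x y < e" by auto
  have "chordal v x y \<ge> 0" by (rule LIMSEQ_le_const[OF chordal_lim[OF x y'(1)]]) auto
  hence "e > 0" using y'(2) by simp
  moreover have "z \<in> {y\<in>P1_compl v. chordal v x y < e}" if "z \<in> P1_compl v" "chordal v y z < e" for z
    using chordal_ultra[OF x y'(1) that(1)] that y'(2) by simp
  ultimately show "\<exists>e'>0. \<forall>z\<in>P1_compl v. chordal v y z < e' \<longrightarrow> z \<in> {y\<in>P1_compl v. chordal v x y < e}"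
    by (intro exI[of _ e] conjI ballI impI)
qed auto

end

section \<open>Rational maps in homogeneous coordinates\<close>

lemma hp_rat_map:
  assumes "rat_map_degree f g > 0"
  shows "wedge (hp (rat_map f g Q)) (hform (rat_map_degree f g) f (hp Q), hform (rat_map_degree f g) g (hp Q)) = 0"
proof (cases Q)
  case (Some x)
  have "degree f \<le> rat_map_degree f g" "degree g \<le> rat_map_degree f g" by (simp_all add: rat_map_degree_def)
  thus ?thesis using Some by (simp add: hp_def hform_affine wedge_def)
next
  case None
  consider "degree f > degree g" | "degree f = degree g" | "degree f < degree g" by linarith
  thus ?thesis
  proof cases
    case 1
    thus ?thesis using None by (simp add: hp_def hform_infty wedge_def rat_map_degree_def coeff_eq_0)
  next
    case 2
    hence "g \<noteq> 0" using assms by (auto simp: rat_map_degree_def)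
    thus ?thesis using None 2 by (simp add: hp_def hform_infty wedge_def rat_map_degree_def)
  next
    case 3
    thus ?thesis using None by (simp add: hp_def hform_infty wedge_def rat_map_degree_def coeff_eq_0)
  qed
qed

text \<open>At infinity, d being the exact degree keeps one coefficient of degree d alive; elsewhere
  the Bezout identity excludes a common zero.\<close>

lemma coprime_no_common_zero:
  fixes f g :: "'a::field poly"
  assumes fg: "coprime f g" and d: "rat_map_degree f g = d" "d > 0"
    and zero: "hform d (map_poly to_ac f) u = 0" "hform d (map_poly to_ac g) u = 0"
  shows "u = (0, 0)"
proof (cases "snd u = 0")
  case True
  hence u: "u = (fst u, 0)" by (simp add: prod_eq_iff)
  have "coeff f d \<noteq> 0 \<or> coeff g d \<noteq> 0" using d by (auto simp: rat_map_degree_def max_def split: if_splits)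
  moreover have "to_ac (coeff f d) * fst u ^ d = 0" "to_ac (coeff g d) * fst u ^ d = 0"
    using zero by (subst (asm) (1 2) u, simp add: hform_infty coeff_map_poly)+
  ultimately have "fst u = 0" by auto
  thus ?thesis using u by simp
next
  case False
  define \<gamma> where "\<gamma> = fst u / snd u"
  have "degree (map_poly to_ac f) \<le> d" "degree (map_poly to_ac g) \<le> d"
    using d by (auto simp: rat_map_degree_def degree_map_poly)
  hence "hform d (map_poly to_ac f) u = snd u ^ d * pac f \<gamma>" "hform d (map_poly to_ac g) u = snd u ^ d * pac g \<gamma>"
    using hform_eq_poly[of "map_poly to_ac f" d "snd u" "fst u"] hform_eq_poly[of "map_poly to_ac g" d "snd u" "fst u"] False
    by (simp_all add: \<gamma>_def pac_def)
  hence "pac f \<gamma> = 0" "pac g \<gamma> = 0" using zero False by simp_all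
  moreover obtain a b where "a * f + b * g = 1" using bezout_coprime_poly[OF fg] by blast
  hence "pac (a * f + b * g) \<gamma> = pac 1 \<gamma>" by simp
  ultimately have False by simp
  thus ?thesis ..
qed

lemma (in dynamics) hp_orbit:
  assumes d: "rat_map_degree f g = d"
  shows "wedge (hp ((rat_map f g ^^ n) P)) ((phi ^^ n) (hp P)) = 0"
proof (induction n)
  case 0
  thus ?case by simp
next
  case (Suc n)
  define Q where "Q = (rat_map f g ^^ n) P"
  define u where "u = (phi ^^ n) (hp P)"
  have u: "u \<noteq> (0, 0)" unfolding u_def by (rule phi_pow_nz[OF hp_nz])
  obtain c where c: "c \<noteq> 0" "hp Q = (c * fst u, c * snd u)"
    using Suc.IH wedge_proportional[OF hp_nz u] by (auto simp: Q_def u_def)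
  have "wedge (phi (hp Q)) (phi u) = 0"
    unfolding c(2) phi_scale by (simp add: wedge_def)
  moreover have "wedge (hp (rat_map f g Q)) (phi (hp Q)) = 0"
    using hp_rat_map[of f g Q] d d2 by (simp add: phi_def)
  moreover have "phi (hp Q) \<noteq> (0, 0)" using phi_pow_nz[OF hp_nz, of 1 Q] by simp
  ultimately have "wedge (hp (rat_map f g Q)) (phi u) = 0" by (blast intro: wedge_trans)
  thus ?case by (simp add: Q_def u_def)
qed

text \<open>Balls at the finitely many places of T and the whole line elsewhere form an open set of
  the product, so one element of A is close to z at all of T simultaneously.\<close>

lemma C_S_approx:
  assumes z: "z \<in> C_S k S A" and T: "finite T" "T \<subseteq> places k - S" and e: "e > 0"
    and na: "\<And>p. p \<in> T \<Longrightarrow> nonarch (rep p)" and zz: "\<And>p. p \<in> T \<Longrightarrow> z p = P1_emb (rep p) (zz p)"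
  shows "\<exists>Q\<in>A. \<forall>p\<in>T. nonarch.cdist (rep p) (hp (zz p)) (hp Q) < e"
proof -
  define TP where "TP = (\<lambda>p :: ('a \<Rightarrow> real) set. P1_top (rep p))"
  define B where "B = (\<lambda>p. if p \<in> T then {y \<in> P1_compl (rep p). chordal (rep p) (z p) y < e} else topspace (TP p))"
  define U where "U = (\<Pi>\<^sub>E p\<in>places k - S. B p)"
  have zt: "z \<in> (\<Pi>\<^sub>E p\<in>places k - S. topspace (TP p))"
    and zc: "\<And>U. z \<in> U \<Longrightarrow> openin (product_topology TP (places k - S)) U \<Longrightarrow> \<exists>y\<in>diag k S ` A. y \<in> U"
    using z unfolding C_S_def adelic_P1_top_def TP_def in_closure_of by auto
  have "openin (TP p) (B p)" for p
  proof (cases "p \<in> T")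
    case True
    interpret nonarch "rep p" by (rule na[OF True])
    show ?thesis unfolding B_def TP_def using True zz[OF True] by (simp add: openin_ball P1_emb_in)
  qed (simp add: B_def)
  moreover have "{p \<in> places k - S. B p \<noteq> topspace (TP p)} \<subseteq> T" by (auto simp: B_def)
  hence "finite {p \<in> places k - S. B p \<noteq> topspace (TP p)}" using T(1) by (rule finite_subset)
  ultimately have "openin (product_topology TP (places k - S)) U"
    unfolding U_def openin_PiE_gen by blast
  moreover have "z p \<in> B p" if "p \<in> places k - S" for p
  proof (cases "p \<in> T")
    case True
    interpret nonarch "rep p" by (rule na[OF True])
    have "chordal (rep p) (z p) (z p) = 0" unfolding zz[OF True] chordal_emb by (simp add: cdist_def)
    thus ?thesis using True e zz[OF True] P1_emb_in by (simp add: B_def)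
  next
    case False
    thus ?thesis using zt that by (auto simp: B_def)
  qed
  hence "z \<in> U" unfolding U_def using zt by (auto simp: PiE_iff)
  ultimately obtain Q where Q: "Q \<in> A" "diag k S Q \<in> U" using zc by blast
  have "nonarch.cdist (rep p) (hp (zz p)) (hp Q) < e" if p: "p \<in> T" for p
  proof -
    interpret nonarch "rep p" by (rule na[OF p])
    have "p \<in> places k - S" using p T(2) by blast
    hence "diag k S Q p \<in> B p" "diag k S Q p = P1_emb (rep p) Q" using Q(2) by (auto simp: U_def diag_def PiE_iff)
    thus ?thesis using p by (simp add: B_def zz chordal_emb)
  qed
  thus ?thesis using Q(1) by blast
qed

lemma funpow_repeat:
  fixes \<phi> :: "'b \<Rightarrow> 'b"
  assumes "(\<phi> ^^ i) x = (\<phi> ^^ j) x" "i < j"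
  shows "\<exists>m<j. (\<phi> ^^ n) x = (\<phi> ^^ m) x"
proof (induction n)
  case 0
  show ?case using assms(2) by (intro exI[of _ 0]) simp
next
  case (Suc n)
  then obtain m where m: "m < j" "(\<phi> ^^ n) x = (\<phi> ^^ m) x" by blast
  show ?case
  proof (cases "Suc m = j")
    case True
    have "(\<phi> ^^ Suc n) x = (\<phi> ^^ Suc m) x" using m(2) by simp
    hence "(\<phi> ^^ Suc n) x = (\<phi> ^^ i) x" unfolding True assms(1) .
    thus ?thesis using assms(2) by blast
  next
    case False
    hence "Suc m < j" using m(1) by simp
    thus ?thesis using m(2) by (intro exI[of _ "Suc m"]) simp
  qed
qed

theorem theorem7:
  fixes k :: "'a::field set" and S :: "('a \<Rightarrow> real) set set"
    and f g :: "'a poly" and Z :: "'a option set" and P :: "'a option"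
  assumes "alg_closed_subfield k"
    and "finitely_generated_over k"
    and "trdeg_one_over k"
    and "S \<subseteq> places k" and "finite S"
    and "coprime f g" and "rat_map_degree f g \<ge> 2"
    and "finite Z"
  shows "diag k S ` (orbit (rat_map f g) P \<inter> Z)
           = C_S k S (orbit (rat_map f g) P) \<inter> adelic_points k S Z"
proof
  interpret function_field k by unfold_locales (use assms in auto)
  define I where "I = places k - S"
  have na: "nonarch (rep p)" if "p \<in> I" for p using that place_nonarch by (simp add: I_def)
  have diag_pt: "diag k S Q \<in> topspace (adelic_P1_top k S)" for Q
  proof -
    have "P1_emb (rep p) Q \<in> topspace (P1_top (rep p))" if "p \<in> I" for p
      using nonarch.P1_emb_in[OF na[OF that]] nonarch.topspace_P1_top[OF na[OF that]] by blast
    thus ?thesis by (simp add: adelic_P1_top_def diag_def I_def[symmetric])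
  qed
  show "diag k S ` (orbit (rat_map f g) P \<inter> Z) \<subseteq> C_S k S (orbit (rat_map f g) P) \<inter> adelic_points k S Z"
  proof
    fix z assume "z \<in> diag k S ` (orbit (rat_map f g) P \<inter> Z)"
    then obtain Q where Q: "z = diag k S Q" "Q \<in> orbit (rat_map f g) P" "Q \<in> Z" by blast
    have "z \<in> C_S k S (orbit (rat_map f g) P)" unfolding C_S_def
      using closure_of_subset_Int[of "adelic_P1_top k S" "diag k S ` orbit (rat_map f g) P"] diag_pt[of Q] Q(1,2) by blast
    moreover have "z \<in> adelic_points k S Z" using Q by (auto simp: adelic_points_def diag_def)
    ultimately show "z \<in> C_S k S (orbit (rat_map f g) P) \<inter> adelic_points k S Z" ..
  qed
  show "C_S k S (orbit (rat_map f g) P) \<inter> adelic_points k S Z \<subseteq> diag k S ` (orbit (rat_map f g) P \<inter> Z)"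
  proof (rule subsetI, rule ccontr)
    fix z assume z: "z \<in> C_S k S (orbit (rat_map f g) P) \<inter> adelic_points k S Z"
      and notin: "z \<notin> diag k S ` (orbit (rat_map f g) P \<inter> Z)"
    define h where "h = (\<lambda>n. (rat_map f g ^^ n) P)"
    define \<delta> where "\<delta> = rat_map_degree f g"
    have orb: "orbit (rat_map f g) P = range h" by (auto simp: orbit_def h_def)
    have zA: "z \<in> (\<Pi>\<^sub>E p\<in>I. P1_emb (rep p) ` Z)" using z by (simp add: adelic_points_def I_def)
    hence "\<forall>p\<in>I. \<exists>x. x \<in> Z \<and> z p = P1_emb (rep p) x" by (auto simp: PiE_iff)
    then obtain zz where zz: "\<And>p. p \<in> I \<Longrightarrow> zz p \<in> Z" "\<And>p. p \<in> I \<Longrightarrow> z p = P1_emb (rep p) (zz p)" by metis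
    have "infinite I" unfolding I_def using infinite_places assms(5) by simp
    then obtain p0 where p0: "p0 \<in> I" using infinite_imp_nonempty by blast
    have "\<exists>p\<in>I. h n \<noteq> zz p" for n
    proof (rule ccontr)
      assume "\<not> (\<exists>p\<in>I. h n \<noteq> zz p)"
      hence e: "zz p = h n" if "p \<in> I" for p using that by auto
      have "z = diag k S (h n)"
      proof
        fix p
        show "z p = diag k S (h n) p"
          using zz(2)[of p] e[of p] zA by (cases "p \<in> I") (auto simp: diag_def I_def PiE_iff extensional_def)
      qed
      moreover have "h n \<in> orbit (rat_map f g) P \<inter> Z" using zz(1)[OF p0] e[OF p0] orb by auto
      ultimately show False using notin by blast
    qed
    \<comment> \<open>For each n, a place at which the n-th orbit point differs from the limit
      there.\<close>
    then obtain q where q: "\<And>n. q n \<in> I" "\<And>n. h n \<noteq> zz (q n)" by metis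
    have step: "\<exists>n. (\<forall>m\<le>N. h n \<noteq> h m) \<and> nonarch.cdist (rep p) (hp (zz p)) (hp (h n)) < e"
      if p: "p \<in> I" and e: "e > 0" for p e N
    proof -
      define D where "D = (\<lambda>m. nonarch.cdist (rep (q m)) (hp (zz (q m))) (hp (h m)))"
      have D: "D m > 0" for m
      proof -
        interpret nonarch "rep (q m)" by (rule na[OF q(1)])
        have "cdist (hp (zz (q m))) (hp (h m)) \<noteq> 0"
          using q(2)[of m] hp_inj[of "zz (q m)" "h m"] cdist_eq_0[OF hp_nz hp_nz] by metis
        moreover have "cdist (hp (zz (q m))) (hp (h m)) \<ge> 0" by simp
        ultimately show ?thesis unfolding D_def by linarith
      qed
      \<comment> \<open>At most the distance at \<open>q m\<close> between \<open>h m\<close> and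
        the limit, for every m \<le> N; an orbit point closer than this at all the
        \<open>q m\<close> is none of h 0, ..., h N.\<close>
      define e' where "e' = Min (insert e (D ` {..N}))"
      have e': "e' > 0" "e' \<le> e" "\<And>m. m \<le> N \<Longrightarrow> e' \<le> D m" using D e unfolding e'_def by (auto simp del: Min_insert intro!: Min_le)
      have "\<exists>Q\<in>range h. \<forall>r\<in>insert p (q ` {..N}). nonarch.cdist (rep r) (hp (zz r)) (hp Q) < e'"
      proof (rule C_S_approx[where k = k and S = S and z = z])
        show "z \<in> C_S k S (range h)" using z orb by simp
        show "insert p (q ` {..N}) \<subseteq> places k - S" using p q(1) by (auto simp: I_def)
        show "nonarch (rep r)" "z r = P1_emb (rep r) (zz r)" if "r \<in> insert p (q ` {..N})" for r
          using that p q(1) na zz(2) by auto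
      qed (use e' in auto)
      then obtain n where n: "\<forall>r\<in>insert p (q ` {..N}). nonarch.cdist (rep r) (hp (zz r)) (hp (h n)) < e'" by blast
      have "h n \<noteq> h m" if "m \<le> N" for m
      proof
        assume "h n = h m"
        hence "D m < e'" using n that by (auto simp: D_def)
        thus False using e'(3)[OF that] by simp
      qed
      moreover have "nonarch.cdist (rep p) (hp (zz p)) (hp (h n)) < e" using n e'(2) by auto
      ultimately show ?thesis by blast
    qed
    \<comment> \<open>After a repetition the orbit would be finite, whereas \<open>step\<close>
      always produces a new member.\<close>
    have no_repeat: "h i \<noteq> h j" if "i < j" for i j
    proof
      assume ij: "h i = h j"
      obtain n where "\<forall>m\<le>j. h n \<noteq> h m" using step[OF p0 zero_less_one, of j] by blast
      thus False using funpow_repeat[of i "rat_map f g" P j n] ij that by (force simp: h_def dest: less_imp_le)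
    qed
    interpret dynamics k \<delta> f g
    proof
      show "\<delta> \<ge> 2" "degree f \<le> \<delta>" "degree g \<le> \<delta>" using assms(7) by (simp_all add: \<delta>_def rat_map_degree_def)
      show "u = (0, 0)" if "hform \<delta> (map_poly to_ac f) u = 0" "hform \<delta> (map_poly to_ac g) u = 0" for u
        using coprime_no_common_zero[OF assms(6), of \<delta> u] that assms(7) by (simp add: \<delta>_def)
    qed
    have pnz: "(phi ^^ n) (hp P) \<noteq> (0, 0)" for n by (rule phi_pow_nz[OF hp_nz])
    have conj: "wedge (hp (h n)) ((phi ^^ n) (hp P)) = 0" for n unfolding h_def by (rule hp_orbit) (simp add: \<delta>_def)
    show False
    proof (rule no_everywhere_accumulating[of S "hp ` Z" "hp P"])
      show "finite S" "finite (hp ` Z)" "hp P \<noteq> (0, 0)" using assms(5,8) hp_nz by auto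
      show "x \<noteq> (0, 0)" if "x \<in> hp ` Z" for x using that hp_nz by auto
      show "wedge ((phi ^^ m) (hp P)) ((phi ^^ n) (hp P)) \<noteq> 0" if mn: "m \<noteq> n" for m n
      proof
        assume w: "wedge ((phi ^^ m) (hp P)) ((phi ^^ n) (hp P)) = 0"
        have "wedge (hp (h m)) ((phi ^^ n) (hp P)) = 0" by (rule wedge_trans[OF conj w pnz])
        moreover have "wedge ((phi ^^ n) (hp P)) (hp (h n)) = 0" using conj[of n] wedge_eq_0_sym by blast
        ultimately have "wedge (hp (h m)) (hp (h n)) = 0" using pnz wedge_trans by blast
        hence "h m = h n" by (rule hp_inj)
        thus False using no_repeat[of m n] no_repeat[of n m] mn by (metis linorder_neqE_nat)
      qed
      fix p assume p: "p \<in> places k - S"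
      hence pI: "p \<in> I" by (simp add: I_def)
      interpret v: nonarch "rep p" by (rule na[OF pI])
      show "\<exists>y\<in>hp ` Z. \<forall>e>0. \<forall>n0. \<exists>n\<ge>n0. v.cdist ((phi ^^ n) (hp P)) y < e"
      proof (intro bexI[of _ "hp (zz p)"] allI impI imageI zz(1) pI)
        fix e :: real and n0 assume e: "e > 0"
        obtain n where n: "\<forall>m\<le>n0. h n \<noteq> h m" "v.cdist (hp (zz p)) (hp (h n)) < e" using step[OF pI e] by blast
        obtain c where c: "c \<noteq> 0" "hp (h n) = (c * fst ((phi ^^ n) (hp P)), c * snd ((phi ^^ n) (hp P)))"
          using conj[of n] wedge_proportional[OF hp_nz pnz] by blast
        have "v.cdist ((phi ^^ n) (hp P)) (hp (zz p)) = v.cdist (hp (h n)) (hp (zz p))"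
          unfolding c(2) v.cdist_scale[OF c(1)] by simp
        hence "v.cdist ((phi ^^ n) (hp P)) (hp (zz p)) < e" using n(2) v.cdist_commute by simp
        \<comment> \<open>Being different from every h m with m \<le> n0 forces the index to be
          large.\<close>
        moreover have "n \<ge> n0" using n(1) by (metis linorder_le_cases)
        ultimately show "\<exists>n\<ge>n0. v.cdist ((phi ^^ n) (hp P)) (hp (zz p)) < e" by blast
      qed
    qed
  qed
qed

end
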